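(* Under the standing assumptions on $(\Omega,\mathbf{A},\mathbf{B})$ given in the context, let $L>0$ and $d\in(\frac{3}{16},\frac14)$. There exist $C>0$ and $h_d>0$ such that for all $h\in(0,h_d)$ and every eigenpair $(\lambda(h),\psi_h)$ of $\mathcal{P}_h$ with $\lambda(h)\le Lh^{3/2}$, $$\int_\Omega e^{2\,\mathrm{d}(\mathsf{x},\Sigma)/h^d}\,|\psi_h(\mathsf{x})|^2\,d\mathsf{x}+h^{-3/2}\,\mathcal{Q}_h\big(e^{\mathrm{d}(\cdot,\Sigma)/h^d}\psi_h\big)\ \le\ C\,\|\psi_h\|^2 .$$
   Context: Let $\Omega\subset\mathbb{R}^2$ be a bounded, smooth, simply connected open set, $\mathbf{A}=(A_1,A_2)\in\mathcal{C}^\infty(\overline\Omega,\mathbb{R}^2)$, and $\mathbf{B}=\partial_2A_1-\partial_1A_2$. For $h>0$, $\mathcal{P}_h=(-ih\nabla+\mathbf{A})^2$ is the self-adjoint Neumann realization on $L^2(\Omega)$, with domain $\{u\in H^2(\Omega):(-ih\nabla+\mathbf{A})u\cdot\nu=0\text{ on }\partial\Omega\}$ ($\nu$ the outward normal); its quadratic form is $\mathcal{Q}_h(u)=\int_\Omega|(-ih\nabla+\mathbf{A})u|^2\,d\mathsf{x}$ with form domain $H^1(\Omega)$. Standing assumptions. Let $\Gamma=\{\mathsf{x}\in\overline\Omega:\mathbf{B}(\mathsf{x})=0\}$, assumed nonempty, and $\Sigma=\{\mathsf{x}\in\Gamma:\nabla\mathbf{B}(\mathsf{x})=0\}$. Assume: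 (i) $\Sigma$ is nonempty, finite, and $\partial\Omega\cap\Sigma=\emptyset$; (ii) for every $\mathsf{x}\in\Sigma$ the Hessian matrix of $\mathbf{B}$ at $\mathsf{x}$ has two nonzero eigenvalues of opposite signs; (iii) $\Gamma\cap\partial\Omega$ is finite, and at each of these intersection points $\Gamma$ is non tangent to $\partial\Omega$. $\mathrm{d}(\mathsf{x},\Sigma)$ is the Euclidean distance from $\mathsf{x}$ to $\Sigma$, and $\|\cdot\|$ is the $L^2(\Omega)$ norm. *)

theory Defs
  imports "HOL-Analysis.Analysis"
begin

section \<open>Smooth functions in the plane\<close>

definition partial :: "2 \<Rightarrow> (real^2 \<Rightarrow> 'b::real_normed_vector) \<Rightarrow> real^2 \<Rightarrow> 'b" where
  "partial j f x = frechet_derivative f (at x) (axis j 1)"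

text \<open>Only meant for open \<open>U\<close>.\<close>
primrec Ck_on :: "nat \<Rightarrow> (real^2) set \<Rightarrow> (real^2 \<Rightarrow> 'b::real_normed_vector) \<Rightarrow> bool" where
  "Ck_on 0 U f \<longleftrightarrow> continuous_on U f"
| "Ck_on (Suc k) U f \<longleftrightarrow> (\<forall>x\<in>U. f differentiable (at x)) \<and> (\<forall>j. Ck_on k U (partial j f))"

definition smooth_on :: "(real^2) set \<Rightarrow> (real^2 \<Rightarrow> 'b::real_normed_vector) \<Rightarrow> bool" where
  "smooth_on U f \<longleftrightarrow> (\<forall>k. Ck_on k U f)"

text \<open>The space of smooth functions up to the boundary, realised as restrictions of functions that
  are smooth in a neighbourhood of the closure. The partial derivatives at boundary points of a
  domain with smooth boundary do not depend on the chosen extension.\<close>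
definition smooth_on_closure :: "(real^2) set \<Rightarrow> (real^2 \<Rightarrow> 'b::real_normed_vector) \<Rightarrow> bool" where
  "smooth_on_closure \<Omega> f \<longleftrightarrow> (\<exists>U. open U \<and> closure \<Omega> \<subseteq> U \<and> smooth_on U f)"

definition grad :: "(real^2 \<Rightarrow> real) \<Rightarrow> real^2 \<Rightarrow> real^2" where
  "grad f x = (\<chi> j. partial j f x)"

definition hessian :: "(real^2 \<Rightarrow> real) \<Rightarrow> real^2 \<Rightarrow> real^2^2" where
  "hessian f x = (\<chi> i j. partial i (partial j f) x)"

definition eigenvalue :: "real^2^2 \<Rightarrow> real \<Rightarrow> bool" where
  "eigenvalue M a \<longleftrightarrow> (\<exists>v. v \<noteq> 0 \<and> M *v v = a *\<^sub>R v)"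

section \<open>Domains with smooth boundary\<close>

definition local_defining_function ::
  "(real^2) set \<Rightarrow> real^2 \<Rightarrow> (real^2) set \<Rightarrow> (real^2 \<Rightarrow> real) \<Rightarrow> bool" where
  "local_defining_function \<Omega> p U \<rho> \<longleftrightarrow>
     open U \<and> p \<in> U \<and> smooth_on U \<rho> \<and> (\<forall>x\<in>U. grad \<rho> x \<noteq> 0) \<and> \<Omega> \<inter> U = {x \<in> U. \<rho> x < 0}"

definition smooth_boundary :: "(real^2) set \<Rightarrow> bool" where
  "smooth_boundary \<Omega> \<longleftrightarrow> (\<forall>p\<in>frontier \<Omega>. \<exists>U \<rho>. local_defining_function \<Omega> p U \<rho>)"

text \<open>The direction of the gradient of a defining function at a boundary point
  does not depend on the defining function.\<close>
definition outward_normal :: "(real^2) set \<Rightarrow> real^2 \<Rightarrow> real^2" where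
  "outward_normal \<Omega> p =
     (THE n. \<exists>U \<rho>. local_defining_function \<Omega> p U \<rho> \<and> n = grad \<rho> p /\<^sub>R norm (grad \<rho> p))"

section \<open>One-dimensional Hausdorff measure and surface measure\<close>

definition hausdorff1_pre :: "real \<Rightarrow> 'a::metric_space set \<Rightarrow> ennreal" where
  "hausdorff1_pre \<delta> E =
     (INF U\<in>{U :: nat \<Rightarrow> 'a set. E \<subseteq> (\<Union>n. U n) \<and> (\<forall>n. bounded (U n) \<and> diameter (U n) \<le> \<delta>)}.
        \<Sum>n. ennreal (diameter (U n)))"

definition hausdorff1_outer :: "'a::metric_space set \<Rightarrow> ennreal" where
  "hausdorff1_outer E = (SUP \<delta>\<in>{0<..}. hausdorff1_pre \<delta> E)"

text \<open>\<open>measure_of\<close> would silently give the zero measure if \<open>hausdorff1_outer\<close> were not a measure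
  on the Borel sets; \<open>emeasure_hausdorff1\<close> below excludes this.\<close>
definition hausdorff1 :: "'a::metric_space measure" where
  "hausdorff1 = measure_of UNIV (sets borel) hausdorff1_outer"

definition surface_measure :: "(real^2) set \<Rightarrow> (real^2) measure" where
  "surface_measure \<Omega> = restrict_space hausdorff1 (frontier \<Omega>)"

lemma hausdorff1_pre_mono: "E \<subseteq> F \<Longrightarrow> hausdorff1_pre \<delta> E \<le> hausdorff1_pre \<delta> F"
  unfolding hausdorff1_pre_def by (rule INF_superset_mono) auto

lemma hausdorff1_pre_antimono: "\<delta> \<le> \<delta>' \<Longrightarrow> hausdorff1_pre \<delta>' E \<le> hausdorff1_pre \<delta> E"
  unfolding hausdorff1_pre_def by (rule INF_superset_mono) (auto intro: order_trans)

lemma hausdorff1_outer_mono: "E \<subseteq> F \<Longrightarrow> hausdorff1_outer E \<le> hausdorff1_outer F"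
  unfolding hausdorff1_outer_def by (intro SUP_mono) (auto intro: hausdorff1_pre_mono)

lemma hausdorff1_pre_le_outer: "\<delta> > 0 \<Longrightarrow> hausdorff1_pre \<delta> E \<le> hausdorff1_outer E"
  unfolding hausdorff1_outer_def by (rule SUP_upper) auto

lemma hausdorff1_outer_empty: "hausdorff1_outer ({} :: 'a::metric_space set) = 0"
proof -
  have "hausdorff1_pre \<delta> ({} :: 'a set) \<le> 0" if "\<delta> > 0" for \<delta>
    unfolding hausdorff1_pre_def
    by (rule INF_lower2[where i = "\<lambda>_. {}"]) (use that in auto)
  then show ?thesis
    unfolding hausdorff1_outer_def by (intro antisym SUP_least) auto
qed

lemma hausdorff1_pre_UN:
  fixes A :: "nat \<Rightarrow> 'a::metric_space set"
  shows "hausdorff1_pre \<delta> (\<Union>i. A i) \<le> (\<Sum>i. hausdorff1_pre \<delta> (A i))"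
proof (cases "(\<Sum>i. hausdorff1_pre \<delta> (A i)) = top")
  case False
  show ?thesis
  proof (rule ennreal_le_epsilon)
    fix e :: real assume "e > 0"
    have fin: "hausdorff1_pre \<delta> (A i) < top" for i
      using False ennreal_suminf_lessD[of "\<lambda>i. hausdorff1_pre \<delta> (A i)" top i]
      by (simp add: less_top)
    have "\<exists>U :: nat \<Rightarrow> 'a set. A i \<subseteq> (\<Union>n. U n) \<and> (\<forall>n. bounded (U n) \<and> diameter (U n) \<le> \<delta>) \<and>
        (\<Sum>n. ennreal (diameter (U n))) \<le> hausdorff1_pre \<delta> (A i) + ennreal (e * (1/2)^Suc i)" for i
    proof -
      have "hausdorff1_pre \<delta> (A i) < hausdorff1_pre \<delta> (A i) + ennreal (e * (1/2)^Suc i)"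
        using fin[of i] \<open>e > 0\<close>
          ennreal_add_left_cancel_less[of "hausdorff1_pre \<delta> (A i)" 0 "ennreal (e * (1/2)^Suc i)"]
        by (simp add: less_top[symmetric])
      then show ?thesis
        unfolding hausdorff1_pre_def INF_less_iff
        by (auto simp del: power_Suc intro: less_imp_le)
    qed
    then obtain U :: "nat \<Rightarrow> nat \<Rightarrow> 'a set" where
      U: "\<And>i. A i \<subseteq> (\<Union>n. U i n)" "\<And>i n. bounded (U i n)" "\<And>i n. diameter (U i n) \<le> \<delta>"
        "\<And>i. (\<Sum>n. ennreal (diameter (U i n))) \<le> hausdorff1_pre \<delta> (A i) + ennreal (e * (1/2)^Suc i)"
      by metis
    define V where "V k = (case prod_decode k of (i, n) \<Rightarrow> U i n)" for k
    have cov: "(\<Union>i. A i) \<subseteq> (\<Union>k. V k)"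
    proof
      fix x assume "x \<in> (\<Union>i. A i)"
      then obtain i n where "x \<in> U i n" using U(1) by blast
      then have "x \<in> V (prod_encode (i, n))" by (simp add: V_def)
      then show "x \<in> (\<Union>k. V k)" by blast
    qed
    have "hausdorff1_pre \<delta> (\<Union>i. A i) \<le> (\<Sum>k. ennreal (diameter (V k)))"
      unfolding hausdorff1_pre_def
      by (rule INF_lower2[where i = V]) (use cov U in \<open>auto simp: V_def split: prod.split\<close>)
    also have "\<dots> = (\<Sum>i. \<Sum>n. ennreal (diameter (U i n)))"
      unfolding V_def using suminf_ennreal_2dimen[of "\<lambda>i. \<Sum>n. ennreal (diameter (U i n))"
        "\<lambda>(i,n). ennreal (diameter (U i n))"]
      by (simp add: comp_def case_prod_unfold)
    also have "\<dots> \<le> (\<Sum>i. hausdorff1_pre \<delta> (A i) + ennreal (e * (1/2)^Suc i))"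
      by (intro suminf_le U) auto
    also have "\<dots> = (\<Sum>i. hausdorff1_pre \<delta> (A i)) + (\<Sum>i. ennreal (e * (1/2)^Suc i))"
      by (rule suminf_add[symmetric]) auto
    also have "(\<Sum>i. ennreal (e * (1/2)^Suc i)) = ennreal e"
    proof (rule suminf_ennreal_eq)
      show "(\<lambda>i. e * (1/2)^Suc i) sums e"
        using sums_mult[OF power_half_series, of e] by simp
    qed (use \<open>e > 0\<close> in auto)
    finally show "hausdorff1_pre \<delta> (\<Union>i. A i) \<le> (\<Sum>i. hausdorff1_pre \<delta> (A i)) + ennreal e" .
  qed
qed simp

lemma hausdorff1_outer_UN:
  "hausdorff1_outer (\<Union>i::nat. A i) \<le> (\<Sum>i. hausdorff1_outer (A i))"
  unfolding hausdorff1_outer_def[of "\<Union>i. A i"]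
proof (rule SUP_least)
  fix \<delta> :: real assume "\<delta> \<in> {0<..}"
  then show "hausdorff1_pre \<delta> (\<Union>i. A i) \<le> (\<Sum>i. hausdorff1_outer (A i))"
    by (intro order_trans[OF hausdorff1_pre_UN] suminf_le hausdorff1_pre_le_outer) auto
qed

lemma outer_measure_space_hausdorff1: "outer_measure_space (Pow UNIV) hausdorff1_outer"
  by (auto simp: outer_measure_space_def positive_def hausdorff1_outer_empty increasing_def
      countably_subadditive_def intro: hausdorff1_outer_mono hausdorff1_outer_UN)

lemma hausdorff1_outer_Un: "hausdorff1_outer (A \<union> B) \<le> hausdorff1_outer A + hausdorff1_outer B"
proof -
  have "subadditive (Pow UNIV) (hausdorff1_outer :: 'a set \<Rightarrow> ennreal)"
    using outer_measure_space_hausdorff1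
    by (metis outer_measure_space_def ring_of_sets.countably_subadditive_subadditive
        ring_of_sets_Pow)
  have "A \<union> B = A \<union> (B - A)" by blast
  then have "hausdorff1_outer (A \<union> B) \<le> hausdorff1_outer A + hausdorff1_outer (B - A)"
    using subadditiveD[OF \<open>subadditive _ _\<close>, of A "B - A"] by auto
  also have "\<dots> \<le> hausdorff1_outer A + hausdorff1_outer B"
    by (intro add_left_mono hausdorff1_outer_mono) auto
  finally show ?thesis .
qed

lemma hausdorff1_outer_separated:
  fixes A B :: "'a::metric_space set"
  assumes "e > 0" and sep: "\<And>a b. a \<in> A \<Longrightarrow> b \<in> B \<Longrightarrow> dist a b \<ge> e"
  shows "hausdorff1_outer A + hausdorff1_outer B \<le> hausdorff1_outer (A \<union> B)"
proof -
  have pre: "hausdorff1_pre \<delta> A + hausdorff1_pre \<delta> B \<le> hausdorff1_pre \<delta> (A \<union> B)"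
    if "0 < \<delta>" "\<delta> < e" for \<delta>
    unfolding hausdorff1_pre_def[of \<delta> "A \<union> B"]
  proof (rule INF_greatest)
    fix U :: "nat \<Rightarrow> 'a set"
    assume "U \<in> {U. A \<union> B \<subseteq> (\<Union>n. U n) \<and> (\<forall>n. bounded (U n) \<and> diameter (U n) \<le> \<delta>)}"
    then have U: "A \<union> B \<subseteq> (\<Union>n. U n)" "\<And>n. bounded (U n)" "\<And>n. diameter (U n) \<le> \<delta>" by auto
    have one: "U n \<inter> A = {} \<or> U n \<inter> B = {}" for n
    proof (rule ccontr)
      assume "\<not> ?thesis"
      then obtain a b where ab: "a \<in> A" "b \<in> B" "a \<in> U n" "b \<in> U n" by auto
      then have "dist a b \<le> \<delta>"
        using diameter_bounded_bound[OF U(2)] U(3)[of n] by (meson order_trans)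
      then show False using sep[OF ab(1,2)] that by simp
    qed
    define V where "V C n = (if U n \<inter> C = {} then {} else U n)" for C n
    have VC: "hausdorff1_pre \<delta> C \<le> (\<Sum>n. ennreal (diameter (V C n)))" if "C \<subseteq> A \<union> B" for C
      unfolding hausdorff1_pre_def
    proof (rule INF_lower2[where i = "V C"], safe)
      fix x assume "x \<in> C"
      then obtain n where "x \<in> U n" using U(1) \<open>C \<subseteq> A \<union> B\<close> by blast
      then have "x \<in> V C n" using \<open>x \<in> C\<close> by (auto simp: V_def)
      then show "x \<in> (\<Union>n. V C n)" by blast
    qed (use U(2,3) \<open>0 < \<delta>\<close> in \<open>auto simp: V_def\<close>)
    have "hausdorff1_pre \<delta> A + hausdorff1_pre \<delta> B
        \<le> (\<Sum>n. ennreal (diameter (V A n))) + (\<Sum>n. ennreal (diameter (V B n)))"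
      by (intro add_mono VC) auto
    also have "\<dots> = (\<Sum>n. ennreal (diameter (V A n)) + ennreal (diameter (V B n)))"
      by (rule suminf_add) auto
    also have "\<dots> \<le> (\<Sum>n. ennreal (diameter (U n)))"
      using one by (intro suminf_le) (auto simp: V_def)
    finally show "hausdorff1_pre \<delta> A + hausdorff1_pre \<delta> B \<le> (\<Sum>n. ennreal (diameter (U n)))" .
  qed
  have dir: "\<exists>k\<in>{0<..}. hausdorff1_pre i A + hausdorff1_pre j B \<le> hausdorff1_pre k A + hausdorff1_pre k B"
    if "i \<in> {0<..}" "j \<in> {0<..}" for i j :: real
    using that by (intro bexI[of _ "min i j"] add_mono hausdorff1_pre_antimono) auto
  have "hausdorff1_outer A + hausdorff1_outer B
      = (SUP \<delta>\<in>{0<..}. hausdorff1_pre \<delta> A + hausdorff1_pre \<delta> B)"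
    unfolding hausdorff1_outer_def by (rule SUP_add_directed_ennreal[symmetric]) (use dir in auto)
  also have "\<dots> \<le> hausdorff1_outer (A \<union> B)"
  proof (rule SUP_least)
    fix \<delta> :: real assume "\<delta> \<in> {0<..}"
    define \<eta> where "\<eta> = min \<delta> (e / 2)"
    have \<eta>: "0 < \<eta>" "\<eta> < e" "\<eta> \<le> \<delta>" using \<open>\<delta> \<in> {0<..}\<close> \<open>e > 0\<close> by (auto simp: \<eta>_def)
    have "hausdorff1_pre \<delta> A + hausdorff1_pre \<delta> B \<le> hausdorff1_pre \<eta> A + hausdorff1_pre \<eta> B"
      by (intro add_mono hausdorff1_pre_antimono \<eta>)
    also have "\<dots> \<le> hausdorff1_pre \<eta> (A \<union> B)" by (rule pre) (use \<eta> in auto)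
    also have "\<dots> \<le> hausdorff1_outer (A \<union> B)" by (rule hausdorff1_pre_le_outer) (use \<eta> in auto)
    finally show "hausdorff1_pre \<delta> A + hausdorff1_pre \<delta> B \<le> hausdorff1_outer (A \<union> B)" .
  qed
  finally show ?thesis .
qed

lemma hausdorff1_outer_separated_sum:
  fixes R :: "nat \<Rightarrow> 'a::metric_space set"
  assumes sep: "\<And>i j. i < j \<Longrightarrow> \<exists>e>0. \<forall>a\<in>R i. \<forall>b\<in>R j. dist a b \<ge> e"
  shows "(\<Sum>i<n. hausdorff1_outer (R i)) \<le> hausdorff1_outer (\<Union>i<n. R i)"
proof (induction n)
  case (Suc n)
  have "\<forall>i. \<exists>e. i < n \<longrightarrow> e > 0 \<and> (\<forall>a\<in>R i. \<forall>b\<in>R n. dist a b \<ge> e)"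
    using sep by blast
  then obtain e where e: "\<And>i. i < n \<Longrightarrow> e i > 0 \<and> (\<forall>a\<in>R i. \<forall>b\<in>R n. dist a b \<ge> e i)"
    unfolding choice_iff by blast
  define m where "m = Min (insert 1 (e ` {..<n}))"
  have m: "m > 0" "\<And>i. i < n \<Longrightarrow> m \<le> e i"
    unfolding m_def using e by (auto intro: Min_le)
  have "(\<Sum>i<Suc n. hausdorff1_outer (R i)) \<le> hausdorff1_outer (\<Union>i<n. R i) + hausdorff1_outer (R n)"
    using Suc by (simp add: add_right_mono)
  also have "\<dots> \<le> hausdorff1_outer ((\<Union>i<n. R i) \<union> R n)"
    by (rule hausdorff1_outer_separated[OF m(1)]) (use m(2) e in \<open>force intro: order_trans\<close>)
  also have "(\<Union>i<n. R i) \<union> R n = (\<Union>i<Suc n. R i)"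
    by (auto simp: lessThan_Suc)
  finally show ?case .
qed (simp add: hausdorff1_outer_empty)

lemma closed_in_lambda_system_hausdorff1:
  fixes F :: "'a::metric_space set"
  assumes "closed F"
  shows "F \<in> lambda_system UNIV (Pow UNIV) hausdorff1_outer"
proof (cases "F = {}")
  case True
  then show ?thesis by (simp add: lambda_system_def hausdorff1_outer_empty)
next
  case False
  have main: "hausdorff1_outer (T \<inter> F) + hausdorff1_outer (T - F) \<le> hausdorff1_outer T" for T
  proof (cases "hausdorff1_outer T = top")
    case fin: False
    define T' where "T' n = {x\<in>T. infdist x F \<ge> 1 / real (Suc n)}" for n
    define R where "R n = T' (Suc n) - T' n" for n
    have T'_mono: "m \<le> n \<Longrightarrow> T' m \<subseteq> T' n" for m n
      by (auto simp: T'_def elim!: order_trans[rotated] intro: divide_left_mono)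
    have Rsep: "\<exists>e>0. \<forall>a\<in>R i. \<forall>b\<in>R j. dist a b \<ge> e" if "Suc i < j" for i j
    proof -
      define e where "e = 1 / real (Suc (Suc i)) - 1 / real (Suc j)"
      have "e > 0" using that unfolding e_def by (simp add: frac_less2)
      moreover have "dist a b \<ge> e" if "a \<in> R i" "b \<in> R j" for a b
      proof -
        have "infdist a F \<ge> 1 / real (Suc (Suc i))" "infdist b F < 1 / real (Suc j)"
          using that by (auto simp: R_def T'_def)
        then show ?thesis using infdist_triangle[of a F b] by (simp add: e_def)
      qed
      ultimately show ?thesis by blast
    qed
    have bound: "(\<Sum>i. hausdorff1_outer (R (2 * i + c))) \<le> hausdorff1_outer T" for c
    proof (rule suminf_le_const)
      fix n
      have "(\<Sum>i<n. hausdorff1_outer (R (2 * i + c))) \<le> hausdorff1_outer (\<Union>i<n. R (2 * i + c))"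
        by (rule hausdorff1_outer_separated_sum[of "\<lambda>i. R (2 * i + c)"]) (rule Rsep, simp)
      also have "\<dots> \<le> hausdorff1_outer T"
        by (rule hausdorff1_outer_mono) (auto simp: R_def T'_def)
      finally show "(\<Sum>i<n. hausdorff1_outer (R (2 * i + c))) \<le> hausdorff1_outer T" .
    qed auto
    define S where "S n = (\<Sum>i. hausdorff1_outer (R (2 * (i + n))))
                     + (\<Sum>i. hausdorff1_outer (R (2 * (i + n) + 1)))" for n
    have tail: "(\<lambda>n. \<Sum>i. f (i + n)) \<longlonglongrightarrow> 0" if "(\<Sum>i. f i) \<noteq> top" for f :: "nat \<Rightarrow> ennreal"
    proof -
      have fi: "f i < top" for i
        using ennreal_suminf_lessD[of f top i] that by (simp add: less_top)
      define g where "g i = enn2real (f i)" for i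
      have fg: "f i = ennreal (g i)" "g i \<ge> 0" for i
        using fi[of i] by (auto simp: g_def less_top)
      have sg: "summable g"
        by (rule summable_suminf_not_top[OF fg(2)]) (use that in \<open>simp only: fg(1)[symmetric] not_False_eq_True\<close>)
      have eq: "(\<Sum>i. f (i + n)) = ennreal (\<Sum>i. g (i + n))" for n
        unfolding fg(1) by (rule suminf_ennreal2) (use fg(2) sg in auto)
      have "(\<lambda>n. ennreal (\<Sum>i. g (i + n))) \<longlonglongrightarrow> ennreal 0"
        by (intro tendsto_ennrealI suminf_exist_split2[OF sg])
      then show ?thesis
        unfolding eq by simp
    qed
    have nt: "(\<Sum>i. hausdorff1_outer (R (2 * i + c))) \<noteq> top" for c
      using bound[of c] fin by (auto simp: top_unique)
    have S0: "S \<longlonglongrightarrow> 0"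
      unfolding S_def[abs_def]
      using tendsto_add[OF tail[OF nt[of 0]] tail[OF nt[of 1]]] by simp
    have est: "hausdorff1_outer (T \<inter> F) + hausdorff1_outer (T - F) \<le> hausdorff1_outer T + S n" for n
    proof -
      have cov: "T - F \<subseteq> T' (2 * n) \<union> ((\<Union>i. R (2 * (i + n))) \<union> (\<Union>i. R (2 * (i + n) + 1)))"
      proof
        fix x assume x: "x \<in> T - F"
        then have "infdist x F > 0"
          using in_closed_iff_infdist_zero[OF assms False, of x] infdist_nonneg[of x F] by auto
        then obtain m where "inverse (real (Suc m)) < infdist x F"
          using reals_Archimedean by blast
        then have ex: "\<exists>k. x \<in> T' k" using x by (auto simp: T'_def inverse_eq_divide intro: less_imp_le)
        define k where "k = (LEAST k. x \<in> T' k)"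
        have k: "x \<in> T' k" "\<And>l. l < k \<Longrightarrow> x \<notin> T' l"
          unfolding k_def using ex by (auto intro: LeastI_ex dest: not_less_Least)
        show "x \<in> T' (2 * n) \<union> ((\<Union>i. R (2 * (i + n))) \<union> (\<Union>i. R (2 * (i + n) + 1)))"
        proof (cases "k \<le> 2 * n")
          case True
          then show ?thesis using k(1) T'_mono by blast
        next
          case False
          then have "x \<in> R (k - 1)" using k by (cases k) (auto simp: R_def)
          moreover have "\<exists>i. k - 1 = 2 * (i + n) \<or> k - 1 = 2 * (i + n) + 1"
            using False by presburger
          ultimately show ?thesis by auto
        qed
      qed
      have "hausdorff1_outer (T - F) \<le> hausdorff1_outer (T' (2 * n)) + S n"
      proof -
        have "hausdorff1_outer (T - F) \<le> hausdorff1_outer (T' (2 * n))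
           + (hausdorff1_outer (\<Union>i. R (2 * (i + n))) + hausdorff1_outer (\<Union>i. R (2 * (i + n) + 1)))"
          by (intro order_trans[OF hausdorff1_outer_mono[OF cov]]
              order_trans[OF hausdorff1_outer_Un] add_left_mono hausdorff1_outer_Un)
        also have "\<dots> \<le> hausdorff1_outer (T' (2 * n)) + S n"
          unfolding S_def by (intro add_left_mono add_mono hausdorff1_outer_UN)
        finally show ?thesis .
      qed
      then have "hausdorff1_outer (T \<inter> F) + hausdorff1_outer (T - F)
          \<le> hausdorff1_outer (T \<inter> F) + hausdorff1_outer (T' (2 * n)) + S n"
        by (simp add: add.assoc add_left_mono)
      also have "hausdorff1_outer (T \<inter> F) + hausdorff1_outer (T' (2 * n))
          \<le> hausdorff1_outer ((T \<inter> F) \<union> T' (2 * n))"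
      proof (rule hausdorff1_outer_separated[of "1 / real (Suc (2 * n))"])
        fix a b assume "a \<in> T \<inter> F" "b \<in> T' (2 * n)"
        then show "dist a b \<ge> 1 / real (Suc (2 * n))"
          using infdist_le[of a F b] by (auto simp: T'_def dist_commute)
      qed simp
      also have "\<dots> \<le> hausdorff1_outer T"
        by (rule hausdorff1_outer_mono) (auto simp: T'_def)
      finally show ?thesis by (simp add: add_right_mono)
    qed
    have "(\<lambda>n. hausdorff1_outer T + S n) \<longlonglongrightarrow> hausdorff1_outer T + 0"
      by (intro tendsto_add S0 tendsto_const)
    then show ?thesis
      using est by (intro LIMSEQ_le_const) auto
  qed simp
  have "hausdorff1_outer (F \<inter> T) + hausdorff1_outer ((UNIV - F) \<inter> T) = hausdorff1_outer T" for T
  proof (rule antisym)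
    show "hausdorff1_outer (F \<inter> T) + hausdorff1_outer ((UNIV - F) \<inter> T) \<le> hausdorff1_outer T"
      using main[of T] by (simp add: Int_commute Diff_eq)
    have "T = (F \<inter> T) \<union> ((UNIV - F) \<inter> T)" by blast
    then show "hausdorff1_outer T \<le> hausdorff1_outer (F \<inter> T) + hausdorff1_outer ((UNIV - F) \<inter> T)"
      using hausdorff1_outer_Un by metis
  qed
  then show ?thesis by (simp add: lambda_system_def)
qed

lemma measure_space_hausdorff1: "measure_space UNIV (sets borel) hausdorff1_outer"
proof -
  define \<L> where "\<L> = lambda_system UNIV (Pow UNIV) (hausdorff1_outer :: 'a set \<Rightarrow> ennreal)"
  have ms: "measure_space UNIV \<L> hausdorff1_outer"
    unfolding \<L>_def
    by (rule sigma_algebra.caratheodory_lemma[OF sigma_algebra_Pow outer_measure_space_hausdorff1])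
  then interpret sigma_algebra UNIV \<L> by (simp add: measure_space_def)
  have "U \<in> \<L>" if "open U" for U
    using compl_sets[of "- U"] closed_in_lambda_system_hausdorff1[of "- U"] that
    by (simp add: \<L>_def Compl_eq_Diff_UNIV[symmetric] closed_Compl)
  then have "sets borel \<subseteq> \<L>"
    unfolding sets_borel by (intro sigma_sets_subset) auto
  then show ?thesis
    using ms sets.sigma_algebra_axioms[of "borel :: 'a measure"]
    by (auto simp: measure_space_def positive_def countably_additive_def)
qed

lemma space_hausdorff1 [simp]: "space hausdorff1 = UNIV"
  by (simp add: hausdorff1_def space_measure_of_conv)

lemma sets_hausdorff1 [simp]: "sets hausdorff1 = sets borel"
  unfolding hausdorff1_def by (metis sets.sets_measure_of_eq space_borel)

lemma emeasure_hausdorff1: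
  assumes "E \<in> sets borel"
  shows "emeasure hausdorff1 E = hausdorff1_outer E"
  using measure_space_hausdorff1 assms unfolding hausdorff1_def
  by (subst emeasure_measure_of_sigma) (auto simp: measure_space_def)

section \<open>Lebesgue and Sobolev spaces\<close>

text \<open>Functions are not identified up to null sets, and values outside the domain are irrelevant.\<close>
definition L2 :: "'a measure \<Rightarrow> ('a \<Rightarrow> complex) set" where
  "L2 M = {u \<in> borel_measurable M. integrable M (\<lambda>x. (cmod (u x))\<^sup>2)}"

definition L2_norm :: "'a measure \<Rightarrow> ('a \<Rightarrow> complex) \<Rightarrow> real" where
  "L2_norm M u = sqrt (\<integral>x. (cmod (u x))\<^sup>2 \<partial>M)"

definition test_function :: "(real^2) set \<Rightarrow> (real^2 \<Rightarrow> real) \<Rightarrow> bool" where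
  "test_function \<Omega> \<phi> \<longleftrightarrow>
     smooth_on UNIV \<phi> \<and> (\<exists>K. compact K \<and> K \<subseteq> \<Omega> \<and> (\<forall>x. x \<notin> K \<longrightarrow> \<phi> x = 0))"

definition has_weak_partial ::
  "(real^2) set \<Rightarrow> 2 \<Rightarrow> (real^2 \<Rightarrow> complex) \<Rightarrow> (real^2 \<Rightarrow> complex) \<Rightarrow> bool" where
  "has_weak_partial \<Omega> j u g \<longleftrightarrow>
     u \<in> L2 (lebesgue_on \<Omega>) \<and> g \<in> L2 (lebesgue_on \<Omega>) \<and>
     (\<forall>\<phi>. test_function \<Omega> \<phi> \<longrightarrow>
        (\<integral>x. partial j \<phi> x *\<^sub>R u x \<partial>lebesgue_on \<Omega>) = - (\<integral>x. \<phi> x *\<^sub>R g x \<partial>lebesgue_on \<Omega>))"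

text \<open>A representative of the weak derivative, which is unique up to null sets when it exists.\<close>
definition weak_partial :: "(real^2) set \<Rightarrow> 2 \<Rightarrow> (real^2 \<Rightarrow> complex) \<Rightarrow> real^2 \<Rightarrow> complex" where
  "weak_partial \<Omega> j u = (SOME g. has_weak_partial \<Omega> j u g)"

definition H1 :: "(real^2) set \<Rightarrow> (real^2 \<Rightarrow> complex) set" where
  "H1 \<Omega> = {u \<in> L2 (lebesgue_on \<Omega>). \<forall>j. \<exists>g. has_weak_partial \<Omega> j u g}"

definition H2 :: "(real^2) set \<Rightarrow> (real^2 \<Rightarrow> complex) set" where
  "H2 \<Omega> = {u \<in> H1 \<Omega>. \<forall>j. weak_partial \<Omega> j u \<in> H1 \<Omega>}"

definition H1_norm :: "(real^2) set \<Rightarrow> (real^2 \<Rightarrow> complex) \<Rightarrow> real" where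
  "H1_norm \<Omega> u = sqrt ((L2_norm (lebesgue_on \<Omega>) u)\<^sup>2
     + (\<Sum>j\<in>UNIV. (L2_norm (lebesgue_on \<Omega>) (weak_partial \<Omega> j u))\<^sup>2))"

text \<open>The trace operator is the continuous extension to \<open>H1\<close> of the restriction to the boundary
  of functions that are smooth up to the boundary.\<close>
definition has_trace :: "(real^2) set \<Rightarrow> (real^2 \<Rightarrow> complex) \<Rightarrow> (real^2 \<Rightarrow> complex) \<Rightarrow> bool" where
  "has_trace \<Omega> u g \<longleftrightarrow>
     u \<in> H1 \<Omega> \<and> g \<in> L2 (surface_measure \<Omega>) \<and>
     (\<exists>v :: nat \<Rightarrow> real^2 \<Rightarrow> complex. (\<forall>n. smooth_on_closure \<Omega> (v n)) \<and>
        (\<lambda>n. H1_norm \<Omega> (\<lambda>x. v n x - u x)) \<longlonglongrightarrow> 0 \<and>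
        (\<lambda>n. L2_norm (surface_measure \<Omega>) (\<lambda>x. v n x - g x)) \<longlonglongrightarrow> 0)"

section \<open>The magnetic Neumann Laplacian\<close>

text \<open>The sign convention is that of the operator \<open>-ih\<nabla> + A\<close>.\<close>
definition magnetic_field :: "(real^2 \<Rightarrow> real^2) \<Rightarrow> real^2 \<Rightarrow> real" where
  "magnetic_field A x = partial 2 (\<lambda>y. A y $ 1) x - partial 1 (\<lambda>y. A y $ 2) x"

definition mag_deriv ::
  "(real^2) set \<Rightarrow> (real^2 \<Rightarrow> real^2) \<Rightarrow> real \<Rightarrow> 2 \<Rightarrow> (real^2 \<Rightarrow> complex) \<Rightarrow> real^2 \<Rightarrow> complex" where
  "mag_deriv \<Omega> A h j u x =
     - \<i> * complex_of_real h * weak_partial \<Omega> j u x + complex_of_real (A x $ j) * u x"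

definition mag_op ::
  "(real^2) set \<Rightarrow> (real^2 \<Rightarrow> real^2) \<Rightarrow> real \<Rightarrow> (real^2 \<Rightarrow> complex) \<Rightarrow> real^2 \<Rightarrow> complex" where
  "mag_op \<Omega> A h u x = (\<Sum>j\<in>UNIV. mag_deriv \<Omega> A h j (mag_deriv \<Omega> A h j u) x)"

text \<open>Meant for \<open>u \<in> H1 \<Omega>\<close>, the form domain.\<close>
definition mag_form ::
  "(real^2) set \<Rightarrow> (real^2 \<Rightarrow> real^2) \<Rightarrow> real \<Rightarrow> (real^2 \<Rightarrow> complex) \<Rightarrow> real" where
  "mag_form \<Omega> A h u = (\<integral>x. (\<Sum>j\<in>UNIV. (cmod (mag_deriv \<Omega> A h j u x))\<^sup>2) \<partial>lebesgue_on \<Omega>)"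

definition neumann_domain ::
  "(real^2) set \<Rightarrow> (real^2 \<Rightarrow> real^2) \<Rightarrow> real \<Rightarrow> (real^2 \<Rightarrow> complex) set" where
  "neumann_domain \<Omega> A h = {u \<in> H2 \<Omega>.
     \<exists>g :: 2 \<Rightarrow> real^2 \<Rightarrow> complex. (\<forall>j. has_trace \<Omega> (mag_deriv \<Omega> A h j u) (g j)) \<and>
       (AE x in surface_measure \<Omega>. (\<Sum>j\<in>UNIV. complex_of_real (outward_normal \<Omega> x $ j) * g j x) = 0)}"

text \<open>Eigenvalues are real since the operator is self-adjoint.\<close>
definition eigenpair ::
  "(real^2) set \<Rightarrow> (real^2 \<Rightarrow> real^2) \<Rightarrow> real \<Rightarrow> real \<Rightarrow> (real^2 \<Rightarrow> complex) \<Rightarrow> bool" where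
  "eigenpair \<Omega> A h \<mu> \<psi> \<longleftrightarrow>
     \<psi> \<in> neumann_domain \<Omega> A h \<and> \<not> (AE x in lebesgue_on \<Omega>. \<psi> x = 0) \<and>
     (AE x in lebesgue_on \<Omega>. mag_op \<Omega> A h \<psi> x = complex_of_real \<mu> * \<psi> x)"

section \<open>The zero set of the magnetic field\<close>

definition zero_set :: "(real^2) set \<Rightarrow> (real^2 \<Rightarrow> real^2) \<Rightarrow> (real^2) set" where
  "zero_set \<Omega> A = {x \<in> closure \<Omega>. magnetic_field A x = 0}"

definition singular_set :: "(real^2) set \<Rightarrow> (real^2 \<Rightarrow> real^2) \<Rightarrow> (real^2) set" where
  "singular_set \<Omega> A = {x \<in> zero_set \<Omega> A. grad (magnetic_field A) x = 0}"

text \<open>At a zero of the field where its gradient does not vanish, the zero set is a smooth curve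
  whose tangent line is the orthogonal complement of the gradient.\<close>
definition non_tangent :: "(real^2) set \<Rightarrow> (real^2 \<Rightarrow> real^2) \<Rightarrow> real^2 \<Rightarrow> bool" where
  "non_tangent \<Omega> A x \<longleftrightarrow>
     {v. grad (magnetic_field A) x \<bullet> v = 0} \<noteq> {v. outward_normal \<Omega> x \<bullet> v = 0}"

end

theory Submission
  imports Defs
begin

text \<open>Write \<open>r\<close> for the distance to the critical zeros, \<open>D\<^sub>j = -ih\<partial>\<^sub>j + A\<^sub>j\<close>, and \<open>u = exp (r/h^d) \<psi>\<close> for an eigenfunction \<open>\<psi>\<close>.
Testing the eigenvalue equation against \<open>exp (2r/h^d) \<psi>\<close> gives the Agmon identity
\<open>Q(u) = \<mu> \<parallel>u\<parallel>\<^sup>2 + h^(2-2d) \<parallel>|\<nabla>r| u\<parallel>\<^sup>2\<close>; as \<open>d < 1/4\<close> the last term is below \<open>h^(3/2)\<close>, so \<open>Q(u) \<le> C h^(3/2) \<parallel>u\<parallel>\<^sup>2\<close>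
(\<open>weighted_energy_le\<close>). Since the weight is at most \<open>e\<close> where \<open>r \<le> h^d\<close>, both parts of the claim
follow once at most half of the mass of \<open>u\<close> lies in \<open>r \<ge> h^d\<close>.

This is a lower bound for the form (\<open>mass_away_from_critical_zeros\<close>), obtained from two
integrations by parts instead of model operators. The commutator of \<open>D\<^sub>1\<close> and \<open>D\<^sub>2\<close> is a multiple of
\<open>hB\<close>, so \<open>h \<integral>\<chi> B |u|\<^sup>2\<close> is bounded by the energy for every compactly supported \<open>\<chi>\<close>; this controls
\<open>u\<close> where \<open>B\<close> is large. Near the zero curve \<open>|\<nabla>B|\<close> is at least \<open>c r\<close>, by nondegeneracy of the Hessian, and
a vector field along \<open>\<nabla>B\<close> with large divergence there controls \<open>u\<close> through \<open>\<integral>(div X) |u|\<^sup>2\<close>.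
With \<open>\<rho>\<close> comparable to \<open>s + r\<close> and \<open>y = B/(\<rho>w)\<close> the choice \<open>\<chi> = arctan y\<close>, \<open>X = w (arctan y) \<nabla>B/\<rho>\<close> serves
both purposes, because \<open>1/(1+y\<^sup>2) + y arctan y \<ge> 1/2\<close> for all \<open>y\<close>. Both are cut off at distance of order \<open>w\<close> from
the boundary, at the cost of the mass of \<open>u\<close> in a layer of that width, which is
\<open>O(w)\<close> (\<open>boundary_layer\<close>). For \<open>s = h^d\<close> and \<open>w = h^\<alpha>\<close> with \<open>\<alpha>\<close> slightly above \<open>1/4\<close> all errors tend to zero.

The analytic basis is \<open>neumann_green\<close>: a vector field in \<open>H1\<close> with vanishing normal trace pairs to zero.
Traces are limits of smooth functions in the surface measure, so one compares the mass of a smooth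
normal component in a layer of width \<open>t\<close> with \<open>t\<close> times its surface integral; the required bound for
the Hausdorff measure comes from fattening a covering of the boundary in a transversal direction.\<close>

abbreviation cmod2 :: "complex => real" where "cmod2 z \<equiv> (cmod z)\<^sup>2"

lemmas lint_mono = Bochner_Integration.integral_mono
 and lint_cong = Bochner_Integration.integral_cong
 and lint_add = Bochner_Integration.integral_add
 and lint_sum = Bochner_Integration.integral_sum
 and lint_diff = Bochner_Integration.integral_diff
 and lint_nonneg = Bochner_Integration.integral_nonneg
 and litg_bound = Bochner_Integration.integrable_bound
 and litg_sum = Bochner_Integration.integrable_sum
 and litg_add = Bochner_Integration.integrable_add
 and litg_diff = Bochner_Integration.integrable_diff

section \<open>Continuously differentiable functions in the plane\<close>

lemma partialI: "(f has_derivative D) (at x) ==> partial j f x = D (axis j 1)"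
 unfolding partial_def by (metis frechet_derivative_at)

lemma has_derivative_partial:
 fixes f :: "real^2 => 'b::real_normed_vector"
 assumes "f differentiable (at x)"
 shows "(f has_derivative (%h. \<Sum>j\<in>UNIV. h $ j *\<^sub>R partial j f x)) (at x)"
proof -
 have D: "(f has_derivative frechet_derivative f (at x)) (at x)"
  using assms by (simp add: frechet_derivative_works)
 then interpret linear "frechet_derivative f (at x)" by (rule has_derivative_linear)
 have "frechet_derivative f (at x) h = (\<Sum>j\<in>UNIV. h $ j *\<^sub>R partial j f x)" for h
 proof -
  have "h = (\<Sum>j\<in>UNIV. h $ j *\<^sub>R axis j 1)"
   using basis_expansion[of h] by (simp add: scalar_mult_eq_scaleR)
  then have "frechet_derivative f (at x) h = frechet_derivative f (at x) (\<Sum>j\<in>UNIV. h $ j *\<^sub>R axis j 1)"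
   by simp
  then show ?thesis by (simp add: sum scale partial_def)
 qed
 then have "frechet_derivative f (at x) = (%h. \<Sum>j\<in>UNIV. h $ j *\<^sub>R partial j f x)" by blast
 then show ?thesis using D by simp
qed

lemma partial_cong_open:
 assumes "open U" "x \<in> U" "!!y. y \<in> U ==> f y = g y"
 shows "partial j f x = partial j g x"
  and "f differentiable (at x) \<longleftrightarrow> g differentiable (at x)"
proof -
 have "(f has_derivative D) (at x) = (g has_derivative D) (at x)" for D
  using has_derivative_transform_within_open[of f D x UNIV U g]
   has_derivative_transform_within_open[of g D x UNIV U f] assms by auto
 then show "partial j f x = partial j g x" "f differentiable (at x) \<longleftrightarrow> g differentiable (at x)"
  by (simp_all add: partial_def frechet_derivative_def differentiable_def)
qed

definition C1_on :: "(real^2) set => (real^2 => 'b::real_normed_vector) => bool" where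
 "C1_on U f \<longleftrightarrow> (\<forall>x\<in>U. f differentiable (at x)) \<and> (\<forall>j. continuous_on U (partial j f))"

lemma C1_on_subset: "C1_on U f ==> V \<subseteq> U ==> C1_on V f"
 unfolding C1_on_def by (meson continuous_on_subset subsetD)

lemma C1_on_continuous: "C1_on U f ==> continuous_on U f"
 unfolding C1_on_def by (meson continuous_at_imp_continuous_on differentiable_imp_continuous_within)

lemma C1_on_differentiable: "C1_on U f ==> x \<in> U ==> f differentiable (at x)"
 unfolding C1_on_def by blast

lemma C1_on_has_derivative:
 "C1_on U f ==> x \<in> U ==> (f has_derivative (%h. \<Sum>j\<in>UNIV. h $ j *\<^sub>R partial j f x)) (at x)"
 by (rule has_derivative_partial) (rule C1_on_differentiable)

lemma C1_on_partial: "C1_on U f ==> continuous_on U (partial j f)"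
 unfolding C1_on_def by blast

lemma C1_onI:
 assumes "!!x. x \<in> U ==> (f has_derivative F x) (at x)"
  and "!!j. continuous_on U (%x. F x (axis j 1))"
 shows "C1_on U f"
proof -
 have "partial j f x = F x (axis j 1)" if "x \<in> U" for x j
  using partialI[OF assms(1)[OF that]] .
 then have "continuous_on U (partial j f)" for j
  using assms(2)[of j] by (simp cong: continuous_on_cong)
 then show ?thesis using assms(1) unfolding C1_on_def differentiable_def by blast
qed

lemma C1_on_cong:
 assumes "open U" "!!y. y \<in> U ==> f y = g y"
 shows "C1_on U f \<longleftrightarrow> C1_on U g"
proof -
 have "f differentiable (at x) \<longleftrightarrow> g differentiable (at x)" "partial j f x = partial j g x"
  if "x \<in> U" for x j
  using partial_cong_open[OF \<open>open U\<close> that, of f g] assms(2) by auto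
 then show ?thesis unfolding C1_on_def by (simp cong: continuous_on_cong)
qed

lemma C1_on_const: "C1_on U (%x. c)"
 by (rule C1_onI[of _ _ "%x h. 0"]) auto

lemma C1_on_bilinear:
 assumes "bounded_bilinear pr" "C1_on U f" "C1_on U g"
 shows "C1_on U (%x. pr (f x) (g x))"
  and "x \<in> U ==> partial j (%x. pr (f x) (g x)) x = pr (f x) (partial j g x) + pr (partial j f x) (g x)"
proof -
 interpret bounded_bilinear pr by fact
 have D: "((%x. pr (f x) (g x)) has_derivative
   (%h. pr (f x) (\<Sum>j\<in>UNIV. h $ j *\<^sub>R partial j g x) + pr (\<Sum>j\<in>UNIV. h $ j *\<^sub>R partial j f x) (g x))) (at x)"
  if "x \<in> U" for x
  by (rule FDERIV[OF C1_on_has_derivative[OF assms(2) that] C1_on_has_derivative[OF assms(3) that]])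
 have ax: "(\<Sum>i\<in>UNIV. axis j (1::real) $ i *\<^sub>R w i) = w j" for j :: 2 and w :: "2 => 'z::real_vector"
  by (simp add: axis_def if_distrib[of "%t. t *\<^sub>R _"] sum.delta cong: if_cong)
 show "C1_on U (%x. pr (f x) (g x))"
  by (rule C1_onI[OF D]) (auto simp: ax intro!: continuous_intros continuous_on
    C1_on_continuous[OF assms(2)] C1_on_continuous[OF assms(3)] C1_on_partial[OF assms(2)] C1_on_partial[OF assms(3)])
 show "x \<in> U ==> partial j (%x. pr (f x) (g x)) x = pr (f x) (partial j g x) + pr (partial j f x) (g x)"
  using partialI[OF D, of x j] by (simp add: ax)
qed

lemmas C1_on_mult = C1_on_bilinear[OF bounded_bilinear_mult]

lemma C1_on_linear:
 assumes "bounded_linear L" "C1_on U f"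
 shows "C1_on U (%x. L (f x))"
  and "x \<in> U ==> partial j (%x. L (f x)) x = L (partial j f x)"
proof -
 interpret bounded_linear L by fact
 have D: "((%x. L (f x)) has_derivative (%h. L (\<Sum>j\<in>UNIV. h $ j *\<^sub>R partial j f x))) (at x)" if "x \<in> U" for x
  by (rule has_derivative[OF C1_on_has_derivative[OF assms(2) that]])
 have ax: "(\<Sum>i\<in>UNIV. axis j (1::real) $ i *\<^sub>R w i) = w j" for j :: 2 and w :: "2 => 'z::real_vector"
  by (simp add: axis_def if_distrib[of "%t. t *\<^sub>R _"] sum.delta cong: if_cong)
 show "C1_on U (%x. L (f x))"
  by (rule C1_onI[OF D]) (auto simp: ax intro!: continuous_on C1_on_partial[OF assms(2)])
 show "x \<in> U ==> partial j (%x. L (f x)) x = L (partial j f x)"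
  using partialI[OF D, of x j] by (simp add: ax)
qed

lemma C1_on_add:
 assumes "C1_on U f" "C1_on U g"
 shows "C1_on U (%x. f x + g x)"
  and "x \<in> U ==> partial j (%x. f x + g x) x = partial j f x + partial j g x"
proof -
 have D: "((%x. f x + g x) has_derivative
   (%h. (\<Sum>j\<in>UNIV. h $ j *\<^sub>R partial j f x) + (\<Sum>j\<in>UNIV. h $ j *\<^sub>R partial j g x))) (at x)"
  if "x \<in> U" for x
  by (rule has_derivative_add[OF C1_on_has_derivative[OF assms(1) that] C1_on_has_derivative[OF assms(2) that]])
 have ax: "(\<Sum>i\<in>UNIV. axis j (1::real) $ i *\<^sub>R w i) = w j" for j :: 2 and w :: "2 => 'z::real_vector"
  by (simp add: axis_def if_distrib[of "%t. t *\<^sub>R _"] sum.delta cong: if_cong)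
 show "C1_on U (%x. f x + g x)"
  by (rule C1_onI[OF D]) (auto simp: ax intro!: continuous_intros C1_on_partial[OF assms(1)] C1_on_partial[OF assms(2)])
 show "x \<in> U ==> partial j (%x. f x + g x) x = partial j f x + partial j g x"
  using partialI[OF D, of x j] by (simp add: ax)
qed

lemma C1_on_diff:
 assumes "C1_on U f" "C1_on U g"
 shows "C1_on U (%x. f x - g x)"
  and "x \<in> U ==> partial j (%x. f x - g x) x = partial j f x - partial j g x"
proof -
 note m = C1_on_linear[OF bounded_linear_minus[OF bounded_linear_ident] assms(2)]
 show "C1_on U (%x. f x - g x)"
  using C1_on_add(1)[OF assms(1) m(1)] by simp
 show "x \<in> U ==> partial j (%x. f x - g x) x = partial j f x - partial j g x"
  using C1_on_add(2)[OF assms(1) m(1)] m(2) by simp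
qed

lemma C1_on_compose_real:
 fixes f :: "real^2 => real"
 assumes "C1_on U f" and d: "!!x. x \<in> U ==> (\<phi> has_real_derivative \<phi>' (f x)) (at (f x))"
  and c: "continuous_on U (%x. \<phi>' (f x))"
 shows "C1_on U (%x. \<phi> (f x))"
  and "x \<in> U ==> partial j (%x. \<phi> (f x)) x = \<phi>' (f x) * partial j f x"
proof -
 have D: "((%x. \<phi> (f x)) has_derivative (%h. \<phi>' (f x) * (\<Sum>j\<in>UNIV. h $ j *\<^sub>R partial j f x))) (at x)"
  if "x \<in> U" for x
  using has_derivative_compose[OF C1_on_has_derivative[OF assms(1) that] d[OF that, unfolded has_field_derivative_def]]
  by simp
 have ax: "(\<Sum>i\<in>UNIV. axis j (1::real) $ i *\<^sub>R w i) = w j" for j :: 2 and w :: "2 => 'z::real_vector"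
  by (simp add: axis_def if_distrib[of "%t. t *\<^sub>R _"] sum.delta cong: if_cong)
 have ax': "(\<Sum>i\<in>UNIV. axis j (1::real) $ i * w i) = w j" for j :: 2 and w :: "2 => real"
  using ax[of j w] by simp
 show "C1_on U (%x. \<phi> (f x))"
  by (rule C1_onI[OF D]) (auto simp: ax' intro!: continuous_intros c C1_on_partial[OF assms(1)])
 show "x \<in> U ==> partial j (%x. \<phi> (f x)) x = \<phi>' (f x) * partial j f x"
  using partialI[OF D, of x j] by (simp add: ax')
qed

lemma smooth_on_C1_on:
 assumes "smooth_on U f"
 shows "C1_on U f"
proof -
 have "Ck_on (Suc 0) U f" using assms unfolding smooth_on_def by blast
 then show ?thesis by (simp add: C1_on_def)
qed

lemma smooth_on_partial:
 assumes "smooth_on U f"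
 shows "smooth_on U (partial j f)"
proof -
 have "Ck_on k U (partial j f)" for k
 proof -
  have "Ck_on (Suc k) U f" using assms unfolding smooth_on_def by blast
  then show ?thesis by simp
 qed
 then show ?thesis by (simp add: smooth_on_def)
qed

subsection \<open>Compactly supported functions\<close>

definition C1_compact :: "(real^2) set => (real^2 => 'b::real_normed_vector) => bool" where
 "C1_compact Om \<phi> \<longleftrightarrow> C1_on UNIV \<phi> \<and> (\<exists>K. compact K \<and> K \<subseteq> Om \<and> (\<forall>x. x \<notin> K --> \<phi> x = 0))"

lemma C1_compactD: "C1_compact Om \<phi> ==> C1_on UNIV \<phi>"
 by (simp add: C1_compact_def)

lemma C1_compactE:
 assumes "C1_compact Om \<phi>"
 obtains K where "compact K" "K \<subseteq> Om" "!!x. x \<notin> K ==> \<phi> x = 0" "!!x j. x \<notin> K ==> partial j \<phi> x = 0"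
proof -
 obtain K where K: "compact K" "K \<subseteq> Om" "!!x. x \<notin> K ==> \<phi> x = 0"
  using assms by (auto simp: C1_compact_def)
 have "partial j \<phi> x = 0" if "x \<notin> K" for x j
 proof -
  have "partial j \<phi> x = partial j (%_. 0) x"
   by (rule partial_cong_open[of "- K"]) (use K that in \<open>auto simp: compact_imp_closed open_Compl\<close>)
  then show ?thesis by (simp add: partial_def)
 qed
 then show ?thesis using K that by blast
qed

lemma C1_compact_mono: "C1_compact Om \<phi> ==> Om \<subseteq> Om' ==> C1_compact Om' \<phi>"
 unfolding C1_compact_def by blast

lemma continuous_compact_support_bounded:
 fixes f :: "'a::topological_space => 'b::real_normed_vector"
 assumes "continuous_on UNIV f" "compact K" "!!x. x \<notin> K ==> f x = 0"
 obtains M where "M >= 0" "!!x. norm (f x) <= M"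
proof -
 have "bounded (f ` K)"
  using assms by (meson compact_continuous_image compact_imp_bounded continuous_on_subset subset_UNIV)
 then obtain M where "!!x. x \<in> K ==> norm (f x) <= M" by (auto simp: bounded_iff)
 then have "norm (f x) <= max M 0" for x
  using assms(3)[of x] by (cases "x \<in> K") (auto simp: le_max_iff_disj)
 then show ?thesis using that[of "max M 0"] by auto
qed

lemma C1_compact_bounded:
 assumes "C1_compact Om \<phi>"
 obtains M where "M >= 0" "!!x. norm (\<phi> x) <= M" "!!x j. norm (partial j \<phi> x) <= M"
proof -
 from assms obtain K where K: "compact K" "K \<subseteq> Om" "!!x. x \<notin> K ==> \<phi> x = 0" "!!x j. x \<notin> K ==> partial j \<phi> x = 0"
  by (rule C1_compactE) blast
 obtain M0 where M0: "M0 >= 0" "!!x. norm (\<phi> x) <= M0"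
  using continuous_compact_support_bounded[OF C1_on_continuous[OF C1_compactD[OF assms]] K(1,3)] by blast
 have "\<exists>M\<ge>0. \<forall>x. norm (partial j \<phi> x) <= M" for j
  using continuous_compact_support_bounded[OF C1_on_partial[OF C1_compactD[OF assms]] K(1,4)] by metis
 then obtain M where M: "!!j. M j >= 0" "!!x j. norm (partial j \<phi> x) <= M j" by metis
 have "norm (\<phi> x) <= M0 + (\<Sum>j\<in>UNIV. M j)" "norm (partial j \<phi> x) <= M0 + (\<Sum>j\<in>UNIV. M j)" for x j
 proof -
  have "M j <= (\<Sum>j\<in>UNIV. M j)" by (rule member_le_sum) (auto simp: M)
  moreover have "0 <= (\<Sum>j\<in>UNIV. M j)" by (rule sum_nonneg) (auto simp: M)
  ultimately show "norm (\<phi> x) <= M0 + (\<Sum>j\<in>UNIV. M j)" "norm (partial j \<phi> x) <= M0 + (\<Sum>j\<in>UNIV. M j)"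
   using M0 M(2)[of j x] M0(2)[of x] by linarith+
 qed
 moreover have "M0 + (\<Sum>j\<in>UNIV. M j) >= 0" using M0(1) M(1) by (simp add: sum_nonneg)
 ultimately show ?thesis using that by blast
qed

text \<open>Multiplying by a cut-off that is only defined near the boundary and extending by zero.\<close>
lemma C1_compact_extend:
 fixes f :: "real^2 => 'b::real_normed_vector"
 assumes "open W" "C1_on W f" "compact K" "K \<subseteq> W" "K \<subseteq> Om" "!!x. x \<in> W ==> x \<notin> K ==> f x = 0"
 defines "F \<equiv> (%x. if x \<in> W then f x else 0)"
 shows "C1_compact Om F" and "!!x j. x \<in> W ==> partial j F x = partial j f x"
  and "!!x j. x \<notin> K ==> F x = 0" "!!x j. x \<notin> K ==> partial j F x = 0"
proof -
 have W: "partial j F x = partial j f x" "F differentiable (at x)" if "x \<in> W" for x j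
  using partial_cong_open[OF \<open>open W\<close> that, of F f] C1_on_differentiable[OF assms(2) that]
  by (auto simp: F_def)
 have opK: "open (- K)" using \<open>compact K\<close> by (simp add: compact_imp_closed open_Compl)
 have F0: "F x = 0" if "x \<notin> K" for x using that assms(6) by (auto simp: F_def)
 have K: "partial j F x = 0" "F differentiable (at x)" if "x \<notin> K" for x j
  using partial_cong_open[OF opK, of x F "%_. 0"] F0 that by (auto simp: partial_def)
 have "continuous_on UNIV (partial j F)" for j
 proof -
  have "continuous_on W (partial j F)"
   using C1_on_partial[OF assms(2), of j] by (simp add: W cong: continuous_on_cong)
  moreover have "continuous_on (- K) (partial j F)"
   using continuous_on_cong[of "- K" "- K" "partial j F" "%_. 0"] K by simp
  ultimately have "continuous_on (W \<union> - K) (partial j F)"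
   using \<open>open W\<close> opK by (rule continuous_on_open_Un[rotated 2])
  moreover have "W \<union> - K = UNIV" using \<open>K \<subseteq> W\<close> by blast
  ultimately show ?thesis by simp
 qed
 then have "C1_on UNIV F" unfolding C1_on_def using W K \<open>K \<subseteq> W\<close> by blast
 then show "C1_compact Om F" unfolding C1_compact_def using assms(3,5) F0 by blast
 show "!!x j. x \<in> W ==> partial j F x = partial j f x" "!!x j. x \<notin> K ==> F x = 0"
  "!!x j. x \<notin> K ==> partial j F x = 0"
  using W K F0 by auto
qed

lemma C1_compact_bilinear:
 assumes "bounded_bilinear pr" "open Om" "C1_compact Om ka" "C1_on Om a"
 shows "C1_compact Om (%x. pr (ka x) (a x))"
  and "x \<in> Om ==> partial j (%x. pr (ka x) (a x)) x = pr (ka x) (partial j a x) + pr (partial j ka x) (a x)"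
proof -
 interpret bounded_bilinear pr by fact
 from assms(3) obtain K where K: "compact K" "K \<subseteq> Om" "!!x. x \<notin> K ==> ka x = 0" "!!x j. x \<notin> K ==> partial j ka x = 0"
  by (rule C1_compactE) blast
 note ch = C1_on_subset[OF C1_compactD[OF assms(3)], of Om, simplified]
 note p = C1_on_bilinear[OF assms(1) ch assms(4)]
 have eq: "(%x. if x \<in> Om then pr (ka x) (a x) else 0) = (%x. pr (ka x) (a x))"
  using K zero_left by (metis subsetD)
 show "C1_compact Om (%x. pr (ka x) (a x))"
  using C1_compact_extend(1)[OF assms(2) p(1) K(1,2,2)] K(3) unfolding eq by (simp add: zero_left)
 show "x \<in> Om ==> partial j (%x. pr (ka x) (a x)) x = pr (ka x) (partial j a x) + pr (partial j ka x) (a x)"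
  by (rule p(2))
qed

lemma C1_compact_linear:
 assumes "bounded_linear L" "C1_compact Om ka"
 shows "C1_compact Om (%x. L (ka x))" "partial j (%x. L (ka x)) x = L (partial j ka x)"
proof -
 interpret bounded_linear L by fact
 show "C1_compact Om (%x. L (ka x))"
  using assms(2) C1_on_linear(1)[OF assms(1), of UNIV ka] zero unfolding C1_compact_def by metis
 show "partial j (%x. L (ka x)) x = L (partial j ka x)"
  using C1_on_linear(2)[OF assms(1) C1_compactD[OF assms(2)]] by simp
qed

subsection \<open>A step function\<close>

lemma has_real_derivative_pos_part_square:
 "((%s. (max s 0)^2) has_real_derivative 2 * max t 0) (at t)"
proof -
 consider "t < 0" | "t = 0" | "t > 0" by linarith
 then show ?thesis
 proof cases
  case 1
  have "((%s. (max s 0)^2) has_real_derivative 0) (at t)"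
   by (rule has_field_derivative_transform_within_open[of "%s. 0" _ _ "{..<0}"]) (use 1 in auto)
  then show ?thesis using 1 by simp
 next
  case 3
  have "((%s. (max s 0)^2) has_real_derivative 2 * t) (at t)"
   by (rule has_field_derivative_transform_within_open[of "%s. s^2" _ _ "{0<..}"])
    (use 3 in \<open>auto intro!: derivative_eq_intros\<close>)
  then show ?thesis using 3 by simp
 next
  case 2
  have "(%h::real. (max h 0)^2 / h) \<midarrow>0\<rightarrow> 0"
  proof (rule Lim_null_comparison)
   have b: "norm ((max h 0)^2 / h) <= \<bar>h\<bar>" for h :: real
    by (cases "h > 0") (auto simp: power2_eq_square)
   show "\<forall>\<^sub>F h::real in at 0. norm ((max h 0)^2 / h) <= \<bar>h\<bar>" using b by (intro always_eventually) blast
   show "(%h::real. \<bar>h\<bar>) \<midarrow>0\<rightarrow> 0" by (auto intro!: tendsto_eq_intros)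
  qed
  then show ?thesis unfolding DERIV_def 2 by simp
 qed
qed

text \<open>The quotient of two squares of positive parts is once, but not twice, differentiable at the ends, which is all that cut-offs need.\<close>
definition step :: "real => real" where
 "step s = (max s 0)^2 / ((max s 0)^2 + (max (1 - s) 0)^2)"

definition step' :: "real => real" where
 "step' s = 2 * max s 0 * max (1 - s) 0 * (max s 0 + max (1 - s) 0) / ((max s 0)^2 + (max (1 - s) 0)^2)^2"

lemma step_denominator_pos: "(max s 0)^2 + (max (1 - s) 0)^2 > (0::real)"
 by (cases "s > 0") (auto simp: add_pos_nonneg)

lemma has_real_derivative_step: "(step has_real_derivative step' s) (at s)"
proof -
 have a: "((%s. (max (1 - s) 0)^2) has_real_derivative - (2 * max (1 - s) 0)) (at s)"
 proof -
  have "((%s. 1 - s) has_real_derivative -1) (at s)" by (auto intro!: derivative_eq_intros)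
  from DERIV_chain'[OF this has_real_derivative_pos_part_square[of "1 - s"]]
  show ?thesis by simp
 qed
 have n: "(max s 0)^2 + (max (1 - s) 0)^2 ~= 0" using step_denominator_pos[of s] by linarith
 have eq: "(2 * max s 0 * ((max s 0)^2 + (max (1 - s) 0)^2)
   - (max s 0)^2 * (2 * max s 0 + - (2 * max (1 - s) 0)))
   / (((max s 0)^2 + (max (1 - s) 0)^2) * ((max s 0)^2 + (max (1 - s) 0)^2)) = step' s"
  unfolding step'_def power2_eq_square[of "_ + _"] by (simp add: power2_eq_square algebra_simps)
 show ?thesis
  using DERIV_divide[OF has_real_derivative_pos_part_square
    DERIV_add[OF has_real_derivative_pos_part_square a] n]
  unfolding eq step_def[abs_def] .
qed

lemma step_bounds: "0 <= step s" "step s <= 1" "s <= 0 ==> step s = 0" "s >= 1 ==> step s = 1"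
 using step_denominator_pos[of s] by (auto simp: step_def divide_simps)

lemma continuous_on_step': "continuous_on S step'"
proof -
 have "(max s 0)^2 + (max (1 - s) 0)^2 ~= 0" for s :: real using step_denominator_pos[of s] by linarith
 then show ?thesis unfolding step'_def[abs_def] by (intro continuous_intros) auto
qed

lemma step'_eq_0: "s <= 0 \<or> s >= 1 ==> step' s = 0"
 by (auto simp: step'_def)

lemma step'_bounded: "\<exists>M>0. \<forall>s. \<bar>step' s\<bar> <= M"
proof -
 obtain M where M: "!!s. s \<in> {0..1} ==> norm (step' s) <= M"
  using compact_imp_bounded[OF compact_continuous_image[OF continuous_on_step' compact_Icc[of 0 1]]]
  unfolding bounded_iff by blast
 have "\<bar>step' s\<bar> <= max M 1" for s
  using M[of s] step'_eq_0[of s] by (cases "s \<in> {0..1}") auto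
 then show ?thesis by (intro exI[of _ "max M 1"]) auto
qed

lemma bump_exists:
 fixes p :: "real^2"
 assumes "r > 0"
 obtains a :: "real^2 => real" where "C1_on UNIV a" "!!x. 0 <= a x" "!!x. a x <= 1"
  "!!x. dist x p <= r ==> a x = 1" "!!x. dist x p >= 2 * r ==> a x = 0"
proof -
 define q where "q x = (4 * r^2 - (x - p) \<bullet> (x - p)) / (3 * r^2)" for x :: "real^2"
 have D: "(q has_derivative (%h. - (2 * ((x - p) \<bullet> h)) / (3 * r\<^sup>2))) (at x)" for x
  unfolding q_def[abs_def] using assms
  by (auto intro!: derivative_eq_intros simp: inner_commute field_simps power2_eq_square)
 have q: "C1_on UNIV q" by (rule C1_onI[OF D]) (use assms in \<open>auto intro!: continuous_intros\<close>)
 have c: "continuous_on UNIV (%x. step' (q x))"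
  using continuous_on_compose2[OF continuous_on_step'[of UNIV] C1_on_continuous[OF q]] by simp
 show ?thesis
 proof (rule that[of "%x. step (q x)"])
  show "C1_on UNIV (%x. step (q x))"
   by (rule C1_on_compose_real[OF q has_real_derivative_step c])
  fix x
  have e: "(x - p) \<bullet> (x - p) = (dist x p)^2" by (simp add: dist_norm power2_norm_eq_inner)
  show "dist x p <= r ==> step (q x) = 1"
  proof -
   assume "dist x p <= r"
   then have "(dist x p)^2 <= r^2" by (simp add: power_mono)
   then have "q x >= 1" unfolding q_def e using assms by (simp add: divide_simps)
   then show ?thesis by (rule step_bounds)
  qed
  show "dist x p >= 2 * r ==> step (q x) = 0"
  proof -
   assume "dist x p >= 2 * r"
   then have "(dist x p)^2 >= (2 * r)^2" using assms by (intro power_mono) auto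
   then have "q x <= 0" unfolding q_def e using assms by (simp add: divide_simps power_mult_distrib)
   then show ?thesis by (rule step_bounds)
  qed
 qed (rule step_bounds)+
qed

section \<open>Mollifiers\<close>

subsection \<open>Smooth kernels\<close>

text \<open>Mollifiers must be smooth. The functions \<open>exp (-1/t) / t^n\<close> on the positive axis are closed under differentiation up to linear combinations.\<close>
definition flat :: "nat => real => real" where
 "flat n t = (if t > 0 then exp (- (1 / t)) / t ^ n else 0)"

lemma flat_nonneg: "0 <= flat n t"
 by (simp add: flat_def)

lemma power_le_fact_exp:
 fixes x :: real
 assumes "x >= 0"
 shows "x ^ n <= fact n * exp x"
proof -
 have "(\<Sum>i\<in>{n}. x ^ i /\<^sub>R fact i) <= (\<Sum>i. x ^ i /\<^sub>R fact i)"
  by (rule sum_le_suminf[OF summable_exp_generic]) (use assms in auto)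
 then have "x ^ n / fact n <= exp x" by (simp add: exp_def divide_inverse mult.commute)
 then show ?thesis by (simp add: divide_simps mult.commute)
qed

lemma flat_le: "flat n t <= fact (n + 2) * t^2"
proof (cases "t > 0")
 case True
 have "(1 / t) ^ (n + 2) <= fact (n + 2) * exp (1 / t)"
  using power_le_fact_exp[of "1 / t" "n + 2"] True by simp
 then have "1 / t ^ n <= fact (n + 2) * exp (1 / t) * t^2"
  using True by (simp add: divide_simps power_add power2_eq_square mult_ac)
 then have "(1 / t ^ n) * exp (- (1 / t)) <= (fact (n + 2) * exp (1 / t) * t\<^sup>2) * exp (- (1 / t))"
  by (rule mult_right_mono) simp
 also have "... = fact (n + 2) * t\<^sup>2 * (exp (1 / t) * exp (- (1 / t)))" by (simp only: mult_ac)
 finally show ?thesis using True by (simp add: flat_def exp_minus)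
qed (simp add: flat_def)

lemma has_real_derivative_flat:
 "(flat n has_real_derivative flat (n + 2) t - n * flat (n + 1) t) (at t)"
proof -
 consider "t < 0" | "t = 0" | "t > 0" by linarith
 then show ?thesis
 proof cases
  case 1
  have "(flat n has_real_derivative 0) (at t)"
   by (rule has_field_derivative_transform_within_open[of "%s. 0" _ _ "{..<0}"]) (use 1 in \<open>auto simp: flat_def\<close>)
  then show ?thesis using 1 by (simp add: flat_def)
 next
  case 3
  have "((%s. exp (- (1 / s)) / s ^ n) has_real_derivative flat (n + 2) t - n * flat (n + 1) t) (at t)"
   using 3 apply (auto intro!: derivative_eq_intros simp: flat_def divide_simps)
   by (cases n) (auto simp: algebra_simps power2_eq_square power_add)
  then show ?thesis
   by (rule has_field_derivative_transform_within_open[of _ _ _ "{0<..}"]) (use 3 in \<open>auto simp: flat_def\<close>)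
 next
  case 2
  have "(%h. flat n h / h) \<midarrow>0\<rightarrow> 0"
  proof (rule Lim_null_comparison)
   have "norm (flat n h / h) <= fact (n + 2) * \<bar>h\<bar>" for h
   proof (cases "h = 0")
    case False
    then have "\<bar>h\<bar> * \<bar>h\<bar> = h^2" by (simp add: power2_eq_square)
    then show ?thesis using flat_le[of n h] flat_nonneg[of n h] False
     by (simp add: divide_simps power2_eq_square mult.assoc)
   qed simp
   then show "\<forall>\<^sub>F h::real in at 0. norm (flat n h / h) <= fact (n + 2) * \<bar>h\<bar>"
    by (intro always_eventually) blast
   show "(%h::real. fact (n + 2) * \<bar>h\<bar>) \<midarrow>0\<rightarrow> 0" by (auto intro!: tendsto_eq_intros)
  qed
  then show ?thesis unfolding DERIV_def 2 by (simp add: flat_def)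
 qed
qed

text \<open>The algebra generated by flat functions of one coordinate. Its members are smooth because it is stable under partial derivatives.\<close>
inductive_set flat_algebra :: "(real^2 => real) set" where
 flat: "(%x. flat n (c + s * x $ j)) \<in> flat_algebra"
| scale: "f \<in> flat_algebra ==> (%x. c * f x) \<in> flat_algebra"
| add: "f \<in> flat_algebra ==> g \<in> flat_algebra ==> (%x. f x + g x) \<in> flat_algebra"
| mult: "f \<in> flat_algebra ==> g \<in> flat_algebra ==> (%x. f x * g x) \<in> flat_algebra"

lemma flat_coordinate_derivative:
 "((%x::real^2. flat n (c + s * x $ j)) has_derivative
  (%h. (flat (n + 2) (c + s * x $ j) - n * flat (n + 1) (c + s * x $ j)) * (s * h $ j))) (at x)"
proof -
 have "((%x::real^2. c + s * x $ j) has_derivative (%h. s * h $ j)) (at x)"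
  by (auto intro!: derivative_eq_intros bounded_linear_imp_has_derivative bounded_linear_vec_nth)
 from has_derivative_compose[OF this has_real_derivative_flat[unfolded has_field_derivative_def]]
 show ?thesis by simp
qed

lemma flat_algebra_derivative:
 assumes "f \<in> flat_algebra"
 shows "\<exists>F. (\<forall>x. (f has_derivative F x) (at x)) \<and> (\<forall>j. (%x. F x (axis j 1)) \<in> flat_algebra)"
 using assms
proof induction
 case (flat n c s j)
 have "(%x. (flat (n + 2) (c + s * x $ j) - n * flat (n + 1) (c + s * x $ j)) * (s * axis k 1 $ j)) \<in> flat_algebra" for k
 proof -
  have "(%x. (s * axis k 1 $ j) * (flat (n + 2) (c + s * x $ j) + (- n) * flat (n + 1) (c + s * x $ j))) \<in> flat_algebra"
   by (intro flat_algebra.intros)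
  then show ?thesis by (simp add: algebra_simps)
 qed
 then show ?case
  by (intro exI[of _ "%x h. (flat (n + 2) (c + s * x $ j) - n * flat (n + 1) (c + s * x $ j)) * (s * h $ j)"]
    conjI allI flat_coordinate_derivative)
next
 case (scale f c)
 then obtain F where F: "!!x. (f has_derivative F x) (at x)" "!!j. (%x. F x (axis j 1)) \<in> flat_algebra" by blast
 show ?case
  by (rule exI[of _ "%x h. c * F x h"]) (auto intro!: derivative_eq_intros F flat_algebra.scale)
next
 case (add f g)
 then obtain F G where F: "!!x. (f has_derivative F x) (at x)" "!!j. (%x. F x (axis j 1)) \<in> flat_algebra"
  and G: "!!x. (g has_derivative G x) (at x)" "!!j. (%x. G x (axis j 1)) \<in> flat_algebra" by blast
 show ?case
  by (rule exI[of _ "%x h. F x h + G x h"]) (auto intro!: derivative_eq_intros F G flat_algebra.add)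
next
 case (mult f g)
 then obtain F G where F: "!!x. (f has_derivative F x) (at x)" "!!j. (%x. F x (axis j 1)) \<in> flat_algebra"
  and G: "!!x. (g has_derivative G x) (at x)" "!!j. (%x. G x (axis j 1)) \<in> flat_algebra" by blast
 show ?case
  by (rule exI[of _ "%x h. f x * G x h + F x h * g x"])
   (auto intro!: has_derivative_mult F G flat_algebra.add flat_algebra.mult mult.hyps)
qed

lemma flat_algebra_partial:
 assumes "f \<in> flat_algebra"
 shows "partial j f \<in> flat_algebra" "f differentiable (at x)"
proof -
 obtain F where F: "!!x. (f has_derivative F x) (at x)" "!!j. (%x. F x (axis j 1)) \<in> flat_algebra"
  using flat_algebra_derivative[OF assms] by blast
 have "partial j f = (%x. F x (axis j 1))" using partialI[OF F(1)] by blast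
 then show "partial j f \<in> flat_algebra" using F by simp
 show "f differentiable (at x)" using F(1) by (auto simp: differentiable_def)
qed

lemma flat_algebra_smooth:
 assumes "f \<in> flat_algebra"
 shows "smooth_on UNIV f"
proof -
 have "Ck_on k UNIV f" for k
  using assms
 proof (induction k arbitrary: f)
  case 0
  then show ?case
   using flat_algebra_partial(2)
   by (auto intro!: continuous_at_imp_continuous_on differentiable_imp_continuous_within)
 next
  case (Suc k)
  then show ?case using flat_algebra_partial by auto
 qed
 then show ?thesis by (simp add: smooth_on_def)
qed

lemma flat_algebra_C1: "f \<in> flat_algebra ==> C1_on UNIV f"
 by (rule smooth_on_C1_on[OF flat_algebra_smooth])

lemma flat_algebra_symmetric:
 assumes "f \<in> flat_algebra"
 shows "partial i (partial j f) = partial j (partial i f)"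
 using assms
proof induction
 case (flat n c s k)
 define f where "f = (%n (x::real^2). flat n (c + s * x $ k))"
 have f: "C1_on UNIV (f m)" for m unfolding f_def by (intro flat_algebra_C1 flat_algebra.intros)
 have p: "partial j (f m) = (%x. (s * axis j 1 $ k) * (f (m + 2) x + (- m) * f (m + 1) x))" for j m
  using partialI[OF flat_coordinate_derivative[of m c s k]] by (auto simp: f_def algebra_simps)
 have q: "C1_on UNIV (%x. (- real m) * f (m + 1) x)"
  "partial j (%x. (- real m) * f (m + 1) x) x = - m * partial j (f (m + 1)) x" for m j x
  using C1_on_linear[OF bounded_linear_mult_right[of "- real m"] f] by simp_all
 note q2 = C1_on_add[OF f q(1)]
 have q3: "partial j (%x. b * (f (m + 2) x + (- real m) * f (m + 1) x)) x
  = b * (partial j (f (m + 2)) x + - m * partial j (f (m + 1)) x)" for j x m b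
  using C1_on_linear(2)[OF bounded_linear_mult_right[of b] q2(1)[of "m + 2" m], of x j]
   q2(2)[of x j "m + 2" m] unfolding q(2) by simp
 have "partial i (partial j (f n)) x = partial j (partial i (f n)) x" for x
  unfolding p[of _ n] q3 p by (simp add: algebra_simps)
 then show ?case unfolding f_def by blast
next
 case (scale f c)
 have p: "partial j (%x. c * g x) = (%x. c * partial j g x)" if "g \<in> flat_algebra" for j g
  using C1_on_linear(2)[OF bounded_linear_mult_right[of c] flat_algebra_C1[OF that]] by blast
 show ?case using scale by (simp add: p flat_algebra_partial)
next
 case (add f g)
 have p: "partial j (%x. f x + g x) = (%x. partial j f x + partial j g x)"
  if "f \<in> flat_algebra" "g \<in> flat_algebra" for j f g
  using C1_on_add(2)[OF flat_algebra_C1[OF that(1)] flat_algebra_C1[OF that(2)]] by blast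
 show ?case using add by (simp add: p flat_algebra_partial)
next
 case (mult f g)
 have p: "partial j (%x. f x * g x) = (%x. f x * partial j g x + partial j f x * g x)"
  if "f \<in> flat_algebra" "g \<in> flat_algebra" for j f g
  using C1_on_mult(2)[OF flat_algebra_C1[OF that(1)] flat_algebra_C1[OF that(2)]] by auto
 have q: "partial j (%x. f x + g x) = (%x. partial j f x + partial j g x)"
  if "f \<in> flat_algebra" "g \<in> flat_algebra" for j f g
  using C1_on_add(2)[OF flat_algebra_C1[OF that(1)] flat_algebra_C1[OF that(2)]] by blast
 show ?case using mult.hyps mult.IH
  by (simp add: p q flat_algebra_partial flat_algebra.mult algebra_simps)
qed

text \<open>Equality of the mixed derivatives is recorded here because it is immediate for the kernels below; every use of Schwarz's theorem is reduced to it.\<close>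
definition mollifier :: "real => (real^2 => real) => bool" where
 "mollifier ep \<eta> \<longleftrightarrow> test_function UNIV \<eta> \<and> (\<forall>x. 0 <= \<eta> x) \<and> (\<forall>x. ep <= norm x --> \<eta> x = 0)
  \<and> integral\<^sup>L lborel \<eta> = 1 \<and> partial 1 (partial 2 \<eta>) = partial 2 (partial 1 \<eta>)"

lemma integrable_compact_support:
 fixes f :: "real^2 => 'b::{banach, second_countable_topology}"
 assumes "continuous_on UNIV f" "compact K" "!!x. x \<notin> K ==> f x = 0"
 shows "integrable lborel f"
proof -
 have "integrable lborel (%x. indicator K x *\<^sub>R f x)"
  by (rule borel_integrable_compact[OF assms(2) continuous_on_subset[OF assms(1) subset_UNIV]])
 moreover have "(%x. indicator K x *\<^sub>R f x) = f"
  using assms(3) by (auto simp: fun_eq_iff indicator_def)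
 ultimately show ?thesis by simp
qed

lemma mollifier_exists:
 assumes "ep > 0"
 obtains \<eta> where "mollifier ep \<eta>"
proof -
 define e where "e = ep / 2"
 have e: "e > 0" "e + e = ep" using assms by (auto simp: e_def)
 define f where "f x = flat 0 (e + 1 * x $ 1) * flat 0 (e + (-1) * x $ 1) *
  (flat 0 (e + 1 * x $ 2) * flat 0 (e + (-1) * x $ 2))" for x :: "real^2"
 have f: "f \<in> flat_algebra" unfolding f_def[abs_def] by (intro flat_algebra.intros)
 have pos: "f x > 0" if "norm x < e" for x
  using component_le_norm_cart[of x 1] component_le_norm_cart[of x 2] that
  by (simp add: f_def flat_def)
 have nn: "f x >= 0" for x by (simp add: f_def flat_nonneg)
 have zero: "f x = 0" if "ep <= norm x" for x
 proof (rule ccontr)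
  assume "f x ~= 0"
  then have "\<bar>x $ 1\<bar> < e" "\<bar>x $ 2\<bar> < e" by (auto simp: f_def flat_def split: if_splits)
  moreover have "norm x <= \<bar>x $ 1\<bar> + \<bar>x $ 2\<bar>"
   using norm_le_l1_cart[of x] by (simp add: sum_2)
  ultimately show False using that e by linarith
 qed
 have cont: "continuous_on UNIV f" using C1_on_continuous[OF flat_algebra_C1[OF f]] .
 have zero': "f x = 0" if "x \<notin> cball 0 ep" for x using zero[of x] that by simp
 have int: "integrable lborel f" by (rule integrable_compact_support[OF cont compact_cball zero'])
 define I where "I = integral\<^sup>L lborel f"
 have "I > 0"
 proof -
  obtain m where m: "m \<in> cball (0::real^2) (e/2)" "!!y. y \<in> cball (0::real^2) (e/2) ==> f m <= f y"
  proof -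
   have "cball (0::real^2) (e/2) ~= {}" using e by simp
   then show ?thesis
    using continuous_attains_inf[OF compact_cball _ continuous_on_subset[OF cont subset_UNIV]] that by blast
  qed
  have "0 < f m * measure lborel (cball (0::real^2) (e/2))"
   using pos[of m] m(1) e by (simp add: content_cball_pos)
  also have "... = (\<integral>x. f m * indicator (cball (0::real^2) (e/2)) x \<partial>lborel)" by simp
  also have "... <= I" unfolding I_def
  proof (rule lint_mono[OF _ int])
   show "integrable lborel (%x. f m * indicator (cball (0::real^2) (e/2)) x)"
    using emeasure_lborel_cball_finite[of "0::real^2" "e/2"]
    by (intro integrable_mult_right integrable_real_indicator) auto
   show "f m * indicator (cball 0 (e/2)) x <= f x" for x
    using m(2)[of x] nn[of x] by (auto simp: indicator_def)
  qed
  finally show ?thesis .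
 qed
 define \<eta> where "\<eta> x = (1 / I) * f x" for x
 have \<eta>: "\<eta> \<in> flat_algebra" unfolding \<eta>_def[abs_def] by (intro flat_algebra.intros f)
 show ?thesis
 proof (rule that[of \<eta>], unfold mollifier_def test_function_def, intro conjI exI[of _ "cball 0 ep"])
  show "smooth_on UNIV \<eta>" using \<eta> by (rule flat_algebra_smooth)
  show "partial 1 (partial 2 \<eta>) = partial 2 (partial 1 \<eta>)" using \<eta> by (rule flat_algebra_symmetric)
  show "integral\<^sup>L lborel \<eta> = 1" unfolding \<eta>_def using \<open>I > 0\<close> by (simp add: I_def)
 qed (use zero zero' nn \<open>I > 0\<close> in \<open>auto simp: \<eta>_def\<close>)
qed

subsection \<open>Test functions\<close>

lemma test_function_C1: "test_function Om \<phi> ==> C1_compact Om \<phi>"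
 unfolding test_function_def C1_compact_def by (auto dest: smooth_on_C1_on)

lemma test_function_partial:
 assumes "test_function Om \<phi>"
 shows "test_function Om (partial j \<phi>)"
proof -
 from test_function_C1[OF assms] obtain K where K: "compact K" "K \<subseteq> Om" "!!x j. x \<notin> K ==> partial j \<phi> x = 0"
  by (rule C1_compactE) blast
 then show ?thesis
  using assms smooth_on_partial[of UNIV \<phi> j] unfolding test_function_def by blast
qed

lemma C1_on_reflect:
 fixes f :: "real^2 => 'b::real_normed_vector"
 assumes "C1_on UNIV f"
 shows "C1_on UNIV (%y. f (x - y))" "partial j (%y. f (x - y)) y = - partial j f (x - y)"
proof -
 have D: "((%y. f (x - y)) has_derivative (%h. \<Sum>j\<in>UNIV. (- h) $ j *\<^sub>R partial j f (x - y))) (at y)" for y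
  by (rule has_derivative_compose[OF _ C1_on_has_derivative[OF assms]]) (auto intro!: derivative_eq_intros)
 have ax: "(\<Sum>i\<in>UNIV. (- axis j (1::real)) $ i *\<^sub>R w i) = - w j" for j :: 2 and w :: "2 => 'z::real_vector"
  by (simp add: axis_def if_distrib[of "%t. t *\<^sub>R _"] sum.delta sum_negf cong: if_cong)
 have "continuous_on UNIV (%y. partial j f (x - y))" for j
  by (rule continuous_on_compose2[OF C1_on_partial[OF assms]]) (auto intro!: continuous_intros)
 then show "C1_on UNIV (%y. f (x - y))"
  by (intro C1_onI[OF D]) (auto simp: ax simp del: vector_uminus_component intro!: continuous_intros)
 show "partial j (%y. f (x - y)) y = - partial j f (x - y)"
  using partialI[OF D, of j y] by (simp add: ax del: vector_uminus_component)
qed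

lemma Ck_on_uminus:
 fixes f :: "real^2 => 'b::real_normed_vector"
 shows "Ck_on k UNIV f ==> Ck_on k UNIV (%x. - f x)"
proof (induction k arbitrary: f)
 case (Suc k)
 have "(f has_derivative frechet_derivative f (at x)) (at x)" for x
  using Suc.prems by (simp add: frechet_derivative_works)
 then have D: "((%x. - f x) has_derivative (%h. - frechet_derivative f (at x) h)) (at x)" for x
  by (rule has_derivative_minus)
 have "partial j (%x. - f x) = (%x. - partial j f x)" for j
  using partialI[OF D] by (auto simp: partial_def)
 then show ?case using Suc D by (auto simp: differentiable_def)
qed (auto intro!: continuous_intros)

lemma test_function_reflect:
 assumes "test_function UNIV \<eta>" "!!y. ep <= norm y ==> \<eta> y = 0" "cball x ep \<subseteq> Om"
 shows "test_function Om (%y. \<eta> (x - y))"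
proof -
 have "Ck_on k UNIV (%y. \<eta> (x - y))" if "smooth_on UNIV \<eta>" for k
  using that
 proof (induction k arbitrary: \<eta>)
  case 0
  then show ?case using C1_on_continuous[OF C1_on_reflect(1)[OF smooth_on_C1_on]] by simp
 next
  case (Suc k)
  note r = C1_on_reflect[OF smooth_on_C1_on[OF Suc.prems], where x = x]
  have "Ck_on k UNIV (%y. - partial j \<eta> (x - y))" for j
   by (rule Ck_on_uminus) (rule Suc.IH[OF smooth_on_partial[OF Suc.prems]])
  moreover have "partial j (%y. \<eta> (x - y)) = (%y. - partial j \<eta> (x - y))" for j using r(2) by blast
  ultimately show ?case using r(1) by (auto simp: C1_on_def)
 qed
 moreover have "\<eta> (x - y) = 0" if "y \<notin> cball x ep" for y
  using that assms(2)[of "x - y"] by (simp add: dist_norm)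
 ultimately show ?thesis using assms unfolding test_function_def smooth_on_def by (meson compact_cball)
qed

subsection \<open>Convolution\<close>

lemma lborel_reflect: "distr lborel borel (%y. x - y) = (lborel :: (real^2) measure)"
proof -
 have "(lborel :: (real^2) measure) = density (distr lborel borel (%y. x + (-1) *\<^sub>R y)) (%_. 1)"
  using lborel_affine[of "-1" x] by simp
 then show ?thesis by (simp add: density_1)
qed

lemma lborel_integral_reflect:
 fixes f :: "real^2 => 'b::{banach, second_countable_topology}"
 assumes "f \<in> borel_measurable borel"
 shows "(\<integral>y. f (x - y) \<partial>lborel) = integral\<^sup>L lborel f"
  and "integrable lborel (%y. f (x - y)) \<longleftrightarrow> integrable lborel f"
proof -
 have m: "(%y::real^2. x - y) \<in> measurable lborel borel" by simp
 show "(\<integral>y. f (x - y) \<partial>lborel) = integral\<^sup>L lborel f"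
  using integral_distr[OF m assms] by (simp add: lborel_reflect)
 show "integrable lborel (%y. f (x - y)) \<longleftrightarrow> integrable lborel f"
  using integrable_distr_eq[OF m assms] by (simp add: lborel_reflect)
qed

lemma lborel_integral_translate:
 fixes f :: "real^2 => 'b::{banach, second_countable_topology}"
 assumes "f \<in> borel_measurable borel"
 shows "(\<integral>y. f (y + z) \<partial>lborel) = integral\<^sup>L lborel f"
  and "integrable lborel (%y. f (y + z)) \<longleftrightarrow> integrable lborel f"
proof -
 have m: "(%y. z + y) \<in> measurable lborel borel" by simp
 have d: "distr lborel borel ((+) z) = (lborel :: (real^2) measure)" by (simp add: lborel_distr_plus)
 show "(\<integral>y. f (y + z) \<partial>lborel) = integral\<^sup>L lborel f"
  using integral_distr[OF m assms] unfolding d by (simp add: add.commute)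
 show "integrable lborel (%y. f (y + z)) \<longleftrightarrow> integrable lborel f"
  using integrable_distr_eq[OF m assms] unfolding d by (simp add: add.commute)
qed

definition conv :: "(real^2 => 'b::{banach, second_countable_topology}) => (real^2 => real) => real^2 => 'b" where
 "conv f \<eta> x = (\<integral>y. \<eta> (x - y) *\<^sub>R f y \<partial>lborel)"

lemma integrable_bounded_scaleR:
 fixes f :: "'a => 'b::{banach, second_countable_topology}"
 assumes "integrable M f" "g \<in> borel_measurable M" "!!x. x \<in> space M ==> \<bar>g x\<bar> <= C"
 shows "integrable M (%x. g x *\<^sub>R f x)"
proof (rule litg_bound)
 show "integrable M (%x. C * norm (f x))" using assms(1) by auto
 show "(%x. g x *\<^sub>R f x) \<in> borel_measurable M" using assms(1,2) by auto
 have "norm (g x *\<^sub>R f x) <= norm (C * norm (f x))" if "x \<in> space M" for x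
  using assms(3)[OF that] by (simp add: abs_mult mult_right_mono)
 then show "AE x in M. norm (g x *\<^sub>R f x) <= norm (C * norm (f x))" by (intro AE_I2)
qed

lemma conv_integrable:
 fixes f :: "real^2 => 'b::{banach, second_countable_topology}"
 assumes "integrable lborel f" "C1_compact UNIV \<eta>"
 shows "integrable lborel (%y. \<eta> (x - y) *\<^sub>R f y)" "integrable lborel (%y. partial j \<eta> (x - y) *\<^sub>R f y)"
proof -
 obtain M where M: "M >= 0" "!!x. norm (\<eta> x) <= M" "!!x j. norm (partial j \<eta> x) <= M"
  using C1_compact_bounded[OF assms(2)] by blast
 have "continuous_on UNIV (%y. \<eta> (x - y))" "continuous_on UNIV (%y. partial j \<eta> (x - y))"
  by (rule continuous_on_compose2[OF C1_on_continuous[OF C1_compactD[OF assms(2)]]], auto intro!: continuous_intros)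
   (rule continuous_on_compose2[OF C1_on_partial[OF C1_compactD[OF assms(2)]]], auto intro!: continuous_intros)
 then show "integrable lborel (%y. \<eta> (x - y) *\<^sub>R f y)" "integrable lborel (%y. partial j \<eta> (x - y) *\<^sub>R f y)"
  using M by (auto intro!: integrable_bounded_scaleR[OF assms(1), where C = M] borel_measurable_continuous_onI)
qed

lemma uniformly_continuous_compact_support:
 fixes f :: "real^2 => 'b::real_normed_vector"
 assumes "continuous_on UNIV f" "compact K" "!!x. x \<notin> K ==> f x = 0" "e > 0"
 obtains d where "d > 0" "!!x y. dist x y < d ==> dist (f x) (f y) < e"
proof -
 obtain R where R: "!!x. x \<in> K ==> norm x <= R"
  using compact_imp_bounded[OF \<open>compact K\<close>] by (auto simp: bounded_iff)
 have "uniformly_continuous_on (cball 0 (R + 2)) f"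
  by (rule compact_uniformly_continuous) (auto intro: continuous_on_subset[OF assms(1)])
 then obtain d where d: "d > 0" "!!x y. x \<in> cball 0 (R + 2) ==> y \<in> cball 0 (R + 2) ==> dist x y < d ==> dist (f x) (f y) < e"
  using \<open>e > 0\<close> unfolding uniformly_continuous_on_def by (metis dist_commute)
 have "dist (f x) (f y) < e" if xy: "dist x y < min d 1" for x y
 proof (cases "x \<in> cball 0 (R + 2) \<and> y \<in> cball 0 (R + 2)")
  case False
  have "norm x <= norm y + dist x y" "norm y <= norm x + dist x y"
   by (metis dist_norm norm_triangle_sub, metis dist_commute dist_norm norm_triangle_sub)
  then have "norm x > R" "norm y > R" using False xy by auto
  then have "x \<notin> K" "y \<notin> K" using R by force+
  then show ?thesis using assms(3) \<open>e > 0\<close> by simp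
 qed (use d xy in auto)
 then show ?thesis using that[of "min d 1"] d by auto
qed

lemma C1_compact_uniformly_differentiable:
 fixes \<eta> :: "real^2 => 'b::real_normed_vector"
 assumes "C1_compact UNIV \<eta>" "e > 0"
 obtains d where "d > 0" "!!x h. norm h < d ==>
   norm (\<eta> (x + h) - \<eta> x - (\<Sum>j\<in>UNIV. h $ j *\<^sub>R partial j \<eta> x)) <= e * norm h"
proof -
 from assms(1) obtain K where K: "compact K" "!!x j. x \<notin> K ==> partial j \<eta> x = 0"
  by (rule C1_compactE) blast
 note C1 = C1_compactD[OF assms(1)]
 have "e / 2 > 0" using \<open>e > 0\<close> by simp
 have "\<exists>d>0. \<forall>x y. dist x y < d --> dist (partial j \<eta> x) (partial j \<eta> y) < e / 2" for j
  using uniformly_continuous_compact_support[OF C1_on_partial[OF C1, of j] K(1) K(2) \<open>e / 2 > 0\<close>] by metis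
 then obtain d where d: "!!j. d j > 0" "!!j x y. dist x y < d j ==> dist (partial j \<eta> x) (partial j \<eta> y) < e / 2"
  by metis
 define \<delta> where "\<delta> = min (d 1) (d 2)"
 have \<delta>: "\<delta> > 0" "\<delta> <= d j" for j using d(1) exhaust_2[of j] by (auto simp: \<delta>_def)
 have "norm (\<eta> (x + h) - \<eta> x - (\<Sum>j\<in>UNIV. h $ j *\<^sub>R partial j \<eta> x)) <= e * norm h" if h: "norm h < \<delta>" for x h
 proof -
  define F where "F x h = (\<Sum>j\<in>UNIV. h $ j *\<^sub>R partial j \<eta> x)" for x and h :: "real^2"
  have "norm (\<eta> (x + h) - \<eta> x - F x ((x + h) - x)) <= norm ((x + h) - x) * e"
  proof (rule differentiable_bound_linearization[where S = "ball x \<delta>"])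
   show "x + t *\<^sub>R (x + h - x) \<in> ball x \<delta>" if "t \<in> {0..1}" for t
   proof -
    have "\<bar>t\<bar> * norm h <= 1 * norm h" using that by (intro mult_right_mono) auto
    then show ?thesis using h by (simp add: dist_norm)
   qed
   show "(\<eta> has_derivative F y) (at y within ball x \<delta>)" for y
    unfolding F_def[abs_def] by (rule has_derivative_at_withinI[OF C1_on_has_derivative[OF C1]]) simp
   show "onorm (F y - F x) <= e" if "y \<in> ball x \<delta>" for y
   proof (rule onorm_le)
    fix v :: "real^2"
    have "norm ((F y - F x) v) = norm (\<Sum>j\<in>UNIV. v $ j *\<^sub>R (partial j \<eta> y - partial j \<eta> x))"
     by (simp add: F_def scaleR_diff_right sum_subtractf)
    also have "... <= (\<Sum>j\<in>UNIV. \<bar>v $ j\<bar> * norm (partial j \<eta> y - partial j \<eta> x))"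
     by (rule order_trans[OF norm_sum]) simp
    also have "... <= (\<Sum>j\<in>(UNIV::2 set). norm v * (e / 2))"
    proof (intro sum_mono mult_mono)
     fix j
     have "dist y x < d j" using that \<delta>(2)[of j] by (simp add: dist_commute)
     then show "norm (partial j \<eta> y - partial j \<eta> x) <= e / 2" using d(2)[of y x j] by (simp add: dist_norm)
    qed (auto simp: component_le_norm_cart)
    also have "... = e * norm v" by simp
    finally show "norm ((F y - F x) v) <= e * norm v" .
   qed
   show "x \<in> ball x \<delta>" using \<delta> by simp
  qed
  then show ?thesis by (simp add: F_def mult.commute)
 qed
 then show ?thesis using that \<delta> by blast
qed

lemma conv_has_derivative:
 fixes f :: "real^2 => 'b::{banach, second_countable_topology}"
 assumes "integrable lborel f" "C1_compact UNIV \<eta>"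
 shows "(conv f \<eta> has_derivative (%h. \<Sum>j\<in>UNIV. h $ j *\<^sub>R conv f (partial j \<eta>) x)) (at x)"
 unfolding has_derivative_at_alt
proof (intro conjI allI impI)
 let ?r = "%z y. \<eta> (z - y) - \<eta> (x - y) - (\<Sum>j\<in>UNIV. (z - x) $ j *\<^sub>R partial j \<eta> (x - y))" and ?s = "%z. \<Sum>j\<in>UNIV. (z - x) $ j *\<^sub>R conv f (partial j \<eta>) x"
 show "bounded_linear (%h::real^2. \<Sum>j\<in>UNIV. h $ j *\<^sub>R conv f (partial j \<eta>) x)"
  by (intro bounded_linear_sum bounded_linear_compose[OF bounded_linear_scaleR_left] bounded_linear_vec_nth)
 fix e :: real assume "e > 0"
 define I where "I = (\<integral>y. norm (f y) \<partial>lborel)"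
 have "I >= 0" unfolding I_def by (rule integral_nonneg_AE) auto
 then have "e / (I + 1) > 0" using \<open>e > 0\<close> by simp
 from C1_compact_uniformly_differentiable[OF assms(2) this]
 obtain d where d: "d > 0" "!!x h. norm h < d ==>
   norm (\<eta> (x + h) - \<eta> x - (\<Sum>j\<in>UNIV. h $ j *\<^sub>R partial j \<eta> x)) <= e / (I + 1) * norm h" by blast
 have "norm (conv f \<eta> z - conv f \<eta> x - ?s z) <= e * norm (z - x)"
  if z: "norm (z - x) < d" for z
 proof -
  note i = conv_integrable[OF assms]
  have "conv f \<eta> z - conv f \<eta> x - ?s z
    = (\<integral>y. \<eta> (z - y) *\<^sub>R f y - \<eta> (x - y) *\<^sub>R f y - (\<Sum>j\<in>UNIV. (z - x) $ j *\<^sub>R partial j \<eta> (x - y) *\<^sub>R f y) \<partial>lborel)"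
  proof -
   have s: "(\<integral>y. (\<Sum>j\<in>UNIV. (z - x) $ j *\<^sub>R partial j \<eta> (x - y) *\<^sub>R f y) \<partial>lborel)
     = (\<Sum>j\<in>UNIV. (z - x) $ j *\<^sub>R (\<integral>y. partial j \<eta> (x - y) *\<^sub>R f y \<partial>lborel))"
    by (subst lint_sum)
     (intro integrable_scaleR_right i, simp only: Bochner_Integration.integral_scaleR_right)
   have si: "integrable lborel (%y. \<Sum>j\<in>UNIV. (z - x) $ j *\<^sub>R partial j \<eta> (x - y) *\<^sub>R f y)"
    by (intro litg_sum integrable_scaleR_right i)
   show ?thesis
    unfolding conv_def
    by (subst lint_diff[OF litg_diff[OF i(1) i(1)] si],
     subst lint_diff[OF i(1) i(1)], subst s) (rule refl)
  qed
  also have "... = (\<integral>y. (?r z y) *\<^sub>R f y \<partial>lborel)"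
   by (intro lint_cong) (simp_all add: scaleR_diff_left scaleR_sum_left)
  finally have eq: "conv f \<eta> z - conv f \<eta> x - ?s z
    = (\<integral>y. (?r z y) *\<^sub>R f y \<partial>lborel)" .
  have "norm (conv f \<eta> z - conv f \<eta> x - ?s z)
    <= (\<integral>y. norm ((?r z y) *\<^sub>R f y) \<partial>lborel)"
   unfolding eq by (rule integral_norm_bound)
  also have "... <= (\<integral>y. (e / (I + 1) * norm (z - x)) * norm (f y) \<partial>lborel)"
  proof (rule integral_mono_AE')
   show "integrable lborel (%y. (e / (I + 1) * norm (z - x)) * norm (f y))"
    using assms(1) by (intro integrable_mult_right integrable_norm)
   show "AE y in lborel. norm ((?r z y) *\<^sub>R f y)
     <= (e / (I + 1) * norm (z - x)) * norm (f y)"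
   proof (rule AE_I2)
    fix y
    have "norm (?r z y) <= e / (I + 1) * norm (z - x)"
     using d(2)[OF z, of "x - y"] by simp
    then show "norm ((?r z y) *\<^sub>R f y)
     <= (e / (I + 1) * norm (z - x)) * norm (f y)"
     unfolding norm_scaleR by (intro mult_right_mono) auto
   qed
  qed (use \<open>I >= 0\<close> \<open>e > 0\<close> in auto)
  also have "... = e / (I + 1) * I * norm (z - x)" by (simp add: I_def)
  also have "... <= e * norm (z - x)"
   using \<open>I >= 0\<close> \<open>e > 0\<close> by (intro mult_right_mono) (auto simp: divide_simps)
  finally show ?thesis .
 qed
 then show "\<exists>d>0. \<forall>y. norm (y - x) < d --> norm (conv f \<eta> y - conv f \<eta> x - (\<Sum>j\<in>UNIV. (y - x) $ j *\<^sub>R conv f (partial j \<eta>) x)) <= e * norm (y - x)"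
  using d(1) by blast
qed

lemma partial_conv:
 fixes f :: "real^2 => 'b::{banach, second_countable_topology}"
 assumes "integrable lborel f" "C1_compact UNIV \<eta>"
 shows "partial j (conv f \<eta>) = conv f (partial j \<eta>)"
proof
 fix x
 have ax: "(\<Sum>i\<in>UNIV. axis j (1::real) $ i *\<^sub>R w i) = w j" for w :: "2 => 'b"
  by (simp add: axis_def if_distrib[of "%t. t *\<^sub>R _"] sum.delta cong: if_cong)
 show "partial j (conv f \<eta>) x = conv f (partial j \<eta>) x"
  using partialI[OF conv_has_derivative[OF assms]] by (simp add: ax)
qed

lemma smooth_conv:
 fixes f :: "real^2 => 'b::{banach, second_countable_topology}"
 assumes "integrable lborel f" "test_function UNIV \<eta>"
 shows "smooth_on UNIV (conv f \<eta>)"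
proof -
 have "Ck_on k UNIV (conv f \<eta>)" for k
  using assms(2)
 proof (induction k arbitrary: \<eta>)
  case 0
  have "conv f \<eta> differentiable (at x)" for x
   using conv_has_derivative[OF assms(1) test_function_C1[OF 0]] by (auto simp: differentiable_def)
  then show ?case by (auto intro!: continuous_at_imp_continuous_on differentiable_imp_continuous_within)
 next
  case (Suc k)
  have "conv f \<eta> differentiable (at x)" for x
   using conv_has_derivative[OF assms(1) test_function_C1[OF Suc.prems]] by (auto simp: differentiable_def)
  moreover have "Ck_on k UNIV (conv f (partial j \<eta>))" for j
   by (rule Suc.IH[OF test_function_partial[OF Suc.prems]])
  ultimately show ?case using partial_conv[OF assms(1) test_function_C1[OF Suc.prems]] by simp
 qed
 then show ?thesis by (simp add: smooth_on_def)
qed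

lemma mollifierD:
 assumes "mollifier ep \<eta>"
 shows "test_function UNIV \<eta>" "C1_compact UNIV \<eta>" "0 <= \<eta> x" "ep <= norm x ==> \<eta> x = 0" "integral\<^sup>L lborel \<eta> = 1"
  "partial 1 (partial 2 \<eta>) = partial 2 (partial 1 \<eta>)" "integrable lborel \<eta>" "\<eta> \<in> borel_measurable borel"
  "(\<integral>y. \<eta> (x - y) \<partial>lborel) = 1" "integrable lborel (%y. \<eta> (x - y))"
proof -
 show t: "test_function UNIV \<eta>" "0 <= \<eta> x" "ep <= norm x ==> \<eta> x = 0" and i: "integral\<^sup>L lborel \<eta> = 1"
  and "partial 1 (partial 2 \<eta>) = partial 2 (partial 1 \<eta>)"
  using assms by (auto simp: mollifier_def)
 show c: "C1_compact UNIV \<eta>" by (rule test_function_C1[OF t(1)])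
 show int: "integrable lborel \<eta>" using not_integrable_integral_eq[of lborel \<eta>] i by auto
 show m: "\<eta> \<in> borel_measurable borel"
  using borel_measurable_continuous_onI[OF C1_on_continuous[OF C1_compactD[OF c]]] .
 show "(\<integral>y. \<eta> (x - y) \<partial>lborel) = 1" "integrable lborel (%y. \<eta> (x - y))"
  using lborel_integral_reflect[OF m, of x] i int by auto
qed

lemma conv_support:
 fixes f :: "real^2 => 'b::{banach, second_countable_topology}"
 assumes "!!x. ep <= norm x ==> \<eta> x = 0" "!!y. y \<in> ball x ep ==> f y = 0"
 shows "conv f \<eta> x = 0"
proof -
 have "(%y. \<eta> (x - y) *\<^sub>R f y) = (%y. 0)"
 proof
  show "\<eta> (x - y) *\<^sub>R f y = 0" for y
   using assms(1)[of "x - y"] assms(2)[of y] by (cases "y \<in> ball x ep") (auto simp: dist_norm)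
 qed
 then show ?thesis by (simp only: conv_def Bochner_Integration.integral_zero)
qed

lemma test_function_conv:
 assumes "integrable lborel f" "mollifier ep \<eta>" "compact K" "!!x. x \<notin> K ==> f x = (0::real)"
  "!!x. x \<in> K ==> cball x ep \<subseteq> Om"
 shows "test_function Om (conv f \<eta>)"
proof -
 have K': "compact {x + y | x y. x \<in> K \<and> y \<in> cball 0 ep}" by (rule compact_sums[OF \<open>compact K\<close> compact_cball])
 have "{x + y | x y. x \<in> K \<and> y \<in> cball 0 ep} \<subseteq> Om"
  using assms(5) by (auto simp: subset_iff dist_norm)
 moreover have "conv f \<eta> x = 0" if "x \<notin> {x + y | x y. x \<in> K \<and> y \<in> cball 0 ep}" for x
 proof (rule conv_support[OF mollifierD(4)[OF assms(2)]])
  fix y assume y: "y \<in> ball x ep"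
  have "x - y \<in> cball 0 ep" using y by (simp add: dist_norm norm_minus_commute)
  moreover have "x = y + (x - y)" by simp
  ultimately have "y \<notin> K" using that by blast
  then show "f y = 0" by (rule assms(4))
 qed
 ultimately show ?thesis
  using smooth_conv[OF assms(1) mollifierD(1)[OF assms(2)]] K' unfolding test_function_def by blast
qed

lemma conv_close:
 fixes f :: "real^2 => 'b::{banach, second_countable_topology}"
 assumes "integrable lborel f" "mollifier ep \<eta>" "!!y. norm (x - y) < ep ==> norm (f y - f x) <= e"
 shows "norm (conv f \<eta> x - f x) <= e"
proof -
 note m = mollifierD[OF assms(2)]
 have i: "integrable lborel (%y. \<eta> (x - y) *\<^sub>R f y)" "integrable lborel (%y. \<eta> (x - y) *\<^sub>R f x)"
  using conv_integrable[OF assms(1) m(2)] m(10) by auto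
 have "(\<integral>y. \<eta> (x - y) *\<^sub>R f x \<partial>lborel) = f x" using m(9,10) by simp
 then have eq: "conv f \<eta> x - f x = (\<integral>y. \<eta> (x - y) *\<^sub>R f y - \<eta> (x - y) *\<^sub>R f x \<partial>lborel)"
  unfolding conv_def using lint_diff[OF i] by simp
 have "norm (conv f \<eta> x - f x) <= (\<integral>y. norm (\<eta> (x - y) *\<^sub>R f y - \<eta> (x - y) *\<^sub>R f x) \<partial>lborel)"
  unfolding eq by (rule integral_norm_bound)
 also have "... <= (\<integral>y. \<eta> (x - y) * e \<partial>lborel)"
 proof (rule lint_mono)
  show "integrable lborel (%y. norm (\<eta> (x - y) *\<^sub>R f y - \<eta> (x - y) *\<^sub>R f x))"
   by (intro integrable_norm litg_diff i)
  show "integrable lborel (%y. \<eta> (x - y) * e)" using m(10) by simp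
  fix y
  show "norm (\<eta> (x - y) *\<^sub>R f y - \<eta> (x - y) *\<^sub>R f x) <= \<eta> (x - y) * e"
  proof (cases "norm (x - y) < ep")
   case True
   then show ?thesis using assms(3)[OF True] m(3)[of "x - y"]
    by (simp add: scaleR_diff_right[symmetric] mult_left_mono)
  qed (use m(4)[of "x - y"] in auto)
 qed
 also have "... = e" using m(9) by simp
 finally show ?thesis .
qed

lemma integral_partial_eq_0:
 fixes \<phi> :: "real^2 => 'b::{banach, second_countable_topology}"
 assumes "C1_compact UNIV \<phi>"
 shows "(\<integral>x. partial j \<phi> x \<partial>lborel) = 0"
proof -
 let ?I = "\<integral>x. partial j \<phi> x \<partial>lborel"
 from assms obtain K where K: "compact K" "!!x. x \<notin> K ==> \<phi> x = 0" "!!x j. x \<notin> K ==> partial j \<phi> x = 0"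
  by (rule C1_compactE) blast
 note C1 = C1_compactD[OF assms]
 obtain R where R: "R > 0" "!!x. x \<in> K ==> norm x <= R"
  using compact_imp_bounded[OF \<open>compact K\<close>] by (auto simp: bounded_pos)
 define V where "V = measure lborel (cball (0::real^2) (R + 1))"
 have "V >= 0" by (simp add: V_def)
 have i: "integrable lborel \<phi>" "integrable lborel (partial j \<phi>)"
  using integrable_compact_support[OF C1_on_continuous[OF C1] K(1,2)]
   integrable_compact_support[OF C1_on_partial[OF C1] K(1,3)] by auto
 have small: "norm ?I <= e * V" if "e > 0" for e
 proof -
  from C1_compact_uniformly_differentiable[OF assms \<open>e > 0\<close>] obtain d where
   d: "d > 0" "!!x h. norm h < d ==> norm (\<phi> (x + h) - \<phi> x - (\<Sum>j\<in>UNIV. h $ j *\<^sub>R partial j \<phi> x)) <= e * norm h"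
   by blast
  define s where "s = min (d / 2) 1"
  have s: "0 < s" "s < d" "s <= 1" using d(1) by (auto simp: s_def)
  define z where "z = s *\<^sub>R axis j (1::real)"
  have z: "norm z = s" using s by (simp add: z_def)
  have zs: "(\<Sum>i\<in>UNIV. z $ i *\<^sub>R w i) = s *\<^sub>R w j" for w :: "2 => 'b"
   by (simp add: z_def axis_def if_distrib[of "%t. t *\<^sub>R _"] if_distrib[of "%t. _ * t"] sum.delta cong: if_cong)
  have mphi: "\<phi> \<in> borel_measurable borel" using i(1) by auto
  have it: "integrable lborel (%x. \<phi> (x + z))" "(\<integral>x. \<phi> (x + z) \<partial>lborel) = integral\<^sup>L lborel \<phi>"
   using lborel_integral_translate[OF mphi] i(1) by auto
  have "s *\<^sub>R ?I = - (\<integral>x. \<phi> (x + z) - \<phi> x - s *\<^sub>R partial j \<phi> x \<partial>lborel)"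
   using i it by simp
  then have "s * norm ?I = norm (\<integral>x. \<phi> (x + z) - \<phi> x - s *\<^sub>R partial j \<phi> x \<partial>lborel)"
  proof -
   assume eq: "s *\<^sub>R ?I = - (\<integral>x. \<phi> (x + z) - \<phi> x - s *\<^sub>R partial j \<phi> x \<partial>lborel)"
   have "s * norm ?I = norm (s *\<^sub>R ?I)"
    using s by simp
   then show ?thesis unfolding eq by simp
  qed
  also have "... <= (\<integral>x. norm (\<phi> (x + z) - \<phi> x - s *\<^sub>R partial j \<phi> x) \<partial>lborel)"
   by (rule integral_norm_bound)
  also have "... <= (\<integral>x. (e * s) * indicator (cball (0::real^2) (R + 1)) x \<partial>lborel)"
  proof (rule lint_mono)
   show "integrable lborel (%x. norm (\<phi> (x + z) - \<phi> x - s *\<^sub>R partial j \<phi> x))"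
    by (intro integrable_norm litg_diff integrable_scaleR_right i it)
   show "integrable lborel (%x. (e * s) * indicator (cball (0::real^2) (R + 1)) x)"
    using emeasure_lborel_cball_finite[of "0::real^2" "R + 1"]
    by (intro integrable_mult_right integrable_real_indicator) auto
   fix x
   show "norm (\<phi> (x + z) - \<phi> x - s *\<^sub>R partial j \<phi> x) <= (e * s) * indicator (cball 0 (R + 1)) x"
   proof (cases "x \<in> cball 0 (R + 1)")
    case True
    then show ?thesis using d(2)[of z x] s z by (simp add: zs)
   next
    case False
    have "norm x <= norm (x + z) + norm z" using norm_triangle_ineq4[of "x + z" z] by simp
    then have "norm x > R" "norm (x + z) > R" using False z s R by auto
    then have "x \<notin> K" "x + z \<notin> K" using R(2) by force+
    then show ?thesis using K False by simp
   qed
  qed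
  also have "... = s * (e * V)" by (simp add: V_def)
  finally show ?thesis using s by simp
 qed
 have "norm ?I <= 0 + e" if "e > 0" for e
 proof -
  have "norm ?I <= e / (V + 1) * V"
   using small[of "e / (V + 1)"] \<open>V >= 0\<close> \<open>e > 0\<close> by simp
  also have "... <= e" using \<open>V >= 0\<close> \<open>e > 0\<close> by (simp add: divide_simps)
  finally show ?thesis by simp
 qed
 then have "norm ?I <= 0" by (rule field_le_epsilon)
 then show ?thesis by simp
qed

lemma conv_partial_commute:
 assumes "C1_compact UNIV \<phi>" "mollifier ep \<eta>"
 shows "conv \<phi> (partial j \<eta>) x = conv (partial j \<phi>) \<eta> x"
proof -
 note m = mollifierD[OF assms(2)]
 note r = C1_on_reflect[OF C1_compactD[OF m(2)], where x = x]
 note p = C1_compact_bilinear[OF bounded_bilinear_scaleR[THEN bounded_bilinear.flip] open_UNIV assms(1) r(1)]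
 from assms(1) obtain K where K: "compact K" "!!x. x \<notin> K ==> \<phi> x = 0" "!!x j. x \<notin> K ==> partial j \<phi> x = 0"
  by (rule C1_compactE) blast
 have i: "integrable lborel \<phi>" "integrable lborel (partial j \<phi>)"
  using integrable_compact_support[OF C1_on_continuous[OF C1_compactD[OF assms(1)]] K(1,2)]
   integrable_compact_support[OF C1_on_partial[OF C1_compactD[OF assms(1)]] K(1,3)] by auto
 have "0 = (\<integral>y. partial j (%y. \<eta> (x - y) *\<^sub>R \<phi> y) y \<partial>lborel)"
  using integral_partial_eq_0[OF p(1)] by simp
 also have "... = (\<integral>y. \<eta> (x - y) *\<^sub>R partial j \<phi> y - partial j \<eta> (x - y) *\<^sub>R \<phi> y \<partial>lborel)"
  by (subst p(2)) (auto simp: r(2))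
 also have "... = conv (partial j \<phi>) \<eta> x - conv \<phi> (partial j \<eta>) x"
  unfolding conv_def using conv_integrable[OF i(1) m(2)] conv_integrable[OF i(2) m(2)] by simp
 finally show ?thesis by simp
qed

lemma norm_partial_le_Lipschitz:
 fixes f :: "real^2 => 'b::real_normed_vector"
 assumes "f differentiable (at x)" "!!y. norm (f y - f x) <= L * norm (y - x)"
 shows "norm (partial j f x) <= L"
proof (rule field_le_epsilon)
 fix e :: real assume "e > 0"
 have D: "(f has_derivative frechet_derivative f (at x)) (at x)"
  using assms(1) by (simp add: frechet_derivative_works)
 then obtain d where d: "d > 0" "!!y. norm (y - x) < d ==>
   norm (f y - f x - frechet_derivative f (at x) (y - x)) <= e * norm (y - x)"
  using \<open>e > 0\<close> unfolding has_derivative_at_alt by blast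
 define y where "y = x + (d / 2) *\<^sub>R axis j 1"
 interpret bounded_linear "frechet_derivative f (at x)" using D by (rule has_derivative_bounded_linear)
 have y: "y - x = (d / 2) *\<^sub>R axis j 1" "norm (y - x) = d / 2" using d(1) by (auto simp: y_def)
 have n: "norm (f y - f x - frechet_derivative f (at x) (y - x)) <= e * (d / 2)" "norm (f y - f x) <= L * (d / 2)"
  using d(2)[of y] assms(2)[of y] y(2) d(1) by auto
 have "(d / 2) * norm (partial j f x) = norm (frechet_derivative f (at x) (y - x))"
  using d(1) unfolding y(1) scaleR by (simp add: partial_def)
 also have "... <= norm (f y - f x) + norm (f y - f x - frechet_derivative f (at x) (y - x))"
  using norm_triangle_ineq4[of "f y - f x" "f y - f x - frechet_derivative f (at x) (y - x)"] by simp
 also have "... <= L * (d / 2) + e * (d / 2)" using n by (intro add_mono) auto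
 also have "... = (d / 2) * (L + e)" by (simp add: algebra_simps)
 finally show "norm (partial j f x) <= L + e" using d(1) by simp
qed

lemma conv_Lipschitz:
 fixes f :: "real^2 => 'b::{banach, second_countable_topology}"
 assumes "integrable lborel f" "mollifier ep \<eta>" "!!x y. norm (f x - f y) <= L * norm (x - y)"
 shows "norm (partial j (conv f \<eta>) x) <= L"
proof (rule norm_partial_le_Lipschitz)
 note m = mollifierD[OF assms(2)]
 show "conv f \<eta> differentiable at x"
  using conv_has_derivative[OF assms(1) m(2)] by (auto simp: differentiable_def)
 have mf: "f \<in> borel_measurable borel" using assms(1) by auto
 have mm: "(%y. \<eta> y *\<^sub>R f (x - y)) \<in> borel_measurable borel" for x
  using m(8) mf by (intro borel_measurable_scaleR measurable_compose[OF _ mf]) auto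
 have c: "conv f \<eta> x = (\<integral>y. \<eta> y *\<^sub>R f (x - y) \<partial>lborel)" "integrable lborel (%y. \<eta> y *\<^sub>R f (x - y))" for x
  using lborel_integral_reflect[OF mm[of x], of x] conv_integrable(1)[OF assms(1) m(2), of x] by (auto simp: conv_def)
 fix y
 have eq: "conv f \<eta> y - conv f \<eta> x = (\<integral>z. \<eta> z *\<^sub>R (f (y - z) - f (x - z)) \<partial>lborel)"
  unfolding c(1) scaleR_diff_right by (rule lint_diff[symmetric]) (rule c(2))+
 have "norm (conv f \<eta> y - conv f \<eta> x) <= (\<integral>z. norm (\<eta> z *\<^sub>R (f (y - z) - f (x - z))) \<partial>lborel)"
  unfolding eq by (rule integral_norm_bound)
 also have "... <= (\<integral>z. \<eta> z * (L * norm (y - x)) \<partial>lborel)"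
 proof (rule lint_mono)
  show "integrable lborel (%z. norm (\<eta> z *\<^sub>R (f (y - z) - f (x - z))))"
   using c(2) by (simp add: scaleR_diff_right)
  show "integrable lborel (%z. \<eta> z * (L * norm (y - x)))" using m(7) by simp
  show "norm (\<eta> z *\<^sub>R (f (y - z) - f (x - z))) <= \<eta> z * (L * norm (y - x))" for z
   using m(3)[of z] assms(3)[of "y - z" "x - z"] by (simp add: mult_left_mono)
 qed
 also have "... = L * norm (y - x)" using m(5) by simp
 finally show "norm (conv f \<eta> y - conv f \<eta> x) <= L * norm (y - x)" .
qed

section \<open>Square-integrable functions\<close>

lemma L2D: "u \<in> L2 M ==> u \<in> borel_measurable M" "u \<in> L2 M ==> integrable M (%x. cmod2 (u x))"
 by (auto simp: L2_def)

lemma L2I: "u \<in> borel_measurable M ==> integrable M (%x. cmod2 (u x)) ==> u \<in> L2 M"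
 by (auto simp: L2_def)

lemma L2_norm_nonneg: "0 <= L2_norm M u"
 by (simp add: L2_norm_def)

lemma L2_norm_square: "(L2_norm M u)^2 = (\<integral>x. cmod2 (u x) \<partial>M)"
 by (simp add: L2_norm_def)

lemma L2_dominated:
 assumes "v \<in> borel_measurable M" "u \<in> L2 M" "C >= 0" "!!x. x \<in> space M ==> cmod (v x) <= C * cmod (u x)"
 shows "v \<in> L2 M" "L2_norm M v <= C * L2_norm M u"
proof -
 have le: "cmod2 (v x) <= C^2 * cmod2 (u x)" if "x \<in> space M" for x
  using power_mono[OF assms(4)[OF that], of 2] by (simp add: power_mult_distrib)
 have i: "integrable M (%x. C^2 * cmod2 (u x))" using L2D(2)[OF assms(2)] by simp
 have iv: "integrable M (%x. cmod2 (v x))"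
  by (rule litg_bound[OF i]) (use assms(1) le in auto)
 then show "v \<in> L2 M" by (intro L2I assms)
 have "(L2_norm M v)^2 <= (\<integral>x. C^2 * cmod2 (u x) \<partial>M)"
  unfolding L2_norm_square by (rule lint_mono[OF iv i le])
 also have "... = (C * L2_norm M u)^2" by (simp add: power_mult_distrib L2_norm_square)
 finally show "L2_norm M v <= C * L2_norm M u"
  by (rule power2_le_imp_le) (simp add: assms L2_norm_nonneg)
qed

lemma L2_mult_bounded:
 assumes "u \<in> L2 M" "a \<in> borel_measurable M" "!!x. x \<in> space M ==> cmod (a x) <= C" "C >= 0"
 shows "(%x. a x * u x) \<in> L2 M" "L2_norm M (%x. a x * u x) <= C * L2_norm M u"
 by (rule L2_dominated[of _ M u C]; use assms L2D(1)[OF assms(1)] in \<open>auto simp: norm_mult mult_right_mono\<close>)+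

lemma L2_scale: "u \<in> L2 M ==> (%x. c * u x) \<in> L2 M"
 by (rule L2_mult_bounded[where C = "cmod c"]) auto

lemma L2_norm_scale: "L2_norm M (%x. c * u x) = cmod c * L2_norm M u"
 by (simp add: L2_norm_def norm_mult power_mult_distrib real_sqrt_mult)

lemma L2_add:
 assumes "u \<in> L2 M" "v \<in> L2 M"
 shows "(%x. u x + v x) \<in> L2 M"
proof (rule L2I)
 have [measurable]: "u \<in> borel_measurable M" "v \<in> borel_measurable M" using assms L2D(1) by auto
 show m: "(%x. u x + v x) \<in> borel_measurable M" by measurable
 show "integrable M (%x. cmod2 (u x + v x))"
 proof (rule litg_bound)
  show "integrable M (%x. 2 * cmod2 (u x) + 2 * cmod2 (v x))"
   using L2D(2)[OF assms(1)] L2D(2)[OF assms(2)] by simp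
  have "cmod2 (u x + v x) <= 2 * cmod2 (u x) + 2 * cmod2 (v x)" for x
  proof -
   have "cmod2 (u x + v x) <= (cmod (u x) + cmod (v x))^2" by (intro power_mono norm_triangle_ineq) auto
   also have "... <= 2 * cmod2 (u x) + 2 * cmod2 (v x)"
    using sum_squares_bound[of "cmod (u x)" "cmod (v x)"] by (simp add: power2_sum)
   finally show ?thesis .
  qed
  then show "AE x in M. norm (cmod2 (u x + v x)) <= norm (2 * cmod2 (u x) + 2 * cmod2 (v x))"
   by (intro AE_I2) (simp add: order_trans[OF _ abs_ge_self])
 qed (use m in simp)
qed

lemma L2_diff: "u \<in> L2 M ==> v \<in> L2 M ==> (%x. u x - v x) \<in> L2 M"
 using L2_add[of u M "%x. (-1) * v x"] L2_scale[of v M "-1"] by simp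

lemma L2_cnj: "u \<in> L2 M ==> (%x. cnj (u x)) \<in> L2 M"
proof (rule L2_dominated[of _ M u 1])
 assume "u \<in> L2 M"
 then have [measurable]: "u \<in> borel_measurable M" by (rule L2D)
 show "(%x. cnj (u x)) \<in> borel_measurable M"
  by (rule measurable_compose[OF \<open>u \<in> borel_measurable M\<close>]) (rule borel_measurable_continuous_onI, intro continuous_intros)
qed auto

lemma L2_zero: "(%x. 0) \<in> L2 M"
 by (simp add: L2_def)

lemma Cauchy_Schwarz_integral:
 assumes m: "f \<in> borel_measurable M" "g \<in> borel_measurable M"
  and i: "integrable M (%x. (f x)^2)" "integrable M (%x. (g x)^2)"
 shows "integrable M (%x. \<bar>f x\<bar> * \<bar>g x\<bar> :: real)"
  and "(\<integral>x. \<bar>f x\<bar> * \<bar>g x\<bar> \<partial>M) <= sqrt (\<integral>x. (f x)^2 \<partial>M) * sqrt (\<integral>x. (g x)^2 \<partial>M)"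
proof -
 show ifg: "integrable M (%x. \<bar>f x\<bar> * \<bar>g x\<bar>)"
 proof (rule litg_bound)
  show "integrable M (%x. (f x)^2 + (g x)^2)" using i by simp
  have "\<bar>f x\<bar> * \<bar>g x\<bar> <= (f x)^2 + (g x)^2" for x
  proof -
   have "2 * \<bar>f x\<bar> * \<bar>g x\<bar> <= (f x)^2 + (g x)^2" using sum_squares_bound[of "\<bar>f x\<bar>" "\<bar>g x\<bar>"] by simp
   moreover have "0 <= \<bar>f x\<bar> * \<bar>g x\<bar>" by simp
   ultimately show ?thesis by linarith
  qed
  then show "AE x in M. norm (\<bar>f x\<bar> * \<bar>g x\<bar>) <= norm ((f x)^2 + (g x)^2)"
   by (intro AE_I2) (simp add: abs_mult order_trans[OF _ abs_ge_self])
 qed (use m in simp)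
 define a b I where "a = (\<integral>x. (f x)^2 \<partial>M)" and "b = (\<integral>x. (g x)^2 \<partial>M)" and "I = (\<integral>x. \<bar>f x\<bar> * \<bar>g x\<bar> \<partial>M)"
 have nn: "a >= 0" "b >= 0" "I >= 0" by (auto simp: a_def b_def I_def)
 have q: "2 * t * I <= t^2 * a + b" for t
 proof -
  have "0 <= (\<integral>x. (t * \<bar>f x\<bar> - \<bar>g x\<bar>)\<^sup>2 \<partial>M)" by simp
  also have "... = (\<integral>x. t^2 * (f x)^2 - 2 * t * (\<bar>f x\<bar> * \<bar>g x\<bar>) + (g x)^2 \<partial>M)"
   by (intro lint_cong) (auto simp: power2_diff power_mult_distrib)
  also have "... = t^2 * a - 2 * t * I + b"
   unfolding a_def b_def I_def using i ifg by simp
  finally show ?thesis by simp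
 qed
 have "I^2 <= a * b"
 proof (cases "a = 0")
  case True
  have "I = 0"
  proof (rule ccontr)
   assume "I ~= 0"
   then have "2 * ((b + 1) / (2 * I)) * I = b + 1" by simp
   then show False using q[of "(b + 1) / (2 * I)"] True by simp
  qed
  then show ?thesis using True by simp
 next
  case False
  then have "a > 0" using nn by simp
  have "2 * (I / a) * I <= (I / a)^2 * a + b" by (rule q)
  moreover have "(I / a)^2 * a = I^2 / a" using \<open>a > 0\<close> by (simp add: power2_eq_square)
  moreover have "2 * (I / a) * I = 2 * (I^2 / a)" by (simp add: power2_eq_square)
  ultimately have "I^2 / a <= b" by linarith
  then show ?thesis using \<open>a > 0\<close> by (simp add: divide_simps mult.commute)
 qed
 then have "I <= sqrt (a * b)" by (rule real_le_rsqrt)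
 then show "I <= sqrt a * sqrt b" by (simp add: real_sqrt_mult)
qed

lemma L2_product:
 assumes "u \<in> L2 M" "v \<in> L2 M"
 shows "integrable M (%x. cmod (u x) * cmod (v x))"
  and "(\<integral>x. cmod (u x) * cmod (v x) \<partial>M) <= L2_norm M u * L2_norm M v"
  and "integrable M (%x. u x * v x)"
proof -
 note cs = Cauchy_Schwarz_integral[of "%x. cmod (u x)" M "%x. cmod (v x)"]
 show 1: "integrable M (%x. cmod (u x) * cmod (v x))"
  by (rule cs(1)[simplified abs_norm_cancel]) (use L2D[OF assms(1)] L2D[OF assms(2)] in simp_all)
 show "(\<integral>x. cmod (u x) * cmod (v x) \<partial>M) <= L2_norm M u * L2_norm M v"
  unfolding L2_norm_def
  by (rule cs(2)[simplified abs_norm_cancel]) (use L2D[OF assms(1)] L2D[OF assms(2)] in simp_all)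
 show "integrable M (%x. u x * v x)"
  by (rule litg_bound[OF 1]) (use L2D(1)[OF assms(1)] L2D(1)[OF assms(2)] in \<open>auto simp: norm_mult\<close>)
qed

lemma L2_product_bounded:
 fixes k :: "'a => real"
 assumes "u \<in> L2 M" "v \<in> L2 M" "k \<in> borel_measurable M" "!!x. x \<in> space M ==> \<bar>k x\<bar> <= C"
 shows "integrable M (%x. k x *\<^sub>R (u x * v x))" "integrable M (%x. k x * (cmod (u x) * cmod (v x)))"
  "integrable M (%x. \<bar>k x\<bar> * (cmod (u x) * cmod (v x)))"
 using integrable_bounded_scaleR[OF L2_product(3)[OF assms(1,2)] assms(3,4)]
  integrable_bounded_scaleR[OF L2_product(1)[OF assms(1,2)] assms(3,4)]
  integrable_bounded_scaleR[OF L2_product(1)[OF assms(1,2)], of "%x. \<bar>k x\<bar>"] assms(3,4) by auto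

lemma L2_norm_triangle:
 assumes "u \<in> L2 M" "v \<in> L2 M"
 shows "L2_norm M (%x. u x + v x) <= L2_norm M u + L2_norm M v"
proof (rule power2_le_imp_le)
 note i = L2D(2)[OF L2_add[OF assms]] L2D(2)[OF assms(1)] L2D(2)[OF assms(2)] L2_product(1)[OF assms]
 have "(L2_norm M (%x. u x + v x))^2 = (\<integral>x. cmod2 (u x + v x) \<partial>M)" by (rule L2_norm_square)
 also have "... <= (\<integral>x. cmod2 (u x) + 2 * (cmod (u x) * cmod (v x)) + cmod2 (v x) \<partial>M)"
 proof (rule lint_mono[OF i(1)])
  show "integrable M (%x. cmod2 (u x) + 2 * (cmod (u x) * cmod (v x)) + cmod2 (v x))" using i by simp
  show "cmod2 (u x + v x) <= cmod2 (u x) + 2 * (cmod (u x) * cmod (v x)) + cmod2 (v x)" for x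
   using power_mono[OF norm_triangle_ineq[of "u x" "v x"], of 2] by (simp add: power2_sum)
 qed
 also have "... = (L2_norm M u)^2 + 2 * (\<integral>x. cmod (u x) * cmod (v x) \<partial>M) + (L2_norm M v)^2"
  using i by (simp add: L2_norm_square)
 also have "... <= (L2_norm M u + L2_norm M v)^2"
  using L2_product(2)[OF assms] by (simp add: power2_sum)
 finally show "(L2_norm M (%x. u x + v x))^2 <= (L2_norm M u + L2_norm M v)^2" .
qed (simp add: L2_norm_nonneg)

lemma L2_norm_triangle_diff:
 assumes "u \<in> L2 M" "v \<in> L2 M"
 shows "L2_norm M (%x. u x - v x) <= L2_norm M u + L2_norm M v"
 using L2_norm_triangle[OF assms(1) L2_scale[OF assms(2), of "-1"]] L2_norm_scale[of M "-1" v] by simp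

lemma L2_norm_cong_AE:
 assumes "u \<in> L2 M" "v \<in> L2 M" "AE x in M. u x = v x"
 shows "L2_norm M u = L2_norm M v"
proof -
 have "(\<integral>x. cmod2 (u x) \<partial>M) = (\<integral>x. cmod2 (v x) \<partial>M)"
  by (rule integral_cong_AE) (use assms L2D(1)[OF assms(1)] L2D(1)[OF assms(2)] in auto)
 then show ?thesis by (simp add: L2_norm_def)
qed

lemma L2_pairing_tendsto:
 fixes k :: "'a => real"
 assumes "!!n. w n \<in> L2 M" "w0 \<in> L2 M" "u \<in> L2 M" "k \<in> borel_measurable M" "!!x. x \<in> space M ==> \<bar>k x\<bar> <= C"
  "(%n. L2_norm M (%x. w n x - w0 x)) \<longlonglongrightarrow> 0" "C >= 0"
 shows "(%n. \<integral>x. k x *\<^sub>R (w n x * u x) \<partial>M) \<longlonglongrightarrow> (\<integral>x. k x *\<^sub>R (w0 x * u x) \<partial>M)"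
proof (rule LIM_zero_cancel, rule Lim_null_comparison)
 show "(%n. C * (L2_norm M (%x. w n x - w0 x) * L2_norm M u)) \<longlonglongrightarrow> 0"
  using tendsto_mult[OF tendsto_const[of C] tendsto_mult[OF assms(6) tendsto_const[of "L2_norm M u"]]] by simp
 have "norm ((\<integral>x. k x *\<^sub>R (w n x * u x) \<partial>M) - (\<integral>x. k x *\<^sub>R (w0 x * u x) \<partial>M))
   <= C * (L2_norm M (%x. w n x - w0 x) * L2_norm M u)" for n
 proof -
  note d = L2_diff[OF assms(1)[of n] assms(2)]
  have eq: "(\<integral>x. k x *\<^sub>R (w n x * u x) \<partial>M) - (\<integral>x. k x *\<^sub>R (w0 x * u x) \<partial>M)
    = (\<integral>x. k x *\<^sub>R ((w n x - w0 x) * u x) \<partial>M)"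
   using L2_product_bounded(1)[OF assms(1)[of n] assms(3-5)] L2_product_bounded(1)[OF assms(2-5)]
   by (subst lint_diff[symmetric]) (auto simp: algebra_simps scaleR_diff_right)
  have "norm (\<integral>x. k x *\<^sub>R ((w n x - w0 x) * u x) \<partial>M) <= (\<integral>x. norm (k x *\<^sub>R ((w n x - w0 x) * u x)) \<partial>M)"
   by (rule integral_norm_bound)
  also have "... <= (\<integral>x. C * (cmod (w n x - w0 x) * cmod (u x)) \<partial>M)"
  proof (rule lint_mono)
   show "integrable M (%x. norm (k x *\<^sub>R ((w n x - w0 x) * u x)))"
    by (rule integrable_norm) (rule L2_product_bounded(1)[OF d assms(3-5)])
   show "integrable M (%x. C * (cmod (w n x - w0 x) * cmod (u x)))"
    by (intro integrable_mult_right L2_product d assms)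
   show "norm (k x *\<^sub>R ((w n x - w0 x) * u x)) <= C * (cmod (w n x - w0 x) * cmod (u x))" if "x \<in> space M" for x
    using assms(5)[OF that] by (simp add: norm_mult mult_right_mono)
  qed
  also have "... <= C * (L2_norm M (%x. w n x - w0 x) * L2_norm M u)"
   using L2_product(2)[OF d assms(3)] \<open>C >= 0\<close> by (simp add: mult_left_mono)
  finally show ?thesis unfolding eq .
 qed
 then show "\<forall>\<^sub>F n in sequentially. norm ((\<integral>x. k x *\<^sub>R (w n x * u x) \<partial>M) - (\<integral>x. k x *\<^sub>R (w0 x * u x) \<partial>M))
   <= C * (L2_norm M (%x. w n x - w0 x) * L2_norm M u)" by (intro always_eventually allI)
qed

lemma L2_norm_tendsto_dominated:
 assumes "!!n. w n \<in> L2 M" "w0 \<in> L2 M" "integrable M B"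
  "!!n. AE x in M. cmod2 (w n x - w0 x) <= B x" "AE x in M. (%n. w n x) \<longlonglongrightarrow> w0 x"
 shows "(%n. L2_norm M (%x. w n x - w0 x)) \<longlonglongrightarrow> 0"
proof -
 have "(%n. \<integral>x. cmod2 (w n x - w0 x) \<partial>M) \<longlonglongrightarrow> (\<integral>x. 0 \<partial>M)"
 proof (rule integral_dominated_convergence[where w = B])
  show "AE x in M. (%n. cmod2 (w n x - w0 x)) \<longlonglongrightarrow> 0"
   using assms(5)
  proof eventually_elim
   case (elim x)
   then have "(%n. cmod2 (w n x - w0 x)) \<longlonglongrightarrow> cmod2 (w0 x - w0 x)" by (intro tendsto_intros)
   then show ?case by simp
  qed
  show "AE x in M. norm (cmod2 (w n x - w0 x)) <= B x" for n using assms(4)[of n] by simp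
 qed (use assms L2D(1)[OF L2_diff[OF assms(1) assms(2)]] in auto)
 then have "(%n. sqrt (\<integral>x. cmod2 (w n x - w0 x) \<partial>M)) \<longlonglongrightarrow> sqrt 0"
  by (intro tendsto_real_sqrt) simp
 then show ?thesis by (simp add: L2_norm_def)
qed

subsection \<open>Convergence of mollifications\<close>

lemma L2_bounded_support_integrable:
 assumes "u \<in> L2 M" "finite_measure M"
 shows "integrable M u"
proof -
 interpret finite_measure M by fact
 have "(%x. 1) \<in> L2 M" by (auto simp: L2_def)
 from L2_product(3)[OF assms(1) this] show ?thesis by simp
qed

text \<open>Truncate first; a bounded measurable function is an almost everywhere limit of continuous ones, and after a second truncation dominated convergence applies.\<close>
lemma continuous_dense_L2_real:
 fixes f :: "real^2 => real"
 assumes f: "f \<in> borel_measurable borel" "integrable lborel (%x. (f x)^2)" "!!x. norm x > R ==> f x = 0" and "e > 0"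
 obtains g where "continuous_on UNIV g" "!!x. norm x > R + 1 ==> g x = 0"
  "integrable lborel (%x. (f x - g x)^2)" "(\<integral>x. (f x - g x)^2 \<partial>lborel) < e"
proof -
 define T where "T M y = max (- M) (min M y)" for M y :: real
 have T: "\<bar>T M y\<bar> <= M" "\<bar>T M y\<bar> <= \<bar>y\<bar>" "\<bar>y - T M y\<bar> <= \<bar>y\<bar>" if "M >= 0" for M y
  using that by (auto simp: T_def max_def min_def)
 have Tm: "(%x. T M (f x)) \<in> borel_measurable borel" for M unfolding T_def using f(1) by measurable
 have "(%n. \<integral>x. (f x - T (real n) (f x))^2 \<partial>lborel) \<longlonglongrightarrow> (\<integral>x. 0 \<partial>(lborel :: (real^2) measure))"
 proof (rule integral_dominated_convergence[where w = "%x. (f x)^2"])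
  show "AE x in lborel. (%n. (f x - T (real n) (f x))^2) \<longlonglongrightarrow> 0"
  proof (rule AE_I2)
   fix x
   obtain N :: nat where "\<bar>f x\<bar> <= N" using real_arch_simple by blast
   then have "(f x - T (real n) (f x))^2 = 0" if "n >= N" for n using that by (auto simp: T_def)
   then show "(%n. (f x - T (real n) (f x))^2) \<longlonglongrightarrow> 0"
    by (intro tendsto_eventually) (auto simp: eventually_sequentially)
  qed
  show "AE x in lborel. norm ((f x - T (real n) (f x))^2) <= (f x)^2" for n
   using T(3)[of "real n"] by (intro AE_I2) (simp add: abs_le_square_iff[symmetric])
 qed (use f Tm in auto)
 then have "(%n. \<integral>x. (f x - T (real n) (f x))^2 \<partial>lborel) \<longlonglongrightarrow> 0" by simp
 then have "\<forall>\<^sub>F n in sequentially. (\<integral>x. (f x - T (real n) (f x))^2 \<partial>lborel) < e / 4"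
  using \<open>e > 0\<close> by (intro order_tendstoD) auto
 then obtain n :: nat where n: "(\<integral>x. (f x - T (real n) (f x))^2 \<partial>lborel) < e / 4"
  by (auto simp: eventually_sequentially)
 define M where "M = real n"
 define k where "k x = T M (f x)" for x
 have "f \<in> borel_measurable lebesgue" using f(1) by (simp add: measurable_completion)
 then have "f measurable_on UNIV" by (rule lebesgue_measurable_imp_measurable_on_real) simp
 then obtain N g where N: "negligible N" and g: "!!m. continuous_on UNIV (g m)" "!!x. x \<notin> N ==> (%m. g m x) \<longlonglongrightarrow> f x"
  unfolding measurable_on_def by auto
 define cut where "cut x = max 0 (min 1 (R + 1 - norm x))" for x :: "real^2"
 have cut: "0 <= cut x" "cut x <= 1" "norm x > R + 1 ==> cut x = 0" "norm x <= R ==> cut x = 1" for x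
  by (auto simp: cut_def)
 have cutc: "continuous_on UNIV cut" unfolding cut_def[abs_def] by (intro continuous_intros)
 define h where "h m x = cut x * T M (g m x)" for m x
 have hc: "continuous_on UNIV (h m)" for m
  unfolding h_def[abs_def] T_def by (intro continuous_intros cutc g)
 have h0: "h m x = 0" if "norm x > R + 1" for m x using cut(3)[OF that] by (simp add: h_def)
 have k0: "k x = 0" if "norm x > R" for x using f(3)[OF that] by (simp add: k_def T_def M_def)
 have kc: "cut x * k x = k x" for x using k0[of x] cut(4)[of x] by (cases "norm x <= R") auto
 have M: "M >= 0" by (simp add: M_def)
 have hb: "\<bar>h m x\<bar> <= M" for m x
 proof -
  have "\<bar>h m x\<bar> = \<bar>cut x\<bar> * \<bar>T M (g m x)\<bar>" by (simp add: h_def abs_mult)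
  also have "... <= 1 * M" using cut(1,2) T(1)[OF M] by (intro mult_mono) auto
  finally show ?thesis by simp
 qed
 have kb: "\<bar>k x\<bar> <= M" for x unfolding k_def by (rule T(1)[OF M])
 have hk: "(k x - h m x)^2 <= (2 * M)^2 * indicator (cball 0 (R + 1)) x" for x m
 proof (cases "x \<in> cball 0 (R + 1)")
  case True
  have "\<bar>k x - h m x\<bar> <= 2 * M" using kb[of x] hb[of m x] by linarith
  then have "\<bar>k x - h m x\<bar> <= \<bar>2 * M\<bar>" using M by simp
  then show ?thesis using True by (simp only: abs_le_square_iff) simp
 qed (use h0[of x m] k0[of x] in simp)
 have ib: "integrable lborel (%x. (2 * M)^2 * indicator (cball (0::real^2) (R + 1)) x)"
  using emeasure_lborel_cball_finite[of "0::real^2" "R + 1"]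
  by (intro integrable_mult_right integrable_real_indicator) auto
 have hm: "h m \<in> borel_measurable borel" for m by (rule borel_measurable_continuous_onI[OF hc])
 have km: "k \<in> borel_measurable borel" unfolding k_def[abs_def] by (rule Tm)
 have "AE x in lborel. (%m. g m x) \<longlonglongrightarrow> f x"
 proof -
  have "N \<in> null_sets lebesgue" using N by (simp add: negligible_iff_null_sets)
  then have "AE x in lebesgue. x \<notin> N" by (rule AE_not_in)
  then have "AE x in lebesgue. (%m. g m x) \<longlonglongrightarrow> f x" by eventually_elim (rule g(2))
  then show ?thesis by (simp add: AE_completion_iff)
 qed
 then have hlim: "AE x in lborel. (%m. (k x - h m x)^2) \<longlonglongrightarrow> 0"
 proof eventually_elim
  case (elim x)
  have "(%m. (k x - h m x)^2) \<longlonglongrightarrow> (k x - cut x * T M (f x))^2"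
   unfolding h_def T_def by (intro tendsto_intros tendsto_max tendsto_min elim)
  also have "cut x * T M (f x) = k x" using kc[of x] by (simp add: k_def)
  finally show ?case by simp
 qed
 have ik: "integrable lborel (%x. (k x - h m x)^2)" for m
  by (rule litg_bound[OF ib])
   (use hm km hk[of _ m] in \<open>auto simp: abs_mult\<close>)
 have "(%m. \<integral>x. (k x - h m x)^2 \<partial>lborel) \<longlonglongrightarrow> (\<integral>x. 0 \<partial>(lborel :: (real^2) measure))"
  by (rule integral_dominated_convergence[OF _ _ ib hlim]) (use hm km hk in auto)
 then have "(%m. \<integral>x. (k x - h m x)^2 \<partial>lborel) \<longlonglongrightarrow> 0" by simp
 then have "\<forall>\<^sub>F m in sequentially. (\<integral>x. (k x - h m x)^2 \<partial>lborel) < e / 4"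
  using \<open>e > 0\<close> by (intro order_tendstoD) auto
 then obtain m where m: "(\<integral>x. (k x - h m x)^2 \<partial>lborel) < e / 4" by (auto simp: eventually_sequentially)
 have ifk: "integrable lborel (%x. (f x - k x)^2)"
 proof (rule litg_bound[OF f(2)])
  show "AE x in lborel. norm ((f x - k x)^2) <= norm ((f x)^2)"
   using T(3)[OF M] unfolding k_def by (intro AE_I2) (simp add: abs_le_square_iff[symmetric])
 qed (use f(1) km in simp)
 have le: "(f x - h m x)^2 <= 2 * (f x - k x)^2 + 2 * (k x - h m x)^2" for x
  using sum_squares_bound[of "f x - k x" "k x - h m x"] by (simp add: power2_eq_square algebra_simps)
 have isum: "integrable lborel (%x. 2 * (f x - k x)^2 + 2 * (k x - h m x)^2)" using ifk ik[of m] by simp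
 have ifh: "integrable lborel (%x. (f x - h m x)^2)"
  by (rule litg_bound[OF isum]) (use f(1) hm le in \<open>auto simp: order_trans[OF _ abs_ge_self]\<close>)
 have "(\<integral>x. (f x - h m x)^2 \<partial>lborel) <= (\<integral>x. 2 * (f x - k x)^2 + 2 * (k x - h m x)^2 \<partial>lborel)"
  by (rule lint_mono[OF ifh isum le])
 also have "... = 2 * (\<integral>x. (f x - k x)^2 \<partial>lborel) + 2 * (\<integral>x. (k x - h m x)^2 \<partial>lborel)" using ifk ik[of m] by simp
 also have "... < e" using n m by (simp add: k_def M_def)
 finally show ?thesis using that[of "h m"] hc h0 ifh by blast
qed

lemma continuous_dense_L2:
 fixes f :: "real^2 => complex"
 assumes f: "f \<in> borel_measurable borel" "integrable lborel (%x. cmod2 (f x))" "!!x. norm x > R ==> f x = 0" and "e > 0"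
 obtains g where "continuous_on UNIV g" "!!x. norm x > R + 1 ==> g x = 0"
  "integrable lborel (%x. cmod2 (f x - g x))" "(\<integral>x. cmod2 (f x - g x) \<partial>lborel) < e"
proof -
 have e: "e / 2 > 0" using \<open>e > 0\<close> by simp
 have re: "integrable lborel (%x. (Re (f x))^2)" "integrable lborel (%x. (Im (f x))^2)"
  using f(1,2) by (auto intro!: litg_bound[OF f(2)] simp: cmod_def)
 obtain g where g: "continuous_on UNIV g" "!!x. norm x > R + 1 ==> g x = 0"
  "integrable lborel (%x. (Re (f x) - g x)^2)" "(\<integral>x. (Re (f x) - g x)^2 \<partial>lborel) < e / 2"
  using continuous_dense_L2_real[of "%x. Re (f x)" R, OF _ re(1) _ e] f by auto
 obtain h where h: "continuous_on UNIV h" "!!x. norm x > R + 1 ==> h x = 0"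
  "integrable lborel (%x. (Im (f x) - h x)^2)" "(\<integral>x. (Im (f x) - h x)^2 \<partial>lborel) < e / 2"
  using continuous_dense_L2_real[of "%x. Im (f x)" R, OF _ re(2) _ e] f by auto
 have eq: "cmod2 (f x - Complex (g x) (h x)) = (Re (f x) - g x)^2 + (Im (f x) - h x)^2" for x
  by (simp add: cmod_def)
 show ?thesis
 proof (rule that[of "%x. Complex (g x) (h x)"])
  show "continuous_on UNIV (%x. Complex (g x) (h x))"
   unfolding Complex_eq by (intro continuous_intros g h)
  show "(\<integral>x. cmod2 (f x - Complex (g x) (h x)) \<partial>lborel) < e"
   unfolding eq using g(3,4) h(3,4) by simp
  show "integrable lborel (%x. cmod2 (f x - Complex (g x) (h x)))" unfolding eq using g(3) h(3) by simp
 qed (use g(2) h(2) in \<open>auto simp: complex_eq_iff\<close>)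
qed

lemma conv_square_le:
 fixes f :: "real^2 => complex"
 assumes "integrable lborel f" "integrable lborel (%x. cmod2 (f x))" "mollifier ep \<eta>"
 shows "cmod2 (conv f \<eta> x) <= conv (%y. cmod2 (f y)) \<eta> x"
proof -
 note m = mollifierD[OF assms(3)]
 define I where "I = (\<integral>y. \<eta> (x - y) * cmod (f y) \<partial>lborel)"
 have i1: "integrable lborel (%y. \<eta> (x - y) * cmod (f y))"
  using conv_integrable(1)[OF integrable_norm[OF assms(1)] m(2)] by simp
 have i2: "integrable lborel (%y. \<eta> (x - y) * cmod2 (f y))"
  using conv_integrable(1)[OF assms(2) m(2)] by simp
 have "0 <= (\<integral>y. \<eta> (x - y) * (cmod (f y) - I)^2 \<partial>lborel)"
  using m(3) by (intro lint_nonneg) simp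
 also have "... = (\<integral>y. \<eta> (x - y) * cmod2 (f y) - 2 * I * (\<eta> (x - y) * cmod (f y)) + I^2 * \<eta> (x - y) \<partial>lborel)"
  by (intro lint_cong) (auto simp: power2_diff algebra_simps)
 also have "... = conv (%y. cmod2 (f y)) \<eta> x - 2 * I * I + I^2"
  using i1 i2 m(9,10) by (simp add: conv_def I_def)
 finally have "I^2 <= conv (%y. cmod2 (f y)) \<eta> x" by (simp add: power2_eq_square)
 moreover have "cmod (conv f \<eta> x) <= I"
  unfolding conv_def I_def using m(3)
  by (intro order_trans[OF integral_norm_bound]) (simp add: abs_of_nonneg)
 ultimately show ?thesis by (meson norm_ge_zero order_trans power_mono)
qed

lemma conv_L2_bound:
 fixes f :: "real^2 => complex"
 assumes "integrable lborel f" "integrable lborel (%x. cmod2 (f x))" "mollifier ep \<eta>"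
 shows "integrable lborel (%x. cmod2 (conv f \<eta> x))"
  and "(\<integral>x. cmod2 (conv f \<eta> x) \<partial>lborel) <= (\<integral>x. cmod2 (f x) \<partial>lborel)"
proof -
 note m = mollifierD[OF assms(3)]
 note [measurable] = m(8)
 have [measurable]: "f \<in> borel_measurable borel" using assms(1) by auto
 have [measurable]: "conv f \<eta> \<in> borel_measurable borel"
  by (rule borel_measurable_continuous_onI[OF C1_on_continuous[OF smooth_on_C1_on[OF smooth_conv[OF assms(1) m(1)]]]])
 have "(\<integral>\<^sup>+x. ennreal (cmod2 (conv f \<eta> x)) \<partial>lborel) <= (\<integral>\<^sup>+x. ennreal (conv (%y. cmod2 (f y)) \<eta> x) \<partial>lborel)"
  by (intro nn_integral_mono ennreal_leI conv_square_le[OF assms])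
 also have "... = (\<integral>\<^sup>+x. (\<integral>\<^sup>+y. ennreal (\<eta> (x - y) * cmod2 (f y)) \<partial>lborel) \<partial>lborel)"
 proof (intro nn_integral_cong)
  fix x
  have "integrable lborel (%y. \<eta> (x - y) * cmod2 (f y))"
   using conv_integrable(1)[OF assms(2) m(2)] by simp
  from nn_integral_eq_integral[OF this]
  show "ennreal (conv (%y. cmod2 (f y)) \<eta> x) = (\<integral>\<^sup>+y. ennreal (\<eta> (x - y) * cmod2 (f y)) \<partial>lborel)"
   using m(3) by (simp add: conv_def)
 qed
 also have "... = (\<integral>\<^sup>+y. (\<integral>\<^sup>+x. ennreal (\<eta> (x - y) * cmod2 (f y)) \<partial>lborel) \<partial>lborel)"
  by (rule lborel_pair.Fubini') measurable
 also have "... = (\<integral>\<^sup>+y. ennreal (cmod2 (f y)) \<partial>lborel)"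
 proof (intro nn_integral_cong)
  fix y
  have t: "integrable lborel (%x. \<eta> (x + (- y)))" "(\<integral>x. \<eta> (x + (- y)) \<partial>lborel) = 1"
   using lborel_integral_translate[OF m(8), of "- y"] m(5,7) by auto
  have "(\<integral>\<^sup>+x. ennreal (\<eta> (x - y) * cmod2 (f y)) \<partial>lborel) = ennreal (\<integral>x. \<eta> (x - y) * cmod2 (f y) \<partial>lborel)"
   by (rule nn_integral_eq_integral) (use t m(3) in auto)
  then show "(\<integral>\<^sup>+x. ennreal (\<eta> (x - y) * cmod2 (f y)) \<partial>lborel) = ennreal (cmod2 (f y))"
   using t by simp
 qed
 also have "... = ennreal (\<integral>y. cmod2 (f y) \<partial>lborel)" by (rule nn_integral_eq_integral[OF assms(2)]) simp
 finally have le: "(\<integral>\<^sup>+x. ennreal (cmod2 (conv f \<eta> x)) \<partial>lborel) <= ennreal (\<integral>y. cmod2 (f y) \<partial>lborel)" .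
 show i: "integrable lborel (%x. cmod2 (conv f \<eta> x))"
 proof (rule integrableI_bounded)
  show "(\<integral>\<^sup>+x. ennreal (norm (cmod2 (conv f \<eta> x))) \<partial>lborel) < \<infinity>"
   using le_less_trans[OF le ennreal_less_top] by simp
 qed simp
 have "ennreal (\<integral>x. cmod2 (conv f \<eta> x) \<partial>lborel) <= ennreal (\<integral>y. cmod2 (f y) \<partial>lborel)"
  using le nn_integral_eq_integral[OF i] by simp
 then show "(\<integral>x. cmod2 (conv f \<eta> x) \<partial>lborel) <= (\<integral>x. cmod2 (f x) \<partial>lborel)" by simp
qed

lemma conv_diff:
 fixes f :: "real^2 => 'b::{banach, second_countable_topology}"
 assumes "integrable lborel f" "integrable lborel g" "C1_compact UNIV \<eta>"
 shows "conv (%x. f x - g x) \<eta> x = conv f \<eta> x - conv g \<eta> x"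
 unfolding conv_def scaleR_diff_right
 by (rule lint_diff) (rule conv_integrable(1)[OF assms(1,3)] conv_integrable(1)[OF assms(2,3)])+

text \<open>Mollification contracts the norm, so it suffices to treat the dense set of continuous functions, where the convergence is uniform on a fixed compact set.\<close>
lemma mollification_L2:
 fixes f :: "real^2 => complex"
 assumes f: "f \<in> borel_measurable borel" "integrable lborel f" "integrable lborel (%x. cmod2 (f x))"
   "!!x. norm x > R ==> f x = 0"
  and eta: "!!n. mollifier (ep n) (\<eta> n)" "ep \<longlonglongrightarrow> 0"
 shows "(%n. \<integral>x. cmod2 (conv f (\<eta> n) x - f x) \<partial>lborel) \<longlonglongrightarrow> 0"
  and "!!n. integrable lborel (%x. cmod2 (conv f (\<eta> n) x - f x))"
proof -
 have fL: "f \<in> L2 lborel" using f by (auto intro: L2I)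
 have cL: "conv h (\<eta> n) \<in> L2 lborel" if "integrable lborel h" "h \<in> L2 lborel" for h n
 proof (rule L2I)
  show "conv h (\<eta> n) \<in> borel_measurable lborel"
   using borel_measurable_continuous_onI[OF C1_on_continuous[OF smooth_on_C1_on[OF smooth_conv[OF that(1) mollifierD(1)[OF eta(1)[of n]]]]]]
   by simp
 qed (rule conv_L2_bound(1)[OF that(1) L2D(2)[OF that(2)] eta(1)])
 show "integrable lborel (%x. cmod2 (conv f (\<eta> n) x - f x))" for n
  by (rule L2D(2)[OF L2_diff[OF cL[OF f(2) fL] fL]])
 have "\<forall>\<^sub>F n in sequentially. L2_norm lborel (%x. conv f (\<eta> n) x - f x) < e" if "e > 0" for e
 proof -
  have "(e / 4)^2 > 0" using that by simp
  from continuous_dense_L2[OF f(1,3,4) this] obtain g where g: "continuous_on UNIV g" "!!x. norm x > R + 1 ==> g x = 0"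
   "integrable lborel (%x. cmod2 (f x - g x))" "(\<integral>x. cmod2 (f x - g x) \<partial>lborel) < (e / 4)^2" by blast
  have g0: "g x = 0" if "x \<notin> cball 0 (R + 1)" for x using that g(2)[of x] by simp
  have gi: "integrable lborel g" by (rule integrable_compact_support[OF g(1) compact_cball g0])
  have gm: "g \<in> borel_measurable lborel" using borel_measurable_continuous_onI[OF g(1)] by simp
  have fgL: "(%x. f x - g x) \<in> L2 lborel" using f(1) gm g(3) by (intro L2I) auto
  have gL: "g \<in> L2 lborel" using L2_diff[OF fL fgL] by simp
  have n1: "L2_norm lborel (%x. f x - g x) < e / 4"
   using g(4) that real_sqrt_less_mono[OF g(4)] by (simp add: L2_norm_def real_sqrt_abs)
  define V where "V = measure lborel (cball (0::real^2) (R + 3))"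
  have V: "V >= 0" by (simp add: V_def)
  define \<delta> where "\<delta> = e / (4 * (sqrt V + 1))"
  have dpos: "\<delta> > 0" using that V by (simp add: \<delta>_def add_nonneg_pos)
  obtain d where d: "d > 0" "!!x y. dist x y < d ==> dist (g x) (g y) < \<delta>"
   using uniformly_continuous_compact_support[OF g(1) compact_cball g0 dpos] by blast
  have "\<forall>\<^sub>F n in sequentially. ep n < min d 1" using eta(2) d(1) by (intro order_tendstoD) auto
  then show ?thesis
  proof eventually_elim
   case (elim n)
   note m = mollifierD[OF eta(1)[of n]]
   have close: "cmod (conv g (\<eta> n) x - g x) <= \<delta>" for x
   proof (rule conv_close[OF gi eta(1)])
    show "norm (x - y) < ep n ==> norm (g y - g x) <= \<delta>" for y
     using d(2)[of y x] elim by (simp add: dist_norm norm_minus_commute less_imp_le)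
   qed
   have far: "conv g (\<eta> n) x - g x = 0" if "x \<notin> cball 0 (R + 3)" for x
   proof -
    have "conv g (\<eta> n) x = 0"
    proof (rule conv_support[OF m(4)])
     fix y assume "y \<in> ball x (ep n)"
     then have "norm x <= norm y + 1" using elim norm_triangle_sub[of x y] by (simp add: dist_norm)
     then show "g y = 0" using that g(2)[of y] by simp
    qed
    then show ?thesis using g(2)[of x] that by simp
   qed
   have ii: "integrable lborel (%x. \<delta>^2 * indicator (cball (0::real^2) (R + 3)) x)"
    using emeasure_lborel_cball_finite[of "0::real^2" "R + 3"]
    by (intro integrable_mult_right integrable_real_indicator) auto
   have gd: "(%x. conv g (\<eta> n) x - g x) \<in> L2 lborel" by (rule L2_diff[OF cL[OF gi gL] gL])
   have "(\<integral>x. cmod2 (conv g (\<eta> n) x - g x) \<partial>lborel) <= (\<integral>x. \<delta>^2 * indicator (cball (0::real^2) (R + 3)) x \<partial>lborel)"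
   proof (rule lint_mono[OF L2D(2)[OF gd] ii])
    show "cmod2 (conv g (\<eta> n) x - g x) <= \<delta>^2 * indicator (cball (0::real^2) (R + 3)) x" for x
     using close[of x] far[of x] by (cases "x \<in> cball 0 (R + 3)") (auto intro: power_mono)
   qed
   also have "... = \<delta>^2 * V" by (simp add: V_def)
   finally have "L2_norm lborel (%x. conv g (\<eta> n) x - g x) <= sqrt (\<delta>^2 * V)"
    unfolding L2_norm_def by (rule real_sqrt_le_mono)
   also have "... = \<delta> * sqrt V" using dpos by (simp add: real_sqrt_mult)
   also have "... <= e / 4" using V that by (simp add: \<delta>_def divide_simps add_nonneg_pos)
   finally have n2: "L2_norm lborel (%x. conv g (\<eta> n) x - g x) <= e / 4" .
   have fgi: "integrable lborel (%x. f x - g x)" using f(2) gi by simp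
   have cd: "conv (%x. f x - g x) (\<eta> n) = (%x. conv f (\<eta> n) x - conv g (\<eta> n) x)"
    using conv_diff[OF f(2) gi m(2)] by blast
   have n3: "L2_norm lborel (conv (%x. f x - g x) (\<eta> n)) <= L2_norm lborel (%x. f x - g x)"
    unfolding L2_norm_def using conv_L2_bound(2)[OF fgi L2D(2)[OF fgL] eta(1)] by simp
   have "L2_norm lborel (%x. conv f (\<eta> n) x - f x)
     = L2_norm lborel (%x. (conv (%x. f x - g x) (\<eta> n) x + (conv g (\<eta> n) x - g x)) - (f x - g x))"
    unfolding cd by simp
   also have "... <= L2_norm lborel (%x. conv (%x. f x - g x) (\<eta> n) x + (conv g (\<eta> n) x - g x)) + L2_norm lborel (%x. f x - g x)"
    by (rule L2_norm_triangle_diff[OF L2_add[OF cL[OF fgi fgL] gd] fgL])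
   also have "... <= (L2_norm lborel (conv (%x. f x - g x) (\<eta> n)) + L2_norm lborel (%x. conv g (\<eta> n) x - g x))
     + L2_norm lborel (%x. f x - g x)"
    by (intro add_right_mono L2_norm_triangle cL fgi fgL gd)
   also have "... < e" using n1 n2 n3 that by linarith
   finally show "L2_norm lborel (%x. conv f (\<eta> n) x - f x) < e" .
  qed
 qed
 then have "(%n. L2_norm lborel (%x. conv f (\<eta> n) x - f x)) \<longlonglongrightarrow> 0"
  by (intro order_tendstoI) (auto intro: always_eventually less_le_trans[OF _ L2_norm_nonneg])
 from tendsto_power[OF this, of 2]
 show "(%n. \<integral>x. cmod2 (conv f (\<eta> n) x - f x) \<partial>lborel) \<longlonglongrightarrow> 0"
  by (simp add: L2_norm_square)
qed

section \<open>Weak derivatives\<close>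

text \<open>Convolutions are taken over \<open>lborel\<close>; this is a Borel representative extended by zero.\<close>
definition borel_version :: "(real^2) set => (real^2 => complex) => (real^2 => complex) => bool" where
 "borel_version Om u u0 \<longleftrightarrow> u0 \<in> borel_measurable borel \<and> (\<forall>x. x \<notin> Om --> u0 x = 0) \<and> (AE x in lebesgue_on Om. u0 x = u x)"

lemma conv_norm_le:
 fixes f :: "real^2 => 'b::{banach, second_countable_topology}"
 assumes "mollifier ep \<eta>" "integrable lborel f" "!!y. norm (f y) <= M"
 shows "norm (conv f \<eta> x) <= M"
proof -
 note m = mollifierD[OF assms(1)]
 have "norm (conv f \<eta> x) <= (\<integral>y. norm (\<eta> (x - y) *\<^sub>R f y) \<partial>lborel)"
  unfolding conv_def by (rule integral_norm_bound)
 also have "... <= (\<integral>y. \<eta> (x - y) * M \<partial>lborel)"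
 proof (rule lint_mono)
  show "integrable lborel (%y. norm (\<eta> (x - y) *\<^sub>R f y))"
   by (rule integrable_norm) (rule conv_integrable(1)[OF assms(2) m(2)])
  show "integrable lborel (%y. \<eta> (x - y) * M)" using m(10) by simp
  show "norm (\<eta> (x - y) *\<^sub>R f y) <= \<eta> (x - y) * M" for y
   using assms(3)[of y] m(3)[of "x - y"] by (simp add: mult_left_mono)
 qed
 also have "... = M" using m(9) by simp
 finally show ?thesis .
qed

lemma conv_tendsto:
 fixes f :: "real^2 => 'b::{banach, second_countable_topology}"
 assumes "continuous_on UNIV f" "compact K" "!!x. x \<notin> K ==> f x = 0"
  "!!n. mollifier (ep n) (\<eta> n)" "ep \<longlonglongrightarrow> 0"
 shows "(%n. conv f (\<eta> n) x) \<longlonglongrightarrow> f x"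
proof (rule tendstoI)
 fix e :: real assume "e > 0"
 then have "e / 2 > 0" by simp
 obtain d where d: "d > 0" "!!x y. dist x y < d ==> dist (f x) (f y) < e / 2"
  using uniformly_continuous_compact_support[OF assms(1-3) \<open>e / 2 > 0\<close>] by blast
 have i: "integrable lborel f" by (rule integrable_compact_support[OF assms(1-3)])
 have "\<forall>\<^sub>F n in sequentially. ep n < d" using assms(5) d(1) by (intro order_tendstoD) auto
 then show "\<forall>\<^sub>F n in sequentially. dist (conv f (\<eta> n) x) (f x) < e"
 proof eventually_elim
  case (elim n)
  have "norm (conv f (\<eta> n) x - f x) <= e / 2"
  proof (rule conv_close[OF i assms(4)])
   show "norm (x - y) < ep n ==> norm (f y - f x) <= e / 2" for y
    using d(2)[of y x] elim by (simp add: dist_norm norm_minus_commute less_imp_le)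
  qed
  then show ?case using \<open>e > 0\<close> by (simp add: dist_norm)
 qed
qed

lemma mollifier_sequence:
 assumes "r > 0"
 obtains ep :: "nat => real" and \<eta> where "!!n. mollifier (ep n) (\<eta> n)" "!!n. 0 < ep n" "!!n. ep n <= r" "ep \<longlonglongrightarrow> 0"
proof -
 define ep where "ep n = r / real (Suc n)" for n
 have pos: "0 < ep n" for n using assms by (simp add: ep_def)
 have "\<exists>\<eta>. mollifier (ep n) \<eta>" for n using mollifier_exists[OF pos] by blast
 then obtain \<eta> where \<eta>: "!!n. mollifier (ep n) (\<eta> n)" by metis
 have "ep n <= r" for n using assms by (simp add: ep_def divide_simps)
 moreover have "ep \<longlonglongrightarrow> 0"
  using tendsto_mult[OF tendsto_const[of r] LIMSEQ_inverse_real_of_nat]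
  by (simp add: ep_def[abs_def] divide_inverse)
 ultimately show ?thesis using that \<eta> pos by blast
qed

lemma borel_lebesgue_on: "f \<in> borel_measurable borel ==> f \<in> borel_measurable (lebesgue_on Om)"
 by (rule measurable_restrict_space1) (simp add: measurable_completion)

lemma continuous_lebesgue_on: "continuous_on UNIV f ==> f \<in> borel_measurable (lebesgue_on Om)"
 by (rule borel_lebesgue_on) (rule borel_measurable_continuous_onI)

locale planar_domain =
 fixes Om :: "(real^2) set"
 assumes open_domain: "open Om" and bounded_domain: "bounded Om"
begin

abbreviation "Leb \<equiv> lebesgue_on Om"

abbreviation "weak \<equiv> has_weak_partial Om"

lemma domain_lebesgue: "Om \<in> sets lebesgue"
 using open_domain by (intro sets_completionI_sets) simp

lemma domain_lebesgue': "Om \<inter> space lebesgue \<in> sets lebesgue"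
 using domain_lebesgue by simp

lemma domain_borel: "Om \<in> sets borel"
 using open_domain by simp

lemma domain_finite_measure: "finite_measure Leb"
 using bounded_set_imp_lmeasurable[OF bounded_domain domain_lebesgue] by (rule finite_measure_lebesgue_on)

lemma continuous_domain_measurable:
 fixes f :: "real^2 => 'b::euclidean_space"
 shows "continuous_on Om f ==> f \<in> borel_measurable Leb"
 by (rule continuous_imp_measurable_on_sets_lebesgue[OF _ domain_lebesgue])

lemma AE_domain_iff: "(AE x in Leb. P x) \<longleftrightarrow> (AE x in lborel. x \<in> Om --> P x)"
 by (simp add: AE_restrict_space_iff[OF domain_lebesgue'] AE_completion_iff)

lemma L2_integrable: "u \<in> L2 Leb ==> integrable Leb u"
 by (rule L2_bounded_support_integrable[OF _ domain_finite_measure])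

lemma L2_bounded:
 assumes "u \<in> borel_measurable Leb" "!!x. x \<in> Om ==> cmod (u x) <= C"
 shows "u \<in> L2 Leb"
proof (rule L2I[OF assms(1)])
 interpret finite_measure "Leb" by (rule domain_finite_measure)
 show "integrable Leb (%x. cmod2 (u x))"
 proof (rule integrable_const_bound[where B = "C^2"])
  show "AE x in Leb. norm (cmod2 (u x)) <= C^2"
   by (rule AE_I2) (auto intro: power_mono assms(2))
 qed (use assms(1) in simp)
qed

lemma borel_version_exists:
 assumes "u \<in> borel_measurable Leb"
 obtains u0 where "borel_version Om u u0"
proof -
 have m: "(%x. indicator Om x *\<^sub>R u x) \<in> borel_measurable lebesgue"
  using assms borel_measurable_restrict_space_iff[OF domain_lebesgue', of u] by simp
 have "(%x. Re (indicator Om x *\<^sub>R u x)) \<in> borel_measurable (completion lborel)"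
  using borel_measurable_continuous_on[OF _ m, of Re] by (simp add: continuous_on_Re)
 then obtain a where a: "a \<in> borel_measurable lborel" "AE x in lborel. Re (indicator Om x *\<^sub>R u x) = a x"
  using completion_ex_borel_measurable_real by blast
 have "(%x. Im (indicator Om x *\<^sub>R u x)) \<in> borel_measurable (completion lborel)"
  using borel_measurable_continuous_on[OF _ m, of Im] by (simp add: continuous_on_Im)
 then obtain b where b: "b \<in> borel_measurable lborel" "AE x in lborel. Im (indicator Om x *\<^sub>R u x) = b x"
  using completion_ex_borel_measurable_real by blast
 define u0 where "u0 x = indicator Om x *\<^sub>R (complex_of_real (a x) + \<i> * complex_of_real (b x))" for x
 have "u0 \<in> borel_measurable borel"
  unfolding u0_def[abs_def] using a(1) b(1) domain_borel by measurable
 moreover have "AE x in Leb. u0 x = u x"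
  unfolding AE_domain_iff using a(2) b(2)
  by eventually_elim (auto simp: u0_def complex_eq_iff)
 ultimately show ?thesis using that[of u0] by (auto simp: borel_version_def u0_def)
qed

lemma lebesgue_on_borel:
 fixes f :: "real^2 => 'b::{banach, second_countable_topology}"
 assumes "f \<in> borel_measurable borel"
 shows "integral\<^sup>L Leb f = integral\<^sup>L lborel (%x. indicator Om x *\<^sub>R f x)"
  and "integrable Leb f \<longleftrightarrow> integrable lborel (%x. indicator Om x *\<^sub>R f x)"
proof -
 have m: "(%x. indicator Om x *\<^sub>R f x) \<in> borel_measurable lborel" using assms domain_borel by measurable
 show "integral\<^sup>L Leb f = integral\<^sup>L lborel (%x. indicator Om x *\<^sub>R f x)"
  by (simp add: integral_restrict_space[OF domain_lebesgue'] integral_completion[OF m])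
 show "integrable Leb f \<longleftrightarrow> integrable lborel (%x. indicator Om x *\<^sub>R f x)"
  by (simp add: integrable_restrict_space[OF domain_lebesgue'] integrable_completion[OF m])
qed

lemma borel_version_integral:
 fixes w :: "real^2 => real"
 assumes "borel_version Om u u0" "u \<in> borel_measurable Leb" "w \<in> borel_measurable borel"
 shows "(\<integral>x. w x *\<^sub>R u x \<partial>Leb) = (\<integral>x. w x *\<^sub>R u0 x \<partial>lborel)"
proof -
 have u0: "u0 \<in> borel_measurable borel" "!!x. x \<notin> Om ==> u0 x = 0" "AE x in Leb. u0 x = u x"
  using assms(1) by (auto simp: borel_version_def)
 have "(\<integral>x. w x *\<^sub>R u x \<partial>Leb) = (\<integral>x. w x *\<^sub>R u0 x \<partial>Leb)"
 proof (rule integral_cong_AE)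
  show "AE x in Leb. w x *\<^sub>R u x = w x *\<^sub>R u0 x" using u0(3) by eventually_elim simp
 qed (use borel_lebesgue_on[OF assms(3)] borel_lebesgue_on[OF u0(1)] assms(2) in auto)
 also have "... = (\<integral>x. indicator Om x *\<^sub>R (w x *\<^sub>R u0 x) \<partial>lborel)"
  by (rule lebesgue_on_borel(1)) (use assms(3) u0(1) in measurable)
 also have "(%x. indicator Om x *\<^sub>R (w x *\<^sub>R u0 x)) = (%x. w x *\<^sub>R u0 x)"
  using u0(2) by (auto simp: fun_eq_iff indicator_def)
 finally show ?thesis .
qed

lemma borel_version_L2:
 assumes "borel_version Om u u0" "u \<in> L2 Leb"
 shows "integrable lborel u0" "integrable lborel (%x. cmod2 (u0 x))" "u0 \<in> L2 Leb"
proof -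
 have u0: "u0 \<in> borel_measurable borel" "!!x. x \<notin> Om ==> u0 x = 0" "AE x in Leb. u0 x = u x"
  using assms(1) by (auto simp: borel_version_def)
 have m: "u0 \<in> borel_measurable Leb" by (rule borel_lebesgue_on[OF u0(1)])
 have i: "integrable Leb (%x. cmod2 (u0 x))"
 proof (rule litg_bound[OF L2D(2)[OF assms(2)]])
  show "AE x in Leb. norm (cmod2 (u0 x)) <= norm (cmod2 (u x))"
   using u0(3) by eventually_elim simp
 qed (use m in simp)
 then show L: "u0 \<in> L2 Leb" using m by (intro L2I)
 have e: "(%x. indicator Om x *\<^sub>R u0 x) = u0" "(%x. indicator Om x *\<^sub>R cmod2 (u0 x)) = (%x. cmod2 (u0 x))"
  using u0(2) by (auto simp: fun_eq_iff indicator_def)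
 show "integrable lborel u0" using L2_integrable[OF L] lebesgue_on_borel(2)[OF u0(1)] by (simp add: e)
 have "(%x. cmod2 (u0 x)) \<in> borel_measurable borel" using u0(1) by measurable
 from lebesgue_on_borel(2)[OF this] i show "integrable lborel (%x. cmod2 (u0 x))" unfolding e by simp
qed

lemma borel_version_conv_L2:
 assumes "borel_version Om u u0" "u \<in> L2 Leb" "mollifier ep \<eta>"
 shows "conv u0 \<eta> \<in> L2 Leb"
proof -
 note b = borel_version_L2[OF assms(1,2)]
 have m: "conv u0 \<eta> \<in> borel_measurable borel"
  using borel_measurable_continuous_onI[OF C1_on_continuous[OF smooth_on_C1_on[OF smooth_conv[OF b(1) mollifierD(1)[OF assms(3)]]]]] .
 have m2: "(%x. cmod2 (conv u0 \<eta> x)) \<in> borel_measurable borel" using m by measurable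
 have "integrable lborel (%x. indicator Om x *\<^sub>R cmod2 (conv u0 \<eta> x))"
  by (rule integrable_mult_indicator) (use domain_borel conv_L2_bound(1)[OF b(1,2) assms(3)] in auto)
 then show ?thesis using lebesgue_on_borel(2)[OF m2] borel_lebesgue_on[OF m] by (intro L2I) auto
qed

lemma mollification_tendsto:
 assumes "borel_version Om u u0" "u \<in> L2 Leb" "!!n. mollifier (ep n) (\<eta> n)" "ep \<longlonglongrightarrow> 0"
 shows "(%n. L2_norm Leb (%x. conv u0 (\<eta> n) x - u x)) \<longlonglongrightarrow> 0"
proof -
 note b = borel_version_L2[OF assms(1,2)]
 have u0: "u0 \<in> borel_measurable borel" "!!x. x \<notin> Om ==> u0 x = 0" "AE x in Leb. u0 x = u x"
  using assms(1) by (auto simp: borel_version_def)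
 obtain R where R: "!!x. x \<in> Om ==> norm x <= R" using bounded_domain by (auto simp: bounded_iff)
 have z: "u0 x = 0" if "norm x > R" for x using R[of x] u0(2)[of x] that by auto
 note M = mollification_L2[OF u0(1) b(1,2) z assms(3,4)]
 have cL: "conv u0 (\<eta> n) \<in> L2 Leb" for n by (rule borel_version_conv_L2[OF assms(1-3)])
 have le: "L2_norm Leb (%x. conv u0 (\<eta> n) x - u x) <= sqrt (\<integral>x. cmod2 (conv u0 (\<eta> n) x - u0 x) \<partial>lborel)" for n
 proof -
  have m: "conv u0 (\<eta> n) \<in> borel_measurable borel"
   using borel_measurable_continuous_onI[OF C1_on_continuous[OF smooth_on_C1_on[OF smooth_conv[OF b(1) mollifierD(1)[OF assms(3)]]]]] .
  have "L2_norm Leb (%x. conv u0 (\<eta> n) x - u x) = L2_norm Leb (%x. conv u0 (\<eta> n) x - u0 x)"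
  proof (rule L2_norm_cong_AE[OF L2_diff[OF cL assms(2)] L2_diff[OF cL b(3)]])
   show "AE x in Leb. conv u0 (\<eta> n) x - u x = conv u0 (\<eta> n) x - u0 x"
    using u0(3) by eventually_elim simp
  qed
  also have "... = sqrt (\<integral>x. indicator Om x *\<^sub>R cmod2 (conv u0 (\<eta> n) x - u0 x) \<partial>lborel)"
   unfolding L2_norm_def by (subst lebesgue_on_borel(1)) (use m u0(1) in auto)
  also have "... <= sqrt (\<integral>x. cmod2 (conv u0 (\<eta> n) x - u0 x) \<partial>lborel)"
  proof (intro real_sqrt_le_mono lint_mono M(2))
   show "integrable lborel (%x. indicator Om x *\<^sub>R cmod2 (conv u0 (\<eta> n) x - u0 x))"
    by (rule integrable_mult_indicator) (use domain_borel M(2) in auto)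
  qed (auto simp: indicator_def)
  finally show ?thesis .
 qed
 have "(%n. sqrt (\<integral>x. cmod2 (conv u0 (\<eta> n) x - u0 x) \<partial>lborel)) \<longlonglongrightarrow> 0"
  using tendsto_real_sqrt[OF M(1)] by simp
 then show ?thesis
 proof (rule Lim_null_comparison[rotated])
  show "\<forall>\<^sub>F n in sequentially. norm (L2_norm Leb (%x. conv u0 (\<eta> n) x - u x))
    <= sqrt (\<integral>x. cmod2 (conv u0 (\<eta> n) x - u0 x) \<partial>lborel)"
   using le by (intro always_eventually allI) (simp only: real_norm_def abs_of_nonneg[OF L2_norm_nonneg])
 qed
qed

lemma weakD:
 assumes "weak j u g"
 shows "u \<in> L2 Leb" "g \<in> L2 Leb"
 using assms by (auto simp: has_weak_partial_def)

lemma C1_compact_measurable: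
 fixes \<phi> :: "real^2 => 'b::real_normed_vector"
 assumes "C1_compact W \<phi>"
 shows "\<phi> \<in> borel_measurable borel" "partial j \<phi> \<in> borel_measurable borel"
 using borel_measurable_continuous_onI[OF C1_on_continuous[OF C1_compactD[OF assms]]]
  borel_measurable_continuous_onI[OF C1_on_partial[OF C1_compactD[OF assms]]] by auto

text \<open>Mollify the test function: its support stays inside the domain and its derivatives converge uniformly.\<close>
lemma weak_C1_test_function:
 fixes \<phi> :: "real^2 => real"
 assumes "weak j u g" "C1_compact Om \<phi>"
 shows "(\<integral>x. partial j \<phi> x *\<^sub>R u x \<partial>Leb) = - (\<integral>x. \<phi> x *\<^sub>R g x \<partial>Leb)"
proof -
 from assms(2) obtain K where K: "compact K" "K \<subseteq> Om" "!!x. x \<notin> K ==> \<phi> x = 0" "!!x j. x \<notin> K ==> partial j \<phi> x = 0"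
  by (rule C1_compactE) blast
 note cU = C1_compact_mono[OF assms(2) subset_UNIV]
 obtain M where M: "M >= 0" "!!x. norm (\<phi> x) <= M" "!!x j. norm (partial j \<phi> x) <= M"
  using C1_compact_bounded[OF assms(2)] by blast
 obtain r where r: "r > 0" "(\<Union>x\<in>K. cball x r) \<subseteq> Om"
  using compact_subset_open_imp_cball_epsilon_subset[OF K(1) open_domain K(2)] by blast
 obtain ep \<eta> where m: "!!n. mollifier (ep n) (\<eta> n)" "!!n. 0 < ep n" "!!n. ep n <= r" "ep \<longlonglongrightarrow> 0"
  using mollifier_sequence[OF r(1)] by metis
 note c = C1_on_continuous[OF C1_compactD[OF assms(2)]] and c' = C1_on_partial[OF C1_compactD[OF assms(2)], of j]
 have i: "integrable lborel \<phi>" "integrable lborel (partial j \<phi>)"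
  using integrable_compact_support[OF c K(1,3)] integrable_compact_support[OF c' K(1,4)] by auto
 have t: "test_function Om (conv \<phi> (\<eta> n))" for n
 proof (rule test_function_conv[OF i(1) m(1) K(1,3)])
  show "x \<in> K ==> cball x (ep n) \<subseteq> Om" for x using r(2) m(3)[of n] subset_cball[of "ep n" r x] by blast
 qed
 have p: "partial j (conv \<phi> (\<eta> n)) x = conv (partial j \<phi>) (\<eta> n) x" for n x
  unfolding partial_conv[OF i(1) mollifierD(2)[OF m(1)]] by (rule conv_partial_commute[OF cU m(1)])
 have eq: "(\<integral>x. conv (partial j \<phi>) (\<eta> n) x *\<^sub>R u x \<partial>Leb) = - (\<integral>x. conv \<phi> (\<eta> n) x *\<^sub>R g x \<partial>Leb)" for n
  using assms(1) t[of n] unfolding has_weak_partial_def p[symmetric] by blast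
 have lim: "(%n. \<integral>x. conv f (\<eta> n) x *\<^sub>R w x \<partial>Leb) \<longlonglongrightarrow> (\<integral>x. f x *\<^sub>R w x \<partial>Leb)"
  if f: "continuous_on UNIV f" "!!x. x \<notin> K ==> f x = 0" "!!x. norm (f x) <= M" and w: "w \<in> L2 Leb"
  for f :: "real^2 => real" and w
 proof (rule integral_dominated_convergence[where w = "%x. M * cmod (w x)"])
  have fi: "integrable lborel f" by (rule integrable_compact_support[OF f(1) K(1) f(2)])
  have wm: "w \<in> borel_measurable Leb" using L2D(1)[OF w] .
  show "(%x. f x *\<^sub>R w x) \<in> borel_measurable Leb"
   using continuous_lebesgue_on[OF f(1)] wm by measurable
  show "(%x. conv f (\<eta> n) x *\<^sub>R w x) \<in> borel_measurable Leb" for n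
   using continuous_lebesgue_on[OF C1_on_continuous[OF smooth_on_C1_on[OF smooth_conv[OF fi mollifierD(1)[OF m(1)]]]]] wm
   by measurable
  show "integrable Leb (%x. M * cmod (w x))" using L2_integrable[OF w] by simp
  show "AE x in Leb. (%n. conv f (\<eta> n) x *\<^sub>R w x) \<longlonglongrightarrow> f x *\<^sub>R w x"
   by (intro AE_I2 tendsto_scaleR tendsto_const conv_tendsto[OF f(1) K(1) f(2) m(1,4)])
  show "AE x in Leb. norm (conv f (\<eta> n) x *\<^sub>R w x) <= M * cmod (w x)" for n
   using conv_norm_le[OF m(1) fi f(3)] by (intro AE_I2) (simp add: mult_right_mono)
 qed
 have "(%n. - (\<integral>x. conv \<phi> (\<eta> n) x *\<^sub>R g x \<partial>Leb)) \<longlonglongrightarrow> - (\<integral>x. \<phi> x *\<^sub>R g x \<partial>Leb)"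
  by (intro tendsto_minus lim c K(3) M(2) weakD(2)[OF assms(1)])
 moreover have "(%n. - (\<integral>x. conv \<phi> (\<eta> n) x *\<^sub>R g x \<partial>Leb)) \<longlonglongrightarrow> (\<integral>x. partial j \<phi> x *\<^sub>R u x \<partial>Leb)"
  unfolding eq[symmetric] by (intro lim c' K(4) M(3) weakD(1)[OF assms(1)])
 ultimately show ?thesis by (rule LIMSEQ_unique[OF _ _, symmetric])
qed

lemma weak_C1_test_function_complex:
 fixes \<phi> :: "real^2 => complex"
 assumes "weak j u g" "C1_compact Om \<phi>"
 shows "(\<integral>x. partial j \<phi> x * u x \<partial>Leb) = - (\<integral>x. \<phi> x * g x \<partial>Leb)"
proof -
 obtain M where M: "M >= 0" "!!x. norm (\<phi> x) <= M" "!!x j. norm (partial j \<phi> x) <= M"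
  using C1_compact_bounded[OF assms(2)] by blast
 note re = C1_compact_linear[OF bounded_linear_Re assms(2)]
 note im = C1_compact_linear[OF bounded_linear_Im assms(2)]
 have split: "(\<integral>x. f x * w x \<partial>Leb) =
   (\<integral>x. Re (f x) *\<^sub>R w x \<partial>Leb) + \<i> * (\<integral>x. Im (f x) *\<^sub>R w x \<partial>Leb)"
  if f: "f \<in> borel_measurable borel" "!!x. norm (f x) <= M" and w: "w \<in> L2 Leb" for f w
 proof -
  have [measurable]: "f \<in> borel_measurable Leb" using f(1) by (rule borel_lebesgue_on)
  have "\<bar>Re (f x)\<bar> <= M" "\<bar>Im (f x)\<bar> <= M" for x
   using f(2)[of x] abs_Re_le_cmod[of "f x"] abs_Im_le_cmod[of "f x"] by linarith+
  then have i: "integrable Leb (%x. Re (f x) *\<^sub>R w x)" "integrable Leb (%x. Im (f x) *\<^sub>R w x)"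
   by (intro integrable_bounded_scaleR[OF L2_integrable[OF w], where C = M]; measurable)+
  have "(\<integral>x. f x * w x \<partial>Leb) = (\<integral>x. Re (f x) *\<^sub>R w x + \<i> * (Im (f x) *\<^sub>R w x) \<partial>Leb)"
   by (intro lint_cong) (auto simp: complex_eq_iff)
  also have "... = (\<integral>x. Re (f x) *\<^sub>R w x \<partial>Leb) + \<i> * (\<integral>x. Im (f x) *\<^sub>R w x \<partial>Leb)"
  proof -
   have "integrable Leb (%x. \<i> * (Im (f x) *\<^sub>R w x))"
    by (rule integrable_mult_right) (rule i(2))
   from lint_add[OF i(1) this]
   show ?thesis unfolding Bochner_Integration.integral_mult_right_zero .
  qed
  finally show ?thesis .
 qed
 note wr = weak_C1_test_function[OF assms(1) re(1), unfolded re(2)]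
 note wi = weak_C1_test_function[OF assms(1) im(1), unfolded im(2)]
 show ?thesis
  unfolding split[OF C1_compact_measurable(1)[OF assms(2)] M(2) weakD(2)[OF assms(1)]]
   split[OF C1_compact_measurable(2)[OF assms(2)] M(3) weakD(1)[OF assms(1)]] wr wi
  by (simp add: algebra_simps)
qed

lemma weak_conv:
 assumes "weak j u g" "borel_version Om u u0" "borel_version Om g g0" "mollifier ep \<eta>" "cball x ep \<subseteq> Om"
 shows "partial j (conv u0 \<eta>) x = conv g0 \<eta> x"
proof -
 note m = mollifierD[OF assms(4)]
 have t: "test_function Om (%y. \<eta> (x - y))" by (rule test_function_reflect[OF m(1,4) assms(5)])
 note r = C1_on_reflect(2)[OF C1_compactD[OF m(2)], where x = x]
 have [measurable]: "\<eta> \<in> borel_measurable borel" "partial j \<eta> \<in> borel_measurable borel"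
  using m(8) C1_compact_measurable(2)[OF m(2)] by auto
 have mm: "(%y. \<eta> (x - y)) \<in> borel_measurable borel" "(%y. partial j \<eta> (x - y)) \<in> borel_measurable borel"
  by measurable
 have "partial j (conv u0 \<eta>) x = (\<integral>y. partial j \<eta> (x - y) *\<^sub>R u0 y \<partial>lborel)"
  using partial_conv[OF borel_version_L2(1)[OF assms(2) weakD(1)[OF assms(1)]] m(2)] by (simp add: conv_def)
 also have "... = (\<integral>y. partial j \<eta> (x - y) *\<^sub>R u y \<partial>Leb)"
  by (rule borel_version_integral[symmetric, OF assms(2) L2D(1)[OF weakD(1)[OF assms(1)]] mm(2)])
 also have "... = - (\<integral>y. partial j (%y. \<eta> (x - y)) y *\<^sub>R u y \<partial>Leb)"
  by (simp add: r)
 also have "... = (\<integral>y. \<eta> (x - y) *\<^sub>R g y \<partial>Leb)"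
  using assms(1) t unfolding has_weak_partial_def by simp
 also have "... = conv g0 \<eta> x"
  unfolding conv_def by (rule borel_version_integral[OF assms(3) L2D(1)[OF weakD(2)[OF assms(1)]] mm(1)])
 finally show ?thesis .
qed

text \<open>The mollified function vanishes at interior points, as translated kernels are test functions, and converges to the given one in mean square.\<close>
lemma orthogonal_test_functions_AE_0:
 assumes "d \<in> L2 Leb" "!!\<phi>. test_function Om \<phi> ==> (\<integral>x. \<phi> x *\<^sub>R d x \<partial>Leb) = 0"
 shows "AE x in Leb. d x = 0"
proof -
 obtain d0 where d0: "borel_version Om d d0" using borel_version_exists[OF L2D(1)[OF assms(1)]] by blast
 obtain ep \<eta> where m: "!!n. mollifier (ep n) (\<eta> n)" "!!n. 0 < ep n" "!!n. ep n <= 1" "ep \<longlonglongrightarrow> 0"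
  using mollifier_sequence[OF zero_less_one] by metis
 have zero: "conv d0 (\<eta> n) x = 0" if "cball x (ep n) \<subseteq> Om" for n x
 proof -
  note mm = mollifierD[OF m(1)[of n]]
  have [measurable]: "\<eta> n \<in> borel_measurable borel" by (rule mm(8))
  have "conv d0 (\<eta> n) x = (\<integral>y. \<eta> n (x - y) *\<^sub>R d y \<partial>Leb)"
   unfolding conv_def by (rule borel_version_integral[symmetric, OF d0 L2D(1)[OF assms(1)]]) measurable
  also have "... = 0" by (rule assms(2)) (rule test_function_reflect[OF mm(1,4) that])
  finally show ?thesis .
 qed
 have cL: "(%x. conv d0 (\<eta> n) x - d x) \<in> L2 Leb" for n
  by (rule L2_diff[OF borel_version_conv_L2[OF d0 assms(1) m(1)] assms(1)])
 have lim: "(%n. \<integral>\<^sup>+x. ennreal (cmod2 (conv d0 (\<eta> n) x - d x)) \<partial>Leb) \<longlonglongrightarrow> 0"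
 proof -
  have "(%n. ennreal ((L2_norm Leb (%x. conv d0 (\<eta> n) x - d x))^2)) \<longlonglongrightarrow> ennreal (0^2)"
   by (intro tendsto_ennrealI tendsto_power mollification_tendsto[OF d0 assms(1) m(1,4)])
  moreover have "(\<integral>\<^sup>+x. ennreal (cmod2 (conv d0 (\<eta> n) x - d x)) \<partial>Leb)
    = ennreal ((L2_norm Leb (%x. conv d0 (\<eta> n) x - d x))^2)" for n
   unfolding L2_norm_square by (rule nn_integral_eq_integral[OF L2D(2)[OF cL]]) simp
  ultimately show ?thesis by simp
 qed
 have "(\<integral>\<^sup>+x. ennreal (cmod2 (d x)) \<partial>Leb)
   <= (\<integral>\<^sup>+x. liminf (%n. ennreal (cmod2 (conv d0 (\<eta> n) x - d x))) \<partial>Leb)"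
 proof (rule nn_integral_mono)
  fix x assume "x \<in> space Leb"
  then have "x \<in> Om" by simp
  then obtain r where r: "r > 0" "cball x r \<subseteq> Om" using open_domain open_contains_cball by blast
  have "\<forall>\<^sub>F n in sequentially. ep n < r" using m(4) r(1) by (intro order_tendstoD) auto
  then have "\<forall>\<^sub>F n in sequentially. ennreal (cmod2 (conv d0 (\<eta> n) x - d x)) = ennreal (cmod2 (d x))"
  proof eventually_elim
   case (elim n)
   have "cball x (ep n) \<subseteq> cball x r" using elim by (intro subset_cball) simp
   then show ?case using zero[of x n] r(2) by auto
  qed
  then have "(%n. ennreal (cmod2 (conv d0 (\<eta> n) x - d x))) \<longlonglongrightarrow> ennreal (cmod2 (d x))"
   by (rule tendsto_eventually)
  then show "ennreal (cmod2 (d x)) <= liminf (%n. ennreal (cmod2 (conv d0 (\<eta> n) x - d x)))"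
   using lim_imp_Liminf[OF sequentially_bot] by (metis order_refl)
 qed
 also have "... <= liminf (%n. \<integral>\<^sup>+x. ennreal (cmod2 (conv d0 (\<eta> n) x - d x)) \<partial>Leb)"
  by (rule nn_integral_liminf) (use L2D(1)[OF cL] in measurable)
 also have "... = 0" using lim_imp_Liminf[OF sequentially_bot lim] by simp
 finally have "(\<integral>\<^sup>+x. ennreal (cmod2 (d x)) \<partial>Leb) = 0" by simp
 then have "AE x in Leb. ennreal (cmod2 (d x)) = 0"
  by (subst (asm) nn_integral_0_iff_AE) (use L2D(1)[OF assms(1)] in measurable)
 then show ?thesis by eventually_elim simp
qed

lemma weak_partial_unique:
 assumes "weak j u g" "weak j u g'"
 shows "AE x in Leb. g x = g' x"
proof -
 note g = weakD(2)[OF assms(1)] weakD(2)[OF assms(2)]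
 have "AE x in Leb. g x - g' x = 0"
 proof (rule orthogonal_test_functions_AE_0[OF L2_diff[OF g]])
  fix \<phi> assume t: "test_function Om \<phi>"
  note c = test_function_C1[OF t]
  obtain M where M: "M >= 0" "!!x. norm (\<phi> x) <= M" "!!x j. norm (partial j \<phi> x) <= M" using C1_compact_bounded[OF c] by blast
  have i: "integrable Leb (%x. \<phi> x *\<^sub>R w x)" if "w \<in> L2 Leb" for w
   by (rule integrable_bounded_scaleR[OF L2_integrable[OF that], where C = M])
    (use M(2) borel_lebesgue_on[OF C1_compact_measurable(1)[OF c]] in auto)
  have "(\<integral>x. \<phi> x *\<^sub>R g x \<partial>Leb) = (\<integral>x. \<phi> x *\<^sub>R g' x \<partial>Leb)"
  proof -
   have "(\<integral>x. partial j \<phi> x *\<^sub>R u x \<partial>Leb) = - (\<integral>x. \<phi> x *\<^sub>R g x \<partial>Leb)"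
    "(\<integral>x. partial j \<phi> x *\<^sub>R u x \<partial>Leb) = - (\<integral>x. \<phi> x *\<^sub>R g' x \<partial>Leb)"
    using assms t unfolding has_weak_partial_def by blast+
   then show ?thesis by simp
  qed
  then show "(\<integral>x. \<phi> x *\<^sub>R (g x - g' x) \<partial>Leb) = 0"
   unfolding scaleR_diff_right using lint_diff[OF i[OF g(1)] i[OF g(2)]] by simp
 qed
 then show ?thesis by eventually_elim simp
qed

text \<open>One factor is mollified; near the support of the cut-off its derivative is the mollified weak derivative.\<close>
lemma weak_partial_product:
 fixes ka :: "real^2 => real"
 assumes "weak j u g" "weak j v k" "C1_compact Om ka"
 shows "(\<integral>x. partial j ka x *\<^sub>R (u x * v x) \<partial>Leb)
  = - (\<integral>x. ka x *\<^sub>R (g x * v x) \<partial>Leb) - (\<integral>x. ka x *\<^sub>R (u x * k x) \<partial>Leb)"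
proof -
 note L = weakD[OF assms(1)] weakD[OF assms(2)]
 obtain v0 where v0: "borel_version Om v v0" using borel_version_exists[OF L2D(1)[OF L(3)]] by blast
 obtain k0 where k0: "borel_version Om k k0" using borel_version_exists[OF L2D(1)[OF L(4)]] by blast
 from assms(3) obtain K where K: "compact K" "K \<subseteq> Om" "!!x. x \<notin> K ==> ka x = 0" "!!x j. x \<notin> K ==> partial j ka x = 0"
  by (rule C1_compactE) blast
 obtain M where M: "M >= 0" "!!x. norm (ka x) <= M" "!!x j. norm (partial j ka x) <= M"
  using C1_compact_bounded[OF assms(3)] by blast
 obtain r where r: "r > 0" "(\<Union>x\<in>K. cball x r) \<subseteq> Om"
  using compact_subset_open_imp_cball_epsilon_subset[OF K(1) open_domain K(2)] by blast
 obtain ep \<eta> where m: "!!n. mollifier (ep n) (\<eta> n)" "!!n. 0 < ep n" "!!n. ep n <= r" "ep \<longlonglongrightarrow> 0"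
  using mollifier_sequence[OF r(1)] by metis
 define w z where "w n = conv v0 (\<eta> n)" and "z n = conv k0 (\<eta> n)" for n
 have wL: "w n \<in> L2 Leb" and zL: "z n \<in> L2 Leb" for n
  unfolding w_def z_def using borel_version_conv_L2[OF v0 L(3) m(1)] borel_version_conv_L2[OF k0 L(4) m(1)] by auto
 have km: "ka \<in> borel_measurable Leb" "partial j ka \<in> borel_measurable Leb"
  by (auto intro!: borel_lebesgue_on C1_compact_measurable[OF assms(3)])
 have bd: "!!x. x \<in> space Leb ==> \<bar>ka x\<bar> <= M" "!!x. x \<in> space Leb ==> \<bar>partial j ka x\<bar> <= M"
  using M by auto
 have eq: "(\<integral>x. partial j ka x *\<^sub>R (w n x * u x) \<partial>Leb)
   = - (\<integral>x. ka x *\<^sub>R (w n x * g x) \<partial>Leb) - (\<integral>x. ka x *\<^sub>R (z n x * u x) \<partial>Leb)" for n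
 proof -
  have C: "C1_on Om (w n)"
   unfolding w_def
   by (rule C1_on_subset[OF smooth_on_C1_on[OF smooth_conv[OF borel_version_L2(1)[OF v0 L(3)] mollifierD(1)[OF m(1)]]] subset_UNIV])
  note p = C1_compact_bilinear[OF bounded_bilinear_scaleR open_domain assms(3) C]
  have zw: "ka x *\<^sub>R partial j (w n) x = ka x *\<^sub>R z n x" for x
  proof (cases "x \<in> K")
   case True
   then have "cball x (ep n) \<subseteq> Om" using r(2) m(3)[of n] subset_cball[of "ep n" r x] by blast
   then show ?thesis unfolding w_def z_def using weak_conv[OF assms(2) v0 k0 m(1)] by simp
  qed (simp add: K(3))
  note i = L2_product_bounded(1)[OF zL[of n] L(1) km(1) bd(1)] L2_product_bounded(1)[OF wL[of n] L(1) km(2) bd(2)]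
  have "(\<integral>x. ka x *\<^sub>R (z n x * u x) \<partial>Leb) + (\<integral>x. partial j ka x *\<^sub>R (w n x * u x) \<partial>Leb)
    = (\<integral>x. ka x *\<^sub>R (z n x * u x) + partial j ka x *\<^sub>R (w n x * u x) \<partial>Leb)"
   using i by simp
  also have "... = (\<integral>x. partial j (%x. ka x *\<^sub>R w n x) x * u x \<partial>Leb)"
   by (intro lint_cong) (auto simp: p(2) zw algebra_simps)
  also have "... = - (\<integral>x. (ka x *\<^sub>R w n x) * g x \<partial>Leb)"
   by (rule weak_C1_test_function_complex[OF assms(1) p(1)])
  finally show ?thesis by (simp add: algebra_simps)
 qed
 have wt: "(%n. L2_norm Leb (%x. w n x - v x)) \<longlonglongrightarrow> 0"
  unfolding w_def by (rule mollification_tendsto[OF v0 L(3) m(1,4)])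
 have zt: "(%n. L2_norm Leb (%x. z n x - k x)) \<longlonglongrightarrow> 0"
  unfolding z_def by (rule mollification_tendsto[OF k0 L(4) m(1,4)])
 have 1: "(%n. \<integral>x. partial j ka x *\<^sub>R (w n x * u x) \<partial>Leb) \<longlonglongrightarrow> (\<integral>x. partial j ka x *\<^sub>R (v x * u x) \<partial>Leb)"
  by (rule L2_pairing_tendsto[OF wL L(3,1) km(2) bd(2) wt M(1)])
 have 2: "(%n. - (\<integral>x. ka x *\<^sub>R (w n x * g x) \<partial>Leb) - (\<integral>x. ka x *\<^sub>R (z n x * u x) \<partial>Leb))
   \<longlonglongrightarrow> - (\<integral>x. ka x *\<^sub>R (v x * g x) \<partial>Leb) - (\<integral>x. ka x *\<^sub>R (k x * u x) \<partial>Leb)"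
  by (intro tendsto_diff tendsto_minus L2_pairing_tendsto[OF wL L(3,2) km(1) bd(1) wt M(1)]
    L2_pairing_tendsto[OF zL L(4,1) km(1) bd(1) zt M(1)])
 show ?thesis using LIMSEQ_unique[OF 1 2[folded eq]] by (simp add: mult.commute)
qed

lemma weak_add:
 assumes "weak j u g" "weak j v k"
 shows "weak j (%x. u x + v x) (%x. g x + k x)"
 unfolding has_weak_partial_def
proof (intro conjI allI impI L2_add weakD[OF assms(1)] weakD[OF assms(2)])
 fix \<phi> assume t: "test_function Om \<phi>"
 note c = test_function_C1[OF t]
 obtain M where M: "M >= 0" "!!x. norm (\<phi> x) <= M" "!!x j. norm (partial j \<phi> x) <= M" using C1_compact_bounded[OF c] by blast
 have i: "integrable Leb (%x. \<phi> x *\<^sub>R w x)" "integrable Leb (%x. partial j \<phi> x *\<^sub>R w x)"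
  if "w \<in> L2 Leb" for w
  by (rule integrable_bounded_scaleR[OF L2_integrable[OF that], where C = M],
    use M borel_lebesgue_on[OF C1_compact_measurable(1)[OF c]] in auto)
   (rule integrable_bounded_scaleR[OF L2_integrable[OF that], where C = M],
    use M borel_lebesgue_on[OF C1_compact_measurable(2)[OF c]] in auto)
 have "(\<integral>x. partial j \<phi> x *\<^sub>R u x \<partial>Leb) = - (\<integral>x. \<phi> x *\<^sub>R g x \<partial>Leb)"
  "(\<integral>x. partial j \<phi> x *\<^sub>R v x \<partial>Leb) = - (\<integral>x. \<phi> x *\<^sub>R k x \<partial>Leb)"
  using assms t unfolding has_weak_partial_def by blast+
 then show "(\<integral>x. partial j \<phi> x *\<^sub>R (u x + v x) \<partial>Leb) = - (\<integral>x. \<phi> x *\<^sub>R (g x + k x) \<partial>Leb)"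
  unfolding scaleR_add_right
  using lint_add[OF i(2)[OF weakD(1)[OF assms(1)]] i(2)[OF weakD(1)[OF assms(2)]]]
   lint_add[OF i(1)[OF weakD(2)[OF assms(1)]] i(1)[OF weakD(2)[OF assms(2)]]]
  by simp
qed

lemma weak_mult_C1:
 fixes a :: "real^2 => complex"
 assumes "weak j u g" "C1_on Om a" "!!x. x \<in> Om ==> cmod (a x) <= C" "!!x. x \<in> Om ==> cmod (partial j a x) <= C"
 shows "weak j (%x. a x * u x) (%x. a x * g x + partial j a x * u x)"
proof -
 note L = weakD[OF assms(1)]
 have am: "a \<in> borel_measurable Leb" "partial j a \<in> borel_measurable Leb"
  by (intro continuous_domain_measurable C1_on_continuous C1_on_partial assms)+
 define C' where "C' = max C 0"
 have b: "!!x. x \<in> space Leb ==> cmod (a x) <= C'" "!!x. x \<in> space Leb ==> cmod (partial j a x) <= C'" "C' >= 0"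
  using assms(3,4) by (auto simp: C'_def le_max_iff_disj)
 note aL = L2_mult_bounded(1)[OF L(1) am(1) b(1,3)] L2_mult_bounded(1)[OF L(2) am(1) b(1,3)] L2_mult_bounded(1)[OF L(1) am(2) b(2,3)]
 show ?thesis
  unfolding has_weak_partial_def
 proof (intro conjI allI impI L2_add aL)
  fix \<phi> assume t: "test_function Om \<phi>"
  note c = test_function_C1[OF t]
  obtain M where M: "M >= 0" "!!x. norm (\<phi> x) <= M" "!!x j. norm (partial j \<phi> x) <= M" using C1_compact_bounded[OF c] by blast
  have i: "integrable Leb (%x. \<phi> x *\<^sub>R w x)" "integrable Leb (%x. partial j \<phi> x *\<^sub>R w x)"
   if "w \<in> L2 Leb" for w
   by (rule integrable_bounded_scaleR[OF L2_integrable[OF that], where C = M],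
     use M borel_lebesgue_on[OF C1_compact_measurable(1)[OF c]] in auto)
    (rule integrable_bounded_scaleR[OF L2_integrable[OF that], where C = M],
     use M borel_lebesgue_on[OF C1_compact_measurable(2)[OF c]] in auto)
  note p = C1_compact_bilinear[OF bounded_bilinear_scaleR open_domain c assms(2)]
  have "(\<integral>x. partial j \<phi> x *\<^sub>R (a x * u x) \<partial>Leb) + (\<integral>x. \<phi> x *\<^sub>R (partial j a x * u x) \<partial>Leb)
    = (\<integral>x. partial j \<phi> x *\<^sub>R (a x * u x) + \<phi> x *\<^sub>R (partial j a x * u x) \<partial>Leb)"
   using i(2)[OF aL(1)] i(1)[OF aL(3)] by simp
  also have "... = (\<integral>x. partial j (%x. \<phi> x *\<^sub>R a x) x * u x \<partial>Leb)"
   by (intro lint_cong) (auto simp: p(2) algebra_simps)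
  also have "... = - (\<integral>x. (\<phi> x *\<^sub>R a x) * g x \<partial>Leb)"
   by (rule weak_C1_test_function_complex[OF assms(1) p(1)])
  also have "... = - (\<integral>x. \<phi> x *\<^sub>R (a x * g x) \<partial>Leb)" by simp
  finally have e: "(\<integral>x. partial j \<phi> x *\<^sub>R (a x * u x) \<partial>Leb) + (\<integral>x. \<phi> x *\<^sub>R (partial j a x * u x) \<partial>Leb)
    = - (\<integral>x. \<phi> x *\<^sub>R (a x * g x) \<partial>Leb)" .
  have "(\<integral>x. \<phi> x *\<^sub>R (a x * g x + partial j a x * u x) \<partial>Leb)
    = (\<integral>x. \<phi> x *\<^sub>R (a x * g x) \<partial>Leb) + (\<integral>x. \<phi> x *\<^sub>R (partial j a x * u x) \<partial>Leb)"
   unfolding scaleR_add_right by (rule lint_add[OF i(1)[OF aL(2)] i(1)[OF aL(3)]])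
  then show "(\<integral>x. partial j \<phi> x *\<^sub>R (a x * u x) \<partial>Leb) = - (\<integral>x. \<phi> x *\<^sub>R (a x * g x + partial j a x * u x) \<partial>Leb)"
   using e by (simp add: algebra_simps)
 qed
qed

lemma weak_const: "weak j (%x. c) (%x. 0)"
 unfolding has_weak_partial_def
proof (intro conjI allI impI L2_zero)
 show "(%x. c) \<in> L2 Leb" by (rule L2_bounded[of _ "cmod c"]) auto
 fix \<phi> assume t: "test_function Om \<phi>"
 note c = test_function_C1[OF t]
 from c obtain K where K: "K \<subseteq> Om" "!!x j. x \<notin> K ==> partial j \<phi> x = 0" by (rule C1_compactE) blast
 have m: "(%x. partial j \<phi> x *\<^sub>R c) \<in> borel_measurable borel" using C1_compact_measurable(2)[OF c] by measurable
 have e: "(%x. indicator Om x *\<^sub>R partial j \<phi> x *\<^sub>R c) = (%x. partial j \<phi> x *\<^sub>R c)"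
  using K by (auto simp: fun_eq_iff indicator_def)
 have "(\<integral>x. partial j \<phi> x *\<^sub>R c \<partial>Leb) = (\<integral>x. partial j \<phi> x *\<^sub>R c \<partial>lborel)"
  unfolding lebesgue_on_borel(1)[OF m] e ..
 also have "... = (\<integral>x. partial j (%x. \<phi> x *\<^sub>R c) x \<partial>lborel)"
  using C1_compact_linear(2)[OF bounded_linear_scaleR_left[of c] c] by simp
 also have "... = 0"
  by (rule integral_partial_eq_0) (rule C1_compact_mono[OF C1_compact_linear(1)[OF bounded_linear_scaleR_left c] subset_UNIV])
 finally show "(\<integral>x. partial j \<phi> x *\<^sub>R c \<partial>Leb) = - (\<integral>x. \<phi> x *\<^sub>R 0 \<partial>Leb)" by simp
qed

lemma weak_scale:
 assumes "weak j u g"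
 shows "weak j (%x. c * u x) (%x. c * g x)"
proof -
 have "partial j (%x. c) x = 0" for x using partialI[OF has_derivative_const[of c "at x"], of j] by simp
 then show ?thesis using weak_mult_C1[OF assms C1_on_const[of Om c], of "cmod c"] by simp
qed

lemma weak_diff:
 assumes "weak j u g" "weak j v k"
 shows "weak j (%x. u x - v x) (%x. g x - k x)"
 using weak_add[OF assms(1) weak_scale[OF assms(2), of "-1"]] by simp

lemma weak_of_C1:
 fixes a :: "real^2 => complex"
 assumes "C1_on Om a" "!!x. x \<in> Om ==> cmod (a x) <= C" "!!x. x \<in> Om ==> cmod (partial j a x) <= C"
 shows "weak j a (partial j a)"
 using weak_mult_C1[OF weak_const[of j 1] assms] by simp

lemma weak_cnj:
 assumes "weak j u g"
 shows "weak j (%x. cnj (u x)) (%x. cnj (g x))"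
 unfolding has_weak_partial_def
proof (intro conjI allI impI L2_cnj weakD[OF assms])
 fix \<phi> assume "test_function Om \<phi>"
 then have "(\<integral>x. partial j \<phi> x *\<^sub>R u x \<partial>Leb) = - (\<integral>x. \<phi> x *\<^sub>R g x \<partial>Leb)"
  using assms unfolding has_weak_partial_def by blast
 moreover have "(\<integral>x. a x *\<^sub>R cnj (w x) \<partial>Leb) = cnj (\<integral>x. a x *\<^sub>R w x \<partial>Leb)"
  for a :: "real^2 => real" and w
  using Bochner_Integration.integral_cnj[of "Leb" "%x. a x *\<^sub>R w x"] by simp
 ultimately show "(\<integral>x. partial j \<phi> x *\<^sub>R cnj (u x) \<partial>Leb) = - (\<integral>x. \<phi> x *\<^sub>R cnj (g x) \<partial>Leb)"
  by simp
qed

text \<open>Weak derivatives are closed under convergence in mean square of functions and derivatives.\<close>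
lemma weak_limit:
 assumes "!!n. weak j (w n) (z n)" "u \<in> L2 Leb" "g \<in> L2 Leb"
  "(%n. L2_norm Leb (%x. w n x - u x)) \<longlonglongrightarrow> 0"
  "(%n. L2_norm Leb (%x. z n x - g x)) \<longlonglongrightarrow> 0"
 shows "weak j u g"
 unfolding has_weak_partial_def
proof (intro conjI allI impI assms)
 fix \<phi> assume t: "test_function Om \<phi>"
 note c = test_function_C1[OF t]
 obtain M where M: "M >= 0" "!!x. norm (\<phi> x) <= M" "!!x j. norm (partial j \<phi> x) <= M" using C1_compact_bounded[OF c] by blast
 have one: "(%x. 1) \<in> L2 Leb" by (rule L2_bounded[of _ 1]) auto
 have 1: "(%n. \<integral>x. partial j \<phi> x *\<^sub>R (w n x * 1) \<partial>Leb) \<longlonglongrightarrow> (\<integral>x. partial j \<phi> x *\<^sub>R (u x * 1) \<partial>Leb)"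
  by (rule L2_pairing_tendsto[OF weakD(1)[OF assms(1)] assms(2) one _ _ assms(4) M(1)])
   (use M borel_lebesgue_on[OF C1_compact_measurable(2)[OF c]] in auto)
 have 2: "(%n. \<integral>x. \<phi> x *\<^sub>R (z n x * 1) \<partial>Leb) \<longlonglongrightarrow> (\<integral>x. \<phi> x *\<^sub>R (g x * 1) \<partial>Leb)"
  by (rule L2_pairing_tendsto[OF weakD(2)[OF assms(1)] assms(3) one _ _ assms(5) M(1)])
   (use M borel_lebesgue_on[OF C1_compact_measurable(1)[OF c]] in auto)
 have e: "(\<integral>x. partial j \<phi> x *\<^sub>R (w n x * 1) \<partial>Leb) = - (\<integral>x. \<phi> x *\<^sub>R (z n x * 1) \<partial>Leb)" for n
  using assms(1)[of n] t unfolding has_weak_partial_def by simp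
 show "(\<integral>x. partial j \<phi> x *\<^sub>R u x \<partial>Leb) = - (\<integral>x. \<phi> x *\<^sub>R g x \<partial>Leb)"
  using LIMSEQ_unique[OF 1[unfolded e] tendsto_minus[OF 2]] by simp
qed

lemma H1D: "u \<in> H1 Om ==> weak j u (weak_partial Om j u)"
 unfolding H1_def weak_partial_def by (auto intro: someI_ex[of "weak j u"])

lemma H1I: "(!!j. weak j u (g j)) ==> u \<in> H1 Om"
 using weakD(1) unfolding H1_def by blast

lemma weak_partial_AE: "weak j u g ==> AE x in Leb. weak_partial Om j u x = g x"
 by (rule weak_partial_unique[of j u]) (auto simp: weak_partial_def intro: someI[of "weak j u"])

end

section \<open>Boundary charts and the boundary layer\<close>

lemma segment_mean_value:
 fixes \<rho> :: "real^2 => real"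
 assumes "convex W" "C1_on W \<rho>" "x \<in> W" "y \<in> W"
 obtains z where "z \<in> W" "\<rho> y - \<rho> x = (\<Sum>j\<in>UNIV. (y - x) $ j * partial j \<rho> z)"
proof -
 define \<gamma> where "\<gamma> t = x + t *\<^sub>R (y - x)" for t :: real
 have W: "\<gamma> t \<in> W" if "t \<in> {0..1}" for t
 proof -
  have "\<gamma> t = (1 - t) *\<^sub>R x + t *\<^sub>R y" by (simp add: \<gamma>_def algebra_simps)
  then show ?thesis using convexD[OF assms(1,3,4), of "1 - t" t] that by simp
 qed
 have "\<exists>t\<in>{0<..<1}. (\<rho> \<circ> \<gamma>) 1 - (\<rho> \<circ> \<gamma>) 0
   = (%s. \<Sum>j\<in>UNIV. (s *\<^sub>R (y - x)) $ j *\<^sub>R partial j \<rho> (\<gamma> t)) (1 - 0)"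
 proof (rule mvt_simple)
  fix t :: real assume "0 <= t" "t <= 1"
  have "(\<gamma> has_derivative (%s. s *\<^sub>R (y - x))) (at t within {0..1})"
   unfolding \<gamma>_def[abs_def] by (auto intro!: derivative_eq_intros)
  from diff_chain_within[OF this has_derivative_at_withinI[OF C1_on_has_derivative[OF assms(2) W]]] \<open>0 <= t\<close> \<open>t <= 1\<close>
  show "((\<rho> \<circ> \<gamma>) has_derivative (%s. \<Sum>j\<in>UNIV. (s *\<^sub>R (y - x)) $ j *\<^sub>R partial j \<rho> (\<gamma> t))) (at t within {0..1})"
   by (simp add: o_def)
 qed simp
 then obtain t where "t \<in> {0<..<1}" "\<rho> (\<gamma> 1) - \<rho> (\<gamma> 0) = (\<Sum>j\<in>UNIV. (y - x) $ j * partial j \<rho> (\<gamma> t))" by auto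
 then show ?thesis using that[OF W[of t]] by (auto simp: \<gamma>_def)
qed

text \<open>A defining function whose derivative in one signed coordinate direction is bounded below, so that \<open>-\<rho>\<close> measures the depth inside the domain.\<close>
definition boundary_chart ::
 "(real^2) set => real^2 => real => (real^2 => real) => 2 => real => real => real => bool" where
 "boundary_chart Om p r \<rho> k \<sigma> c C \<longleftrightarrow> r > 0 \<and> c > 0 \<and> C > 0 \<and> \<bar>\<sigma>\<bar> = 1 \<and> p \<in> frontier Om \<and>
  smooth_on (ball p (5 * r)) \<rho> \<and> Om \<inter> ball p (5 * r) = {x \<in> ball p (5 * r). \<rho> x < 0} \<and>
  (\<forall>x\<in>ball p (5 * r). c <= \<sigma> * partial k \<rho> x \<and> (\<forall>j. \<bar>partial j \<rho> x\<bar> <= C))"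

lemma Ck_on_subset: "Ck_on k U f ==> V \<subseteq> U ==> Ck_on k V f"
proof (induction k arbitrary: f)
 case (Suc k)
 then show ?case by auto
qed (auto intro: continuous_on_subset)

lemma smooth_on_subset: "smooth_on U f ==> V \<subseteq> U ==> smooth_on V f"
 unfolding smooth_on_def using Ck_on_subset by blast

locale smooth_domain = planar_domain +
 assumes smooth_domain: "smooth_boundary Om"
begin

lemma boundary_chart_exists:
 assumes "p \<in> frontier Om"
 obtains r \<rho> k \<sigma> c C where "boundary_chart Om p r \<rho> k \<sigma> c C"
proof -
 obtain U \<rho> where "local_defining_function Om p U \<rho>"
  using smooth_domain assms unfolding smooth_boundary_def by blast
 then have U: "open U" "p \<in> U" "smooth_on U \<rho>" "grad \<rho> p ~= 0" "Om \<inter> U = {x \<in> U. \<rho> x < 0}"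
  by (auto simp: local_defining_function_def)
 note C1 = smooth_on_C1_on[OF U(3)]
 obtain k where k: "partial k \<rho> p ~= 0" using U(4) by (auto simp: grad_def vec_eq_iff)
 define c where "c = \<bar>partial k \<rho> p\<bar> / 2"
 have c: "c > 0" using k by (simp add: c_def)
 define \<sigma> where "\<sigma> = sgn (partial k \<rho> p)"
 have \<sigma>: "\<bar>\<sigma>\<bar> = 1" using k by (simp add: \<sigma>_def sgn_if)
 have sp: "\<sigma> * partial k \<rho> p = 2 * c" using k by (simp add: \<sigma>_def c_def sgn_if)
 define C where "C = (\<Sum>j\<in>UNIV. \<bar>partial j \<rho> p\<bar>) + 1"
 have C: "C > 0" by (simp add: C_def sum_nonneg add_nonneg_pos)
 have cont: "isCont (partial j \<rho>) p" for j
  using C1_on_partial[OF C1, of j] U(1,2) by (simp add: continuous_on_eq_continuous_at)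
 have ev: "\<forall>\<^sub>F x in at p. \<bar>partial j \<rho> x\<bar> < C" for j
 proof (rule order_tendstoD(2))
  show "((%x. \<bar>partial j \<rho> x\<bar>) \<longlongrightarrow> \<bar>partial j \<rho> p\<bar>) (at p)" using cont[of j] by (intro tendsto_rabs) (simp add: isCont_def)
  have "\<bar>partial j \<rho> p\<bar> <= (\<Sum>j\<in>UNIV. \<bar>partial j \<rho> p\<bar>)" by (rule member_le_sum) auto
  then show "\<bar>partial j \<rho> p\<bar> < C" by (simp add: C_def)
 qed
 have ev2: "\<forall>\<^sub>F x in at p. c < \<sigma> * partial k \<rho> x"
 proof (rule order_tendstoD(1))
  show "((%x. \<sigma> * partial k \<rho> x) \<longlongrightarrow> \<sigma> * partial k \<rho> p) (at p)" using cont[of k] by (intro tendsto_intros) (simp add: isCont_def)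
  show "c < \<sigma> * partial k \<rho> p" using sp c by simp
 qed
 have "\<forall>\<^sub>F x in at p. c < \<sigma> * partial k \<rho> x \<and> \<bar>partial 1 \<rho> x\<bar> < C \<and> \<bar>partial 2 \<rho> x\<bar> < C"
  by (intro eventually_conj ev ev2)
 then obtain d where d: "d > 0" "!!x. x ~= p ==> dist x p < d ==> c < \<sigma> * partial k \<rho> x \<and> \<bar>partial 1 \<rho> x\<bar> < C \<and> \<bar>partial 2 \<rho> x\<bar> < C"
  unfolding eventually_at by auto
 obtain d' where d': "d' > 0" "ball p d' \<subseteq> U" using U(1,2) open_contains_ball by blast
 define r where "r = min d d' / 5"
 have r: "r > 0" "5 * r <= d" "5 * r <= d'" using d d' by (auto simp: r_def)
 have sub: "ball p (5 * r) \<subseteq> U" using d'(2) subset_ball[OF r(3), of p] by blast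
 have "c <= \<sigma> * partial k \<rho> x \<and> (\<forall>j. \<bar>partial j \<rho> x\<bar> <= C)" if "x \<in> ball p (5 * r)" for x
 proof (cases "x = p")
  case True
  have "\<bar>partial j \<rho> p\<bar> <= (\<Sum>j\<in>UNIV. \<bar>partial j \<rho> p\<bar>)" for j by (rule member_le_sum) auto
  then show ?thesis using True sp c by (auto simp: C_def intro: add_increasing2)
 next
  case False
  have "dist x p < d" using that r(2) by (simp add: dist_commute)
  from d(2)[OF False this] show ?thesis by (metis exhaust_2 less_imp_le)
 qed
 then have "boundary_chart Om p r \<rho> k \<sigma> c C"
  unfolding boundary_chart_def using assms r(1) c C \<sigma> smooth_on_subset[OF U(3) sub] sub U(5) by blast
 then show ?thesis using that by blast
qed

lemma nearest_frontier:
 assumes "x \<in> Om" "infdist x (- Om) < t"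
 obtains q where "q \<in> frontier Om" "dist x q < t"
proof -
 have "closed (- Om)" using open_domain by (simp add: closed_Compl)
 moreover have "- Om ~= {}" using bounded_domain not_bounded_UNIV by (metis Compl_empty_eq double_compl)
 ultimately obtain y where y: "y \<in> - Om" "infdist x (- Om) = dist x y" by (rule infdist_attains_inf)
 have "closed_segment x y \<inter> frontier Om ~= {}"
 proof (rule connected_Int_frontier)
  show "closed_segment x y \<inter> Om ~= {}" using assms(1) by auto
  show "closed_segment x y - Om ~= {}" using y(1) by auto
 qed simp
 then obtain q where q: "q \<in> closed_segment x y" "q \<in> frontier Om" by blast
 have "dist x q <= dist x y" using dist_in_closed_segment[OF q(1)] by (simp add: dist_commute)
 then show ?thesis using that[OF q(2)] y(2) assms(2) by simp
qed

end

locale chart = smooth_domain +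
 fixes p :: "real^2" and r :: real and \<rho> :: "real^2 => real" and k :: 2 and \<sigma> c C :: real
 assumes is_chart: "boundary_chart Om p r \<rho> k \<sigma> c C"
begin

lemma chart_pos: "r > 0" "c > 0" "C > 0" and abs_sigma: "\<bar>\<sigma>\<bar> = 1" and p_frontier: "p \<in> frontier Om"
 using is_chart by (auto simp: boundary_chart_def)

abbreviation "W \<equiv> ball p (5 * r)"

lemma chart_smooth: "smooth_on W \<rho>"
 using is_chart by (simp add: boundary_chart_def)

lemma chart_C1: "C1_on W \<rho>"
 by (rule smooth_on_C1_on[OF chart_smooth])

lemma chart_domain: "x \<in> W ==> x \<in> Om \<longleftrightarrow> \<rho> x < 0"
 using is_chart by (auto simp: boundary_chart_def)

lemma chart_bounds: "x \<in> W ==> c <= \<sigma> * partial k \<rho> x" "x \<in> W ==> \<bar>partial j \<rho> x\<bar> <= C"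
 using is_chart by (auto simp: boundary_chart_def)

definition dir :: "real^2" where "dir = \<sigma> *\<^sub>R axis k 1"

lemma norm_dir: "norm dir = 1"
 by (simp add: dir_def abs_sigma)

lemma chart_increasing:
 assumes "x \<in> W" "x + s *\<^sub>R dir \<in> W" "s >= 0"
 shows "\<rho> x + c * s <= \<rho> (x + s *\<^sub>R dir)"
proof -
 obtain z where z: "z \<in> W" "\<rho> (x + s *\<^sub>R dir) - \<rho> x = (\<Sum>j\<in>UNIV. (x + s *\<^sub>R dir - x) $ j * partial j \<rho> z)"
  using segment_mean_value[OF convex_ball chart_C1 assms(1,2)] by blast
 have "(\<Sum>j\<in>UNIV. (x + s *\<^sub>R dir - x) $ j * partial j \<rho> z) = s * (\<sigma> * partial k \<rho> z)"
  by (simp add: dir_def axis_def if_distrib[of "%t. _ * t"] if_distrib[of "%t. t * _"] sum.delta cong: if_cong)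
 moreover have "s * c <= s * (\<sigma> * partial k \<rho> z)" using chart_bounds(1)[OF z(1)] assms(3) by (rule mult_left_mono)
 ultimately show ?thesis using z(2) by (simp add: mult.commute)
qed

lemma chart_Lipschitz:
 assumes "x \<in> W" "y \<in> W"
 shows "\<bar>\<rho> y - \<rho> x\<bar> <= 2 * C * dist x y"
proof -
 obtain z where z: "z \<in> W" "\<rho> y - \<rho> x = (\<Sum>j\<in>UNIV. (y - x) $ j * partial j \<rho> z)"
  using segment_mean_value[OF convex_ball chart_C1 assms] by blast
 have "\<bar>\<Sum>j\<in>UNIV. (y - x) $ j * partial j \<rho> z\<bar> <= (\<Sum>j\<in>UNIV. \<bar>(y - x) $ j\<bar> * \<bar>partial j \<rho> z\<bar>)"
  by (rule order_trans[OF sum_abs]) (simp add: abs_mult)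
 also have "... <= (\<Sum>j\<in>(UNIV::2 set). dist x y * C)"
  by (intro sum_mono mult_mono chart_bounds(2)[OF z(1)])
   (auto simp: dist_norm norm_minus_commute[of x y] component_le_norm_cart simp del: vector_minus_component)
 finally show ?thesis using z(2) by (simp add: mult_ac)
qed

lemma chart_frontier:
 assumes "q \<in> W"
 shows "q \<in> frontier Om \<longleftrightarrow> \<rho> q = 0"
proof
 assume q: "q \<in> frontier Om"
 then have "q \<notin> Om" using open_domain by (simp add: frontier_def interior_open)
 then have "\<rho> q >= 0" using chart_domain[OF assms] by simp
 moreover have "\<rho> q <= 0"
 proof (rule ccontr)
  assume "\<not> \<rho> q <= 0"
  obtain e where e: "e > 0" "ball q e \<subseteq> W" using assms open_contains_ball open_ball by blast
  have "\<rho> q / (2 * C) > 0" using \<open>\<not> \<rho> q <= 0\<close> chart_pos by simp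
  then obtain y where y: "y \<in> Om" "dist y q < min e (\<rho> q / (2 * C))"
   using q e(1) unfolding frontier_def closure_approachable by (metis DiffD1 closure_approachable min_less_iff_conj)
  then have yW: "y \<in> W" using e(2) by (auto simp: dist_commute)
  have "2 * C * dist q y < \<rho> q" using y(2) chart_pos by (simp add: dist_commute field_simps)
  then have "\<rho> y > 0" using chart_Lipschitz[OF assms yW] by linarith
  then show False using y(1) chart_domain[OF yW] by simp
 qed
 ultimately show "\<rho> q = 0" by simp
next
 assume q: "\<rho> q = 0"
 then have "q \<notin> Om" using chart_domain[OF assms] by simp
 moreover have "q \<in> closure Om"
  unfolding closure_approachable
 proof (intro allI impI)
  fix e :: real assume "e > 0"
  obtain e' where e': "e' > 0" "ball q e' \<subseteq> W" using assms open_contains_ball open_ball by blast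
  define s where "s = min e e' / 2"
  have s: "s > 0" "s < e" "s < e'" using \<open>e > 0\<close> e' by (auto simp: s_def)
  define y where "y = q - s *\<^sub>R dir"
  have dy: "dist y q = s" using s norm_dir by (simp add: y_def dist_norm)
  then have yW: "y \<in> W" using s e' by (auto simp: dist_commute)
  have yq: "y + s *\<^sub>R dir = q" by (simp add: y_def)
  have "\<rho> y + c * s <= \<rho> (y + s *\<^sub>R dir)" using chart_increasing[OF yW, of s] s assms unfolding yq by simp
  moreover have "c * s > 0" using s chart_pos by simp
  ultimately have "\<rho> y < 0" using q unfolding yq by simp
  then show "\<exists>y\<in>Om. dist y q < e" using chart_domain[OF yW] dy s by auto
 qed
 ultimately show "q \<in> frontier Om" using open_domain by (simp add: frontier_def interior_open)
qed

lemma chart_cutoff: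
 fixes a :: "real^2 => real" and G G' :: "real => real"
 assumes a: "C1_on UNIV a" "\<forall>x. dist x p >= 4 * r --> a x = 0"
  and G: "!!s. (G has_real_derivative G' s) (at s)" "continuous_on UNIV G'" "\<forall>s\<le>ep. G s = 0" and "ep > 0"
 defines "ka \<equiv> (%x. if x \<in> W then a x * G (- \<rho> x) else 0)"
 shows "C1_compact Om ka"
  and "!!x j. x \<in> W ==> partial j ka x = partial j a x * G (- \<rho> x) - a x * G' (- \<rho> x) * partial j \<rho> x"
  and "!!x j. x \<notin> W ==> partial j ka x = 0"
proof -
 note aW = C1_on_subset[OF a(1) subset_UNIV, of W]
 note m = C1_on_linear[OF bounded_linear_minus[OF bounded_linear_ident] chart_C1]
 have cG: "continuous_on W (%x. G' (- \<rho> x))"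
  by (rule continuous_on_compose2[OF G(2) C1_on_continuous[OF m(1)]]) auto
 note g = C1_on_compose_real[OF m(1) G(1) cG]
 note ag = C1_on_mult[OF aW g(1)]
 define K where "K = {x \<in> cball p (4 * r). ep <= - \<rho> x}"
 have sub: "cball p (4 * r) \<subseteq> W" using chart_pos(1) by (auto simp: subset_iff)
 have "K = cball p (4 * r) \<inter> (%x. - \<rho> x) -` {ep..}" by (auto simp: K_def)
 then have "closed K"
  using continuous_closed_preimage[OF continuous_on_subset[OF C1_on_continuous[OF m(1)] sub] closed_cball] by simp
 then have "compact (cball p (4 * r) \<inter> K)" by (intro compact_Int_closed compact_cball)
 moreover have "cball p (4 * r) \<inter> K = K" by (auto simp: K_def)
 ultimately have K: "compact K" by simp
 have KW: "K \<subseteq> W" using sub by (auto simp: K_def)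
 have KO: "K \<subseteq> Om" using chart_domain KW \<open>ep > 0\<close> by (fastforce simp: K_def)
 have z: "a x * G (- \<rho> x) = 0" if "x \<in> W" "x \<notin> K" for x
  using that a(2)[rule_format, of x] G(3)[rule_format, of "- \<rho> x"] by (cases "x \<in> cball p (4 * r)") (auto simp: K_def dist_commute)
 note e = C1_compact_extend[OF open_ball ag(1) K KW KO z]
 show "C1_compact Om ka" unfolding ka_def by (rule e(1))
 show "!!x j. x \<in> W ==> partial j ka x = partial j a x * G (- \<rho> x) - a x * G' (- \<rho> x) * partial j \<rho> x"
  unfolding ka_def by (subst e(2)) (auto simp: ag(2) g(2) m(2))
 show "!!x j. x \<notin> W ==> partial j ka x = 0"
  unfolding ka_def by (rule e(4)) (use KW in auto)
qed

end

text \<open>Slope of order one on \<open>[2\<epsilon>, t]\<close>, size of order \<open>t\<close>, zero near the boundary: the derivative detects a layer while the function itself is small.\<close>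
definition ramp :: "real => real => real => real" where
 "ramp ep t s = t * arctan ((sqrt ((max (s - ep) 0)^2 + ep^2) - ep) / t)"

definition ramp' :: "real => real => real => real" where
 "ramp' ep t s = inverse (1 + ((sqrt ((max (s - ep) 0)^2 + ep^2) - ep) / t)^2)
  * (max (s - ep) 0 / sqrt ((max (s - ep) 0)^2 + ep^2))"

lemma ramp:
 assumes "ep > 0" "t > 0"
 shows "(ramp ep t has_real_derivative ramp' ep t s) (at s)" "continuous_on UNIV (ramp' ep t)"
  "s <= ep ==> ramp ep t s = 0" "\<bar>ramp ep t s\<bar> <= 2 * t" "0 <= ramp' ep t s" "2 * ep <= s ==> s <= t ==> 1/4 <= ramp' ep t s"
proof -
 define n where "n s = max (s - ep) 0" for s
 let ?q = "%s. (n s)^2 + ep^2"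
 have pos: "?q s > 0" for s using assms by (simp add: add_nonneg_pos)
 have dn: "((%s. (n s)^2) has_real_derivative 2 * n s) (at s)" for s
 proof -
  have "((%s. s - ep) has_real_derivative 1) (at s)" by (auto intro!: derivative_eq_intros)
  from DERIV_chain'[OF this has_real_derivative_pos_part_square[of "s - ep"]]
  show ?thesis by (simp add: n_def[abs_def])
 qed
 have ds: "((%s. sqrt (?q s)) has_real_derivative n s / sqrt (?q s)) (at s)" for s
 proof -
  have "((%s. ?q s) has_real_derivative 2 * n s) (at s)"
   using DERIV_add[OF dn DERIV_const] by simp
  from DERIV_chain'[OF this DERIV_real_sqrt[OF pos]]
  have "((%s. sqrt (?q s)) has_real_derivative (inverse (sqrt (?q s)) / 2) * (2 * n s)) (at s)" .
  moreover have "(inverse X / 2) * (2 * n s) = n s / X" for X :: real by (cases "X = 0") (simp_all add: field_simps)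
  ultimately show ?thesis by (simp only:)
 qed
 have "((%s. (sqrt (?q s) - ep) / t) has_real_derivative (n s / sqrt (?q s)) / t) (at s)"
  using DERIV_cdivide[OF DERIV_diff[OF ds[of s] DERIV_const[of ep]], of t] by simp
 from DERIV_cmult[OF DERIV_chain'[OF this DERIV_arctan], of t]
 show "(ramp ep t has_real_derivative ramp' ep t s) (at s)"
  using assms unfolding ramp_def[abs_def] ramp'_def n_def by (simp add: mult_ac)
 have ne: "1 + ((sqrt (?q s) - ep) / t)^2 ~= 0" for s
  using zero_le_power2[of "(sqrt (?q s) - ep) / t"] by linarith
 have ne2: "sqrt (?q s) ~= 0" for s using real_sqrt_gt_zero[OF pos[of s]] by linarith
 show "continuous_on UNIV (ramp' ep t)"
  unfolding ramp'_def[abs_def] n_def[symmetric]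
  by (intro continuous_intros ballI ne ne2) (use assms in \<open>auto simp: n_def[abs_def] intro!: continuous_intros\<close>)
 show "s <= ep ==> ramp ep t s = 0" using assms by (simp add: ramp_def)
 have at: "\<bar>arctan y\<bar> <= 2" for y using arctan_lbound[of y] arctan_ubound[of y] pi_less_4 by linarith
 show "\<bar>ramp ep t s\<bar> <= 2 * t"
  unfolding ramp_def abs_mult abs_of_pos[OF assms(2)] mult.commute[of 2]
  by (rule mult_left_mono[OF at less_imp_le[OF assms(2)]])
 show "0 <= ramp' ep t s" by (simp add: ramp'_def)
 assume s: "2 * ep <= s" "s <= t"
 have n: "n s = s - ep" "ep <= n s" "n s <= t" using s assms by (auto simp: n_def)
 have "sqrt (?q s) <= n s + ep"
 proof -
  have "0 <= n s * ep" using assms n by simp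
  then have "?q s <= (n s + ep)^2" unfolding power2_sum by linarith
  then have "sqrt (?q s) <= sqrt ((n s + ep)^2)" by (rule real_sqrt_le_mono)
  also have "... = n s + ep" using assms n by simp
  finally show ?thesis .
 qed
 moreover have "ep <= sqrt (?q s)" by (rule real_le_rsqrt) simp
 ultimately have y: "0 <= (sqrt (?q s) - ep) / t" "(sqrt (?q s) - ep) / t <= 1"
  using assms n by (auto simp: divide_simps)
 then have "((sqrt (?q s) - ep) / t)^2 <= 1" by (simp add: power_le_one)
 then have 1: "1/2 <= inverse (1 + ((sqrt (?q s) - ep) / t)^2)"
 proof -
  assume "((sqrt (?q s) - ep) / t)^2 <= 1"
  moreover have "1/2 <= inverse (1 + Y)" if "0 <= Y" "Y <= 1" for Y :: real
   using that by (simp add: inverse_eq_divide le_divide_eq)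
  ultimately show ?thesis by (meson zero_le_power2)
 qed
 have "sqrt (?q s) <= 2 * n s" using \<open>sqrt (?q s) <= n s + ep\<close> n by simp
 then have "1/2 * sqrt (?q s) <= n s" by simp
 then have 2: "1/2 <= n s / sqrt (?q s)"
  unfolding pos_le_divide_eq[OF real_sqrt_gt_zero[OF pos]] .
 have "1/2 * (1/2) <= ramp' ep t s"
  unfolding ramp'_def n_def[symmetric] by (rule mult_mono[OF 1 2]) auto
 then show "1/4 <= ramp' ep t s" by simp
qed

context planar_domain
begin

text \<open>Only the real part of \<open>cnj u * g\<close> enters. It is gauge invariant, so for the magnetic form it is bounded by \<open>|u| |D\<^sub>j u| / h\<close> without a loss from the potential.\<close>
definition bl_energy :: "(real^2 => complex) => (2 => real^2 => complex) => real" where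
 "bl_energy u g = (\<integral>x. cmod2 (u x) \<partial>Leb) + (\<Sum>j\<in>UNIV. \<integral>x. \<bar>Re (cnj (u x) * g j x)\<bar> \<partial>Leb)"

lemma integrable_Re_product:
 assumes "u \<in> L2 Leb" "v \<in> L2 Leb"
 shows "integrable Leb (%x. Re (cnj (u x) * v x))" "integrable Leb (%x. \<bar>Re (cnj (u x) * v x)\<bar>)"
 using integrable_Re[OF L2_product(3)[OF L2_cnj[OF assms(1)] assms(2)]]
  integrable_abs[OF integrable_Re[OF L2_product(3)[OF L2_cnj[OF assms(1)] assms(2)]]] by blast+

lemma bl_energy_nonneg: "0 <= bl_energy u g"
 unfolding bl_energy_def by (intro add_nonneg_nonneg sum_nonneg lint_nonneg) auto

lemma weak_partial_square:
 fixes ka :: "real^2 => real"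
 assumes "weak j u g" "C1_compact Om ka"
 shows "(\<integral>x. partial j ka x * cmod2 (u x) \<partial>Leb) = - 2 * (\<integral>x. ka x * Re (cnj (u x) * g x) \<partial>Leb)"
proof -
 note L = weakD[OF assms(1)]
 obtain M where M: "M >= 0" "!!x. norm (ka x) <= M" "!!x j. norm (partial j ka x) <= M" using C1_compact_bounded[OF assms(2)] by blast
 have m: "ka \<in> borel_measurable Leb" "partial j ka \<in> borel_measurable Leb"
  by (intro borel_lebesgue_on C1_compact_measurable[OF assms(2)])+
 have b: "!!x. x \<in> space Leb ==> \<bar>ka x\<bar> <= M" "!!x. x \<in> space Leb ==> \<bar>partial j ka x\<bar> <= M"
  using M by auto
 have i0: "integrable Leb (%x. ka x *\<^sub>R (cnj (g x) * u x))" "integrable Leb (%x. ka x *\<^sub>R (cnj (u x) * g x))"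
  "integrable Leb (%x. partial j ka x *\<^sub>R (cnj (u x) * u x))"
  using L2_product_bounded(1)[OF L2_cnj[OF L(2)] L(1) m(1) b(1)] L2_product_bounded(1)[OF L2_cnj[OF L(1)] L(2) m(1) b(1)]
   L2_product_bounded(1)[OF L2_cnj[OF L(1)] L(1) m(2) b(2)] by blast+
 have "(\<integral>x. partial j ka x *\<^sub>R (cnj (u x) * u x) \<partial>Leb)
  = - (\<integral>x. ka x *\<^sub>R (cnj (g x) * u x) \<partial>Leb) - (\<integral>x. ka x *\<^sub>R (cnj (u x) * g x) \<partial>Leb)"
  by (rule weak_partial_product[OF weak_cnj[OF assms(1)] assms])
 then have "Re (\<integral>x. partial j ka x *\<^sub>R (cnj (u x) * u x) \<partial>Leb)
  = Re (- (\<integral>x. ka x *\<^sub>R (cnj (g x) * u x) \<partial>Leb) - (\<integral>x. ka x *\<^sub>R (cnj (u x) * g x) \<partial>Leb))" by simp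
 then have "(\<integral>x. Re (partial j ka x *\<^sub>R (cnj (u x) * u x)) \<partial>Leb)
  = - (\<integral>x. Re (ka x *\<^sub>R (cnj (g x) * u x)) \<partial>Leb) - (\<integral>x. Re (ka x *\<^sub>R (cnj (u x) * g x)) \<partial>Leb)"
  unfolding integral_Re[OF i0(1)] integral_Re[OF i0(2)] integral_Re[OF i0(3)] by simp
 moreover have "Re (partial j ka x *\<^sub>R (cnj (u x) * u x)) = partial j ka x * cmod2 (u x)" for x
 proof -
  have "Re (cnj (u x) * u x) = cmod2 (u x)"
   by (simp add: cmod_power2 power2_eq_square[of "Re _"] power2_eq_square[of "Im _"])
  then show ?thesis by (simp only: scaleR_complex.sel)
 qed
 moreover have "Re (ka x *\<^sub>R (cnj (g x) * u x)) = ka x * Re (cnj (u x) * g x)" "Re (ka x *\<^sub>R (cnj (u x) * g x)) = ka x * Re (cnj (u x) * g x)" for x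
  by (simp_all add: mult_ac)
 ultimately show ?thesis by (simp only:)
qed

lemma indicator_integrable:
 fixes f :: "real^2 => real"
 assumes "integrable Leb f" "E \<in> sets lebesgue"
 shows "integrable Leb (%x. indicator E x * f x)"
proof -
 have "(indicator E :: real^2 => real) \<in> borel_measurable Leb"
  using assms(2) by (intro measurable_restrict_space1 borel_measurable_indicator)
 from integrable_bounded_scaleR[OF assms(1) this, of 1] show ?thesis by (simp add: indicator_def)
qed

end

context chart
begin

lemma layer_borel: "{x \<in> Om \<inter> cball p (2 * r). a <= - \<rho> x \<and> - \<rho> x <= t} \<in> sets lebesgue"
proof -
 have sub: "cball p (2 * r) \<subseteq> W" using chart_pos(1) by (auto simp: subset_iff)
 have c: "continuous_on (cball p (2 * r)) (%x. - \<rho> x)"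
  by (intro continuous_intros continuous_on_subset[OF C1_on_continuous[OF chart_C1] sub])
 have "{x \<in> cball p (2 * r). a <= - \<rho> x} = cball p (2 * r) \<inter> (%x. - \<rho> x) -` {a..}"
  "{x \<in> cball p (2 * r). - \<rho> x <= t} = cball p (2 * r) \<inter> (%x. - \<rho> x) -` {..t}" by auto
 then have "closed {x \<in> cball p (2 * r). a <= - \<rho> x}" "closed {x \<in> cball p (2 * r). - \<rho> x <= t}"
  using continuous_closed_preimage[OF c closed_cball] by simp_all
 then have "Om \<inter> ({x \<in> cball p (2 * r). a <= - \<rho> x} \<inter> {x \<in> cball p (2 * r). - \<rho> x <= t}) \<in> sets lebesgue"
  using domain_lebesgue by (intro sets.Int) (auto intro: sets_completionI_sets)
 moreover have "Om \<inter> ({x \<in> cball p (2 * r). a <= - \<rho> x} \<inter> {x \<in> cball p (2 * r). - \<rho> x <= t})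
   = {x \<in> Om \<inter> cball p (2 * r). a <= - \<rho> x \<and> - \<rho> x <= t}" by blast
 ultimately show ?thesis by simp
qed

definition layer :: "real => (real^2) set" where
 "layer t = {x \<in> Om \<inter> cball p (2 * r). - \<rho> x <= t}"

lemma layer_lebesgue: "layer t \<in> sets lebesgue"
proof -
 have "layer t = {x \<in> Om \<inter> cball p (2 * r). 0 <= - \<rho> x \<and> - \<rho> x <= t}"
  using chart_domain chart_pos(1) by (fastforce simp: layer_def)
 then show ?thesis using layer_borel[of 0 t] by (simp only:)
qed

text \<open>Apply \<open>weak_partial_square\<close> with the ramp of the depth and let its dead zone shrink.\<close>
lemma boundary_layer_local:
 "\<exists>B>0. \<forall>t>0. \<forall>u g. (\<forall>j. weak j u (g j)) -->
  (\<integral>x. indicator (layer t) x * cmod2 (u x) \<partial>Leb) <= B * t * bl_energy u g"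
proof -
 have "2 * r > 0" using chart_pos(1) by simp
 from bump_exists[OF this, of p] obtain a :: "real^2 => real" where a: "C1_on UNIV a" "!!x. 0 <= a x" "!!x. a x <= 1"
  "!!x. dist x p <= 2 * r ==> a x = 1" "!!x. dist x p >= 2 * (2 * r) ==> a x = 0" by blast
 have a0: "dist x p >= 4 * r ==> a x = 0" for x using a(5)[of x] by simp
 have a0': "\<forall>x. dist x p >= 4 * r --> a x = 0" using a0 by blast
 have "C1_compact UNIV a"
  unfolding C1_compact_def using a(1) a0 by (intro conjI exI[of _ "cball p (4 * r)"]) (auto simp: dist_commute)
 then obtain A where A: "A >= 0" "!!x. norm (a x) <= A" "!!x j. norm (partial j a x) <= A" using C1_compact_bounded by blast
 define B where "B = 4 / c * (2 * A + 4)"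
 have "B > 0" using A chart_pos by (simp add: B_def)
 have main: "(\<integral>x. indicator {x \<in> Om \<inter> cball p (2 * r). 2 * ep <= - \<rho> x \<and> - \<rho> x <= t} x * cmod2 (u x) \<partial>Leb)
   <= B * t * bl_energy u g"
  if t: "t > 0" and u: "!!j. weak j u (g j)" and e: "ep > 0" for t u g ep
 proof -
  note R = ramp[OF e t]
  define ka where "ka = (%x. if x \<in> W then a x * ramp ep t (- \<rho> x) else 0)"
  have R3: "\<forall>s\<le>ep. ramp ep t s = 0" using R(3) by blast
  note cut = chart_cutoff[OF a(1) a0' R(1) R(2) R3 e, folded ka_def]
  note L = weakD[OF u]
  define E where "E = {x \<in> Om \<inter> cball p (2 * r). 2 * ep <= - \<rho> x \<and> - \<rho> x <= t}"
  have E: "E \<in> sets lebesgue" unfolding E_def by (rule layer_borel)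
  have iu: "integrable Leb (%x. cmod2 (u x))" by (rule L2D(2)[OF L(1)])
  have iR: "integrable Leb (%x. \<bar>Re (cnj (u x) * g k x)\<bar>)" by (rule integrable_Re_product(2)[OF L])
  obtain M where M: "M >= 0" "!!x. norm (ka x) <= M" "!!x j. norm (partial j ka x) <= M" using C1_compact_bounded[OF cut(1)] by blast
  have ik: "integrable Leb (%x. partial k ka x * cmod2 (u x))"
   using integrable_bounded_scaleR[OF iu borel_lebesgue_on[OF C1_compact_measurable(2)[OF cut(1)]], where C = M] M(3) by simp
  have pw: "c / 4 * (indicator E x * cmod2 (u x)) <= - \<sigma> * partial k ka x * cmod2 (u x) + 2 * A * t * cmod2 (u x)" for x
  proof -
   have "c / 4 * indicator E x <= - \<sigma> * partial k ka x + 2 * A * t"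
   proof (cases "x \<in> W")
    case True
    have b: "\<bar>\<sigma> * (partial k a x * ramp ep t (- \<rho> x))\<bar> <= A * (2 * t)"
     unfolding abs_mult abs_sigma using A(3)[of k x] A(1) R(4)[of "- \<rho> x"] by (simp add: mult_mono)
    have g: "c / 4 * indicator E x <= a x * ramp' ep t (- \<rho> x) * (\<sigma> * partial k \<rho> x)"
    proof (cases "x \<in> E")
     case True
     then have "1/4 <= ramp' ep t (- \<rho> x)" "a x = 1" using R(6)[of "- \<rho> x"] a(4)[of x] by (auto simp: E_def dist_commute)
     then have "1/4 * c <= a x * ramp' ep t (- \<rho> x) * (\<sigma> * partial k \<rho> x)"
      using chart_bounds(1)[OF \<open>x \<in> W\<close>] chart_pos(2) by (intro mult_mono) auto
     then show ?thesis using True by simp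
    next
     case False
     have "0 <= a x * ramp' ep t (- \<rho> x) * (\<sigma> * partial k \<rho> x)"
      using a(2)[of x] R(5)[of "- \<rho> x"] order_trans[OF less_imp_le[OF chart_pos(2)] chart_bounds(1)[OF \<open>x \<in> W\<close>]]
      by (intro mult_nonneg_nonneg[OF mult_nonneg_nonneg])
     then show ?thesis using False by simp
    qed
    have "- \<sigma> * partial k ka x = a x * ramp' ep t (- \<rho> x) * (\<sigma> * partial k \<rho> x) - \<sigma> * (partial k a x * ramp ep t (- \<rho> x))"
     unfolding cut(2)[OF True] by (simp add: algebra_simps)
    then show ?thesis using b g by linarith
   next
    case False
    then have "x \<notin> E" using chart_pos(1) by (auto simp: E_def)
    then show ?thesis using False cut(3) A t by simp
   qed
   from mult_right_mono[OF this, of "cmod2 (u x)"] show ?thesis by (simp add: algebra_simps)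
  qed
  have kb: "\<bar>ka x\<bar> <= 2 * t" for x
  proof (cases "x \<in> W")
   case True
   have "\<bar>ka x\<bar> <= 1 * (2 * t)" unfolding ka_def if_P[OF True] abs_mult
    using a(2,3)[of x] R(4) by (intro mult_mono) auto
   then show ?thesis by simp
  qed (use t in \<open>simp add: ka_def\<close>)
  have ikr: "integrable Leb (%x. ka x * Re (cnj (u x) * g k x))"
   using integrable_bounded_scaleR[OF integrable_Re_product(1)[OF L] borel_lebesgue_on[OF C1_compact_measurable(1)[OF cut(1)]], where C = "2 * t"] kb by simp
  have "c / 4 * (\<integral>x. indicator E x * cmod2 (u x) \<partial>Leb)
    = (\<integral>x. c / 4 * (indicator E x * cmod2 (u x)) \<partial>Leb)" by simp
  also have "... <= (\<integral>x. - \<sigma> * (partial k ka x * cmod2 (u x)) + 2 * A * t * cmod2 (u x) \<partial>Leb)"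
  proof (rule lint_mono)
   show "integrable Leb (%x. c / 4 * (indicator E x * cmod2 (u x)))"
    by (intro integrable_mult_right indicator_integrable iu E)
   show "integrable Leb (%x. - \<sigma> * (partial k ka x * cmod2 (u x)) + 2 * A * t * cmod2 (u x))"
    by (intro litg_add integrable_mult_right ik iu)
  qed (use pw in \<open>simp add: mult.assoc\<close>)
  also have "... = - \<sigma> * (\<integral>x. partial k ka x * cmod2 (u x) \<partial>Leb) + 2 * A * t * (\<integral>x. cmod2 (u x) \<partial>Leb)"
   by (subst lint_add) (auto intro!: integrable_mult_right ik iu)
  also have "... = 2 * \<sigma> * (\<integral>x. ka x * Re (cnj (u x) * g k x) \<partial>Leb) + 2 * A * t * (\<integral>x. cmod2 (u x) \<partial>Leb)"
   unfolding weak_partial_square[OF u cut(1)] by simp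
  also have "... <= 2 * (2 * t * (\<integral>x. \<bar>Re (cnj (u x) * g k x)\<bar> \<partial>Leb)) + 2 * A * t * (\<integral>x. cmod2 (u x) \<partial>Leb)"
  proof -
   have "\<bar>\<sigma> * (\<integral>x. ka x * Re (cnj (u x) * g k x) \<partial>Leb)\<bar> = \<bar>\<integral>x. ka x * Re (cnj (u x) * g k x) \<partial>Leb\<bar>"
    by (simp add: abs_mult abs_sigma)
   also have "... <= (\<integral>x. \<bar>ka x * Re (cnj (u x) * g k x)\<bar> \<partial>Leb)" by (rule integral_abs_bound)
   also have "... <= (\<integral>x. 2 * t * \<bar>Re (cnj (u x) * g k x)\<bar> \<partial>Leb)"
   proof (rule lint_mono)
    show "integrable Leb (%x. \<bar>ka x * Re (cnj (u x) * g k x)\<bar>)" by (rule integrable_abs[OF ikr])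
    show "integrable Leb (%x. 2 * t * \<bar>Re (cnj (u x) * g k x)\<bar>)" by (rule integrable_mult_right) (rule iR)
   qed (use kb in \<open>auto simp: abs_mult intro!: mult_right_mono\<close>)
   also have "... = 2 * t * (\<integral>x. \<bar>Re (cnj (u x) * g k x)\<bar> \<partial>Leb)" by simp
   finally show ?thesis by linarith
  qed
  also have "... <= (2 * A + 4) * t * bl_energy u g"
  proof -
   have "(\<integral>x. \<bar>Re (cnj (u x) * g k x)\<bar> \<partial>Leb) <= (\<Sum>j\<in>UNIV. \<integral>x. \<bar>Re (cnj (u x) * g j x)\<bar> \<partial>Leb)"
    by (rule member_le_sum) auto
   moreover have "0 <= (\<integral>x. cmod2 (u x) \<partial>Leb)" by simp
   moreover have "0 <= (\<Sum>j\<in>UNIV. \<integral>x. \<bar>Re (cnj (u x) * g j x)\<bar> \<partial>Leb)" by (intro sum_nonneg lint_nonneg) simp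
   ultimately have 1: "(\<integral>x. \<bar>Re (cnj (u x) * g k x)\<bar> \<partial>Leb) <= bl_energy u g" "(\<integral>x. cmod2 (u x) \<partial>Leb) <= bl_energy u g"
    unfolding bl_energy_def by linarith+
   have "2 * (2 * t * (\<integral>x. \<bar>Re (cnj (u x) * g k x)\<bar> \<partial>Leb)) <= 2 * (2 * t * bl_energy u g)"
    using 1(1) t by simp
   moreover have "2 * A * t * (\<integral>x. cmod2 (u x) \<partial>Leb) <= 2 * A * t * bl_energy u g"
    using 1(2) t A(1) by (intro mult_left_mono) auto
   ultimately show ?thesis by (simp add: algebra_simps)
  qed
  finally have "c / 4 * (\<integral>x. indicator E x * cmod2 (u x) \<partial>Leb) <= (2 * A + 4) * t * bl_energy u g" .
  then have "(\<integral>x. indicator E x * cmod2 (u x) \<partial>Leb) <= 4 / c * ((2 * A + 4) * t * bl_energy u g)"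
   using chart_pos(2) by (simp add: field_simps)
  then show ?thesis by (simp add: E_def B_def mult_ac)
 qed
 have "(\<integral>x. indicator (layer t) x * cmod2 (u x) \<partial>Leb) <= B * t * bl_energy u g"
  if t: "t > 0" and u: "!!j. weak j u (g j)" for t u g
 proof (rule LIMSEQ_le_const2)
  define E where "E n = {x \<in> Om \<inter> cball p (2 * r). 2 * (1 / real (Suc n)) <= - \<rho> x \<and> - \<rho> x <= t}" for n
  have E: "E n \<in> sets lebesgue" for n unfolding E_def by (rule layer_borel)
  have iu: "integrable Leb (%x. cmod2 (u x))" by (rule L2D(2)[OF weakD(1)[OF u]])
  show "(%n. \<integral>x. indicator (E n) x * cmod2 (u x) \<partial>Leb) \<longlonglongrightarrow> (\<integral>x. indicator (layer t) x * cmod2 (u x) \<partial>Leb)"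
  proof (rule integral_dominated_convergence[where w = "%x. cmod2 (u x)"])
   show "AE x in Leb. (%n. indicator (E n) x * cmod2 (u x)) \<longlonglongrightarrow> indicator (layer t) x * cmod2 (u x)"
   proof (rule AE_I2)
    fix x assume x: "x \<in> space Leb"
    have "\<forall>\<^sub>F n in sequentially. indicator (E n) x = (indicator (layer t) x :: real)"
    proof (cases "x \<in> layer t")
     case True
     then have "x \<in> W" "x \<in> Om" using chart_pos(1) by (auto simp: layer_def)
     then have "- \<rho> x > 0" using chart_domain by simp
     have "(%n. 2 * (1 / real (Suc n))) \<longlonglongrightarrow> 2 * 0"
      using LIMSEQ_inverse_real_of_nat by (intro tendsto_intros) (simp add: divide_inverse)
     then have "\<forall>\<^sub>F n in sequentially. 2 * (1 / real (Suc n)) < - \<rho> x"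
      using \<open>- \<rho> x > 0\<close> by (intro order_tendstoD) auto
     then show ?thesis by eventually_elim (use True in \<open>auto simp: E_def layer_def\<close>)
    next
     case False
     then have "x \<notin> E n" for n by (auto simp: E_def layer_def)
     then show ?thesis using False by simp
    qed
    then have "\<forall>\<^sub>F n in sequentially. indicator (E n) x * cmod2 (u x) = indicator (layer t) x * cmod2 (u x)"
     by eventually_elim simp
    then show "(%n. indicator (E n) x * cmod2 (u x)) \<longlonglongrightarrow> indicator (layer t) x * cmod2 (u x)"
     by (rule tendsto_eventually)
   qed
   show "AE x in Leb. norm (indicator (E n) x * cmod2 (u x)) <= cmod2 (u x)" for n
    by (intro AE_I2) (simp add: indicator_def)
   show "integrable Leb (%x. cmod2 (u x))" by (rule iu)
  qed (use borel_measurable_integrable[OF indicator_integrable[OF iu E]]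
    borel_measurable_integrable[OF indicator_integrable[OF iu layer_lebesgue]] in auto)
  show "\<exists>N. \<forall>n\<ge>N. (\<integral>x. indicator (E n) x * cmod2 (u x) \<partial>Leb) <= B * t * bl_energy u g"
   unfolding E_def using main[OF t u, of "1 / real (Suc _)"] by auto
 qed
 then show ?thesis using \<open>B > 0\<close> by blast
qed

end

context smooth_domain
begin

text \<open>Finitely many charts cover a neighbourhood of the compact boundary.\<close>
lemma boundary_layer:
 "\<exists>B>0. \<exists>t0>0. \<forall>t. 0 < t --> t <= t0 --> (\<forall>u g. (\<forall>j. weak j u (g j)) -->
  (\<integral>x. indicator {x. infdist x (- Om) < t} x * cmod2 (u x) \<partial>Leb) <= B * t * bl_energy u g)"
proof -
 have "\<forall>p\<in>frontier Om. \<exists>r C. r > 0 \<and> C > 0 \<and> (\<exists>\<rho> k \<sigma> c. boundary_chart Om p r \<rho> k \<sigma> c C)"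
  using boundary_chart_exists by (metis boundary_chart_def)
 then obtain r C where rC: "!!p. p \<in> frontier Om ==> r p > 0 \<and> C p > 0 \<and> (\<exists>\<rho> k \<sigma> c. boundary_chart Om p (r p) \<rho> k \<sigma> c (C p))"
  by metis
 have "compact (frontier Om)" using bounded_domain by (simp add: compact_frontier_bounded)
 moreover have "frontier Om \<subseteq> (\<Union>p\<in>frontier Om. ball p (r p))" using rC by force
 ultimately obtain P where P: "P \<subseteq> frontier Om" "finite P" "frontier Om \<subseteq> (\<Union>p\<in>P. ball p (r p))"
  using compactE_image[of "frontier Om" "frontier Om" "%p. ball p (r p)"] by auto
 obtain \<rho> k \<sigma> c where ch: "!!p. p \<in> P ==> boundary_chart Om p (r p) (\<rho> p) (k p) (\<sigma> p) (c p) (C p)"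
  using rC P(1) by (metis subsetD)
 have chart: "chart Om p (r p) (\<rho> p) (k p) (\<sigma> p) (c p) (C p)" if "p \<in> P" for p
  using ch[OF that] by unfold_locales
 define lay where "lay p t = {x \<in> Om \<inter> cball p (2 * r p). - \<rho> p x <= t}" for p t
 have lay: "chart.layer Om p (r p) (\<rho> p) t = lay p t" if "p \<in> P" for p t
  using chart.layer_def[OF chart[OF that]] by (simp add: lay_def)
 have "\<forall>p\<in>P. \<exists>B>0. \<forall>t>0. \<forall>u g. (\<forall>j. weak j u (g j)) -->
  (\<integral>x. indicator (lay p t) x * cmod2 (u x) \<partial>Leb) <= B * t * bl_energy u g"
  using chart.boundary_layer_local[OF chart] lay by simp
 from bchoice[OF this] obtain B where B': "\<forall>p\<in>P. B p > 0 \<and> (\<forall>t>0. \<forall>u g. (\<forall>j. weak j u (g j)) -->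
  (\<integral>x. indicator (lay p t) x * cmod2 (u x) \<partial>Leb) <= B p * t * bl_energy u g)" by blast
 have B: "!!p. p \<in> P ==> B p > 0" "!!p t u g. p \<in> P ==> t > 0 ==> (\<forall>j. weak j u (g j)) ==>
  (\<integral>x. indicator (lay p t) x * cmod2 (u x) \<partial>Leb) <= B p * t * bl_energy u g" using B' by blast+
 have layL: "lay p t \<in> sets lebesgue" if "p \<in> P" for p t
  using chart.layer_lebesgue[OF chart[OF that]] lay[OF that] by simp
 define t0 where "t0 = Min (insert 1 (r ` P))"
 have t0: "t0 > 0" "!!p. p \<in> P ==> t0 <= r p" unfolding t0_def using P rC by (auto intro: Min_le)
 define BB where "BB = 1 + (\<Sum>p\<in>P. B p * (2 * C p))"
 have BB: "BB > 0" unfolding BB_def using B(1) rC P(1) by (intro add_pos_nonneg sum_nonneg mult_nonneg_nonneg) (auto intro: less_imp_le)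
 have "(\<integral>x. indicator {x. infdist x (- Om) < t} x * cmod2 (u x) \<partial>Leb) <= BB * t * bl_energy u g"
  if t: "0 < t" "t <= t0" and u: "!!j. weak j u (g j)" for t u g
 proof -
  have iu: "integrable Leb (%x. cmod2 (u x))" by (rule L2D(2)[OF weakD(1)[OF u]])
  have "open {x. infdist x (- Om) < t}"
   by (intro open_Collect_less continuous_intros)
  then have S: "{x. infdist x (- Om) < t} \<in> sets lebesgue" by (intro sets_completionI_sets) simp
  have il: "integrable Leb (%x. indicator (lay p (2 * C p * t)) x * cmod2 (u x))" if "p \<in> P" for p
   by (intro indicator_integrable iu layL that)
  have "(\<integral>x. indicator {x. infdist x (- Om) < t} x * cmod2 (u x) \<partial>Leb)
    <= (\<integral>x. (\<Sum>p\<in>P. indicator (lay p (2 * C p * t)) x * cmod2 (u x)) \<partial>Leb)"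
  proof (rule lint_mono)
   show "integrable Leb (%x. indicator {x. infdist x (- Om) < t} x * cmod2 (u x))"
    by (intro indicator_integrable iu S)
   show "integrable Leb (%x. \<Sum>p\<in>P. indicator (lay p (2 * C p * t)) x * cmod2 (u x))"
    by (intro litg_sum il)
   fix x assume "x \<in> space Leb"
   then have x: "x \<in> Om" by simp
   have nn: "0 <= (\<Sum>p\<in>P. indicator (lay p (2 * C p * t)) x * cmod2 (u x))" by (intro sum_nonneg) simp
   show "indicator {x. infdist x (- Om) < t} x * cmod2 (u x) <= (\<Sum>p\<in>P. indicator (lay p (2 * C p * t)) x * cmod2 (u x))"
   proof (cases "infdist x (- Om) < t")
    case True
    then obtain q where q: "q \<in> frontier Om" "dist x q < t" using nearest_frontier[OF x] by blast
    then obtain p where p: "p \<in> P" "q \<in> ball p (r p)" using P(3) by blast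
    interpret chart Om p "r p" "\<rho> p" "k p" "\<sigma> p" "c p" "C p" by (rule chart[OF p(1)])
    have "dist p x <= dist p q + dist x q" by (metis dist_commute dist_triangle)
    then have xb: "dist p x <= 2 * r p" using p(2) q(2) t(2) t0(2)[OF p(1)] by simp
    then have W: "x \<in> ball p (5 * r p)" "q \<in> ball p (5 * r p)" using p(2) chart_pos(1) by auto
    have "\<rho> p q = 0" using chart_frontier[OF W(2)] q(1) by simp
    then have "- \<rho> p x <= 2 * C p * dist x q" using chart_Lipschitz[OF W] by simp
    also have "... <= 2 * C p * t" using q(2) chart_pos(3) by simp
    finally have "x \<in> lay p (2 * C p * t)" using x xb by (simp add: lay_def)
    then have "indicator {x. infdist x (- Om) < t} x * cmod2 (u x) = indicator (lay p (2 * C p * t)) x * cmod2 (u x)"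
     using True by simp
    also have "... <= (\<Sum>p\<in>P. indicator (lay p (2 * C p * t)) x * cmod2 (u x))"
     by (rule member_le_sum[OF p(1)]) (auto simp: P)
    finally show ?thesis .
   qed (use nn in simp)
  qed
  also have "... = (\<Sum>p\<in>P. \<integral>x. indicator (lay p (2 * C p * t)) x * cmod2 (u x) \<partial>Leb)"
   by (rule lint_sum) (rule il)
  also have "... <= (\<Sum>p\<in>P. B p * (2 * C p * t) * bl_energy u g)"
   using rC P(1) t u by (intro sum_mono B(2)) auto
  also have "... = (\<Sum>p\<in>P. B p * (2 * C p)) * (t * bl_energy u g)" unfolding sum_distrib_right by (intro sum.cong refl) (simp add: mult_ac)
  also have "... <= BB * (t * bl_energy u g)"
   using t bl_energy_nonneg by (intro mult_right_mono mult_nonneg_nonneg) (auto simp: BB_def)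
  finally show ?thesis by (simp add: mult_ac)
 qed
 then show ?thesis using BB t0(1) by blast
qed

end

section \<open>Surface measure of the boundary\<close>

text \<open>Each covering set is replaced by a box around it, elongated by \<open>T\<close> in direction \<open>k\<close>: its area is of order \<open>T\<close> times the diameter. This is the only link needed between Hausdorff and Lebesgue measure.\<close>
lemma fattening:
 fixes E :: "(real^2) set"
 assumes "hausdorff1_outer E < m" "T > 0" "\<bar>\<sigma>\<bar> = 1"
 obtains L where "L \<in> sets borel" "!!q s. q \<in> E ==> 0 <= s ==> s <= T ==> q - s *\<^sub>R (\<sigma> *\<^sub>R axis k 1) \<in> L"
  "emeasure lborel L <= ennreal (8 * T) * m"
proof -
 have "hausdorff1_pre T E < m" using hausdorff1_pre_le_outer[OF \<open>T > 0\<close>, of E] assms(1) by (rule le_less_trans)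
 then obtain U :: "nat => (real^2) set" where U: "E \<subseteq> (\<Union>n. U n)" "!!n. bounded (U n)" "!!n. diameter (U n) <= T"
  "(\<Sum>n. ennreal (diameter (U n))) < m"
  unfolding hausdorff1_pre_def INF_less_iff by blast
 define a where "a n = (SOME x. x \<in> U n)" for n
 define lo hi where "lo n = (\<chi> i. if i = k then a n $ i - diameter (U n) - T else a n $ i - diameter (U n))"
  and "hi n = (\<chi> i. if i = k then a n $ i + diameter (U n) + T else a n $ i + diameter (U n))" for n
 define Q where "Q n = (if U n = {} then {} else cbox (lo n) (hi n))" for n
 have dnn: "0 <= diameter (U n)" for n using U(2) by (rule diameter_ge_0)
 have Q: "emeasure lborel (Q n) <= ennreal (8 * T) * ennreal (diameter (U n))" for n
 proof (cases "U n = {}")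
  case False
  have ne: "cbox (lo n) (hi n) ~= {}"
   using dnn[of n] \<open>T > 0\<close> by (simp add: lo_def hi_def interval_ne_empty_cart)
  have "measure lborel (cbox (lo n) (hi n)) = (\<Prod>i\<in>UNIV. hi n $ i - lo n $ i)" by (rule content_cbox_cart[OF ne])
  also have "... = (2 * diameter (U n) + 2 * T) * (2 * diameter (U n))"
   using exhaust_2[of k] by (auto simp: UNIV_2 lo_def hi_def)
  also have "... <= (4 * T) * (2 * diameter (U n))"
   using U(3)[of n] dnn[of n] by (intro mult_right_mono) auto
  finally have "measure lborel (cbox (lo n) (hi n)) <= 8 * T * diameter (U n)" by (simp add: mult_ac)
  moreover have "emeasure lborel (cbox (lo n) (hi n)) = ennreal (measure lborel (cbox (lo n) (hi n)))"
   using emeasure_lborel_cbox_finite[of "lo n" "hi n"] by (intro emeasure_eq_ennreal_measure) simp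
  ultimately have "emeasure lborel (cbox (lo n) (hi n)) <= ennreal (8 * T * diameter (U n))"
   by (simp only: ennreal_leI)
  then show ?thesis using False \<open>T > 0\<close> dnn[of n] by (simp add: Q_def ennreal_mult)
 qed (simp add: Q_def)
 define L where "L = (\<Union>n. Q n)"
 have "L \<in> sets borel" unfolding L_def Q_def by (intro sets.countable_UN) auto
 moreover have "q - s *\<^sub>R (\<sigma> *\<^sub>R axis k 1) \<in> L" if q: "q \<in> E" "0 <= s" "s <= T" for q s
 proof -
  obtain n where n: "q \<in> U n" using U(1) q(1) by blast
  then have an: "a n \<in> U n" unfolding a_def by (rule someI)
  have "dist q (a n) <= diameter (U n)" by (rule diameter_bounded_bound[OF U(2) n an])
  then have c: "\<bar>q $ i - a n $ i\<bar> <= diameter (U n)" for i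
   using component_le_norm_cart[of "q - a n" i] by (simp add: dist_norm)
  have s: "\<bar>s * \<sigma>\<bar> <= T" using q assms(3) by (simp add: abs_mult)
  have "q - s *\<^sub>R (\<sigma> *\<^sub>R axis k 1) \<in> cbox (lo n) (hi n)"
   unfolding mem_box_cart
  proof
   fix i
   show "lo n $ i <= (q - s *\<^sub>R (\<sigma> *\<^sub>R axis k 1)) $ i \<and> (q - s *\<^sub>R (\<sigma> *\<^sub>R axis k 1)) $ i <= hi n $ i"
    using c[of i] s by (auto simp: lo_def hi_def axis_def abs_le_iff)
  qed
  then show ?thesis using n by (auto simp: L_def Q_def)
 qed
 moreover have "emeasure lborel L <= ennreal (8 * T) * m"
 proof -
  have "emeasure lborel L <= (\<Sum>n. emeasure lborel (Q n))"
   unfolding L_def by (rule emeasure_subadditive_countably) (auto simp: Q_def)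
  also have "... <= (\<Sum>n. ennreal (8 * T) * ennreal (diameter (U n)))" by (intro suminf_le Q) auto
  also have "... = ennreal (8 * T) * (\<Sum>n. ennreal (diameter (U n)))" by simp
  also have "... <= ennreal (8 * T) * m" using U(4) by (intro mult_left_mono) auto
  finally show ?thesis .
 qed
 ultimately show ?thesis using that by blast
qed

lemma inner_grad: "grad f x \<bullet> v = (\<Sum>j\<in>UNIV. v $ j *\<^sub>R partial j f x)"
 by (simp add: inner_vec_def grad_def mult.commute)

lemma local_defining_function_zero:
 assumes "local_defining_function Om q U \<rho>" "q \<in> frontier Om" "open Om"
 shows "\<rho> q = 0"
proof -
 have U: "open U" "q \<in> U" "smooth_on U \<rho>" "Om \<inter> U = {x \<in> U. \<rho> x < 0}" using assms(1) by (auto simp: local_defining_function_def)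
 have "q \<notin> Om" using assms(2,3) by (simp add: frontier_def interior_open)
 then have "\<rho> q >= 0" using U by force
 moreover have "\<not> \<rho> q > 0"
 proof
  assume "\<rho> q > 0"
  have "continuous_on U \<rho>" by (rule C1_on_continuous[OF smooth_on_C1_on[OF U(3)]])
  then have o: "open (U \<inter> \<rho> -` {0<..})" by (rule continuous_open_preimage[OF _ U(1)]) simp
  have "q \<in> U \<inter> \<rho> -` {0<..}" using U \<open>\<rho> q > 0\<close> by simp
  then have "Om \<inter> (U \<inter> \<rho> -` {0<..}) ~= {}"
   using assms(2) o unfolding frontier_def by (metis DiffD1 Int_emptyI Int_iff closure_iff_nhds_not_empty empty_iff inf_commute order_refl)
  then show False using U(4) by force
 qed
 ultimately show ?thesis by simp
qed

lemma local_defining_function_direction: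
 assumes "local_defining_function Om q U \<rho>" "local_defining_function Om q U' \<rho>'" "q \<in> frontier Om" "open Om"
  and "grad \<rho> q \<bullet> v < 0"
 shows "grad \<rho>' q \<bullet> v <= 0"
proof (rule ccontr)
 assume n: "\<not> grad \<rho>' q \<bullet> v <= 0"
 have z: "\<rho> q = 0" "\<rho>' q = 0" using local_defining_function_zero assms by blast+
 have U: "open U" "q \<in> U" "smooth_on U \<rho>" "Om \<inter> U = {x \<in> U. \<rho> x < 0}"
  and U': "open U'" "q \<in> U'" "smooth_on U' \<rho>'" "Om \<inter> U' = {x \<in> U'. \<rho>' x < 0}"
  using assms(1,2) by (auto simp: local_defining_function_def)
 have D: "((%t. f (q + t *\<^sub>R v)) has_real_derivative grad f q \<bullet> v) (at 0)"
  if "smooth_on V f" "q \<in> V" for f V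
 proof -
  have d: "(f has_derivative (%h. \<Sum>j\<in>UNIV. h $ j *\<^sub>R partial j f (q + 0 *\<^sub>R v))) (at (q + 0 *\<^sub>R v))"
   using C1_on_has_derivative[OF smooth_on_C1_on[OF that(1)] that(2)] by simp
  have "((%t. q + t *\<^sub>R v) has_derivative (%t. t *\<^sub>R v)) (at 0)" by (auto intro!: derivative_eq_intros)
  from has_derivative_compose[OF this d]
  have "((%t. f (q + t *\<^sub>R v)) has_derivative (%t. \<Sum>j\<in>UNIV. (t *\<^sub>R v) $ j *\<^sub>R partial j f q)) (at 0)" by simp
  moreover have "(%t. \<Sum>j\<in>UNIV. (t *\<^sub>R v) $ j *\<^sub>R partial j f q) = (*) (grad f q \<bullet> v)"
   by (rule ext) (simp add: inner_grad sum_distrib_left mult_ac)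
  ultimately show ?thesis by (simp add: has_field_derivative_def)
 qed
 obtain d1 where d1: "d1 > 0" "!!t. t > 0 ==> t < d1 ==> \<rho> (q + t *\<^sub>R v) < \<rho> q"
  using DERIV_neg_dec_right[OF D[OF U(3,2)] assms(5)] by auto
 obtain d2 where d2: "d2 > 0" "!!t. t > 0 ==> t < d2 ==> \<rho>' (q + t *\<^sub>R v) > \<rho>' q"
  using DERIV_pos_inc_right[OF D[OF U'(3,2)]] n by auto
 have "open (U \<inter> U')" "q \<in> U \<inter> U'" using U U' by auto
 then obtain e where e: "e > 0" "ball q e \<subseteq> U \<inter> U'" using open_contains_ball by blast
 define e' where "e' = e / (norm v + 1)"
 have e'0: "e' > 0" using e(1) by (simp add: e'_def add_nonneg_pos)
 define t where "t = min (min d1 d2) e' / 2"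
 have t: "t > 0" "t < d1" "t < d2" "t < e / (norm v + 1)" unfolding e'_def[symmetric] using d1(1) d2(1) e'0 by (auto simp: t_def)
 have "t * norm v <= t * (norm v + 1)" using t by simp
 also have "... < e" using t(4) by (simp add: pos_less_divide_eq add_nonneg_pos)
 finally have "q + t *\<^sub>R v \<in> U \<inter> U'" using e(2) t(1) by (intro subsetD[OF e(2)]) (simp add: dist_norm)
 moreover have "\<rho> (q + t *\<^sub>R v) < 0" "\<rho>' (q + t *\<^sub>R v) > 0" using d1(2)[of t] d2(2)[of t] t z by auto
 ultimately show False using U(4) U'(4) by force
qed

text \<open>Two defining functions at the same point have parallel gradients, since one vanishes wherever the other does.\<close>
lemma outward_normal_eq:
 assumes "local_defining_function Om q U \<rho>" "q \<in> frontier Om" "open Om"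
 shows "outward_normal Om q = grad \<rho> q /\<^sub>R norm (grad \<rho> q)"
 unfolding outward_normal_def
proof (rule the_equality)
 show "\<exists>U \<rho>'. local_defining_function Om q U \<rho>' \<and> grad \<rho> q /\<^sub>R norm (grad \<rho> q) = grad \<rho>' q /\<^sub>R norm (grad \<rho>' q)"
  using assms(1) by blast
 fix n assume "\<exists>U \<rho>. local_defining_function Om q U \<rho> \<and> n = grad \<rho> q /\<^sub>R norm (grad \<rho> q)"
 then obtain U' \<rho>' where 2: "local_defining_function Om q U' \<rho>'" "n = grad \<rho>' q /\<^sub>R norm (grad \<rho>' q)" by blast
 define a b where "a = grad \<rho> q" and "b = grad \<rho>' q"
 have nz: "a ~= 0" "b ~= 0" using assms(1) 2(1) by (auto simp: a_def b_def local_defining_function_def)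
 have lt: "b \<bullet> v <= 0" if "a \<bullet> v < 0" for v
  unfolding b_def by (rule local_defining_function_direction[OF assms(1) 2(1) assms(2,3)]) (use that in \<open>simp add: a_def\<close>)
 have aa: "a \<bullet> a > 0" using nz by simp
 have le: "b \<bullet> v <= 0" if "a \<bullet> v <= 0" for v
 proof (rule field_le_epsilon)
  fix e :: real assume "e > 0"
  define s where "s = e / (\<bar>b \<bullet> a\<bar> + 1)"
  have s: "s > 0" using \<open>e > 0\<close> by (simp add: s_def add_nonneg_pos)
  have "s * (a \<bullet> a) > 0" using s aa by (rule mult_pos_pos)
  then have "a \<bullet> (v - s *\<^sub>R a) < 0" unfolding inner_diff_right inner_scaleR_right using that by linarith
  then have "b \<bullet> (v - s *\<^sub>R a) <= 0" by (rule lt)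
  then have "b \<bullet> v <= s * (b \<bullet> a)" by (simp add: inner_diff_right)
  also have "... <= s * \<bar>b \<bullet> a\<bar>" using s by (intro mult_left_mono) auto
  also have "... <= e" using \<open>e > 0\<close> by (simp add: s_def divide_simps)
  finally show "b \<bullet> v <= 0 + e" by simp
 qed
 define lam where "lam = (b \<bullet> a) / (a \<bullet> a)"
 define w where "w = b - lam *\<^sub>R a"
 have aw: "a \<bullet> w = 0" using aa by (simp add: w_def lam_def inner_diff_right inner_commute)
 have "b \<bullet> w <= 0" "b \<bullet> (- w) <= 0" using le[of w] le[of "- w"] aw by auto
 then have "b \<bullet> w = 0" by simp
 then have "w \<bullet> w = 0" using aw by (simp add: w_def inner_diff_left)
 then have b: "b = lam *\<^sub>R a" by (simp add: w_def)
 have "b \<bullet> (- a) <= 0" using aa by (intro le) simp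
 then have "lam >= 0" using aa by (simp add: lam_def)
 moreover have "lam ~= 0" using b nz by auto
 ultimately have "b /\<^sub>R norm b = a /\<^sub>R norm a" using nz(1) by (simp add: b)
 then show "n = grad \<rho> q /\<^sub>R norm (grad \<rho> q)" using 2(2) by (simp add: a_def b_def)
qed

context chart
begin

lemma chart_defining: "q \<in> W ==> local_defining_function Om q W \<rho>"
proof -
 assume q: "q \<in> W"
 have "grad \<rho> x ~= 0" if "x \<in> W" for x
 proof
  assume "grad \<rho> x = 0"
  then have "partial k \<rho> x = 0" by (metis grad_def vec_lambda_beta zero_index)
  then show False using chart_bounds(1)[OF that] chart_pos(2) by simp
 qed
 moreover have "Om \<inter> W = {x \<in> W. \<rho> x < 0}" using chart_domain by blast
 ultimately show ?thesis using q chart_smooth by (simp add: local_defining_function_def)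
qed

lemma chart_normal: "q \<in> W ==> q \<in> frontier Om ==> outward_normal Om q = grad \<rho> q /\<^sub>R norm (grad \<rho> q)"
 by (rule outward_normal_eq[OF chart_defining _ open_domain])

definition F :: "(real^2) set" where "F = frontier Om \<inter> cball p (4 * r)"

lemma F_closed: "closed F" and F_compact: "compact F" and F_borel: "F \<in> sets borel"
proof -
 show "closed F" unfolding F_def by (intro closed_Int frontier_closed closed_cball)
 show "compact F" unfolding F_def Int_commute[of "frontier Om"] by (intro compact_Int_closed compact_cball frontier_closed)
 show "F \<in> sets borel" using \<open>closed F\<close> by simp
qed

lemma F_sub: "F \<subseteq> W"
 using chart_pos(1) by (auto simp: F_def)

lemma F_graph:
 assumes "q \<in> F" "q' \<in> F" "l ~= k"
 shows "dist q q' <= (1 + C / c) * \<bar>(q - q') $ l\<bar>"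
proof -
 have W: "q \<in> W" "q' \<in> W" using assms F_sub by auto
 have z: "\<rho> q = 0" "\<rho> q' = 0" using chart_frontier W assms by (auto simp: F_def)
 obtain z where z': "z \<in> W" "\<rho> q - \<rho> q' = (\<Sum>j\<in>UNIV. (q - q') $ j * partial j \<rho> z)"
  using segment_mean_value[OF convex_ball chart_C1 W(2,1)] by blast
 have kl: "UNIV = {k, l}" using assms(3) exhaust_2[of k] exhaust_2[of l] by (auto simp: UNIV_2)
 have s: "(\<Sum>j\<in>UNIV. f j) = f k + f l" for f :: "2 => real" unfolding kl using assms(3) by simp
 have "(q - q') $ k * partial k \<rho> z = - ((q - q') $ l * partial l \<rho> z)" using z z'(2) unfolding s by simp
 then have "\<bar>(q - q') $ k\<bar> * \<bar>partial k \<rho> z\<bar> = \<bar>(q - q') $ l\<bar> * \<bar>partial l \<rho> z\<bar>" by (metis abs_minus_cancel abs_mult)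
 also have "... <= \<bar>(q - q') $ l\<bar> * C" by (intro mult_left_mono chart_bounds(2) z'(1)) simp
 finally have 1: "\<bar>(q - q') $ k\<bar> * \<bar>partial k \<rho> z\<bar> <= \<bar>(q - q') $ l\<bar> * C" .
 have "\<bar>\<sigma> * partial k \<rho> z\<bar> = \<bar>partial k \<rho> z\<bar>" by (simp add: abs_mult abs_sigma)
 then have "\<bar>partial k \<rho> z\<bar> >= c" using chart_bounds(1)[OF z'(1)] by linarith
 then have "\<bar>(q - q') $ k\<bar> * c <= \<bar>(q - q') $ k\<bar> * \<bar>partial k \<rho> z\<bar>" by (intro mult_left_mono) auto
 then have "\<bar>(q - q') $ k\<bar> * c <= \<bar>(q - q') $ l\<bar> * C" using 1 by linarith
 then have 2: "\<bar>(q - q') $ k\<bar> <= C / c * \<bar>(q - q') $ l\<bar>" using chart_pos(2) by (simp add: field_simps)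
 have "dist q q' <= (\<Sum>j\<in>UNIV. \<bar>(q - q') $ j\<bar>)" unfolding dist_norm by (rule norm_le_l1_cart)
 then show ?thesis using 2 unfolding s by (simp add: algebra_simps)
qed

text \<open>The boundary piece is a Lipschitz graph over an interval of the other coordinate.\<close>
lemma F_finite: "hausdorff1_outer F < top"
proof -
 obtain l where l: "l ~= k" using exhaust_2[of k] by (metis zero_neq_one one_neq_zero num1_eq_iff)
 define A where "A = (1 + C / c) * (8 * r)"
 have A: "A > 0" using chart_pos by (simp add: A_def add_pos_pos)
 have "hausdorff1_pre \<delta> F <= ennreal A" if "\<delta> > 0" for \<delta>
 proof -
  obtain N :: nat where N: "A / \<delta> <= N" using real_arch_simple by blast
  define n where "n = Suc N"
  have n: "n > 0" "A / n <= \<delta>"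
  proof -
   show "n > 0" by (simp add: n_def)
   have "A / \<delta> <= n" using N by (simp add: n_def)
   then show "A / n <= \<delta>" using \<open>\<delta> > 0\<close> \<open>n > 0\<close> by (simp add: field_simps)
  qed
  define h where "h = 8 * r / n"
  have h: "h > 0" using chart_pos n by (simp add: h_def)
  define U where "U i = (if i < n then {q \<in> F. p $ l - 4 * r + i * h <= q $ l \<and> q $ l <= p $ l - 4 * r + (i + 1) * h} else {})" for i
  have An: "(1 + C / c) * h = A / n" by (simp add: A_def h_def)
  have d: "diameter (U i) <= A / n" for i
  proof (rule diameter_le)
   show "U i ~= {} \<or> 0 <= A / n" using A n by simp
   fix x y assume "x \<in> U i" "y \<in> U i"
   then have xy: "x \<in> F" "y \<in> F" "\<bar>(x - y) $ l\<bar> <= h" by (auto simp: U_def algebra_simps split: if_splits)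
   have "dist x y <= (1 + C / c) * \<bar>(x - y) $ l\<bar>" by (rule F_graph[OF xy(1,2) l])
   also have "... <= (1 + C / c) * h" using xy(3) chart_pos by (intro mult_left_mono) auto
   finally show "norm (x - y) <= A / n" by (simp add: An dist_norm)
  qed
  have b: "bounded (U i)" for i
   by (rule bounded_subset[OF compact_imp_bounded[OF F_compact]]) (auto simp: U_def)
  have cov: "F \<subseteq> (\<Union>i. U i)"
  proof
   fix q assume q: "q \<in> F"
   then have "dist p q <= 4 * r" by (simp add: F_def)
   then have ql: "\<bar>q $ l - p $ l\<bar> <= 4 * r" using component_le_norm_cart[of "p - q" l] by (simp add: dist_norm)
   define y where "y = (q $ l - p $ l + 4 * r) / h"
   have "0 <= q $ l - p $ l + 4 * r" "q $ l - p $ l + 4 * r <= n * h"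
    using ql n by (auto simp: h_def abs_le_iff)
   then have y: "0 <= y" "y <= n" using h by (auto simp: y_def divide_le_eq)
   show "q \<in> (\<Union>i. U i)"
   proof (cases "y = n")
    case True
    then have "q $ l = p $ l - 4 * r + n * h" using h by (simp add: y_def field_simps)
    moreover have "real (n - 1) + 1 = n" using n by simp
    ultimately have "q \<in> U (n - 1)" using q n h by (simp add: U_def)
    then show ?thesis by blast
   next
    case False
    define i where "i = nat \<lfloor>y\<rfloor>"
    have i: "real i <= y" "y <= i + 1" "i < n" using y False by (auto simp: i_def floor_less_iff nat_less_iff) linarith+
    have "i * h <= y * h" "y * h <= (i + 1) * h" using i h by (auto intro!: mult_right_mono)
    moreover have "y * h = q $ l - p $ l + 4 * r" using h by (simp add: y_def)
    ultimately have "q \<in> U i" using q i(3) unfolding U_def by (auto simp: algebra_simps)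
    then show ?thesis by blast
   qed
  qed
  have "hausdorff1_pre \<delta> F <= (\<Sum>i. ennreal (diameter (U i)))"
   unfolding hausdorff1_pre_def
   by (rule INF_lower) (use cov b d n(2) in \<open>auto intro: order_trans\<close>)
  also have "... = (\<Sum>i<n. ennreal (diameter (U i)))" by (rule suminf_finite) (auto simp: U_def)
  also have "... <= (\<Sum>i<n. ennreal (A / n))" by (intro sum_mono ennreal_leI d)
  also have "... = ennreal A" using A n by (simp add: ennreal_of_nat_eq_real_of_nat ennreal_mult[symmetric])
  finally show ?thesis .
 qed
 then have "hausdorff1_outer F <= ennreal A" unfolding hausdorff1_outer_def by (intro SUP_least) auto
 then show ?thesis using ennreal_less_top le_less_trans by blast
qed

lemma emeasure_F: "E \<subseteq> F ==> E \<in> sets borel ==> emeasure hausdorff1 E = ennreal (measure hausdorff1 E)"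
 "E \<subseteq> F ==> E \<in> sets borel ==> emeasure hausdorff1 E < \<infinity>"
proof -
 assume E: "E \<subseteq> F" "E \<in> sets borel"
 have "emeasure hausdorff1 E = hausdorff1_outer E" by (rule emeasure_hausdorff1[OF E(2)])
 also have "... <= hausdorff1_outer F" by (rule hausdorff1_outer_mono[OF E(1)])
 finally show "emeasure hausdorff1 E < \<infinity>" using F_finite by (simp add: le_less_trans)
 then show "emeasure hausdorff1 E = ennreal (measure hausdorff1 E)" by (simp add: emeasure_eq_ennreal_measure)
qed

text \<open>Moving from an inner point in the chart direction, one meets the boundary after a length proportional to the depth.\<close>
lemma foot_exists:
 assumes "x \<in> layer t" "t > 0" "t / c <= r"
 obtains q s where "q \<in> F" "0 <= s" "s <= t / c" "x = q - s *\<^sub>R dir"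
proof -
 have x: "x \<in> Om" "dist p x <= 2 * r" "- \<rho> x <= t" using assms(1) by (auto simp: layer_def)
 have nn: "0 <= t / c" using assms chart_pos by simp
 have inW: "x + s *\<^sub>R dir \<in> cball p (4 * r)" if "s \<in> {0..t / c}" for s
 proof -
  have "dist p (x + s *\<^sub>R dir) <= dist p x + dist x (x + s *\<^sub>R dir)" by (rule dist_triangle)
  also have "dist x (x + s *\<^sub>R dir) = s" using that norm_dir by (simp add: dist_norm)
  finally show ?thesis using that x(2) assms(3) chart_pos(1) by simp
 qed
 have sub: "cball p (4 * r) \<subseteq> W" using chart_pos(1) by auto
 have W: "x \<in> W" "x + (t / c) *\<^sub>R dir \<in> W" using inW[of 0] inW[of "t / c"] nn sub by auto
 have "\<rho> x + c * (t / c) <= \<rho> (x + (t / c) *\<^sub>R dir)" by (rule chart_increasing[OF W nn])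
 then have 1: "0 <= \<rho> (x + (t / c) *\<^sub>R dir)" using x(3) chart_pos by simp
 have 0: "\<rho> (x + 0 *\<^sub>R dir) <= 0" using chart_domain[OF W(1)] x(1) by simp
 have "continuous_on {0..t / c} (%s. \<rho> (x + s *\<^sub>R dir))"
  by (rule continuous_on_compose2[OF C1_on_continuous[OF chart_C1]]) (use inW sub in \<open>auto intro!: continuous_intros\<close>)
 from IVT'[OF 0 1 nn this] obtain s where s: "0 <= s" "s <= t / c" "\<rho> (x + s *\<^sub>R dir) = 0" by auto
 have "x + s *\<^sub>R dir \<in> F" unfolding F_def using s inW[of s] sub chart_frontier[of "x + s *\<^sub>R dir"] by auto
 then show ?thesis using that[of "x + s *\<^sub>R dir" s] s by simp
qed

text \<open>Partition the boundary piece by the values of the function and fatten each part; uniform continuity transports the value at the foot point to the layer.\<close>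
lemma layer_integral_le:
 fixes f :: "real^2 => real"
 assumes f: "continuous_on (closure Om \<inter> cball p (4 * r)) f" "!!x. 0 <= f x" and "e > 0"
 shows "\<exists>t0>0. \<forall>t. 0 < t --> t < t0 -->
  (\<integral>x. indicator (layer t) x * f x \<partial>Leb) <= 8 * t / c * ((\<integral>q. indicator F q * f q \<partial>hausdorff1) + e)"
proof -
 define K where "K = closure Om \<inter> cball p (4 * r)"
 have K: "compact K" unfolding K_def Int_commute[of "closure Om"] by (intro compact_Int_closed compact_cball closed_closure)
 have FK: "F \<subseteq> K" by (auto simp: F_def K_def frontier_def)
 have fK: "continuous_on K f" using f(1) by (simp add: K_def)
 have fF: "continuous_on F f" by (rule continuous_on_subset[OF fK FK])
 have u: "uniformly_continuous_on K f" by (rule compact_uniformly_continuous[OF fK K])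
 define H where "H = measure hausdorff1 F"
 have H: "H >= 0" by (simp add: H_def)
 define \<eta> where "\<eta> = e / (4 * (H + 1))"
 have \<eta>: "\<eta> > 0" using \<open>e > 0\<close> H by (simp add: \<eta>_def)
 obtain d where d: "d > 0" "!!x y. x \<in> K ==> y \<in> K ==> dist y x < d ==> dist (f y) (f x) < \<eta>"
  using u \<eta> unfolding uniformly_continuous_on_def by metis
 obtain M where M: "!!q. q \<in> F ==> norm (f q) <= M"
  using compact_imp_bounded[OF compact_continuous_image[OF fF F_compact]] unfolding bounded_iff by blast
 obtain N :: nat where N: "M / \<eta> <= N" using real_arch_simple by blast
 define E where "E i = {q \<in> F. i * \<eta> <= f q} - {q \<in> F. (i + 1) * \<eta> <= f q}" for i :: nat
 have cl: "closed {q \<in> F. a <= f q}" for a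
 proof -
  have "{q \<in> F. a <= f q} = F \<inter> f -` {a..}" by auto
  then show ?thesis using continuous_closed_preimage[OF fF F_closed] by simp
 qed
 have Eb: "E i \<in> sets borel" for i unfolding E_def using cl by (intro sets.Diff) auto
 have EF: "E i \<subseteq> F" for i by (auto simp: E_def)
 define \<mu> where "\<mu> i = measure hausdorff1 (E i)" for i
 define S where "S = (\<Sum>i\<le>N. (real i + 2) * \<eta>)"
 have S: "S >= 0" unfolding S_def using \<eta> by (intro sum_nonneg) auto
 define \<gamma> where "\<gamma> = e / (2 * (S + 1))"
 have \<gamma>: "\<gamma> > 0" using \<open>e > 0\<close> S by (simp add: \<gamma>_def)
 have indi: "integrable hausdorff1 (indicator (E i) :: real^2 => real)" for i
  using emeasure_F(2)[OF EF Eb] Eb by (intro integrable_real_indicator) auto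
 have indF: "integrable hausdorff1 (indicator F :: real^2 => real)"
  using emeasure_F(2)[OF subset_refl F_borel] F_borel by (intro integrable_real_indicator) auto
 have disj: "(\<Sum>i\<le>N. a i * indicator (E i) q) <= b q"
  if ab: "!!i. q \<in> E i ==> a i <= b q" "0 <= b q" for a :: "nat => real" and b q
 proof (cases "\<exists>i\<le>N. q \<in> E i")
  case True
  then obtain i where i: "i <= N" "q \<in> E i" by blast
  have uniq: "j = i" if "q \<in> E j" for j
  proof -
   have "real i * \<eta> < (real j + 1) * \<eta>" "real j * \<eta> < (real i + 1) * \<eta>"
    using i(2) that unfolding E_def by (auto simp: not_le add.commute)
   then have "real i < real j + 1" "real j < real i + 1" using \<eta> by auto
   then show ?thesis by linarith
  qed
  have "(\<Sum>j\<le>N. a j * indicator (E j) q) = (\<Sum>j\<le>N. if j = i then a i else 0)"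
  proof (intro sum.cong refl)
   fix j
   show "a j * indicator (E j) q = (if j = i then a i else 0)"
   proof (cases "q \<in> E j")
    case True
    then show ?thesis using uniq[OF True] by simp
   next
    case False
    then have "j ~= i" using i(2) by blast
    then show ?thesis using False by simp
   qed
  qed
  also have "... = a i" using i(1) by simp
  finally show ?thesis using ab(1)[OF i(2)] by simp
 next
  case False
  then have "(\<Sum>j\<le>N. a j * indicator (E j) q) = 0" by (intro sum.neutral) (auto simp: indicator_def)
  then show ?thesis using ab(2) by simp
 qed
 have iF: "integrable hausdorff1 (%q. indicator F q * f q)"
 proof (rule litg_bound)
  show "integrable hausdorff1 (%q. M * indicator F q)" using indF by simp
  have "(%q. indicator F q *\<^sub>R f q) \<in> borel_measurable borel"
   by (rule borel_measurable_continuous_on_indicator[OF _ fF]) (simp add: F_borel)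
  moreover have "borel_measurable hausdorff1 = (borel_measurable borel :: (real^2 => real) set)"
   by (rule measurable_cong_sets) auto
  ultimately show "(%q. indicator F q * f q) \<in> borel_measurable hausdorff1" by simp
  show "AE q in hausdorff1. norm (indicator F q * f q) <= norm (M * indicator F q :: real)"
  proof (rule AE_I2)
   show "norm (indicator F q * f q) <= norm (M * indicator F q :: real)" for q
    using M[of q] by (cases "q \<in> F") auto
  qed
 qed
 have s1: "(\<Sum>i\<le>N. real i * \<eta> * \<mu> i) <= (\<integral>q. indicator F q * f q \<partial>hausdorff1)"
 proof -
  have "(\<Sum>i\<le>N. real i * \<eta> * \<mu> i) = (\<Sum>i\<le>N. \<integral>q. real i * \<eta> * indicator (E i) q \<partial>hausdorff1)"
   by (simp add: \<mu>_def)
  also have "... = (\<integral>q. (\<Sum>i\<le>N. real i * \<eta> * indicator (E i) q) \<partial>hausdorff1)"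
   by (rule lint_sum[symmetric]) (use indi in simp)
  also have "... <= (\<integral>q. indicator F q * f q \<partial>hausdorff1)"
  proof (rule lint_mono[OF _ iF])
   show "integrable hausdorff1 (%q. \<Sum>i\<le>N. real i * \<eta> * indicator (E i) q)"
    by (intro litg_sum integrable_mult_right indi)
   show "(\<Sum>i\<le>N. real i * \<eta> * indicator (E i) q) <= indicator F q * f q" for q
    by (rule disj) (use f(2) in \<open>auto simp: E_def\<close>)
  qed
  finally show ?thesis .
 qed
 have s2: "(\<Sum>i\<le>N. \<mu> i) <= H"
 proof -
  have "(\<Sum>i\<le>N. \<mu> i) = (\<Sum>i\<le>N. \<integral>q. 1 * indicator (E i) q \<partial>hausdorff1)" by (simp add: \<mu>_def)
  also have "... = (\<integral>q. (\<Sum>i\<le>N. 1 * indicator (E i) q) \<partial>hausdorff1)"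
   by (rule lint_sum[symmetric]) (use indi in simp)
  also have "... <= (\<integral>q. indicator F q \<partial>hausdorff1)"
  proof (rule lint_mono[OF _ indF])
   show "integrable hausdorff1 (%q. \<Sum>i\<le>N. 1 * indicator (E i) q :: real)"
    by (intro litg_sum integrable_mult_right indi)
   show "(\<Sum>i\<le>N. 1 * indicator (E i) q) <= (indicator F q :: real)" for q
    by (rule disj) (auto simp: E_def)
  qed
  also have "... = H" by (simp add: H_def)
  finally show ?thesis .
 qed
 define t0 where "t0 = c * min r (d / 2)"
 have "t0 > 0" using chart_pos d(1) by (simp add: t0_def)
 moreover have "(\<integral>x. indicator (layer t) x * f x \<partial>Leb) <= 8 * t / c * ((\<integral>q. indicator F q * f q \<partial>hausdorff1) + e)"
  if t: "0 < t" "t < t0" for t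
 proof -
  define T where "T = t / c"
  have "T < min r (d / 2)" unfolding T_def pos_divide_less_eq[OF chart_pos(2)] using t(2) by (simp only: t0_def mult.commute)
  moreover have "T > 0" using t(1) chart_pos(2) by (simp add: T_def)
  ultimately have T: "T > 0" "T <= r" "T < d" using d(1) by auto
  have "\<exists>L. L \<in> sets borel \<and> (\<forall>q s. q \<in> E i --> 0 <= s --> s <= T --> q - s *\<^sub>R dir \<in> L) \<and>
   emeasure lborel L <= ennreal (8 * T * (\<mu> i + \<gamma>))" for i
  proof -
   have "hausdorff1_outer (E i) = ennreal (\<mu> i)"
    using emeasure_hausdorff1[OF Eb[of i]] emeasure_F(1)[OF EF Eb] by (simp add: \<mu>_def)
   then have "hausdorff1_outer (E i) < ennreal (\<mu> i + \<gamma>)" using \<gamma> by (simp add: ennreal_less_iff \<mu>_def)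
   from fattening[OF this T(1) abs_sigma, of k] obtain L where L: "L \<in> sets borel"
    "!!q s. q \<in> E i ==> 0 <= s ==> s <= T ==> q - s *\<^sub>R (\<sigma> *\<^sub>R axis k 1) \<in> L"
    "emeasure lborel L <= ennreal (8 * T) * ennreal (\<mu> i + \<gamma>)" by blast
   have "ennreal (8 * T) * ennreal (\<mu> i + \<gamma>) = ennreal (8 * T * (\<mu> i + \<gamma>))"
    using T \<gamma> by (intro ennreal_mult[symmetric]) (auto simp: \<mu>_def)
   then show ?thesis using L by (auto simp: dir_def)
  qed
  then obtain L where L: "!!i. L i \<in> sets borel" "!!i q s. q \<in> E i ==> 0 <= s ==> s <= T ==> q - s *\<^sub>R dir \<in> L i"
   "!!i. emeasure lborel (L i) <= ennreal (8 * T * (\<mu> i + \<gamma>))" by metis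
  have Lfin: "emeasure lborel (L i) < \<infinity>" for i using le_less_trans[OF L(3) ennreal_less_top] by simp
  have Lm: "measure lborel (L i) <= 8 * T * (\<mu> i + \<gamma>)" for i
  proof -
   have nn: "0 <= 8 * T * (\<mu> i + \<gamma>)" using T(1) \<gamma> by (simp add: \<mu>_def)
   have "enn2real (emeasure lborel (L i)) <= enn2real (ennreal (8 * T * (\<mu> i + \<gamma>)))"
    by (rule enn2real_mono[OF L(3)]) simp
   then show ?thesis unfolding enn2real_ennreal[OF nn] measure_def .
  qed
  have Li: "integrable lborel (indicator (L i) :: real^2 => real)" for i
   using Lfin L(1) by (intro integrable_real_indicator) auto
  have LO: "integrable lborel (%x. indicator Om x *\<^sub>R (indicator (L i) x :: real))" for i
   by (rule integrable_mult_indicator) (use domain_borel Li in auto)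
  have Lb: "(indicator (L i) :: real^2 => real) \<in> borel_measurable borel" for i using L(1) by simp
  have Lint: "integrable Leb (indicator (L i) :: real^2 => real)" for i
   using lebesgue_on_borel(2)[OF Lb] LO by simp
  have Lint2: "(\<integral>x. indicator (L i) x \<partial>Leb) <= 8 * T * (\<mu> i + \<gamma>)" for i
  proof -
   have "(\<integral>x. indicator (L i) x \<partial>Leb) = (\<integral>x. indicator Om x *\<^sub>R (indicator (L i) x :: real) \<partial>lborel)"
    by (rule lebesgue_on_borel(1)[OF Lb])
   also have "... <= (\<integral>x. indicator (L i) x \<partial>lborel)"
    by (rule lint_mono[OF LO Li]) (auto simp: indicator_def)
   also have "... = measure lborel (L i)" by simp
   finally show ?thesis using Lm[of i] by linarith
  qed
  have pw: "indicator (layer t) x * f x <= (\<Sum>i\<le>N. (real i + 2) * \<eta> * indicator (L i) x)" for x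
  proof (cases "x \<in> layer t")
   case True
   obtain q s where q: "q \<in> F" "0 <= s" "s <= T" "x = q - s *\<^sub>R dir"
    using foot_exists[OF True t(1)] T(2) by (auto simp: T_def)
   have xK: "x \<in> K" using True chart_pos(1) closure_subset by (fastforce simp: layer_def K_def)
   have "dist q x <= T" using q norm_dir by (simp add: dist_norm)
   then have "dist (f q) (f x) < \<eta>" using d(2)[OF xK, of q] FK q(1) T(3) by auto
   then have fx: "f x < f q + \<eta>" by (auto simp: dist_real_def)
   define i where "i = nat (floor (f q / \<eta>))"
   have fq: "0 <= f q / \<eta>" using f(2) \<eta> by simp
   have ii: "real i <= f q / \<eta>" "f q / \<eta> < real i + 1" using fq by (auto simp: i_def)
   then have i2: "real i * \<eta> <= f q" "f q < (real i + 1) * \<eta>" using \<eta> by (auto simp: field_simps)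
   have "f q / \<eta> <= M / \<eta>" using M[OF q(1)] \<eta> by (intro divide_right_mono) auto
   then have "real i <= real N" using ii(1) N by linarith
   then have iN: "i <= N" by simp
   have "q \<in> E i" using q(1) i2 by (auto simp: E_def add.commute)
   then have xL: "x \<in> L i" using L(2) q by blast
   have "indicator (layer t) x * f x <= (real i + 2) * \<eta> * indicator (L i) x"
    using True xL fx i2(2) by (simp add: algebra_simps)
   also have "... <= (\<Sum>i\<le>N. (real i + 2) * \<eta> * indicator (L i) x)"
    by (rule member_le_sum) (use iN \<eta> in auto)
   finally show ?thesis .
  next
   case False
   have "0 <= (\<Sum>i\<le>N. (real i + 2) * \<eta> * indicator (L i) x)" using \<eta> by (intro sum_nonneg) auto
   then show ?thesis using False by simp
  qed
  have "(\<integral>x. indicator (layer t) x * f x \<partial>Leb) <= (\<integral>x. (\<Sum>i\<le>N. (real i + 2) * \<eta> * indicator (L i) x) \<partial>Leb)"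
  proof (rule integral_mono_AE')
   show "integrable Leb (%x. \<Sum>i\<le>N. (real i + 2) * \<eta> * indicator (L i) x)"
    by (intro litg_sum integrable_mult_right Lint)
   show "AE x in Leb. indicator (layer t) x * f x <= (\<Sum>i\<le>N. (real i + 2) * \<eta> * indicator (L i) x)"
    by (intro AE_I2 pw)
   show "AE x in Leb. 0 <= (\<Sum>i\<le>N. (real i + 2) * \<eta> * indicator (L i) x)"
    using \<eta> by (intro AE_I2 sum_nonneg) auto
  qed
  also have "... = (\<Sum>i\<le>N. (real i + 2) * \<eta> * (\<integral>x. indicator (L i) x \<partial>Leb))"
   using Lint by (subst lint_sum) auto
  also have "... <= (\<Sum>i\<le>N. (real i + 2) * \<eta> * (8 * T * (\<mu> i + \<gamma>)))"
   using \<eta> by (intro sum_mono mult_left_mono Lint2) auto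
  also have "... = (\<Sum>i\<le>N. 8 * T * (real i * \<eta> * \<mu> i) + 8 * T * (2 * \<eta> * \<mu> i) + 8 * T * \<gamma> * ((real i + 2) * \<eta>))"
   by (intro sum.cong refl) (simp add: algebra_simps)
  also have "... = 8 * T * ((\<Sum>i\<le>N. real i * \<eta> * \<mu> i) + 2 * \<eta> * (\<Sum>i\<le>N. \<mu> i) + \<gamma> * S)"
   unfolding S_def by (simp add: sum.distrib sum_distrib_left algebra_simps)
  also have "... <= 8 * T * ((\<integral>q. indicator F q * f q \<partial>hausdorff1) + e)"
  proof (rule mult_left_mono)
   have "2 * \<eta> * (\<Sum>i\<le>N. \<mu> i) <= 2 * \<eta> * H" using s2 \<eta> by (intro mult_left_mono) auto
   also have "... <= e / 2" using H \<open>e > 0\<close> by (simp add: \<eta>_def field_simps)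
   finally have 1: "2 * \<eta> * (\<Sum>i\<le>N. \<mu> i) <= e / 2" .
   have "\<gamma> * S <= e / 2" using S \<open>e > 0\<close> by (simp add: \<gamma>_def field_simps)
   then show "(\<Sum>i\<le>N. real i * \<eta> * \<mu> i) + 2 * \<eta> * (\<Sum>i\<le>N. \<mu> i) + \<gamma> * S <= (\<integral>q. indicator F q * f q \<partial>hausdorff1) + e"
    using s1 1 by linarith
  qed (use T in simp)
  finally show ?thesis by (simp add: T_def)
 qed
 ultimately show ?thesis by blast
qed

end

context smooth_domain
begin

lemma surface_finite: "finite_measure (surface_measure Om)"
proof
 have fb: "frontier Om \<in> sets hausdorff1" by simp
 have "\<forall>p\<in>frontier Om. \<exists>r. r > 0 \<and> emeasure hausdorff1 (frontier Om \<inter> cball p (4 * r)) < \<infinity>"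
 proof
  fix p assume "p \<in> frontier Om"
  then obtain r \<rho> k \<sigma> c C where "boundary_chart Om p r \<rho> k \<sigma> c C" using boundary_chart_exists by blast
  then interpret chart Om p r \<rho> k \<sigma> c C by unfold_locales
  show "\<exists>r. r > 0 \<and> emeasure hausdorff1 (frontier Om \<inter> cball p (4 * r)) < \<infinity>"
   using chart_pos(1) emeasure_F(2)[OF subset_refl F_borel] unfolding F_def by blast
 qed
 from bchoice[OF this] obtain r where r: "!!p. p \<in> frontier Om ==> r p > 0"
  "!!p. p \<in> frontier Om ==> emeasure hausdorff1 (frontier Om \<inter> cball p (4 * r p)) < \<infinity>" by blast
 have "compact (frontier Om)" using bounded_domain by (simp add: compact_frontier_bounded)
 moreover have "frontier Om \<subseteq> (\<Union>p\<in>frontier Om. ball p (r p))" using r(1) by force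
 ultimately obtain P where P: "P \<subseteq> frontier Om" "finite P" "frontier Om \<subseteq> (\<Union>p\<in>P. ball p (r p))"
  using compactE_image[of "frontier Om" "frontier Om" "%p. ball p (r p)"] by auto
 have "frontier Om \<subseteq> (\<Union>p\<in>P. frontier Om \<inter> cball p (4 * r p))"
 proof
  fix q assume q: "q \<in> frontier Om"
  then obtain p where "p \<in> P" "dist p q < r p" using P(3) by auto
  then have "q \<in> frontier Om \<inter> cball p (4 * r p)" using q r(1)[of p] P(1) by auto
  then show "q \<in> (\<Union>p\<in>P. frontier Om \<inter> cball p (4 * r p))" using \<open>p \<in> P\<close> by blast
 qed
 then have "emeasure hausdorff1 (frontier Om) <= emeasure hausdorff1 (\<Union>p\<in>P. frontier Om \<inter> cball p (4 * r p))"
  by (intro emeasure_mono) (simp_all only: sets_hausdorff1, intro sets.finite_UN P(2), simp)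
 also have "... <= (\<Sum>p\<in>P. emeasure hausdorff1 (frontier Om \<inter> cball p (4 * r p)))"
  by (rule emeasure_subadditive_finite[OF P(2)]) auto
 also have "... < \<infinity>" using r(2) P(1,2) by (auto simp: subset_iff)
 finally have "emeasure hausdorff1 (frontier Om) < \<infinity>" .
 moreover have "space (surface_measure Om) = frontier Om" by (simp add: surface_measure_def space_restrict_space)
 ultimately show "emeasure (surface_measure Om) (space (surface_measure Om)) ~= \<infinity>"
  by (simp add: surface_measure_def emeasure_restrict_space)
qed

end

section \<open>Green's formula with a vanishing normal trace\<close>

context smooth_domain
begin

lemma closure_compact: "compact (closure Om)"
 using bounded_domain by simp

lemma smooth_on_closure_C1:
 fixes v :: "real^2 => complex"
 assumes "smooth_on_closure Om v"
 shows "C1_on Om v" "continuous_on (closure Om) v" "\<exists>C. \<forall>x\<in>closure Om. cmod (v x) <= C \<and> (\<forall>j. cmod (partial j v x) <= C)"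
proof -
 obtain U where U: "open U" "closure Om \<subseteq> U" "smooth_on U v" using assms by (auto simp: smooth_on_closure_def)
 note C1 = smooth_on_C1_on[OF U(3)]
 show "C1_on Om v" by (rule C1_on_subset[OF C1]) (use U(2) closure_subset in blast)
 show c: "continuous_on (closure Om) v" by (rule continuous_on_subset[OF C1_on_continuous[OF C1] U(2)])
 have cp: "continuous_on (closure Om) (partial j v)" for j by (rule continuous_on_subset[OF C1_on_partial[OF C1] U(2)])
 have b: "\<exists>C. \<forall>x\<in>closure Om. cmod (f x) <= C" if "continuous_on (closure Om) f" for f
  using compact_imp_bounded[OF compact_continuous_image[OF that closure_compact]] unfolding bounded_iff by blast
 obtain C0 where C0: "!!x. x \<in> closure Om ==> cmod (v x) <= C0" using b[OF c] by blast
 obtain C1 where C1: "!!x. x \<in> closure Om ==> cmod (partial 1 v x) <= C1" using b[OF cp] by blast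
 obtain C2 where C2: "!!x. x \<in> closure Om ==> cmod (partial 2 v x) <= C2" using b[OF cp] by blast
 have "cmod (v x) <= max C0 (max C1 C2) \<and> (\<forall>j. cmod (partial j v x) <= max C0 (max C1 C2))" if "x \<in> closure Om" for x
  unfolding forall_2 using C0[OF that] C1[OF that] C2[OF that] by auto
 then show "\<exists>C. \<forall>x\<in>closure Om. cmod (v x) <= C \<and> (\<forall>j. cmod (partial j v x) <= C)" by blast
qed

lemma smooth_on_closure_weak:
 fixes v :: "real^2 => complex"
 assumes "smooth_on_closure Om v"
 shows "weak j v (partial j v)"
proof -
 obtain C where C: "!!x. x \<in> closure Om ==> cmod (v x) <= C" "!!x j. x \<in> closure Om ==> cmod (partial j v x) <= C"
  using smooth_on_closure_C1(3)[OF assms] by blast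
 show ?thesis
  by (rule weak_of_C1[OF smooth_on_closure_C1(1)[OF assms], of C]) (use C closure_subset in blast)+
qed

lemma bl_energy_le_H1_norm:
 assumes "w \<in> H1 Om"
 shows "bl_energy w (%j. weak_partial Om j w) <= 3 * (H1_norm Om w)^2"
proof -
 note L = weakD[OF H1D[OF assms]]
 define h where "h = H1_norm Om w"
 have h2: "h^2 = (L2_norm Leb w)^2 + (\<Sum>j\<in>UNIV. (L2_norm Leb (weak_partial Om j w))^2)"
 proof -
  have "0 <= (\<Sum>j\<in>UNIV. (L2_norm Leb (weak_partial Om j w))^2)" by (intro sum_nonneg) simp
  then have "0 <= (L2_norm Leb w)^2 + (\<Sum>j\<in>UNIV. (L2_norm Leb (weak_partial Om j w))^2)"
   using zero_le_power2[of "L2_norm Leb w"] by linarith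
  then show ?thesis unfolding h_def H1_norm_def by (rule real_sqrt_pow2)
 qed
 have h0: "h >= 0" unfolding h_def H1_norm_def by (intro real_sqrt_ge_zero add_nonneg_nonneg sum_nonneg) auto
 have "0 <= (\<Sum>j\<in>UNIV. (L2_norm Leb (weak_partial Om j w))^2)" by (intro sum_nonneg) simp
 then have w: "(L2_norm Leb w)^2 <= h^2" using h2 by linarith
 have g: "(L2_norm Leb (weak_partial Om j w))^2 <= h^2" for j
 proof -
  have "(L2_norm Leb (weak_partial Om j w))^2 <= (\<Sum>j\<in>UNIV. (L2_norm Leb (weak_partial Om j w))^2)"
   by (rule member_le_sum) auto
  then show ?thesis unfolding h2 by (intro add_increasing) auto
 qed
 have w': "L2_norm Leb w <= h" by (rule power2_le_imp_le[OF w h0])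
 have g': "L2_norm Leb (weak_partial Om j w) <= h" for j by (rule power2_le_imp_le[OF g h0])
 have p: "(\<integral>x. \<bar>Re (cnj (w x) * weak_partial Om j w x)\<bar> \<partial>Leb) <= h^2" for j
 proof -
  have "(\<integral>x. \<bar>Re (cnj (w x) * weak_partial Om j w x)\<bar> \<partial>Leb) <= (\<integral>x. cmod (w x) * cmod (weak_partial Om j w x) \<partial>Leb)"
  proof (rule lint_mono)
   show "integrable Leb (%x. \<bar>Re (cnj (w x) * weak_partial Om j w x)\<bar>)" by (rule integrable_Re_product(2)[OF L])
   show "integrable Leb (%x. cmod (w x) * cmod (weak_partial Om j w x))" by (rule L2_product(1)[OF L])
   show "\<bar>Re (cnj (w x) * weak_partial Om j w x)\<bar> <= cmod (w x) * cmod (weak_partial Om j w x)" for x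
    using abs_Re_le_cmod[of "cnj (w x) * weak_partial Om j w x"] unfolding norm_mult complex_mod_cnj .
  qed
  also have "... <= L2_norm Leb w * L2_norm Leb (weak_partial Om j w)" by (rule L2_product(2)[OF L])
  also have "... <= h * h" using w' g' h0 by (intro mult_mono) (auto simp: L2_norm_nonneg)
  finally show ?thesis by (simp add: power2_eq_square)
 qed
 have "bl_energy w (%j. weak_partial Om j w) <= h^2 + (\<Sum>j\<in>(UNIV::2 set). h^2)"
  unfolding bl_energy_def using w by (intro add_mono sum_mono p) (simp add: L2_norm_square)
 then show ?thesis by (simp add: h_def)
qed

lemma surface_measurable:
 fixes h :: "real^2 => 'b::{real_normed_vector, second_countable_topology}"
 assumes "continuous_on (frontier Om) h"
 shows "h \<in> borel_measurable (surface_measure Om)"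
proof -
 have "(%x. indicator (frontier Om) x *\<^sub>R h x) \<in> borel_measurable borel"
  by (rule borel_measurable_continuous_on_indicator[OF _ assms]) simp
 moreover have "borel_measurable hausdorff1 = (borel_measurable borel :: (real^2 => 'b) set)"
  by (rule measurable_cong_sets) auto
 ultimately show ?thesis
  unfolding surface_measure_def by (subst borel_measurable_restrict_space_iff) auto
qed

lemma space_surface: "space (surface_measure Om) = frontier Om"
 by (simp add: surface_measure_def space_restrict_space)

lemma smooth_on_closure_surface_L2:
 fixes v :: "real^2 => complex"
 assumes "smooth_on_closure Om v"
 shows "v \<in> L2 (surface_measure Om)"
proof (rule L2I)
 interpret finite_measure "surface_measure Om" by (rule surface_finite)
 have sub: "frontier Om \<subseteq> closure Om" by (simp add: frontier_def)
 show m: "v \<in> borel_measurable (surface_measure Om)"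
  by (rule surface_measurable[OF continuous_on_subset[OF smooth_on_closure_C1(2)[OF assms] sub]])
 obtain C where C: "!!x. x \<in> closure Om ==> cmod (v x) <= C" using smooth_on_closure_C1(3)[OF assms] by blast
 show "integrable (surface_measure Om) (%x. cmod2 (v x))"
 proof (rule integrable_const_bound[where B = "C^2"])
  show "AE x in surface_measure Om. norm (cmod2 (v x)) <= C^2"
   by (rule AE_I2) (use C sub in \<open>auto simp: space_surface intro!: power_mono\<close>)
 qed (use m in simp)
qed

end

lemma step_scaled:
 assumes "t > 0"
 shows "((%s. step (s / t - 1)) has_real_derivative step' (s / t - 1) / t) (at s)"
  "continuous_on UNIV (%s. step' (s / t - 1) / t)" "\<forall>s\<le>t. step (s / t - 1) = 0"
proof -
 have t: "t ~= 0" using assms by simp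
 have "((%s. s / t - 1) has_real_derivative 1 / t) (at s)" by (auto intro!: derivative_eq_intros simp: t)
 from DERIV_chain'[OF this has_real_derivative_step]
 show "((%s. step (s / t - 1)) has_real_derivative step' (s / t - 1) / t) (at s)" by simp
 show "continuous_on UNIV (%s. step' (s / t - 1) / t)"
  by (intro continuous_intros continuous_on_compose2[OF continuous_on_step'[of UNIV]]) (auto simp: t)
 show "\<forall>s\<le>t. step (s / t - 1) = 0" using assms by (auto intro!: step_bounds(3))
qed

context planar_domain
begin

definition div_pairing :: "(2 => real^2 => complex) => (2 => real^2 => complex) => (real^2 => complex) => (2 => real^2 => complex) => complex" where
 "div_pairing v dv \<phi> d\<phi> = (\<Sum>j\<in>UNIV. (\<integral>x. dv j x * \<phi> x \<partial>Leb) + (\<integral>x. v j x * d\<phi> j x \<partial>Leb))"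

lemma C1_bounded_on_domain:
 fixes a :: "real^2 => real"
 assumes "C1_on UNIV a"
 obtains C where "C >= 0" "!!x. x \<in> Om ==> \<bar>a x\<bar> <= C" "!!x j. x \<in> Om ==> \<bar>partial j a x\<bar> <= C"
proof -
 have K: "compact (closure Om)" using bounded_domain by simp
 have b: "\<exists>C\<ge>0. \<forall>x\<in>closure Om. \<bar>f x\<bar> <= C" if "continuous_on UNIV f" for f :: "real^2 => real"
 proof -
  have "bounded (f ` closure Om)"
   by (rule compact_imp_bounded[OF compact_continuous_image[OF continuous_on_subset[OF that subset_UNIV] K]])
  then obtain C where "!!x. x \<in> closure Om ==> \<bar>f x\<bar> <= C" unfolding bounded_iff by auto
  then show ?thesis by (intro exI[of _ "max C 0"]) (auto simp: le_max_iff_disj)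
 qed
 obtain C0 where C0: "C0 >= 0" "!!x. x \<in> closure Om ==> \<bar>a x\<bar> <= C0" using b[OF C1_on_continuous[OF assms]] by blast
 obtain C1 where C1: "C1 >= 0" "!!x. x \<in> closure Om ==> \<bar>partial 1 a x\<bar> <= C1" using b[OF C1_on_partial[OF assms]] by blast
 obtain C2 where C2: "C2 >= 0" "!!x. x \<in> closure Om ==> \<bar>partial 2 a x\<bar> <= C2" using b[OF C1_on_partial[OF assms]] by blast
 have 1: "\<bar>a x\<bar> <= C0 + C1 + C2" if "x \<in> Om" for x using C0 C1 C2 that closure_subset by force
 have "\<forall>j. \<bar>partial j a x\<bar> <= C0 + C1 + C2" if "x \<in> Om" for x
  unfolding forall_2 using C0(1) C1 C2 that closure_subset by force
 then show ?thesis using that[of "C0 + C1 + C2"] 1 C0(1) C1(1) C2(1) by auto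
qed

lemma weak_mult_C1_real:
 fixes a :: "real^2 => real"
 assumes "weak j u g" "C1_on Om a" "!!x. x \<in> Om ==> \<bar>a x\<bar> <= C" "!!x. x \<in> Om ==> \<bar>partial j a x\<bar> <= C"
 shows "weak j (%x. a x *\<^sub>R u x) (%x. a x *\<^sub>R g x + partial j a x *\<^sub>R u x)"
proof -
 have bl: "bounded_linear complex_of_real" by (rule bounded_linear_of_real)
 note l = C1_on_linear[OF bl assms(2)]
 have 1: "weak j (%x. complex_of_real (a x) * u x)
   (%x. complex_of_real (a x) * g x + partial j (%x. complex_of_real (a x)) x * u x)"
  by (rule weak_mult_C1[OF assms(1) l(1), of C]) (use assms l(2) in auto)
 note L = weakD[OF assms(1)]
 have eq: "partial j (%x. complex_of_real (a x)) x = complex_of_real (partial j a x)" if "x \<in> Om" for x by (rule l(2)[OF that])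
 have I: "(\<integral>x. \<phi> x *\<^sub>R (a x *\<^sub>R g x + partial j (%x. complex_of_real (a x)) x * u x) \<partial>Leb)
   = (\<integral>x. \<phi> x *\<^sub>R (a x *\<^sub>R g x + partial j a x *\<^sub>R u x) \<partial>Leb)" for \<phi> :: "real^2 => real"
  by (intro lint_cong) (auto simp: eq scaleR_conv_of_real)
 have "(%x. a x *\<^sub>R g x + partial j a x *\<^sub>R u x) \<in> L2 Leb"
 proof (rule L2_dominated(1)[OF _ weakD(2)[OF 1], of _ 1])
  have [measurable]: "a \<in> borel_measurable Leb" "partial j a \<in> borel_measurable Leb"
   "u \<in> borel_measurable Leb" "g \<in> borel_measurable Leb"
   using continuous_domain_measurable[OF C1_on_continuous[OF assms(2)]] continuous_domain_measurable[OF C1_on_partial[OF assms(2)]]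
    L2D(1)[OF L(1)] L2D(1)[OF L(2)] by auto
  show "(%x. a x *\<^sub>R g x + partial j a x *\<^sub>R u x) \<in> borel_measurable Leb" by measurable
 qed (auto simp: eq scaleR_conv_of_real)
 then show ?thesis
  using 1[unfolded has_weak_partial_def scaleR_conv_of_real[symmetric] I] unfolding has_weak_partial_def by blast
qed

lemma div_pairing_diff:
 assumes "!!j. v j \<in> L2 Leb" "!!j. dv j \<in> L2 Leb"
  "\<phi> \<in> L2 Leb" "\<psi> \<in> L2 Leb" "!!j. d\<phi> j \<in> L2 Leb" "!!j. d\<psi> j \<in> L2 Leb"
 shows "div_pairing v dv (%x. \<phi> x - \<psi> x) (%j x. d\<phi> j x - d\<psi> j x) = div_pairing v dv \<phi> d\<phi> - div_pairing v dv \<psi> d\<psi>"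
proof -
 have e: "(\<integral>x. f x * (a x - b x) \<partial>Leb) = (\<integral>x. f x * a x \<partial>Leb) - (\<integral>x. f x * b x \<partial>Leb)"
  if "f \<in> L2 Leb" "a \<in> L2 Leb" "b \<in> L2 Leb" for f a b
  unfolding right_diff_distrib by (rule lint_diff) (rule L2_product(3) that)+
 show ?thesis
  unfolding div_pairing_def sum_2 using assms by (simp add: e)
qed

lemma div_pairing_interior:
 fixes a :: "real^2 => real"
 assumes "C1_compact Om a" "!!j. weak j (v j) (dv j)" "!!j. weak j \<phi> (d\<phi> j)"
 shows "div_pairing v dv (%x. a x *\<^sub>R \<phi> x) (%j x. a x *\<^sub>R d\<phi> j x + partial j a x *\<^sub>R \<phi> x) = 0"
proof -
 obtain M where M: "M >= 0" "!!x. norm (a x) <= M" "!!x j. norm (partial j a x) <= M" using C1_compact_bounded[OF assms(1)] by blast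
 have m: "a \<in> borel_measurable Leb" "partial j a \<in> borel_measurable Leb" for j
  by (intro borel_lebesgue_on C1_compact_measurable[OF assms(1)])+
 note L = weakD[OF assms(2)] weakD[OF assms(3)]
 have i: "integrable Leb (%x. a x *\<^sub>R (v j x * d\<phi> j x))" "integrable Leb (%x. partial j a x *\<^sub>R (v j x * \<phi> x))" for j
  using L2_product_bounded(1)[OF L(1) L(4) m(1), where C = M] L2_product_bounded(1)[OF L(1) L(3) m(2), where C = M] M by auto
 have "(\<integral>x. dv j x * (a x *\<^sub>R \<phi> x) \<partial>Leb) + (\<integral>x. v j x * (a x *\<^sub>R d\<phi> j x + partial j a x *\<^sub>R \<phi> x) \<partial>Leb) = 0" for j
 proof -
  have "(\<integral>x. v j x * (a x *\<^sub>R d\<phi> j x + partial j a x *\<^sub>R \<phi> x) \<partial>Leb)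
    = (\<integral>x. a x *\<^sub>R (v j x * d\<phi> j x) + partial j a x *\<^sub>R (v j x * \<phi> x) \<partial>Leb)"
   by (intro lint_cong) (auto simp: algebra_simps)
  also have "... = (\<integral>x. a x *\<^sub>R (v j x * d\<phi> j x) \<partial>Leb) + (\<integral>x. partial j a x *\<^sub>R (v j x * \<phi> x) \<partial>Leb)"
   by (rule lint_add) (rule i)+
  finally show ?thesis using weak_partial_product[OF assms(2)[of j] assms(3)[of j] assms(1)] by simp
 qed
 then show ?thesis by (simp add: div_pairing_def)
qed

end

locale neumann_field = smooth_domain +
 fixes v dv g :: "2 => real^2 => complex"
 assumes trace: "!!j. has_trace Om (v j) (g j)"
  and normal_zero: "AE x in surface_measure Om. (\<Sum>j\<in>UNIV. complex_of_real (outward_normal Om x $ j) * g j x) = 0"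
  and dv: "!!j. dv j = weak_partial Om j (v j)"
begin

lemma field_weak: "weak i (v j) (weak_partial Om i (v j))"
 using trace[of j] by (intro H1D) (simp add: has_trace_def)

lemma field_div: "weak j (v j) (dv j)"
 using field_weak dv by simp

lemma field_approx:
 assumes "\<delta> > 0"
 obtains w :: "2 => real^2 => complex" where "!!j. smooth_on_closure Om (w j)"
  "!!j. bl_energy (%x. w j x - v j x) (%i. weak_partial Om i (%x. w j x - v j x)) <= \<delta>"
  "!!j. (L2_norm (surface_measure Om) (%x. w j x - g j x))^2 <= \<delta>"
proof -
 have "\<exists>w. smooth_on_closure Om w \<and> bl_energy (%x. w x - v j x) (%i. weak_partial Om i (%x. w x - v j x)) <= \<delta>
   \<and> (L2_norm (surface_measure Om) (%x. w x - g j x))^2 <= \<delta>" for j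
 proof -
  obtain z :: "nat => real^2 => complex" where z: "!!n. smooth_on_closure Om (z n)"
   "(%n. H1_norm Om (%x. z n x - v j x)) \<longlonglongrightarrow> 0"
   "(%n. L2_norm (surface_measure Om) (%x. z n x - g j x)) \<longlonglongrightarrow> 0"
   using trace[of j] unfolding has_trace_def by blast
  have "(%n. 3 * (H1_norm Om (%x. z n x - v j x))^2) \<longlonglongrightarrow> 3 * 0^2" by (intro tendsto_intros z)
  then have "\<forall>\<^sub>F n in sequentially. 3 * (H1_norm Om (%x. z n x - v j x))^2 < \<delta>" using assms by (intro order_tendstoD) auto
  moreover have "(%n. (L2_norm (surface_measure Om) (%x. z n x - g j x))^2) \<longlonglongrightarrow> 0^2" by (intro tendsto_intros z)
  then have "\<forall>\<^sub>F n in sequentially. (L2_norm (surface_measure Om) (%x. z n x - g j x))^2 < \<delta>" using assms by (intro order_tendstoD) auto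
  ultimately have "\<forall>\<^sub>F n in sequentially. 3 * (H1_norm Om (%x. z n x - v j x))^2 < \<delta> \<and> (L2_norm (surface_measure Om) (%x. z n x - g j x))^2 < \<delta>"
   by (rule eventually_conj)
  then obtain n where n: "3 * (H1_norm Om (%x. z n x - v j x))^2 < \<delta>" "(L2_norm (surface_measure Om) (%x. z n x - g j x))^2 < \<delta>"
   unfolding eventually_sequentially by blast
  have "(%x. z n x - v j x) \<in> H1 Om"
   by (rule H1I) (rule weak_diff[OF smooth_on_closure_weak[OF z(1)] field_weak])
  from bl_energy_le_H1_norm[OF this] n show ?thesis using z(1)[of n] by (intro exI[of _ "z n"]) linarith
 qed
 then have "\<forall>j. \<exists>w. smooth_on_closure Om w \<and> bl_energy (%x. w x - v j x) (%i. weak_partial Om i (%x. w x - v j x)) <= \<delta>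
   \<and> (L2_norm (surface_measure Om) (%x. w x - g j x))^2 <= \<delta>" by blast
 from choice[OF this] that show ?thesis by blast
qed

end

locale neumann_chart = neumann_field Om v dv g + chart Om p r \<rho> k \<sigma> c C
 for Om v dv g p r \<rho> k \<sigma> c C
begin

definition nu :: "2 => real^2 => real" where "nu j x = indicator W x * partial j \<rho> x"

lemma nu_borel: "nu j \<in> borel_measurable borel"
 using borel_measurable_continuous_on_indicator[OF _ C1_on_partial[OF chart_C1, of j]] by (simp add: nu_def[abs_def])

lemma nu_bound: "\<bar>nu j x\<bar> <= C"
 using chart_bounds(2)[of x j] chart_pos(3) by (cases "x \<in> W") (auto simp: nu_def)

definition nv :: "(2 => real^2 => complex) => real^2 => complex" where
 "nv w x = (\<Sum>j\<in>UNIV. nu j x *\<^sub>R w j x)"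

lemma nv_square_le: "cmod2 (nv w x) <= 2 * C^2 * (\<Sum>j\<in>UNIV. cmod2 (w j x))"
proof -
 have "cmod (nv w x) <= C * cmod (w 1 x) + C * cmod (w 2 x)"
  unfolding nv_def sum_2 using nu_bound[of 1 x] nu_bound[of 2 x]
  by (intro order_trans[OF norm_triangle_ineq] add_mono) (auto intro: mult_right_mono)
 then have "cmod2 (nv w x) <= (C * cmod (w 1 x) + C * cmod (w 2 x))^2" by (intro power_mono) auto
 also have "... <= 2 * (C * cmod (w 1 x))^2 + 2 * (C * cmod (w 2 x))^2"
  using sum_squares_bound[of "C * cmod (w 1 x)" "C * cmod (w 2 x)"] by (simp add: power2_sum)
 finally show ?thesis by (simp add: sum_2 power_mult_distrib algebra_simps)
qed

lemma nv_L2: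
 assumes "!!j. w j \<in> L2 Leb"
 shows "nv w \<in> L2 Leb"
proof -
 have "(%x. complex_of_real (nu j x) * w j x) \<in> L2 Leb" for j
  by (rule L2_mult_bounded(1)[OF assms, of _ C])
   (use borel_lebesgue_on[OF nu_borel[of j]] nu_bound chart_pos(3) in auto)
 from L2_add[OF this[of 1] this[of 2]] show ?thesis by (simp add: nv_def[abs_def] sum_2 scaleR_conv_of_real)
qed

text \<open>For a smooth approximation of the field, the normal component in the layer is compared with its values on the boundary. These are small in mean square because the limiting normal trace vanishes; the remaining difference is handled by the boundary layer estimate.\<close>
lemma normal_layer:
 "\<exists>K\<ge>0. \<forall>\<delta>>0. \<exists>t0>0. \<forall>t. 0 < t --> t < t0 -->
  (\<integral>x. indicator (layer t) x * cmod2 (nv v x) \<partial>Leb) <= K * t * \<delta>"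
proof -
 obtain B where B: "B > 0" "!!t u g. t > 0 ==> (\<forall>j. weak j u (g j)) ==>
  (\<integral>x. indicator (layer t) x * cmod2 (u x) \<partial>Leb) <= B * t * bl_energy u g"
  using boundary_layer_local by blast
 define K where "K = 2 * (8 / c * (4 * C^2 + 1)) + 2 * (2 * C^2 * (2 * B))"
 have K: "K >= 0" using B(1) chart_pos by (simp add: K_def)
 have "\<exists>t0>0. \<forall>t. 0 < t --> t < t0 --> (\<integral>x. indicator (layer t) x * cmod2 (nv v x) \<partial>Leb) <= K * t * \<delta>" if "\<delta> > 0" for \<delta>
 proof -
  obtain w where w: "!!j. smooth_on_closure Om (w j)"
   "!!j. bl_energy (%x. w j x - v j x) (%i. weak_partial Om i (%x. w j x - v j x)) <= \<delta>"
   "!!j. (L2_norm (surface_measure Om) (%x. w j x - g j x))^2 <= \<delta>"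
   using field_approx[OF \<open>\<delta> > 0\<close>] by blast
  have vL: "v j \<in> L2 Leb" for j by (rule weakD(1)[OF field_weak])
  have wL: "w j \<in> L2 Leb" for j by (rule weakD(1)[OF smooth_on_closure_weak[OF w(1)]])
  have dH: "(%x. w j x - v j x) \<in> H1 Om" for j
   by (rule H1I) (rule weak_diff[OF smooth_on_closure_weak[OF w(1)] field_weak])
  define f where "f x = cmod2 (nv w x)" for x
  have subW: "closure Om \<inter> cball p (4 * r) \<subseteq> W" using chart_pos(1) by auto
  have "continuous_on (closure Om \<inter> cball p (4 * r)) (%x. \<Sum>j\<in>UNIV. partial j \<rho> x *\<^sub>R w j x)"
   by (intro continuous_intros continuous_on_subset[OF C1_on_partial[OF chart_C1] subW]
     continuous_on_subset[OF smooth_on_closure_C1(2)[OF w(1)]]) auto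
  then have cn: "continuous_on (closure Om \<inter> cball p (4 * r)) (nv w)"
   by (rule continuous_on_eq) (use subW in \<open>auto simp: nv_def nu_def\<close>)
  have cf: "continuous_on (closure Om \<inter> cball p (4 * r)) f" unfolding f_def[abs_def] by (intro continuous_intros cn)
  have f0: "0 <= f x" for x by (simp add: f_def)
  obtain t0 where t0: "t0 > 0" "!!t. 0 < t ==> t < t0 ==>
   (\<integral>x. indicator (layer t) x * f x \<partial>Leb) <= 8 * t / c * ((\<integral>q. indicator F q * f q \<partial>hausdorff1) + \<delta>)"
   using layer_integral_le[OF cf f0 \<open>\<delta> > 0\<close>] by blast
  have gL: "g j \<in> L2 (surface_measure Om)" for j using trace[of j] by (simp add: has_trace_def)
  have wgL: "(%x. w j x - g j x) \<in> L2 (surface_measure Om)" for j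
   by (rule L2_diff[OF smooth_on_closure_surface_L2[OF w(1)] gL])
  have bd: "(\<integral>q. indicator F q * f q \<partial>hausdorff1) <= 4 * C^2 * \<delta>"
  proof -
   have eq: "indicator (frontier Om) q *\<^sub>R (indicator F q * f q) = indicator F q * f q" for q
    by (auto simp: F_def indicator_def)
   have "(\<integral>q. indicator F q * f q \<partial>hausdorff1) = (\<integral>q. indicator F q * f q \<partial>surface_measure Om)"
    unfolding surface_measure_def by (subst integral_restrict_space) (simp_all only: eq, simp)
   also have "... <= (\<integral>q. 2 * C^2 * (\<Sum>j\<in>UNIV. cmod2 (w j q - g j q)) \<partial>surface_measure Om)"
   proof (rule integral_mono_AE')
    show "integrable (surface_measure Om) (%q. 2 * C^2 * (\<Sum>j\<in>UNIV. cmod2 (w j q - g j q)))"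
     by (intro integrable_mult_right litg_sum L2D(2)[OF wgL])
    show "AE q in surface_measure Om. indicator F q * f q <= 2 * C^2 * (\<Sum>j\<in>UNIV. cmod2 (w j q - g j q))"
     using normal_zero
    proof eventually_elim
     case (elim q)
     have nn: "0 <= 2 * C^2 * (\<Sum>j\<in>UNIV. cmod2 (w j q - g j q))" by (intro mult_nonneg_nonneg sum_nonneg) auto
     show ?case
     proof (cases "q \<in> F")
      case True
      then have q: "q \<in> W" "q \<in> frontier Om" using F_sub by (auto simp: F_def)
      define m where "m = norm (grad \<rho> q)"
      have m: "m ~= 0" using chart_defining[OF q(1)] q(1) by (auto simp: m_def local_defining_function_def)
      have "outward_normal Om q $ j = partial j \<rho> q / m" for j
       unfolding chart_normal[OF q] m_def by (simp add: grad_def divide_inverse mult.commute)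
      then have "(\<Sum>j\<in>UNIV. complex_of_real (partial j \<rho> q / m) * g j q) = 0" using elim by simp
      then have "(\<Sum>j\<in>UNIV. complex_of_real (partial j \<rho> q) * g j q) / m = 0"
       by (simp add: sum_divide_distrib)
      then have "nv g q = 0" using m q(1) by (simp add: nv_def nu_def scaleR_conv_of_real)
      then have "nv w q = nv (%j x. w j x - g j x) q" by (simp add: nv_def scaleR_diff_right sum_subtractf)
      then have "f q <= 2 * C^2 * (\<Sum>j\<in>UNIV. cmod2 (w j q - g j q))"
       unfolding f_def using nv_square_le[of "%j x. w j x - g j x" q] by simp
      then show ?thesis using True by simp
     qed (use nn in simp)
    qed
    show "AE q in surface_measure Om. 0 <= 2 * C^2 * (\<Sum>j\<in>UNIV. cmod2 (w j q - g j q))"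
     by (intro AE_I2 mult_nonneg_nonneg sum_nonneg) auto
   qed
   also have "... = 2 * C^2 * (\<Sum>j\<in>UNIV. (L2_norm (surface_measure Om) (%x. w j x - g j x))^2)"
    unfolding L2_norm_square by (simp add: lint_sum L2D(2)[OF wgL])
   also have "... <= 2 * C^2 * (\<Sum>j\<in>(UNIV::2 set). \<delta>)" by (intro mult_left_mono sum_mono w(3)) auto
   finally show ?thesis by simp
  qed
  have "(\<integral>x. indicator (layer t) x * cmod2 (nv v x) \<partial>Leb) <= K * t * \<delta>" if t: "0 < t" "t < t0" for t
  proof -
   note nL = nv_L2[OF vL] nv_L2[OF wL] and dL = L2_diff[OF wL vL]
   have il: "integrable Leb (%x. indicator (layer t) x * cmod2 (u x))" if "u \<in> L2 Leb" for u
    by (rule indicator_integrable[OF L2D(2)[OF that] layer_lebesgue])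
   have "(\<integral>x. indicator (layer t) x * cmod2 (nv v x) \<partial>Leb)
    <= (\<integral>x. 2 * (indicator (layer t) x * f x) + 4 * C^2 * (\<Sum>j\<in>UNIV. indicator (layer t) x * cmod2 (w j x - v j x)) \<partial>Leb)"
   proof (rule lint_mono[OF il[OF nL(1)]])
    show "integrable Leb (%x. 2 * (indicator (layer t) x * f x) + 4 * C^2 * (\<Sum>j\<in>UNIV. indicator (layer t) x * cmod2 (w j x - v j x)))"
     unfolding f_def by (intro litg_add integrable_mult_right litg_sum il nL dL)
    fix x
    have "nv v x = nv w x - nv (%j x. w j x - v j x) x" by (simp add: nv_def scaleR_diff_right sum_subtractf)
    then have "cmod (nv v x) <= cmod (nv w x) + cmod (nv (%j x. w j x - v j x) x)" by (simp only: norm_triangle_ineq4)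
    then have "cmod2 (nv v x) <= (cmod (nv w x) + cmod (nv (%j x. w j x - v j x) x))^2" by (intro power_mono) auto
    also have "... <= 2 * cmod2 (nv w x) + 2 * cmod2 (nv (%j x. w j x - v j x) x)"
     using sum_squares_bound[of "cmod (nv w x)" "cmod (nv (%j x. w j x - v j x) x)"] by (simp add: power2_sum)
    also have "... <= 2 * f x + 4 * C^2 * (\<Sum>j\<in>UNIV. cmod2 (w j x - v j x))"
     unfolding f_def using nv_square_le[of "%j x. w j x - v j x" x] by simp
    finally have "cmod2 (nv v x) <= 2 * f x + 4 * C^2 * (\<Sum>j\<in>UNIV. cmod2 (w j x - v j x))" .
    then show "indicator (layer t) x * cmod2 (nv v x) <= 2 * (indicator (layer t) x * f x) + 4 * C^2 * (\<Sum>j\<in>UNIV. indicator (layer t) x * cmod2 (w j x - v j x))"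
     by (cases "x \<in> layer t") auto
   qed
   also have "... = 2 * (\<integral>x. indicator (layer t) x * f x \<partial>Leb) + 4 * C^2 * (\<Sum>j\<in>UNIV. \<integral>x. indicator (layer t) x * cmod2 (w j x - v j x) \<partial>Leb)"
   proof -
    have s: "(\<integral>x. (\<Sum>j\<in>UNIV. indicator (layer t) x * cmod2 (w j x - v j x)) \<partial>Leb)
      = (\<Sum>j\<in>UNIV. \<integral>x. indicator (layer t) x * cmod2 (w j x - v j x) \<partial>Leb)"
     by (rule lint_sum) (rule il[OF dL])
    have iA: "integrable Leb (%x. 2 * (indicator (layer t) x * f x))"
     unfolding f_def by (intro integrable_mult_right il nL)
    have iB: "integrable Leb (%x. 4 * C^2 * (\<Sum>j\<in>UNIV. indicator (layer t) x * cmod2 (w j x - v j x)))"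
     by (intro integrable_mult_right litg_sum il dL)
    show ?thesis
     unfolding lint_add[OF iA iB] Bochner_Integration.integral_mult_right_zero s ..
   qed
   also have "... <= 2 * (8 * t / c * (4 * C^2 * \<delta> + \<delta>)) + 4 * C^2 * (\<Sum>j\<in>(UNIV::2 set). B * t * \<delta>)"
   proof (intro add_mono mult_left_mono sum_mono)
    have "8 * t / c >= 0" using t chart_pos by simp
    then have "8 * t / c * ((\<integral>q. indicator F q * f q \<partial>hausdorff1) + \<delta>) <= 8 * t / c * (4 * C^2 * \<delta> + \<delta>)"
     using bd by (intro mult_left_mono) auto
    then show "(\<integral>x. indicator (layer t) x * f x \<partial>Leb) <= 8 * t / c * (4 * C^2 * \<delta> + \<delta>)" using t0(2)[OF t] by linarith
    fix j
    have "(\<integral>x. indicator (layer t) x * cmod2 (w j x - v j x) \<partial>Leb) <= B * t * bl_energy (%x. w j x - v j x) (%i. weak_partial Om i (%x. w j x - v j x))"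
     using H1D[OF dH] by (intro B(2) t) blast
    also have "... <= B * t * \<delta>" using w(2) B(1) t by (intro mult_left_mono) auto
    finally show "(\<integral>x. indicator (layer t) x * cmod2 (w j x - v j x) \<partial>Leb) <= B * t * \<delta>" .
   qed auto
   also have "... = K * t * \<delta>" by (simp add: K_def algebra_simps)
   finally show ?thesis .
  qed
  then show ?thesis using t0(1) by blast
 qed
 then show ?thesis using K by blast
qed

text \<open>Cut off at depth \<open>t\<close>: the pairing becomes \<open>1/t\<close> times an integral of normal component times test function over the layer, and the layer estimates for the two factors compensate \<open>1/t\<close> with an arbitrarily small factor left over.\<close>
lemma div_pairing_boundary:
 fixes a :: "real^2 => real"
 assumes a: "C1_on UNIV a" "\<forall>x. dist x p >= 2 * r --> a x = 0" "!!x. \<bar>a x\<bar> <= 1"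
  and \<phi>: "!!j. weak j \<phi> (d\<phi> j)"
 shows "div_pairing v dv (%x. a x *\<^sub>R \<phi> x) (%j x. a x *\<^sub>R d\<phi> j x + partial j a x *\<^sub>R \<phi> x) = 0"
proof -
 obtain M where M: "M > 0" "!!s. \<bar>step' s\<bar> <= M" using step'_bounded by blast
 have "C1_compact UNIV a"
  unfolding C1_compact_def using a(1,2) by (intro conjI exI[of _ "cball p (2 * r)"]) (auto simp: dist_commute)
 then obtain A where A: "A >= 0" "!!x. norm (a x) <= A" "!!x j. norm (partial j a x) <= A" using C1_compact_bounded by blast
 have a4: "\<forall>x. dist x p >= 4 * r --> a x = 0" using a(2) chart_pos(1) by auto
 have aW: "a x = 0" "partial j a x = 0" if "x \<notin> W" for x j
 proof -
  have far: "dist p x > 2 * r" using that chart_pos(1) by auto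
  show "a x = 0" using a(2) far by (simp add: dist_commute)
  have "partial j a x = partial j (%_. 0) x"
   by (rule partial_cong_open[of "- cball p (2 * r)"]) (use far a(2) in \<open>auto simp: dist_commute\<close>)
  then show "partial j a x = 0" by (simp add: partial_def)
 qed
 note vL = weakD(1)[OF field_div] and dvL = weakD(2)[OF field_div] and pL = weakD(1)[OF \<phi>] and dpL = weakD(2)[OF \<phi>]
 define ga where "ga t x = indicator W x * step (- \<rho> x / t - 1)" for t x
 define gb where "gb t x = indicator W x * (step' (- \<rho> x / t - 1) / t)" for t x
 have cstep: "continuous_on UNIV step"
  by (auto intro!: continuous_at_imp_continuous_on DERIV_isCont has_real_derivative_step)
 have cr: "continuous_on W (%x. - \<rho> x / t - 1)" if "t > 0" for t
  using that by (intro continuous_intros C1_on_continuous[OF chart_C1]) auto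
 have gm: "ga t \<in> borel_measurable borel" "gb t \<in> borel_measurable borel" if "t > 0" for t
 proof -
  have c: "continuous_on W (%x. step (- \<rho> x / t - 1))" "continuous_on W (%x. step' (- \<rho> x / t - 1) / t)"
   using that by (intro continuous_intros continuous_on_compose2[OF cstep cr] continuous_on_compose2[OF continuous_on_step'[of UNIV] cr]; simp)+
  show "ga t \<in> borel_measurable borel" "gb t \<in> borel_measurable borel"
   using borel_measurable_continuous_on_indicator[OF _ c(1)] borel_measurable_continuous_on_indicator[OF _ c(2)]
   by (simp_all add: ga_def[abs_def] gb_def[abs_def])
 qed
 have gab: "\<bar>ga t x\<bar> <= 1" for t x using step_bounds(1,2)[of "- \<rho> x / t - 1"] by (cases "x \<in> W") (auto simp: ga_def)
 have gbb: "\<bar>gb t x\<bar> <= M / t" if "t > 0" for t x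
  using M(2)[of "- \<rho> x / t - 1"] M(1) that by (cases "x \<in> W") (auto simp: gb_def abs_div intro: divide_right_mono)
 define R where "R t = (\<integral>x. (a x * gb t x) *\<^sub>R (nv v x * \<phi> x) \<partial>Leb)" for t
 define P where "P t = (\<Sum>j\<in>UNIV. (\<integral>x. (a x * ga t x) *\<^sub>R (dv j x * \<phi> x) \<partial>Leb)
   + (\<integral>x. (a x * ga t x) *\<^sub>R (v j x * d\<phi> j x) \<partial>Leb) + (\<integral>x. (partial j a x * ga t x) *\<^sub>R (v j x * \<phi> x) \<partial>Leb))" for t
 have am: "a \<in> borel_measurable Leb" "partial j a \<in> borel_measurable Leb" for j
  using continuous_lebesgue_on[OF C1_on_continuous[OF a(1)]] continuous_lebesgue_on[OF C1_on_partial[OF a(1)]] by auto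
 have bmult: "\<bar>x * y\<bar> <= b * d" if "\<bar>x\<bar> <= b" "\<bar>y\<bar> <= d" for x y b d :: real
  unfolding abs_mult using that by (intro mult_mono) auto
 have PR: "P t = R t" if t: "t > 0" for t
 proof -
  define ka where "ka = (%x. if x \<in> W then a x * step (- \<rho> x / t - 1) else 0)"
  note s = step_scaled[OF t]
  note cut = chart_cutoff[OF a(1) a4 s(1,2,3) t, folded ka_def]
  have k1: "ka x = a x * ga t x" for x by (simp add: ka_def ga_def)
  have k2: "partial j ka x = partial j a x * ga t x - a x * gb t x * nu j x" for j x
   using cut(2)[of x j] cut(3)[of x j] by (cases "x \<in> W") (auto simp: ga_def gb_def nu_def)
  have gtm: "ga t \<in> borel_measurable Leb" "gb t \<in> borel_measurable Leb" "nu j \<in> borel_measurable Leb" for j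
   using borel_lebesgue_on[OF gm(1)[OF t]] borel_lebesgue_on[OF gm(2)[OF t]] borel_lebesgue_on[OF nu_borel] by auto
  have i1: "integrable Leb (%x. (partial j a x * ga t x) *\<^sub>R (v j x * \<phi> x))" for j
  proof (rule L2_product_bounded(1)[OF vL pL, where C = "A * 1"])
   show "\<bar>partial j a x * ga t x\<bar> <= A * 1" for x
    using A(3)[of j x] gab[of t x] by (intro bmult) auto
  qed (use am gtm in measurable)
  have i2: "integrable Leb (%x. (a x * gb t x * nu j x) *\<^sub>R (v j x * \<phi> x))" for j
  proof (rule L2_product_bounded(1)[OF vL pL, where C = "A * (M / t) * C"])
   show "\<bar>a x * gb t x * nu j x\<bar> <= A * (M / t) * C" for x
    using A(2)[of x] gbb[OF t, of x] nu_bound[of j x] by (intro bmult) auto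
  qed (use am gtm in measurable)
  have e: "(\<integral>x. (a x * ga t x) *\<^sub>R (dv j x * \<phi> x) \<partial>Leb) + (\<integral>x. (a x * ga t x) *\<^sub>R (v j x * d\<phi> j x) \<partial>Leb)
    + (\<integral>x. (partial j a x * ga t x) *\<^sub>R (v j x * \<phi> x) \<partial>Leb) = (\<integral>x. (a x * gb t x * nu j x) *\<^sub>R (v j x * \<phi> x) \<partial>Leb)" for j
  proof -
   have "(\<integral>x. partial j ka x *\<^sub>R (v j x * \<phi> x) \<partial>Leb)
     = (\<integral>x. (partial j a x * ga t x) *\<^sub>R (v j x * \<phi> x) \<partial>Leb) - (\<integral>x. (a x * gb t x * nu j x) *\<^sub>R (v j x * \<phi> x) \<partial>Leb)"
    unfolding k2 scaleR_diff_left by (rule lint_diff[OF i1 i2])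
   moreover have "(\<integral>x. ka x *\<^sub>R f x \<partial>Leb) = (\<integral>x. (a x * ga t x) *\<^sub>R f x \<partial>Leb)" for f :: "real^2 => complex"
    by (rule lint_cong) (simp_all only: k1)
   moreover note weak_partial_product[OF field_div[of j] \<phi>[of j] cut(1)]
   moreover have "X + Y + G = N" if "Z = G - N" "Z = - X - Y" for X Y Z G N :: complex
    using that by (simp add: algebra_simps)
   ultimately show ?thesis by simp
  qed
  have "R t = (\<integral>x. (\<Sum>j\<in>UNIV. (a x * gb t x * nu j x) *\<^sub>R (v j x * \<phi> x)) \<partial>Leb)"
   unfolding R_def nv_def by (intro lint_cong) (auto simp: sum_2 algebra_simps)
  also have "... = (\<Sum>j\<in>UNIV. \<integral>x. (a x * gb t x * nu j x) *\<^sub>R (v j x * \<phi> x) \<partial>Leb)"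
   by (rule lint_sum) (rule i2)
  finally show ?thesis unfolding P_def e by simp
 qed
 define T where "T n = inverse (real (Suc n))" for n
 have T: "T n > 0" "T \<longlonglongrightarrow> 0" for n using LIMSEQ_inverse_real_of_nat by (auto simp: T_def[abs_def])
 have lim: "(%n. \<integral>x. (b x * ga (T n) x) *\<^sub>R (f x * h x) \<partial>Leb) \<longlonglongrightarrow> (\<integral>x. b x *\<^sub>R (f x * h x) \<partial>Leb)"
  if b: "b \<in> borel_measurable Leb" "!!x. \<bar>b x\<bar> <= A" "!!x. x \<notin> W ==> b x = 0"
   and fh: "f \<in> L2 Leb" "h \<in> L2 Leb" for b :: "real^2 => real" and f h
 proof (rule integral_dominated_convergence[where w = "%x. A * (cmod (f x) * cmod (h x))"])
  have [measurable]: "f \<in> borel_measurable Leb" "h \<in> borel_measurable Leb" "b \<in> borel_measurable Leb"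
   using fh b L2D(1) by auto
  have [measurable]: "ga (T n) \<in> borel_measurable Leb" for n using borel_lebesgue_on[OF gm(1)[OF T(1)]] .
  show "(%x. b x *\<^sub>R (f x * h x)) \<in> borel_measurable Leb" by measurable
  show "(%x. (b x * ga (T n) x) *\<^sub>R (f x * h x)) \<in> borel_measurable Leb" for n by measurable
  show "integrable Leb (%x. A * (cmod (f x) * cmod (h x)))" by (intro integrable_mult_right L2_product fh)
  show "AE x in Leb. norm ((b x * ga (T n) x) *\<^sub>R (f x * h x)) <= A * (cmod (f x) * cmod (h x))" for n
  proof (rule AE_I2)
   fix x
   have "\<bar>b x * ga (T n) x\<bar> <= A * 1" by (rule bmult[OF b(2) gab])
   then show "norm ((b x * ga (T n) x) *\<^sub>R (f x * h x)) <= A * (cmod (f x) * cmod (h x))"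
    unfolding norm_scaleR norm_mult by (intro mult_right_mono) auto
  qed
  show "AE x in Leb. (%n. (b x * ga (T n) x) *\<^sub>R (f x * h x)) \<longlonglongrightarrow> b x *\<^sub>R (f x * h x)"
  proof (rule AE_I2)
   fix x assume "x \<in> space Leb"
   then have x: "x \<in> Om" by simp
   show "(%n. (b x * ga (T n) x) *\<^sub>R (f x * h x)) \<longlonglongrightarrow> b x *\<^sub>R (f x * h x)"
   proof (cases "x \<in> W")
    case True
    then have "- \<rho> x > 0" using chart_domain x by simp
    then have "\<forall>\<^sub>F n in sequentially. T n < - \<rho> x / 2" using T(2) by (intro order_tendstoD) auto
    then have "\<forall>\<^sub>F n in sequentially. (b x * ga (T n) x) *\<^sub>R (f x * h x) = b x *\<^sub>R (f x * h x)"
    proof eventually_elim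
     case (elim n)
     have "- \<rho> x / T n - 1 >= 1" using elim T(1)[of n] by (simp add: field_simps)
     then have "step (- \<rho> x / T n - 1) = 1" by (rule step_bounds(4))
     then show ?case using True by (simp add: ga_def)
    qed
    then show ?thesis by (rule tendsto_eventually)
   qed (use b(3) in simp)
  qed
 qed
 have i3: "integrable Leb (%x. a x *\<^sub>R (v j x * d\<phi> j x))" "integrable Leb (%x. partial j a x *\<^sub>R (v j x * \<phi> x))" for j
  using L2_product_bounded(1)[OF vL dpL am(1), where C = A] L2_product_bounded(1)[OF vL pL am(2), where C = A] A by auto
 have dp: "div_pairing v dv (%x. a x *\<^sub>R \<phi> x) (%j x. a x *\<^sub>R d\<phi> j x + partial j a x *\<^sub>R \<phi> x)
   = (\<Sum>j\<in>UNIV. (\<integral>x. a x *\<^sub>R (dv j x * \<phi> x) \<partial>Leb)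
    + (\<integral>x. a x *\<^sub>R (v j x * d\<phi> j x) \<partial>Leb) + (\<integral>x. partial j a x *\<^sub>R (v j x * \<phi> x) \<partial>Leb))"
  unfolding div_pairing_def
 proof (intro sum.cong refl)
  fix j
  have "(\<integral>x. v j x * (a x *\<^sub>R d\<phi> j x + partial j a x *\<^sub>R \<phi> x) \<partial>Leb)
    = (\<integral>x. a x *\<^sub>R (v j x * d\<phi> j x) + partial j a x *\<^sub>R (v j x * \<phi> x) \<partial>Leb)"
   by (intro lint_cong) (auto simp: algebra_simps)
  also have "... = (\<integral>x. a x *\<^sub>R (v j x * d\<phi> j x) \<partial>Leb) + (\<integral>x. partial j a x *\<^sub>R (v j x * \<phi> x) \<partial>Leb)"
   by (rule lint_add) (rule i3)+
  finally show "(\<integral>x. dv j x * (a x *\<^sub>R \<phi> x) \<partial>Leb) + (\<integral>x. v j x * (a x *\<^sub>R d\<phi> j x + partial j a x *\<^sub>R \<phi> x) \<partial>Leb)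
   = (\<integral>x. a x *\<^sub>R (dv j x * \<phi> x) \<partial>Leb) + (\<integral>x. a x *\<^sub>R (v j x * d\<phi> j x) \<partial>Leb) + (\<integral>x. partial j a x *\<^sub>R (v j x * \<phi> x) \<partial>Leb)"
   by simp
 qed
 have Plim: "(%n. P (T n)) \<longlonglongrightarrow> div_pairing v dv (%x. a x *\<^sub>R \<phi> x) (%j x. a x *\<^sub>R d\<phi> j x + partial j a x *\<^sub>R \<phi> x)"
  unfolding P_def dp by (intro tendsto_sum tendsto_add lim am vL dvL pL dpL A(2)[unfolded real_norm_def] A(3)[unfolded real_norm_def] aW)
 have Rlim: "(%n. R (T n)) \<longlonglongrightarrow> 0"
 proof -
  obtain K where K: "K >= 0" "!!\<delta>. \<delta> > 0 ==> \<exists>t0>0. \<forall>t. 0 < t --> t < t0 -->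
   (\<integral>x. indicator (layer t) x * cmod2 (nv v x) \<partial>Leb) <= K * t * \<delta>" using normal_layer by blast
  obtain B where B: "B > 0" "!!t u g. t > 0 ==> (\<forall>j. weak j u (g j)) ==>
   (\<integral>x. indicator (layer t) x * cmod2 (u x) \<partial>Leb) <= B * t * bl_energy u g"
   using boundary_layer_local by blast
  define Q where "Q = sqrt (B * bl_energy \<phi> d\<phi>)"
  have Q: "Q >= 0" using B(1) bl_energy_nonneg by (simp add: Q_def)
  have "\<forall>\<^sub>F n in sequentially. norm (R (T n)) < e" if "e > 0" for e
  proof -
   define \<delta> where "\<delta> = (e / (2 * M * (sqrt K * Q + 1)))^2"
   have den: "2 * M * (sqrt K * Q + 1) > 0" using M(1) K(1) Q by (simp add: add_nonneg_pos)
   have d0: "e / (2 * M * (sqrt K * Q + 1)) > 0" using \<open>e > 0\<close> den by simp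
   then have "\<delta> > 0" unfolding \<delta>_def by (rule zero_less_power)
   then obtain t0 where t0: "t0 > 0" "!!t. 0 < t ==> t < t0 ==> (\<integral>x. indicator (layer t) x * cmod2 (nv v x) \<partial>Leb) <= K * t * \<delta>"
    using K(2) by blast
   have "\<forall>\<^sub>F n in sequentially. T n < t0 / 2" using T(2) t0(1) by (intro order_tendstoD) auto
   then show ?thesis
   proof eventually_elim
    case (elim n)
    define t where "t = T n"
    have t: "t > 0" "2 * t < t0" using T(1)[of n] elim by (auto simp: t_def)
    define E where "E = layer (2 * t)"
    let ?E = "%u x. complex_of_real (indicator E x) * u x"
    have nvL: "nv v \<in> L2 Leb" by (rule nv_L2[OF vL])
    have Em: "(%x. complex_of_real (indicator E x)) \<in> borel_measurable Leb"
    proof -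
     have "(indicator E :: real^2 => real) \<in> borel_measurable Leb"
      unfolding E_def by (intro measurable_restrict_space1 borel_measurable_indicator layer_lebesgue)
     then show ?thesis by measurable
    qed
    have EL: "(?E u) \<in> L2 Leb" if "u \<in> L2 Leb" for u
     by (rule L2_mult_bounded(1)[OF that Em, of 1]) (auto simp: indicator_def)
    have En: "L2_norm Leb (?E u) = sqrt (\<integral>x. indicator E x * cmod2 (u x) \<partial>Leb)" for u
     unfolding L2_norm_def by (intro arg_cong[where f = sqrt] lint_cong) (auto simp: norm_mult power_mult_distrib indicator_def)
    have pw: "norm ((a x * gb t x) *\<^sub>R (nv v x * \<phi> x)) <= (M / t) * (cmod (?E (nv v) x) * cmod (?E \<phi> x))"
     if x: "x \<in> Om" for x
    proof (cases "a x * gb t x = 0")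
     case True
     then show ?thesis using M(1) t by (simp only: scaleR_zero_left norm_zero) simp
    next
     case False
     then have "x \<in> W" "a x ~= 0" "step' (- \<rho> x / t - 1) ~= 0" by (auto simp: gb_def indicator_def split: if_splits)
     then have "- \<rho> x / t - 1 < 1" "dist p x < 2 * r" using step'_eq_0[of "- \<rho> x / t - 1"] a(2) by (auto simp: dist_commute not_le[symmetric])
     then have "- \<rho> x <= 2 * t" using t by (simp add: field_simps)
     then have "x \<in> E" using x \<open>dist p x < 2 * r\<close> by (simp add: E_def layer_def)
     have "\<bar>a x * gb t x\<bar> <= 1 * (M / t)" by (rule bmult[OF a(3) gbb[OF t(1)]])
     then have "\<bar>a x * gb t x\<bar> * (cmod (nv v x) * cmod (\<phi> x)) <= (M / t) * (cmod (nv v x) * cmod (\<phi> x))" by (intro mult_right_mono) auto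
     then show ?thesis using \<open>x \<in> E\<close> unfolding norm_scaleR norm_mult by simp
    qed
    have "norm (R t) <= (\<integral>x. norm ((a x * gb t x) *\<^sub>R (nv v x * \<phi> x)) \<partial>Leb)"
     unfolding R_def by (rule integral_norm_bound)
    also have "... <= (\<integral>x. (M / t) * (cmod (?E (nv v) x) * cmod (?E \<phi> x)) \<partial>Leb)"
    proof (rule integral_mono_AE')
     show "integrable Leb (%x. (M / t) * (cmod (?E (nv v) x) * cmod (?E \<phi> x)))"
      by (intro integrable_mult_right L2_product(1) EL nvL pL)
     show "AE x in Leb. norm ((a x * gb t x) *\<^sub>R (nv v x * \<phi> x)) <= (M / t) * (cmod (?E (nv v) x) * cmod (?E \<phi> x))"
      by (rule AE_I2) (rule pw, simp)
     show "AE x in Leb. 0 <= (M / t) * (cmod (?E (nv v) x) * cmod (?E \<phi> x))"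
      using M(1) t by (intro AE_I2 mult_nonneg_nonneg) auto
    qed
    also have "... = (M / t) * (\<integral>x. cmod (?E (nv v) x) * cmod (?E \<phi> x) \<partial>Leb)"
     by (rule Bochner_Integration.integral_mult_right_zero)
    also have "... <= (M / t) * (sqrt (\<integral>x. indicator E x * cmod2 (nv v x) \<partial>Leb) * sqrt (\<integral>x. indicator E x * cmod2 (\<phi> x) \<partial>Leb))"
     using L2_product(2)[OF EL[OF nvL] EL[OF pL]] M(1) t unfolding En by (intro mult_left_mono) auto
    also have "... <= (M / t) * (sqrt (K * (2 * t) * \<delta>) * sqrt (B * (2 * t) * bl_energy \<phi> d\<phi>))"
    proof (intro mult_left_mono mult_mono real_sqrt_le_mono)
     show "(\<integral>x. indicator E x * cmod2 (nv v x) \<partial>Leb) <= K * (2 * t) * \<delta>" unfolding E_def by (rule t0(2)) (use t in auto)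
     show "(\<integral>x. indicator E x * cmod2 (\<phi> x) \<partial>Leb) <= B * (2 * t) * bl_energy \<phi> d\<phi>" unfolding E_def by (rule B(2)) (use t \<phi> in auto)
    qed (use K(1) M(1) t \<open>\<delta> > 0\<close> in \<open>auto intro!: lint_nonneg\<close>)
    also have "... = M * 2 * (sqrt K * Q) * sqrt \<delta>"
    proof -
     have "sqrt (K * (2 * t) * \<delta>) = sqrt K * sqrt (2 * t) * sqrt \<delta>" by (simp add: real_sqrt_mult)
     moreover have "sqrt (B * (2 * t) * bl_energy \<phi> d\<phi>) = sqrt (2 * t) * Q" by (simp add: Q_def real_sqrt_mult)
     moreover have "sqrt (2 * t) * sqrt (2 * t) = 2 * t" using t by simp
     ultimately show ?thesis using t by (simp add: field_simps)
    qed
    also have "sqrt \<delta> = e / (2 * M * (sqrt K * Q + 1))"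
     unfolding \<delta>_def real_sqrt_abs by (rule abs_of_pos[OF d0])
    also have "M * 2 * (sqrt K * Q) * (e / (2 * M * (sqrt K * Q + 1))) < e"
    proof -
     define y where "y = sqrt K * Q"
     have "y >= 0" using K(1) Q by (simp add: y_def)
     have "M * 2 * y * (e / (2 * M * (y + 1))) = ((2 * M) * (y * e)) / ((2 * M) * (y + 1))" by (simp only: times_divide_eq_right mult_ac)
     also have "... = (y * e) / (y + 1)" using M(1) by (subst mult_divide_mult_cancel_left) auto
     also have "... = e * (y / (y + 1))" by simp
     also have "... < e * 1" using \<open>y >= 0\<close> \<open>e > 0\<close> by (intro mult_strict_left_mono) auto
     finally show ?thesis by (simp add: y_def)
    qed
    finally show ?case by (simp add: t_def)
   qed
  qed
  then show ?thesis by (intro tendstoI) (simp add: dist_norm)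
 qed
 have "(%n. P (T n)) = (%n. R (T n))" using PR[OF T(1)] by blast
 then show ?thesis using LIMSEQ_unique[OF Plim] Rlim by simp
qed

end

context neumann_field
begin

text \<open>The functions \<open>a\<close> for which the pairing with \<open>a \<phi>\<close> vanishes are closed under \<open>a + b - a b\<close>, which glues the local statements to \<open>a = 1\<close> on the closure.\<close>
lemma neumann_green:
 assumes \<phi>: "!!j. weak j \<phi> (d\<phi> j)"
 shows "div_pairing v dv \<phi> d\<phi> = 0"
proof -
 define good where "good a \<longleftrightarrow> C1_on UNIV a \<and> (\<forall>\<phi> d\<phi>. (\<forall>j. weak j \<phi> (d\<phi> j)) -->
  div_pairing v dv (%x. a x *\<^sub>R \<phi> x) (%j x. a x *\<^sub>R d\<phi> j x + partial j a x *\<^sub>R \<phi> x) = 0)" for a :: "real^2 => real"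
 have "\<forall>y\<in>closure Om. \<exists>e a. e > 0 \<and> good a \<and> (\<forall>x\<in>ball y e. a x = 1)"
 proof
  fix y assume y: "y \<in> closure Om"
  show "\<exists>e a. e > 0 \<and> good a \<and> (\<forall>x\<in>ball y e. a x = 1)"
  proof (cases "y \<in> Om")
   case True
   then obtain e0 where e0: "e0 > 0" "cball y e0 \<subseteq> Om" using open_domain open_contains_cball by blast
   define e where "e = e0 / 2"
   have e: "e > 0" "cball y (2 * e) \<subseteq> Om" using e0 by (auto simp: e_def)
   obtain a :: "real^2 => real" where a: "C1_on UNIV a" "!!x. 0 <= a x" "!!x. a x <= 1" "!!x. dist x y <= e ==> a x = 1" "!!x. dist x y >= 2 * e ==> a x = 0"
    using bump_exists[OF e(1), of y] by blast
   have "C1_compact Om a"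
    unfolding C1_compact_def using a(1,5) e(2) by (intro conjI exI[of _ "cball y (2 * e)"]) (auto simp: dist_commute)
   then have "good a" unfolding good_def using a(1) div_pairing_interior[of a v dv] field_div by blast
   then show ?thesis using e(1) a(4) by (intro exI[of _ e] exI[of _ a]) (auto simp: dist_commute)
  next
   case False
   then have "y \<in> frontier Om" using y open_domain by (simp add: frontier_def interior_open)
   then obtain r \<rho> k \<sigma> c C where "boundary_chart Om y r \<rho> k \<sigma> c C" using boundary_chart_exists by blast
   then interpret neumann_chart Om v dv g y r \<rho> k \<sigma> c C by unfold_locales
   obtain a :: "real^2 => real" where a: "C1_on UNIV a" "!!x. 0 <= a x" "!!x. a x <= 1" "!!x. dist x y <= r ==> a x = 1" "!!x. dist x y >= 2 * r ==> a x = 0"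
    using bump_exists[OF chart_pos(1), of y] by blast
   have "\<forall>x. dist x y >= 2 * r --> a x = 0" "!!x. \<bar>a x\<bar> <= 1" using a by auto
   then have "good a" unfolding good_def using a(1) div_pairing_boundary by blast
   then show ?thesis using chart_pos(1) a(4) by (intro exI[of _ r] exI[of _ a]) (auto simp: dist_commute)
  qed
 qed
 from bchoice[OF this] obtain e where "\<forall>y\<in>closure Om. \<exists>a. e y > 0 \<and> good a \<and> (\<forall>x\<in>ball y (e y). a x = 1)" by blast
 from bchoice[OF this] obtain a where "\<forall>y\<in>closure Om. e y > 0 \<and> good (a y) \<and> (\<forall>x\<in>ball y (e y). a y x = 1)" by blast
 then have ea: "!!y. y \<in> closure Om ==> e y > 0" "!!y. y \<in> closure Om ==> good (a y)" "!!y x. y \<in> closure Om ==> x \<in> ball y (e y) ==> a y x = 1"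
  by blast+
 have "closure Om \<subseteq> (\<Union>y\<in>closure Om. ball y (e y))" using ea(1) by force
 then obtain Y where Y: "Y \<subseteq> closure Om" "finite Y" "closure Om \<subseteq> (\<Union>y\<in>Y. ball y (e y))"
  using compactE_image[OF closure_compact, of "closure Om" "%y. ball y (e y)"] by auto
 have main: "\<exists>\<psi> d\<psi>. (\<forall>j. weak j \<psi> (d\<psi> j)) \<and> div_pairing v dv \<psi> d\<psi> = div_pairing v dv \<phi> d\<phi> \<and> (\<forall>y\<in>Z. \<forall>x\<in>ball y (e y). \<psi> x = 0)"
  if "finite Z" "Z \<subseteq> closure Om" for Z
  using that
 proof (induction Z)
  case empty
  then show ?case using \<phi> by blast
 next
  case (insert y Z)
  then obtain \<psi> d\<psi> where \<psi>': "(\<forall>j. weak j \<psi> (d\<psi> j)) \<and> div_pairing v dv \<psi> d\<psi> = div_pairing v dv \<phi> d\<phi> \<and> (\<forall>y\<in>Z. \<forall>x\<in>ball y (e y). \<psi> x = 0)"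
   by blast
  then have \<psi>: "!!j. weak j \<psi> (d\<psi> j)" "div_pairing v dv \<psi> d\<psi> = div_pairing v dv \<phi> d\<phi>" "!!y x. y \<in> Z ==> x \<in> ball y (e y) ==> \<psi> x = 0"
   by blast+
  have y: "y \<in> closure Om" using insert by simp
  have g: "C1_on UNIV (a y)" using ea(2)[OF y] by (simp add: good_def)
  obtain Ca where Ca: "Ca >= 0" "!!x. x \<in> Om ==> \<bar>a y x\<bar> <= Ca" "!!x j. x \<in> Om ==> \<bar>partial j (a y) x\<bar> <= Ca" using C1_bounded_on_domain[OF g] by blast
  have w: "weak j (%x. a y x *\<^sub>R \<psi> x) (%x. a y x *\<^sub>R d\<psi> j x + partial j (a y) x *\<^sub>R \<psi> x)" for j
   by (rule weak_mult_C1_real[OF \<psi>(1) C1_on_subset[OF g subset_UNIV], of Ca]) (use Ca(2,3) in auto)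
  have z: "div_pairing v dv (%x. a y x *\<^sub>R \<psi> x) (%j x. a y x *\<^sub>R d\<psi> j x + partial j (a y) x *\<^sub>R \<psi> x) = 0"
   using ea(2)[OF y] \<psi>(1) unfolding good_def by blast
  have "div_pairing v dv (%x. \<psi> x - a y x *\<^sub>R \<psi> x) (%j x. d\<psi> j x - (a y x *\<^sub>R d\<psi> j x + partial j (a y) x *\<^sub>R \<psi> x)) = div_pairing v dv \<phi> d\<phi>"
   by (subst div_pairing_diff) (use weakD(1)[OF field_div] weakD(2)[OF field_div] weakD[OF \<psi>(1)] weakD[OF w] z \<psi>(2) in auto)
  moreover have "weak j (%x. \<psi> x - a y x *\<^sub>R \<psi> x) (%x. d\<psi> j x - (a y x *\<^sub>R d\<psi> j x + partial j (a y) x *\<^sub>R \<psi> x))" for j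
   by (rule weak_diff[OF \<psi>(1) w])
  moreover have "\<psi> x - a y x *\<^sub>R \<psi> x = 0" if "y' \<in> insert y Z" "x \<in> ball y' (e y')" for y' x
   using that ea(3)[OF y, of x] \<psi>(3)[of y' x] by auto
  ultimately show ?case
   by (intro exI[of _ "%x. \<psi> x - a y x *\<^sub>R \<psi> x"] exI[of _ "%j x. d\<psi> j x - (a y x *\<^sub>R d\<psi> j x + partial j (a y) x *\<^sub>R \<psi> x)"]) blast
 qed
 obtain \<psi> d\<psi> where \<psi>: "!!j. weak j \<psi> (d\<psi> j)" "div_pairing v dv \<psi> d\<psi> = div_pairing v dv \<phi> d\<phi>" "!!y x. y \<in> Y ==> x \<in> ball y (e y) ==> \<psi> x = 0"
  using main[OF Y(2,1)] by blast
 have zero: "\<psi> x = 0" if "x \<in> Om" for x using \<psi>(3) Y(3) closure_subset that by blast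
 have d0: "AE x in Leb. d\<psi> j x = 0" for j
 proof -
  have "(\<integral>x. f x *\<^sub>R \<psi> x \<partial>Leb) = (\<integral>x. f x *\<^sub>R 0 \<partial>Leb)" for f :: "real^2 => real"
   by (intro lint_cong) (auto simp: zero)
  then have "weak j \<psi> (%x. 0)"
   unfolding has_weak_partial_def using weakD(1)[OF \<psi>(1)] L2_zero by simp
  from weak_partial_unique[OF \<psi>(1) this] show ?thesis .
 qed
 have "(\<integral>x. dv j x * \<psi> x \<partial>Leb) = 0" for j
 proof -
  have "(\<integral>x. dv j x * \<psi> x \<partial>Leb) = (\<integral>x. 0 \<partial>Leb)"
   by (intro lint_cong) (auto simp: zero)
  then show ?thesis by simp
 qed
 moreover have "(\<integral>x. v j x * d\<psi> j x \<partial>Leb) = 0" for j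
 proof (rule integral_eq_zero_AE)
  show "AE x in Leb. v j x * d\<psi> j x = 0" using d0[of j] by eventually_elim simp
 qed
 ultimately have "div_pairing v dv \<psi> d\<psi> = 0" by (simp add: div_pairing_def)
 then show ?thesis using \<psi>(2) by simp
qed

end

section \<open>The distance to a finite set\<close>

lemma grad_component: "grad f x $ j = partial j f x"
 by (simp add: grad_def)

lemma eventually_nearest:
 fixes x :: "'a::heine_borel"
 assumes "finite S" "a \<in> S" "!!b. b \<in> S ==> b ~= a ==> dist x a < dist x b"
 shows "\<forall>\<^sub>F y in nhds x. infdist y S = dist y a"
proof -
 have "\<forall>\<^sub>F y in nhds x. dist y a < dist y b" if "b \<in> S - {a}" for b
 proof -
  have "((%y. dist y b - dist y a) \<longlongrightarrow> dist x b - dist x a) (nhds x)" by (intro tendsto_intros filterlim_ident)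
  from order_tendstoD(1)[OF this, of 0] show ?thesis using assms(3)[of b] that by simp
 qed
 then have "\<forall>\<^sub>F y in nhds x. \<forall>b\<in>S - {a}. dist y a < dist y b" by (intro eventually_ball_finite) (use assms(1) in auto)
 then show ?thesis
 proof eventually_elim
  case (elim y)
  obtain b where b: "b \<in> S" "infdist y S = dist y b"
   using infdist_attains_inf[OF finite_imp_closed[OF assms(1)], where y = y] assms(2) by blast
  show ?case
  proof (cases "b = a")
   case False
   then have "dist y a < dist y b" using elim b(1) by blast
   then show ?thesis using b(2) infdist_le[OF assms(2), of y] by simp
  qed (use b in simp)
 qed
qed

lemma bisector_negligible:
 fixes a b :: "real^2"
 assumes "a ~= b"
 shows "negligible {x. dist x a = dist x b}"
proof -
 have "dist x a = dist x b \<longleftrightarrow> (2 *\<^sub>R (b - a)) \<bullet> x = b \<bullet> b - a \<bullet> a" for x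
  by (simp add: dist_norm norm_eq inner_diff_left inner_diff_right inner_commute algebra_simps)
 then show ?thesis using negligible_hyperplane[of "2 *\<^sub>R (b - a)" "b \<bullet> b - a \<bullet> a"] assms by auto
qed

lemma C1_on_dist: "a \<notin> W ==> C1_on W (%y. T - dist y a)"
proof (rule C1_onI[where F = "%y h. - (sgn (y - a) \<bullet> h)"])
 fix y assume "a \<notin> W" "y \<in> W"
 then have "(norm has_derivative (%h. h \<bullet> sgn (y - a))) (at (y - a))"
  using GDERIV_norm[of "y - a"] by (auto simp: gderiv_def)
 from has_derivative_diff[OF has_derivative_const has_derivative_compose[OF has_derivative_diff[OF has_derivative_ident has_derivative_const] this]]
 show "((%y. T - dist y a) has_derivative (%h. - (sgn (y - a) \<bullet> h))) (at y)"
  unfolding dist_norm by (simp add: inner_commute)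
qed (auto intro!: continuous_intros)

lemma conv_locally_C1_tendsto:
 fixes R :: "real^2 => real"
 assumes R: "integrable lborel R" and W: "open W" "x \<in> W" and f: "C1_on W f" "!!y. y \<in> W ==> R y = f y"
  and eta: "!!n. mollifier (ep n) (\<eta> n)" "ep \<longlonglongrightarrow> 0"
 shows "(%n. partial j (conv R (\<eta> n)) x) \<longlonglongrightarrow> partial j f x"
proof -
 obtain d where d: "d > 0" "cball x d \<subseteq> W" using W by (meson open_contains_cball)
 define r where "r = d / 3"
 have r: "r > 0" "cball x (2 * r) \<subseteq> W" using d by (auto simp: r_def)
 obtain b :: "real^2 => real" where b: "C1_on UNIV b" "!!x. 0 <= b x" "!!x. b x <= 1" "!!y. dist y x <= r ==> b y = 1" "!!y. dist y x >= 2 * r ==> b y = 0"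
  using bump_exists[OF r(1), of x] by blast
 have bC: "C1_compact W b" unfolding C1_compact_def
  using b(1,5) r(2) by (intro conjI exI[of _ "cball x (2 * r)"]) (auto simp: dist_commute)
 define \<phi> where "\<phi> y = b y * f y" for y
 note p = C1_compact_bilinear[OF bounded_bilinear_mult W(1) bC f(1)]
 have \<phi>C: "C1_compact UNIV \<phi>" unfolding \<phi>_def[abs_def] by (rule C1_compact_mono[OF p(1) subset_UNIV])
 have near: "\<phi> y = f y" "R y = \<phi> y" if "dist y x <= r" for y
  using b(4)[OF that] f(2)[of y] r that by (auto simp: \<phi>_def subset_iff dist_commute)
 from \<phi>C obtain K where K: "compact K" "K \<subseteq> UNIV" "!!y. y \<notin> K ==> \<phi> y = 0" "!!y j. y \<notin> K ==> partial j \<phi> y = 0"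
  by (rule C1_compactE) blast
 have \<phi>i: "integrable lborel \<phi>" by (rule integrable_compact_support[OF C1_on_continuous[OF C1_compactD[OF \<phi>C]] K(1,3)])
 have "\<forall>\<^sub>F n in sequentially. ep n < r / 2" using order_tendstoD(2)[OF eta(2), of "r / 2"] r(1) by simp
 then have "\<forall>\<^sub>F n in sequentially. conv (partial j \<phi>) (\<eta> n) x = partial j (conv R (\<eta> n)) x"
 proof eventually_elim
  case (elim n)
  note m = mollifierD[OF eta(1)[of n]]
  have "conv R (\<eta> n) y = conv \<phi> (\<eta> n) y" if "y \<in> ball x (r / 2)" for y
  proof -
   have "conv (%y. R y - \<phi> y) (\<eta> n) y = 0"
   proof (rule conv_support[OF m(4)])
    fix z assume "z \<in> ball y (ep n)"
    then have "dist z x <= r" using that elim dist_triangle[of z x y] by (simp add: dist_commute)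
    then show "R z - \<phi> z = 0" using near(2) by simp
   qed
   then show ?thesis using conv_diff[OF R \<phi>i m(2), of y] by simp
  qed
  then have "partial j (conv R (\<eta> n)) x = partial j (conv \<phi> (\<eta> n)) x"
   by (intro partial_cong_open(1)[of "ball x (r / 2)"]) (use r(1) in auto)
  also have "... = conv (partial j \<phi>) (\<eta> n) x"
   unfolding partial_conv[OF \<phi>i m(2)] by (rule conv_partial_commute[OF \<phi>C eta(1)])
  finally show ?case by simp
 qed
 moreover have "(%n. conv (partial j \<phi>) (\<eta> n) x) \<longlonglongrightarrow> partial j \<phi> x"
  by (rule conv_tendsto[OF C1_on_partial[OF C1_compactD[OF \<phi>C]] K(1,4) eta])
 moreover have "partial j \<phi> x = partial j f x"
  by (rule partial_cong_open(1)[of "ball x r"]) (use near(1) r(1) in \<open>auto simp: dist_commute\<close>)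
 ultimately show ?thesis by (simp add: Lim_transform_eventually)
qed

context planar_domain
begin

text \<open>Mollify the distance, truncated at large values to have compact support after a change of sign. Off the bisectors it is locally the distance to one point, so there the derivatives converge.\<close>
lemma smooth_distance:
 assumes S: "finite S" "S ~= {}"
 obtains F T and G :: "2 => real^2 => real" where "!!n. C1_on UNIV (F n)" "!!x. x \<in> Om ==> infdist x S <= T" "T >= 0"
  "!!n x. \<bar>F n x - min (infdist x S) T\<bar> <= 1 / real (Suc n)"
  "!!n x j. \<bar>partial j (F n) x\<bar> <= 1" "!!x j. \<bar>G j x\<bar> <= 1" "!!j. G j \<in> borel_measurable Leb"
  "!!j. AE x in Leb. (%n. partial j (F n) x) \<longlonglongrightarrow> G j x"
proof -
 have "bounded ((%x. infdist x S) ` closure Om)"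
  using bounded_domain by (intro compact_imp_bounded compact_continuous_image continuous_intros) simp
 then obtain T0 where T0: "!!x. x \<in> closure Om ==> \<bar>infdist x S\<bar> <= T0" unfolding bounded_iff by auto
 define T where "T = \<bar>T0\<bar> + 1"
 have T: "T > 0" "!!x. x \<in> Om ==> infdist x S < T" using T0 closure_subset unfolding T_def by force+
 define R where "R x = max 0 (T - infdist x S)" for x
 have R0: "T - R x = min (infdist x S) T" for x by (simp add: R_def min_def max_def)
 have lip: "norm (R x - R y) <= 1 * norm (x - y)" for x y
  using infdist_triangle[of x S y] infdist_triangle[of y S x] by (simp add: R_def dist_norm norm_minus_commute abs_le_iff max_def)
 have K: "compact {x. infdist x S <= T}" by (rule compact_infdist_le[OF S(2) finite_imp_compact[OF S(1)] T(1)])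
 have Ri: "integrable lborel R"
  by (rule integrable_compact_support[OF _ K]) (auto simp: R_def intro!: continuous_intros)
 have "\<forall>n. \<exists>\<eta>. mollifier (1 / real (Suc n)) \<eta>" using mollifier_exists by (metis of_nat_0_less_iff zero_less_Suc zero_less_divide_1_iff)
 then obtain \<eta> where eta: "!!n. mollifier (1 / real (Suc n)) (\<eta> n)" by (auto simp: choice_iff simp del: of_nat_Suc)
 have e0: "(%n. 1 / real (Suc n)) \<longlonglongrightarrow> 0" using LIMSEQ_inverse_real_of_nat by (simp add: divide_inverse)
 define F where "F n x = T - conv R (\<eta> n) x" for n x
 have cC: "C1_on UNIV (conv R (\<eta> n))" for n by (rule smooth_on_C1_on[OF smooth_conv[OF Ri mollifierD(1)[OF eta]]])
 have Fp: "partial j (F n) x = - partial j (conv R (\<eta> n)) x" for j n x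
  unfolding F_def[abs_def] using C1_on_diff(2)[OF C1_on_const[of _ T] cC[of n]] by (simp add: partial_def)
 define G where "G j x = max (- 1) (min 1 (lim (%n. partial j (F n) x)))" for j x
 have F1: "C1_on UNIV (F n)" for n unfolding F_def[abs_def] by (rule C1_on_diff(1)[OF C1_on_const cC])
 have Fb: "\<bar>partial j (F n) x\<bar> <= 1" for j n x unfolding Fp using conv_Lipschitz[OF Ri eta lip, of j n x] by simp
 have Fr: "\<bar>F n x - min (infdist x S) T\<bar> <= 1 / real (Suc n)" for n x
 proof -
  have "norm (conv R (\<eta> n) x - R x) <= 1 / real (Suc n)"
  proof (rule conv_close[OF Ri eta])
   fix y assume "norm (x - y) < 1 / real (Suc n)"
   then show "norm (R y - R x) <= 1 / real (Suc n)" using lip[of y x] norm_minus_commute[of x y] by linarith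
  qed
  then show ?thesis unfolding R0[symmetric] F_def by (simp add: abs_minus_commute)
 qed
 define N where "N = S \<union> (\<Union>a\<in>S. \<Union>b\<in>S - {a}. {x. dist x a = dist x b})"
 have "negligible (\<Union>a\<in>S. \<Union>b\<in>S - {a}. {x. dist x a = dist x b})"
  using S(1) by (auto intro!: negligible_Union bisector_negligible)
 then have "negligible N" unfolding N_def by (rule negligible_Un[OF negligible_finite[OF S(1)]])
 then have N: "N \<in> null_sets lebesgue" by (simp add: negligible_iff_null_sets)
 have conv: "(%n. partial j (F n) x) \<longlonglongrightarrow> G j x" if x: "x \<in> Om" "x \<notin> N" for x j
 proof -
  obtain a where a: "a \<in> S" "infdist x S = dist x a"
   using infdist_attains_inf[OF finite_imp_closed[OF S(1)] S(2), of x] by blast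
  have "dist x a < dist x b" if "b \<in> S" "b ~= a" for b
   using infdist_le[OF that(1), of x] a x(2) that by (auto simp: N_def less_le)
  then have "\<forall>\<^sub>F y in nhds x. infdist y S = dist y a" by (rule eventually_nearest[OF S(1) a(1)])
  moreover have "\<forall>\<^sub>F y in nhds x. dist y a < T"
   by (rule order_tendstoD(2)[OF tendsto_dist[OF filterlim_ident tendsto_const]]) (use T(2)[OF x(1)] a(2) in simp)
  moreover have "\<forall>\<^sub>F y in nhds x. y ~= a" using t1_space_nhds[of x a] a(1) x(2) by (auto simp: N_def)
  ultimately have "\<forall>\<^sub>F y in nhds x. R y = T - dist y a \<and> y ~= a" by eventually_elim (simp add: R_def)
  then obtain W where W: "open W" "x \<in> W" "!!y. y \<in> W ==> R y = T - dist y a \<and> y ~= a" unfolding eventually_nhds by blast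
  have "a \<notin> W" using W(3) by blast
  from conv_locally_C1_tendsto[OF Ri W(1,2) C1_on_dist[OF this] _ eta e0] W(3)
  have "(%n. partial j (conv R (\<eta> n)) x) \<longlonglongrightarrow> partial j (%y. T - dist y a) x" by blast
  then have l: "(%n. partial j (F n) x) \<longlonglongrightarrow> - partial j (%y. T - dist y a) x" unfolding Fp by (rule tendsto_minus)
  have "\<bar>- partial j (%y. T - dist y a) x\<bar> <= 1"
   by (rule LIMSEQ_le_const2[OF tendsto_rabs[OF l]]) (use Fb in blast)
  then have "G j x = - partial j (%y. T - dist y a) x" unfolding G_def limI[OF l] by auto
  then show ?thesis using l by simp
 qed
 show thesis
 proof (rule that[of F T G])
  show "infdist x S <= T" if "x \<in> Om" for x using T(2)[OF that] by simp
  show "\<bar>G j x\<bar> <= 1" for j x by (auto simp: G_def)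
  have [measurable]: "partial j (F n) \<in> borel_measurable Leb" for j n by (rule continuous_lebesgue_on[OF C1_on_partial[OF F1]])
  show "G j \<in> borel_measurable Leb" for j unfolding G_def[abs_def] by measurable
  show "AE x in Leb. (%n. partial j (F n) x) \<longlonglongrightarrow> G j x" for j
   unfolding AE_restrict_space_iff[OF domain_lebesgue'] using AE_not_in[OF N] by eventually_elim (use conv in blast)
 qed (use F1 Fr Fb T(1) in auto)
qed

lemma weak_mult_limit:
 fixes E :: "nat => real^2 => real"
 assumes w: "weak j u g" and E: "!!n. C1_on UNIV (E n)" "!!n x. x \<in> Om ==> \<bar>E n x\<bar> <= M" "!!n x. x \<in> Om ==> \<bar>partial j (E n) x\<bar> <= M"
  and e: "e \<in> borel_measurable Leb" "e' \<in> borel_measurable Leb" "!!x. x \<in> Om ==> \<bar>e x\<bar> <= M" "!!x. x \<in> Om ==> \<bar>e' x\<bar> <= M" "M >= 0"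
  and lim: "!!x. x \<in> Om ==> (%n. E n x) \<longlonglongrightarrow> e x" "AE x in Leb. (%n. partial j (E n) x) \<longlonglongrightarrow> e' x"
 shows "weak j (%x. e x *\<^sub>R u x) (%x. e x *\<^sub>R g x + e' x *\<^sub>R u x)"
proof -
 let ?d = "%n x. (E n x *\<^sub>R g x + partial j (E n) x *\<^sub>R u x) - (e x *\<^sub>R g x + e' x *\<^sub>R u x)"
 note L = weakD[OF w]
 have wn: "weak j (%x. E n x *\<^sub>R u x) (%x. E n x *\<^sub>R g x + partial j (E n) x *\<^sub>R u x)" for n
  by (rule weak_mult_C1_real[OF w C1_on_subset[OF E(1) subset_UNIV] E(2,3)])
 have l2: "(%x. a x *\<^sub>R v x) \<in> L2 Leb" if "a \<in> borel_measurable Leb" "!!x. x \<in> Om ==> \<bar>a x\<bar> <= M" "v \<in> L2 Leb" for a v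
  by (rule L2_dominated(1)[OF _ that(3) e(5)]) (use that(1,2) L2D(1)[OF that(3)] in \<open>auto intro: mult_right_mono\<close>)
 have uL: "(%x. e x *\<^sub>R u x) \<in> L2 Leb" by (rule l2[OF e(1,3) L(1)])
 have gL: "(%x. e x *\<^sub>R g x + e' x *\<^sub>R u x) \<in> L2 Leb" by (rule L2_add[OF l2[OF e(1,3) L(2)] l2[OF e(2,4) L(1)]])
 have d: "cmod (a *\<^sub>R z - b *\<^sub>R z) <= 2 * M * cmod z" if "\<bar>a\<bar> <= M" "\<bar>b\<bar> <= M" for a b and z :: complex
  unfolding scaleR_diff_left[symmetric] norm_scaleR using that by (intro mult_right_mono) auto
 have i: "integrable Leb (%x. (2 * M)^2 * cmod2 (u x))" "integrable Leb (%x. 2 * (2 * M)^2 * cmod2 (g x) + 2 * (2 * M)^2 * cmod2 (u x))"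
  using L2D(2)[OF L(1)] L2D(2)[OF L(2)] by auto
 show ?thesis
 proof (rule weak_limit[OF wn uL gL])
  show "(%n. L2_norm Leb (%x. E n x *\<^sub>R u x - e x *\<^sub>R u x)) \<longlonglongrightarrow> 0"
  proof (rule L2_norm_tendsto_dominated[OF weakD(1)[OF wn] uL i(1)])
   show "AE x in Leb. cmod2 (E n x *\<^sub>R u x - e x *\<^sub>R u x) <= (2 * M)^2 * cmod2 (u x)" for n
   proof (rule AE_I2)
    fix x assume "x \<in> space Leb"
    then have "cmod (E n x *\<^sub>R u x - e x *\<^sub>R u x) <= 2 * M * cmod (u x)" using d[OF E(2) e(3)] by simp
    from power_mono[OF this, of 2] show "cmod2 (E n x *\<^sub>R u x - e x *\<^sub>R u x) <= (2 * M)^2 * cmod2 (u x)"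
     by (simp add: power_mult_distrib)
   qed
   show "AE x in Leb. (%n. E n x *\<^sub>R u x) \<longlonglongrightarrow> e x *\<^sub>R u x" by (intro AE_I2 tendsto_scaleR tendsto_const lim) simp
  qed
  show "(%n. L2_norm Leb (%x. ?d n x)) \<longlonglongrightarrow> 0"
  proof (rule L2_norm_tendsto_dominated[OF weakD(2)[OF wn] gL i(2)])
   show "AE x in Leb. cmod2 (?d n x)
     <= 2 * (2 * M)^2 * cmod2 (g x) + 2 * (2 * M)^2 * cmod2 (u x)" for n
   proof (rule AE_I2)
    fix x assume "x \<in> space Leb"
    then have x: "x \<in> Om" by simp
    have "cmod (?d n x) <= 2 * M * cmod (g x) + 2 * M * cmod (u x)"
     unfolding add_diff_add by (rule order_trans[OF norm_triangle_ineq add_mono[OF d[OF E(2)[OF x] e(3)[OF x]] d[OF E(3)[OF x] e(4)[OF x]]]])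
    from power_mono[OF this, of 2]
    have "cmod2 (?d n x) <= (2 * M * cmod (g x) + 2 * M * cmod (u x))^2" by simp
    also have "... <= 2 * (2 * M * cmod (g x))^2 + 2 * (2 * M * cmod (u x))^2"
     using sum_squares_bound[of "2 * M * cmod (g x)" "2 * M * cmod (u x)"] by (simp add: power2_sum)
    finally show "cmod2 (?d n x)
     <= 2 * (2 * M)^2 * cmod2 (g x) + 2 * (2 * M)^2 * cmod2 (u x)" by (simp only: power_mult_distrib mult.assoc)
   qed
   show "AE x in Leb. (%n. E n x *\<^sub>R g x + partial j (E n) x *\<^sub>R u x) \<longlonglongrightarrow> e x *\<^sub>R g x + e' x *\<^sub>R u x"
    using lim(2) AE_space[of Leb] by eventually_elim (auto intro!: tendsto_intros lim(1))
  qed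
 qed
qed

text \<open>Bounding each derivative of the distance by one gives 2 instead of 1 for the squared gradient; this only changes constants.\<close>
lemma weak_exp_distance:
 assumes "finite S" "S ~= {}"
 obtains G :: "2 => real^2 => real" where "!!x. (\<Sum>j\<in>UNIV. (G j x)^2) <= 2" "!!j. G j \<in> borel_measurable Leb"
  "!!k u g j. 0 <= k ==> weak j u g ==>
   weak j (%x. exp (k * infdist x S) *\<^sub>R u x) (%x. exp (k * infdist x S) *\<^sub>R (g x + (k * G j x) *\<^sub>R u x))"
proof -
 obtain F T and G :: "2 => real^2 => real" where F: "!!n. C1_on UNIV (F n)" "!!x. x \<in> Om ==> infdist x S <= T" "T >= 0"
  "!!n x. \<bar>F n x - min (infdist x S) T\<bar> <= 1 / real (Suc n)"
  "!!n x j. \<bar>partial j (F n) x\<bar> <= 1" "!!x j. \<bar>G j x\<bar> <= 1" "!!j. G j \<in> borel_measurable Leb"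
  "!!j. AE x in Leb. (%n. partial j (F n) x) \<longlonglongrightarrow> G j x"
  by (rule smooth_distance[OF assms]) (rule that)
 have e0: "(%n. 1 / real (Suc n)) \<longlonglongrightarrow> 0" using LIMSEQ_inverse_real_of_nat by (simp add: divide_inverse)
 have tF: "(%n. F n x) \<longlonglongrightarrow> infdist x S" if "x \<in> Om" for x
  by (rule LIM_zero_cancel, rule Lim_null_comparison[OF _ e0]) (use F(4)[of _ x] F(2)[OF that] in \<open>simp add: min_absorb1\<close>)
 have main: "weak j (%x. exp (k * infdist x S) *\<^sub>R u x) (%x. exp (k * infdist x S) *\<^sub>R (g x + (k * G j x) *\<^sub>R u x))"
  if k: "0 <= k" and w: "weak j u g" for k u g j
 proof -
  define M where "M = exp (k * (T + 1))"
  have FT: "F n x <= T + 1" for n x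
  proof -
   have "1 / real (Suc n) <= 1" by simp
   then show ?thesis using F(4)[of n x] by linarith
  qed
  have En: "exp (k * F n x) <= M" for n x unfolding M_def using FT[of n x] k by (simp add: mult_left_mono)
  have E0: "exp (k * infdist x S) <= M" if "x \<in> Om" for x unfolding M_def using F(2)[OF that] k by (simp add: mult_left_mono)
  have M: "M >= 0" "M * (1 + k) >= 0" "M <= M * (1 + k)" "M * k <= M * (1 + k)" using k by (auto simp: M_def)
  have kF: "C1_on UNIV (%x. k * F n x)" "partial j (%x. k * F n x) x = k * partial j (F n) x" for n x
   using C1_on_linear[OF bounded_linear_mult_right[of k] F(1)[of n]] by auto
  have ce: "continuous_on UNIV (%x. exp (k * F n x))" for n by (intro continuous_intros C1_on_continuous[OF F(1)])
  have eF: "C1_on UNIV (%x. exp (k * F n x))" "partial j (%x. exp (k * F n x)) x = exp (k * F n x) * (k * partial j (F n) x)" for n x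
   using C1_on_compose_real[OF kF(1) DERIV_exp ce] kF(2) by auto
  have b: "\<bar>y * (k * z)\<bar> <= M * (1 + k)" if "0 <= y" "y <= M" "\<bar>z\<bar> <= 1" for y z
  proof -
   have "\<bar>y * (k * z)\<bar> <= M * (k * 1)" unfolding abs_mult using that k by (intro mult_mono) auto
   then show ?thesis using M(4) by simp
  qed
  have "weak j (%x. exp (k * infdist x S) *\<^sub>R u x)
    (%x. exp (k * infdist x S) *\<^sub>R g x + (exp (k * infdist x S) * (k * G j x)) *\<^sub>R u x)"
  proof (rule weak_mult_limit[OF w eF(1), where M = "M * (1 + k)"])
   show em: "(%x. exp (k * infdist x S)) \<in> borel_measurable Leb" by (rule continuous_lebesgue_on) (intro continuous_intros)
   show "(%x. exp (k * infdist x S) * (k * G j x)) \<in> borel_measurable Leb" using em F(7)[of j] by measurable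
   show "(%n. exp (k * F n x)) \<longlonglongrightarrow> exp (k * infdist x S)" if "x \<in> Om" for x by (intro tendsto_intros tF that)
   show "AE x in Leb. (%n. partial j (%x. exp (k * F n x)) x) \<longlonglongrightarrow> exp (k * infdist x S) * (k * G j x)"
    unfolding eF(2) using F(8)[of j] AE_space[of Leb] by eventually_elim (auto intro!: tendsto_intros tF)
   show "\<bar>exp (k * F n x)\<bar> <= M * (1 + k)" for n x using En[of n x] M by simp
   show "\<bar>exp (k * infdist x S)\<bar> <= M * (1 + k)" if "x \<in> Om" for x using E0[OF that] M by simp
   show "\<bar>partial j (%x. exp (k * F n x)) x\<bar> <= M * (1 + k)" for n x unfolding eF(2) by (rule b[OF exp_ge_zero En F(5)])
   show "\<bar>exp (k * infdist x S) * (k * G j x)\<bar> <= M * (1 + k)" if "x \<in> Om" for x by (rule b[OF exp_ge_zero E0[OF that] F(6)])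
  qed (rule M(2))
  then show ?thesis by (simp add: scaleR_add_right)
 qed
 have "(\<Sum>j\<in>UNIV. (G j x)^2) <= 2" for x
  using F(6)[of 1 x] F(6)[of 2 x] by (simp add: sum_2 abs_square_le_1[symmetric])
 then show ?thesis using that[of G] F(7) main by blast
qed

end

section \<open>The magnetic field near its critical zeros\<close>

lemma magnetic_field_C1:
 assumes "open U" "smooth_on U A"
 shows "C1_on U (%x. A x $ i)" "x \<in> U ==> magnetic_field A x = partial 2 (%y. A y $ 1) x - partial 1 (%y. A y $ 2) x"
  "C1_on U (magnetic_field A)" "C1_on U (partial j (magnetic_field A))"
proof -
 have bl: "bounded_linear (%v::real^2. v $ i)" for i by (rule bounded_linear_vec_nth)
 have C0: "C1_on U A" and C1: "C1_on U (partial j A)" and C2: "C1_on U (partial k (partial j A))" for j k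
  by (intro smooth_on_C1_on smooth_on_partial assms(2))+
 show "C1_on U (%x. A x $ i)" by (rule C1_on_linear(1)[OF bl C0])
 show "magnetic_field A x = partial 2 (%y. A y $ 1) x - partial 1 (%y. A y $ 2) x" by (simp add: magnetic_field_def)
 have eq: "magnetic_field A x = partial 2 A x $ 1 - partial 1 A x $ 2" if "x \<in> U" for x
  unfolding magnetic_field_def using C1_on_linear(2)[OF bl C0 that] by simp
 note d = C1_on_diff[OF C1_on_linear(1)[OF bl C1[of 2], of 1] C1_on_linear(1)[OF bl C1[of 1], of 2]]
 have "C1_on U (magnetic_field A) \<longleftrightarrow> C1_on U (%x. partial 2 A x $ 1 - partial 1 A x $ 2)"
  by (rule C1_on_cong[OF assms(1)]) (rule eq)
 then show "C1_on U (magnetic_field A)" using d(1) by (rule iffD2)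
 have eq2: "partial j (magnetic_field A) x = partial j (partial 2 A) x $ 1 - partial j (partial 1 A) x $ 2" if "x \<in> U" for x j
 proof -
  have "partial j (magnetic_field A) x = partial j (%x. partial 2 A x $ 1 - partial 1 A x $ 2) x"
   by (rule partial_cong_open(1)[OF assms(1) that]) (rule eq)
  also have "... = partial j (partial 2 A) x $ 1 - partial j (partial 1 A) x $ 2"
   unfolding d(2)[OF that] by (simp only: C1_on_linear(2)[OF bl C1 that])
  finally show ?thesis .
 qed
 have "C1_on U (partial j (magnetic_field A)) \<longleftrightarrow> C1_on U (%x. partial j (partial 2 A) x $ 1 - partial j (partial 1 A) x $ 2)"
  by (rule C1_on_cong[OF assms(1)]) (rule eq2)
 then show "C1_on U (partial j (magnetic_field A))"
  using C1_on_diff(1)[OF C1_on_linear(1)[OF bl C2[of j 2], of 1] C1_on_linear(1)[OF bl C2[of j 1], of 2]] by (rule iffD2)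
qed

lemma distinct_eigenvalues_invertible:
 fixes H :: "real^2^2"
 assumes "eigenvalue H a" "eigenvalue H b" "a ~= b" "a ~= 0" "b ~= 0"
 shows "inj ((*v) (transpose H))"
proof -
 obtain e f where e: "e ~= 0" "H *v e = a *\<^sub>R e" and f: "f ~= 0" "H *v f = b *\<^sub>R f"
  using assms(1,2) unfolding eigenvalue_def by blast
 have "w = 0" if w: "transpose H *v w = 0" for w
 proof (rule ccontr)
  assume "w ~= 0"
  have orth: "w \<bullet> (H *v x) = 0" for x
   using w by (simp add: dot_lmul_matrix[symmetric] transpose_matrix_vector)
  have "w \<bullet> e = 0" "w \<bullet> f = 0" using orth[of e] orth[of f] e(2) f(2) assms(4,5) by auto
  then have o: "w $ 1 * e $ 1 + w $ 2 * e $ 2 = 0" "w $ 1 * f $ 1 + w $ 2 * f $ 2 = 0" by (simp_all add: inner_vec_def sum_2)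
  have "w $ 1 * (e $ 1 * f $ 2 - e $ 2 * f $ 1) = 0" "w $ 2 * (e $ 1 * f $ 2 - e $ 2 * f $ 1) = 0"
   using o by algebra+
  then have par: "e $ 1 * f $ 2 = e $ 2 * f $ 1" using \<open>w ~= 0\<close> by (auto simp: vec_eq_iff forall_2)
  have k: "f $ k *\<^sub>R e = e $ k *\<^sub>R f" for k :: 2
   using par exhaust_2[of k] by (auto simp: vec_eq_iff forall_2 algebra_simps)
  have "f $ k = 0" for k
  proof -
   have "(a * f $ k) *\<^sub>R e = H *v (f $ k *\<^sub>R e)" using e(2) by (simp add: matrix_vector_mult_scaleR)
   also have "... = b *\<^sub>R (e $ k *\<^sub>R f)" unfolding k using f(2) by (simp add: matrix_vector_mult_scaleR)
   also have "... = (b * f $ k) *\<^sub>R e" unfolding k[symmetric] by simp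
   finally show ?thesis using e(1) assms(3) by simp
  qed
  then show False using f(1) by (simp add: vec_eq_iff)
 qed
 then show ?thesis
  by (intro linear_injective_0[THEN iffD2] matrix_vector_mul_linear allI impI) blast+
qed

lemma compact_uniform_constant:
 fixes K :: "'a::metric_space set" and P :: "real => 'a => bool"
 assumes "compact K" "!!p. p \<in> K ==> \<exists>c>0. \<forall>\<^sub>F x in nhds p. x \<in> K --> P c x"
  and mono: "!!c c' x. 0 < c' ==> c' <= c ==> P c x ==> P c' x"
 obtains c where "c > 0" "!!x. x \<in> K ==> P c x"
proof -
 have "\<forall>p\<in>K. \<exists>c T. c > 0 \<and> open T \<and> p \<in> T \<and> (\<forall>x\<in>T. x \<in> K --> P c x)"
  using assms(2) unfolding eventually_nhds by blast
 then obtain c T where cT: "!!p. p \<in> K ==> c p > 0 \<and> open (T p) \<and> p \<in> T p \<and> (\<forall>x\<in>T p. x \<in> K --> P (c p) x)"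
  unfolding bchoice_iff by blast
 obtain D where D: "D \<subseteq> K" "finite D" "K \<subseteq> (\<Union>p\<in>D. T p)"
  using compactE_image[OF assms(1), of K T] cT by blast
 define m where "m = Min (insert 1 (c ` D))"
 have m: "m > 0" "!!p. p \<in> D ==> m <= c p" unfolding m_def using D(1,2) cT by auto
 show thesis
 proof (rule that[OF m(1)])
  fix x assume "x \<in> K"
  then obtain p where p: "p \<in> D" "x \<in> T p" using D(3) by blast
  then have "P (c p) x" using cT D(1) \<open>x \<in> K\<close> by blast
  then show "P m x" using mono[OF m(1) m(2)[OF p(1)]] by blast
 qed
qed

text \<open>The gradient is differentiable with invertible derivative, the transposed Hessian.\<close>
lemma nondegenerate_critical_zero:
 fixes f :: "real^2 => real"
 assumes "open U" "p \<in> U" "!!j. C1_on U (partial j f)" "grad f p = 0" "inj ((*v) (transpose (hessian f p)))"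
 obtains c where "c > 0" "\<forall>\<^sub>F x in nhds p. c * dist x p <= norm (grad f x) \<and> norm (grad f x) <= dist x p / c"
proof -
 let ?T = "%v. transpose (hessian f p) *v v"
 have lin: "linear ?T" by (rule matrix_vector_mul_linear)
 obtain b where b: "b > 0" "!!v. b * norm v <= norm (?T v)"
  using linear_inj_bounded_below_pos[OF lin assms(5)] by (metis mult.commute)
 obtain B where B: "B > 0" "!!v. norm (?T v) <= B * norm v"
  using linear_bounded_pos[OF lin] by blast
 have "(grad f has_derivative ?T) (at p)"
 proof (subst has_derivative_componentwise_within, intro ballI)
  fix i :: "real^2" assume "i \<in> Basis"
  then obtain j where j: "i = axis j 1" by (auto simp: Basis_vec_def)
  have "(partial j f has_derivative (%h. \<Sum>i\<in>UNIV. h $ i *\<^sub>R partial i (partial j f) p)) (at p)"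
   by (rule C1_on_has_derivative[OF assms(3,2)])
  moreover have "(%h. \<Sum>i\<in>UNIV. h $ i *\<^sub>R partial i (partial j f) p) = (%h. ?T h \<bullet> i)"
   by (auto simp: j inner_axis matrix_vector_mult_def transpose_def hessian_def mult.commute)
  moreover have "partial j f = (%x. grad f x \<bullet> i)" by (auto simp: j inner_axis grad_def)
  ultimately show "((%x. grad f x \<bullet> i) has_derivative (%x. ?T x \<bullet> i)) (at p)" by simp
 qed
 then obtain d where d: "d > 0" "!!y. norm (y - p) < d ==> norm (grad f y - grad f p - ?T (y - p)) <= (b / 2) * norm (y - p)"
  unfolding has_derivative_at_alt using b(1) by (meson half_gt_zero)
 define c where "c = min (b / 2) (1 / (B + b))"
 have c: "c > 0" using b B by (simp add: c_def)
 show thesis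
 proof (rule that[OF c], unfold eventually_nhds_metric, intro exI[of _ d] conjI d(1) allI impI)
  fix x assume "dist x p < d"
  then have *: "norm (grad f x - ?T (x - p)) <= (b / 2) * norm (x - p)" using d(2)[of x] assms(4) by (simp add: dist_norm)
  have "norm (?T (x - p)) <= norm (grad f x) + norm (grad f x - ?T (x - p))" by (metis norm_minus_commute norm_triangle_sub)
  then have "(b / 2) * norm (x - p) <= norm (grad f x)" using * b(2)[of "x - p"] by (simp add: field_simps)
  moreover have "c * norm (x - p) <= (b / 2) * norm (x - p)" by (intro mult_right_mono) (auto simp: c_def)
  ultimately show "c * dist x p <= norm (grad f x)" by (simp add: dist_norm)
  have "norm (grad f x) <= norm (?T (x - p)) + norm (grad f x - ?T (x - p))" by (rule norm_triangle_sub)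
  also have "... <= (B + b) * norm (x - p)" using * B(2)[of "x - p"] b(1) by (simp add: field_simps) (smt (verit) norm_ge_zero mult_nonneg_nonneg)
  also have "... <= (1 / c) * norm (x - p)"
  proof (rule mult_right_mono)
   have "c * (B + b) <= 1 / (B + b) * (B + b)" using b B by (intro mult_right_mono) (auto simp: c_def)
   then show "B + b <= 1 / c" using b B c by (simp add: field_simps)
  qed simp
  finally show "norm (grad f x) <= dist x p / c" by (simp add: dist_norm)
 qed
qed

text \<open>Near a critical zero this is the nondegeneracy; elsewhere the function or its gradient does not vanish, and compactness gives a uniform constant.\<close>
lemma critical_zero_estimate:
 assumes "open U" "compact K" "K \<subseteq> U" and f: "C1_on U f" "!!j. C1_on U (partial j f)"
  and S: "S = {x \<in> K. f x = 0 \<and> grad f x = 0}" "finite S" "S ~= {}" "!!x. x \<in> S ==> inj ((*v) (transpose (hessian f x)))"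
 obtains c where "c > 0" "!!x. x \<in> K ==> norm (grad f x) <= infdist x S / c"
  "!!x. x \<in> K ==> c * infdist x S <= norm (grad f x) \<or> c <= \<bar>f x\<bar>"
proof -
 define P where "P c x \<longleftrightarrow> norm (grad f x) <= infdist x S / c \<and> (c * infdist x S <= norm (grad f x) \<or> c <= \<bar>f x\<bar>)" for c x
 have dist_cont: "((%x. infdist x S) \<longlongrightarrow> infdist p S) (nhds p)" for p
  by (intro tendsto_infdist filterlim_ident)
 have f_cont: "(f \<longlongrightarrow> f p) (nhds p)" "((%x. norm (grad f x)) \<longlongrightarrow> norm (grad f p)) (nhds p)" if "p \<in> U" for p
 proof -
  have 1: "(g \<longlongrightarrow> g p) (nhds p)" if "continuous_on U g" for g :: "real^2 => real"
   using continuous_on_eq_continuous_at[OF assms(1), of g] that \<open>p \<in> U\<close> tendsto_at_iff_tendsto_nhds[of g p] unfolding isCont_def by blast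
  show "(f \<longlongrightarrow> f p) (nhds p)" by (rule 1[OF C1_on_continuous[OF f(1)]])
  show "((%x. norm (grad f x)) \<longlongrightarrow> norm (grad f p)) (nhds p)"
   unfolding grad_def by (intro tendsto_norm vec_tendstoI) (use 1[OF C1_on_partial[OF f(1)]] in simp)
 qed
 have mono: "P c' x" if "0 < c'" "c' <= c" "P c x" for c c' x
 proof -
  have "infdist x S / c <= infdist x S / c'" using that(1,2) by (intro divide_left_mono) (auto simp: infdist_nonneg)
  moreover have "c' * infdist x S <= c * infdist x S" using that(2) by (intro mult_right_mono) (auto simp: infdist_nonneg)
  ultimately show ?thesis using that unfolding P_def by linarith
 qed
 obtain c where "c > 0" "!!x. x \<in> K ==> P c x"
 proof (rule compact_uniform_constant[OF assms(2), of P])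
  fix p assume p: "p \<in> K"
  show "\<exists>c>0. \<forall>\<^sub>F x in nhds p. x \<in> K --> P c x"
  proof (cases "p \<in> S")
   case True
   then have pU: "p \<in> U" "grad f p = 0" using S(1) assms(3) by auto
   obtain c where c: "c > 0" "\<forall>\<^sub>F x in nhds p. c * dist x p <= norm (grad f x) \<and> norm (grad f x) <= dist x p / c"
    by (rule nondegenerate_critical_zero[OF assms(1) pU(1) f(2) pU(2) S(4)[OF True]]) blast
   have near: "\<forall>\<^sub>F x in nhds p. infdist x S = dist x p" by (rule eventually_nearest[OF S(2) True]) simp
   have "\<forall>\<^sub>F x in nhds p. x \<in> K --> P c x"
    using c(2) near by eventually_elim (auto simp: P_def)
   then show ?thesis using c(1) by blast
  next
   case False
   then have nz: "f p ~= 0 \<or> grad f p ~= 0" and pU: "p \<in> U" using p S(1) assms(3) by auto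
   have rp: "infdist p S > 0"
    using in_closed_iff_infdist_zero[OF finite_imp_closed[OF S(2)] S(3), of p] infdist_nonneg[of p S] False by auto
   note ev1 = order_tendstoD(1)[OF dist_cont, of "infdist p S / 2" p]
   have e1: "\<forall>\<^sub>F x in nhds p. infdist p S / 2 < infdist x S" using ev1 rp by simp
   have e2: "\<forall>\<^sub>F x in nhds p. infdist x S < infdist p S + 1" using order_tendstoD(2)[OF dist_cont, of p "infdist p S + 1"] by simp
   have e3: "\<forall>\<^sub>F x in nhds p. norm (grad f x) < norm (grad f p) + 1" using order_tendstoD(2)[OF f_cont(2)[OF pU]] by simp
   define c0 where "c0 = (infdist p S / 2) / (norm (grad f p) + 1)"
   have c0: "c0 > 0" using rp by (simp add: c0_def add_nonneg_pos)
   have up: "norm (grad f x) <= infdist x S / c0" if "infdist p S / 2 < infdist x S" "norm (grad f x) < norm (grad f p) + 1" for x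
   proof -
    have "c0 * norm (grad f x) <= c0 * (norm (grad f p) + 1)" using that(2) c0 by (intro mult_left_mono) auto
    also have "... = infdist p S / 2"
    proof -
     have "norm (grad f p) + 1 ~= 0" using norm_ge_zero[of "grad f p"] by linarith
     then show ?thesis unfolding c0_def by (rule nonzero_divide_eq_eq[THEN iffD1, OF _ refl, symmetric])
    qed
    finally show ?thesis using that(1) c0 by (simp add: field_simps)
   qed
   show ?thesis
   proof (cases "f p = 0")
    case False
    have e4: "\<forall>\<^sub>F x in nhds p. \<bar>f p\<bar> / 2 < \<bar>f x\<bar>"
     using order_tendstoD(1)[OF tendsto_rabs[OF f_cont(1)[OF pU]], of "\<bar>f p\<bar> / 2"] False by simp
    define c where "c = min c0 (\<bar>f p\<bar> / 2)"
    have c: "c > 0" "c <= c0" "c <= \<bar>f p\<bar> / 2" using c0 False by (auto simp: c_def)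
    have "\<forall>\<^sub>F x in nhds p. x \<in> K --> P c x"
     using e1 e3 e4
    proof eventually_elim
     case (elim x)
     have "infdist x S / c0 <= infdist x S / c" using c c0 by (intro divide_left_mono) (auto simp: infdist_nonneg)
     then show ?case using up[OF elim(1,2)] elim(3) c(3) unfolding P_def by linarith
    qed
    then show ?thesis using c(1) by blast
   next
    case True
    then have gp: "norm (grad f p) > 0" using nz by simp
    have e4: "\<forall>\<^sub>F x in nhds p. norm (grad f p) / 2 < norm (grad f x)"
     using order_tendstoD(1)[OF f_cont(2)[OF pU], of "norm (grad f p) / 2"] gp by simp
    define c1 where "c1 = (norm (grad f p) / 2) / (infdist p S + 1)"
    define c where "c = min c0 c1"
    have c: "c > 0" "c <= c0" "c <= c1" using c0 gp rp by (auto simp: c_def c1_def)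
    have "\<forall>\<^sub>F x in nhds p. x \<in> K --> P c x"
     using e1 e3 e4 e2
    proof eventually_elim
     case (elim x)
     have "infdist x S / c0 <= infdist x S / c" using c c0 by (intro divide_left_mono) (auto simp: infdist_nonneg)
     moreover have "c * infdist x S <= c1 * (infdist p S + 1)" using c elim(4) by (intro mult_mono) (auto simp: infdist_nonneg)
     moreover have "c1 * (infdist p S + 1) = norm (grad f p) / 2"
      unfolding c1_def by (rule nonzero_divide_eq_eq[THEN iffD1, OF _ refl, symmetric]) (use rp in linarith)
     ultimately show ?case using up[OF elim(1,2)] elim(3) unfolding P_def by linarith
    qed
    then show ?thesis using c(1) by blast
   qed
  qed
 qed (use mono in blast)+
 then show thesis using that unfolding P_def by blast
qed

section \<open>Two integral identities and the lower bound away from the critical zeros\<close>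

context planar_domain
begin

text \<open>A mollified piecewise linear function of the distance to the complement.\<close>
lemma boundary_cutoff:
 assumes "w > 0"
 obtains b :: "real^2 => real" where "C1_compact Om b" "!!x. 0 <= b x" "!!x. b x <= 1" "!!x j. \<bar>partial j b x\<bar> <= 1 / w"
  "!!x. 4 * w <= infdist x (- Om) ==> b x = 1" "!!x j. 4 * w < infdist x (- Om) ==> partial j b x = 0"
proof -
 obtain \<eta> where eta: "mollifier w \<eta>" using mollifier_exists[OF assms] by blast
 define d where "d x = infdist x (- Om)" for x
 define f where "f x = min 1 (max 0 (d x / w - 2))" for x
 have ne: "- Om ~= {}" using bounded_domain not_bounded_UNIV by (metis Compl_empty_eq double_complement)
 have lip_d: "\<bar>d x - d y\<bar> <= dist x y" for x y
  unfolding d_def using infdist_triangle[of x "- Om" y] infdist_triangle[of y "- Om" x] by (simp add: dist_commute abs_le_iff)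
 have lip: "norm (f x - f y) <= (1 / w) * norm (x - y)" for x y
 proof -
  have "\<bar>f x - f y\<bar> <= \<bar>d x / w - d y / w\<bar>" unfolding f_def by (auto simp: min_def max_def abs_if)
  also have "... = \<bar>d x - d y\<bar> / w" using assms by (simp add: diff_divide_distrib[symmetric])
  also have "... <= dist x y / w" using lip_d[of x y] assms by (intro divide_right_mono) auto
  finally show ?thesis by (simp add: dist_norm)
 qed
 define K where "K = {x. 2 * w <= d x}"
 have contd: "continuous_on UNIV d" unfolding d_def by (intro continuous_intros)
 have contf: "continuous_on UNIV f" unfolding f_def using assms by (intro continuous_intros contd) auto
 have KO: "cball x w \<subseteq> Om" if "x \<in> K" for x
 proof
  fix y assume "y \<in> cball x w"
  then have "d y >= w" using lip_d[of x y] that by (simp add: K_def abs_le_iff)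
  then show "y \<in> Om" using assms infdist_zero[of y "- Om"] by (cases "y \<in> Om") (auto simp: d_def)
 qed
 have "closed K" unfolding K_def using closed_Collect_le[OF continuous_on_const contd] by blast
 moreover have "K \<subseteq> Om" using KO assms by (meson centre_in_cball less_imp_le subsetD subsetI)
 ultimately have K: "compact K" using bounded_domain bounded_subset compact_eq_bounded_closed by blast
 have f0: "f x = 0" if "x \<notin> K" for x
 proof -
  have "d x / w <= 2" using that assms by (simp add: K_def field_simps)
  then show ?thesis by (simp add: f_def)
 qed
 have int: "integrable lborel f" by (rule integrable_compact_support[OF contf K f0])
 define b where "b = conv f \<eta>"
 have fb: "0 <= f y" "f y <= 1" for y by (auto simp: f_def)
 have C: "C1_compact Om b" unfolding b_def by (rule test_function_C1[OF test_function_conv[OF int eta K f0 KO]])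
 have one: "b x = 1" if "4 * w <= d x" for x
 proof -
  have f1: "f y = 1" if "norm (x - y) < w" for y
  proof -
   have "3 * w <= d y" using that \<open>4 * w <= d x\<close> lip_d[of x y] by (simp add: dist_norm abs_le_iff)
   then have "3 <= d y / w" using assms by (simp add: field_simps)
   then show ?thesis by (simp add: f_def)
  qed
  have "norm (conv f \<eta> x - f x) <= 0" by (rule conv_close[OF int eta]) (use f1 f1[of x] assms in auto)
  then show ?thesis using f1[of x] assms by (simp add: b_def)
 qed
 have "partial j b x = 0" if "4 * w < d x" for x j
 proof -
  have op: "open {x. 4 * w < d x}" using open_Collect_less[OF continuous_on_const contd] by blast
  have "partial j b x = partial j (%_. 1) x" using partial_cong_open[OF op, of x b "%_. 1"] one that by auto
  then show ?thesis by (simp add: partial_def)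
 qed
 moreover have "0 <= b x" for x
  unfolding b_def conv_def using fb mollifierD(3)[OF eta] by (intro lint_nonneg) auto
 moreover have "b x <= 1" for x
  using conv_norm_le[OF eta int, of 1 x] fb by (simp add: b_def abs_le_iff)
 moreover have "\<bar>partial j b x\<bar> <= 1 / w" for x j
  using conv_Lipschitz[OF int eta lip, of j x] by (simp add: b_def)
 ultimately show thesis using that C one unfolding d_def by blast
qed

text \<open>Mollification of \<open>cnj u\<close> leaves only its mixed second derivatives, which cancel.\<close>
lemma mixed_derivatives_commute:
 fixes ka :: "real^2 => real"
 assumes u: "!!j. weak j u (g j)" and chi: "C1_compact Om ka"
 shows "(\<integral>x. ka x *\<^sub>R (cnj (g 1 x) * g 2 x) \<partial>Leb) - (\<integral>x. ka x *\<^sub>R (cnj (g 2 x) * g 1 x) \<partial>Leb)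
  = (\<integral>x. partial 1 ka x *\<^sub>R (cnj (g 2 x) * u x) \<partial>Leb) - (\<integral>x. partial 2 ka x *\<^sub>R (cnj (g 1 x) * u x) \<partial>Leb)"
proof -
 note L = weakD[OF u]
 define v where "v = (%x. cnj (u x))"
 define k where "k j = (%x. cnj (g j x))" for j
 have vk: "weak j v (k j)" for j unfolding v_def k_def by (rule weak_cnj[OF u])
 note Lv = weakD[OF vk]
 obtain v0 where v0: "borel_version Om v v0" using borel_version_exists[OF L2D(1)[OF Lv(1)]] by blast
 have "\<forall>j. \<exists>k0. borel_version Om (k j) k0" using borel_version_exists[OF L2D(1)[OF Lv(2)]] by metis
 then obtain k0 where k0: "!!j. borel_version Om (k j) (k0 j)" by metis
 from chi obtain K where K: "compact K" "K \<subseteq> Om" "!!x. x \<notin> K ==> ka x = 0" "!!x j. x \<notin> K ==> partial j ka x = 0"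
  by (rule C1_compactE) blast
 obtain M where M: "M >= 0" "!!x. norm (ka x) <= M" "!!x j. norm (partial j ka x) <= M"
  using C1_compact_bounded[OF chi] by blast
 obtain r where r: "r > 0" "(\<Union>x\<in>K. cball x r) \<subseteq> Om"
  using compact_subset_open_imp_cball_epsilon_subset[OF K(1) open_domain K(2)] by blast
 obtain ep \<eta> where m: "!!n. mollifier (ep n) (\<eta> n)" "!!n. 0 < ep n" "!!n. ep n <= r" "ep \<longlonglongrightarrow> 0"
  using mollifier_sequence[OF r(1)] by metis
 define z where "z n j = conv (k0 j) (\<eta> n)" for n j
 define y where "y n j = partial j (conv v0 (\<eta> n))" for n j
 have zL: "z n j \<in> L2 Leb" for n j
  unfolding z_def by (rule borel_version_conv_L2[OF k0 Lv(2) m(1)])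
 have yz: "y n j x = z n j x" if "x \<in> K" for n j x
 proof -
  have "cball x (ep n) \<subseteq> Om" using r(2) m(3)[of n] subset_cball[of "ep n" r x] that by blast
  then show ?thesis unfolding y_def z_def using weak_conv[OF vk v0 k0 m(1)] by simp
 qed
 have km: "ka \<in> borel_measurable Leb" "partial j ka \<in> borel_measurable Leb" for j
  by (auto intro!: borel_lebesgue_on C1_compact_measurable[OF chi])
 have bd: "!!x. x \<in> space Leb ==> \<bar>ka x\<bar> <= M" "!!x j. x \<in> space Leb ==> \<bar>partial j ka x\<bar> <= M"
  using M by auto
 have comm: "partial 1 (y n 2) = partial 2 (y n 1)" and yC: "C1_on UNIV (y n j)" for n j
 proof -
  note mm = mollifierD[OF m(1)[of n]]
  note i = borel_version_L2(1)[OF v0 Lv(1)]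
  have y: "y n j = conv v0 (partial j (\<eta> n))" for j unfolding y_def by (rule partial_conv[OF i mm(2)])
  have t: "test_function UNIV (partial j (\<eta> n))" for j by (rule test_function_partial[OF mm(1)])
  show "partial 1 (y n 2) = partial 2 (y n 1)" unfolding y using partial_conv[OF i test_function_C1[OF t]] mm(6) by simp
  show "C1_on UNIV (y n j)" unfolding y by (rule smooth_on_C1_on[OF smooth_conv[OF i t]])
 qed
 have kz: "ka x *\<^sub>R (z n j x * t) = ka x *\<^sub>R (t * y n j x)" "partial i ka x *\<^sub>R (z n j x * t) = partial i ka x *\<^sub>R (t * y n j x)" for n i j x t
  using yz[of x] K(3,4)[of x] by (cases "x \<in> K"; simp add: mult.commute)+
 have eq: "(\<integral>x. ka x *\<^sub>R (z n 1 x * g 2 x) \<partial>Leb) - (\<integral>x. ka x *\<^sub>R (z n 2 x * g 1 x) \<partial>Leb)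
   = (\<integral>x. partial 1 ka x *\<^sub>R (z n 2 x * u x) \<partial>Leb) - (\<integral>x. partial 2 ka x *\<^sub>R (z n 1 x * u x) \<partial>Leb)" for n
 proof -
  have e: "(\<integral>x. ka x *\<^sub>R (z n j x * g i x) \<partial>Leb)
    = - (\<integral>x. ka x *\<^sub>R (partial i (y n j) x * u x) \<partial>Leb) - (\<integral>x. partial i ka x *\<^sub>R (z n j x * u x) \<partial>Leb)" for i j
  proof -
   have bd: "bounded (f ` closure Om)" if "continuous_on UNIV f" for f :: "real^2 => complex"
    using bounded_domain by (intro compact_imp_bounded compact_continuous_image continuous_on_subset[OF that]) auto
   obtain N1 where N1: "!!x. x \<in> closure Om ==> cmod (y n j x) <= N1"
    using bd[OF C1_on_continuous[OF yC[of n j]]] unfolding bounded_iff by auto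
   obtain N2 where N2: "!!x. x \<in> closure Om ==> cmod (partial i (y n j) x) <= N2"
    using bd[OF C1_on_partial[OF yC[of n j], of i]] unfolding bounded_iff by auto
   have "weak i (y n j) (partial i (y n j))"
    by (rule weak_of_C1[OF C1_on_subset[OF yC subset_UNIV], where C = "max N1 N2"]) (use N1 N2 closure_subset in \<open>force simp: le_max_iff_disj\<close>)+
   from weak_partial_product[OF u this chi] show ?thesis unfolding kz by (simp add: mult.commute)
  qed
  show ?thesis unfolding e comm by simp
 qed
 have lim: "(%n. L2_norm Leb (%x. z n j x - k j x)) \<longlonglongrightarrow> 0" for j
  unfolding z_def by (rule mollification_tendsto[OF k0 Lv(2) m(1,4)])
 have t1: "(%n. \<integral>x. ka x *\<^sub>R (z n j x * g i x) \<partial>Leb) \<longlonglongrightarrow> (\<integral>x. ka x *\<^sub>R (k j x * g i x) \<partial>Leb)" for i j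
  by (rule L2_pairing_tendsto[OF zL Lv(2) L(2) km(1) bd(1) lim M(1)])
 have t2: "(%n. \<integral>x. partial i ka x *\<^sub>R (z n j x * u x) \<partial>Leb) \<longlonglongrightarrow> (\<integral>x. partial i ka x *\<^sub>R (k j x * u x) \<partial>Leb)" for i j
  by (rule L2_pairing_tendsto[OF zL Lv(2) L(1) km(2) bd(2) lim M(1)])
 show ?thesis
  using LIMSEQ_unique[OF tendsto_diff[OF t1[of 1 2] t1[of 2 1], unfolded eq] tendsto_diff[OF t2[of 1 2] t2[of 2 1]]]
  unfolding k_def .
qed

end

lemma arctan_bounds:
 fixes y :: real
 shows "\<bar>arctan y\<bar> <= 2" "0 <= y * arctan y" "1 <= \<bar>y\<bar> ==> 1 / 2 <= y * arctan y" "1 / 2 <= 1 / (1 + y^2) + y * arctan y"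
  "0 < 1 / (1 + y^2)" "1 / (1 + y^2) <= 1" "1 / (1 + y^2) * \<bar>y\<bar> <= 1"
proof -
 show "\<bar>arctan y\<bar> <= 2" using arctan_bounded[of y] pi_less_4 by (simp add: abs_le_iff)
 have abs: "y * arctan y = \<bar>y\<bar> * arctan \<bar>y\<bar>" by (simp add: abs_if arctan_minus)
 show nn: "0 <= y * arctan y" unfolding abs by simp
 have 1: "1 / 2 <= y * arctan y" if "1 <= \<bar>y\<bar>"
 proof -
  have "1 / 2 <= arctan \<bar>y\<bar>" using arctan_le_iff[of 1 "\<bar>y\<bar>"] that arctan_one pi_gt3 by linarith
  also have "... <= \<bar>y\<bar> * arctan \<bar>y\<bar>" using that by (simp add: mult_right_mono[of 1 "\<bar>y\<bar>", simplified])
  finally show ?thesis unfolding abs .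
 qed
 then show "1 <= \<bar>y\<bar> ==> 1 / 2 <= y * arctan y" .
 have p: "0 < 1 + y^2" by (simp add: add_pos_nonneg)
 show t: "0 < 1 / (1 + y^2)" using p by simp
 show "1 / (1 + y^2) <= 1" by (simp add: p)
 have "\<bar>y\<bar> <= 1 + y^2"
  using zero_le_power2[of "\<bar>y\<bar> - 1"] by (simp add: power2_diff)
 then show "1 / (1 + y^2) * \<bar>y\<bar> <= 1" using p by simp
 show "1 / 2 <= 1 / (1 + y^2) + y * arctan y"
 proof (cases "1 <= \<bar>y\<bar>")
  case True
  then show ?thesis using 1 t by linarith
 next
  case False
  then have "y^2 <= 1" by (simp add: abs_square_le_1)
  then have "1 / 2 <= 1 / (1 + y^2)" using p by (simp add: field_simps)
  then show ?thesis using nn by linarith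
 qed
qed

locale magnetic_domain = smooth_domain +
 fixes A :: "real^2 => real^2" and B :: "real^2 => real" and S :: "(real^2) set" and M c :: real
 assumes A_C1: "!!i. C1_on Om (%x. A x $ i)"
  and curl: "!!x. x \<in> Om ==> B x = partial 2 (%y. A y $ 1) x - partial 1 (%y. A y $ 2) x"
  and B_C1: "C1_on Om B" "!!j. C1_on Om (partial j B)"
  and const: "M >= 1" "c > 0"
  and A_bound: "!!x i. x \<in> Om ==> \<bar>A x $ i\<bar> <= M"
  and S: "finite S" "S ~= {}"
  and dist_bound: "!!x. x \<in> Om ==> infdist x S <= M"
  and B_bound: "!!x j. x \<in> Om ==> \<bar>partial j B x\<bar> <= M * infdist x S" "!!x j. x \<in> Om ==> \<bar>partial j (partial j B) x\<bar> <= M"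
  and B_nondegenerate: "!!x. x \<in> Om ==> c * infdist x S <= norm (grad B x) \<or> c <= \<bar>B x\<bar>"
begin

text \<open>The magnetic derivative formed with given weak derivatives \<open>g\<close> instead of chosen representatives.\<close>
definition dA :: "real => (real^2 => complex) => (2 => real^2 => complex) => 2 => real^2 => complex" where
 "dA h u g j x = - \<i> * complex_of_real h * g j x + complex_of_real (A x $ j) * u x"

definition mass :: "(real^2 => complex) => real" where
 "mass u = (\<integral>x. cmod2 (u x) \<partial>Leb)"

definition energy :: "real => (real^2 => complex) => (2 => real^2 => complex) => real" where
 "energy h u g = (\<integral>x. (\<Sum>j\<in>UNIV. cmod2 (dA h u g j x)) \<partial>Leb)"

definition cross :: "real => (real^2 => complex) => (2 => real^2 => complex) => real" where
 "cross h u g = (\<integral>x. cmod (u x) * (\<Sum>j\<in>UNIV. cmod (dA h u g j x)) \<partial>Leb)"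

context
 fixes h :: real and u :: "real^2 => complex" and g :: "2 => real^2 => complex"
 assumes h: "h > 0" and u: "!!j. weak j u (g j)"
begin

lemma dA_L2: "dA h u g j \<in> L2 Leb"
proof -
 have m: "(%x. complex_of_real (A x $ j)) \<in> borel_measurable Leb"
  using continuous_domain_measurable[OF C1_on_continuous[OF A_C1[of j]]] by measurable
 have "(%x. complex_of_real (A x $ j) * u x) \<in> L2 Leb"
  by (rule L2_mult_bounded(1)[OF weakD(1)[OF u] m, of M]) (use A_bound const(1) in auto)
 from L2_add[OF L2_scale[OF weakD(2)[OF u[of j]], of "- \<i> * complex_of_real h"] this]
 show ?thesis unfolding dA_def[abs_def] .
qed

lemma energy_integrable:
 "integrable Leb (%x. cmod2 (u x))" "integrable Leb (%x. \<Sum>j\<in>UNIV. cmod2 (dA h u g j x))"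
 "integrable Leb (%x. cmod (u x) * (\<Sum>j\<in>UNIV. cmod (dA h u g j x)))"
 using L2D(2)[OF weakD(1)[OF u]] L2D(2)[OF dA_L2] L2_product(1)[OF weakD(1)[OF u] dA_L2]
 by (auto simp: sum_distrib_left intro!: litg_sum)

lemma energy_nonneg: "0 <= mass u" "0 <= energy h u g" "0 <= cross h u g"
 unfolding mass_def energy_def cross_def by (auto intro!: lint_nonneg sum_nonneg mult_nonneg_nonneg)

lemma cross_le: "cross h u g <= sqrt (2 * mass u * energy h u g)"
proof -
 let ?w = "%x. \<Sum>j\<in>UNIV. cmod (dA h u g j x)"
 have sq: "(?w x)^2 <= 2 * (\<Sum>j\<in>UNIV. cmod2 (dA h u g j x))" for x
  unfolding sum_2 using zero_le_power2[of "cmod (dA h u g 1 x) - cmod (dA h u g 2 x)"]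
  by (simp add: power2_sum power2_diff)
 have m: "?w \<in> borel_measurable Leb" "u \<in> borel_measurable Leb"
  using L2D(1)[OF dA_L2] L2D(1)[OF weakD(1)[OF u]] by auto
 have i2: "integrable Leb (%x. 2 * (\<Sum>j\<in>UNIV. cmod2 (dA h u g j x)))"
  using energy_integrable(2) by (rule integrable_mult_right)
 have i: "integrable Leb (%x. (?w x)^2)"
  by (rule litg_bound[OF i2]) (use sq m in \<open>auto simp: sum_nonneg\<close>)
 have "cross h u g = (\<integral>x. \<bar>cmod (u x)\<bar> * \<bar>?w x\<bar> \<partial>Leb)"
  unfolding cross_def by (intro lint_cong) (auto simp: sum_nonneg abs_of_nonneg)
 also have "... <= sqrt (\<integral>x. cmod2 (u x) \<partial>Leb) * sqrt (\<integral>x. (?w x)^2 \<partial>Leb)"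
  by (rule Cauchy_Schwarz_integral(2)) (use m energy_integrable(1) i in auto)
 also have "... <= sqrt (mass u) * sqrt (2 * energy h u g)"
 proof (intro mult_mono real_sqrt_le_mono)
  have "(\<integral>x. (?w x)^2 \<partial>Leb) <= (\<integral>x. 2 * (\<Sum>j\<in>UNIV. cmod2 (dA h u g j x)) \<partial>Leb)"
   by (rule lint_mono[OF i i2 sq])
  then show "(\<integral>x. (?w x)^2 \<partial>Leb) <= 2 * energy h u g" by (simp add: energy_def)
 qed (auto simp: mass_def)
 finally show ?thesis by (simp add: real_sqrt_mult ac_simps)
qed

lemma Re_partial_eq: "h * Re (cnj (u x) * g j x) = - Im (cnj (u x) * dA h u g j x)"
 by (simp add: dA_def algebra_simps)

lemma C1_compact_square_integrable:
 fixes ka :: "real^2 => real"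
 assumes "C1_compact Om ka"
 shows "integrable Leb (%x. ka x * cmod2 (u x))" "integrable Leb (%x. partial j ka x * cmod2 (u x))"
  "integrable Leb (%x. ka x * Re (cnj (u x) * g j x))"
proof -
 obtain N where N: "N >= 0" "!!x. norm (ka x) <= N" "!!x j. norm (partial j ka x) <= N" using C1_compact_bounded[OF assms] by blast
 have m: "ka \<in> borel_measurable Leb" "partial j ka \<in> borel_measurable Leb"
  by (auto intro!: borel_lebesgue_on C1_compact_measurable[OF assms])
 show "integrable Leb (%x. ka x * cmod2 (u x))" "integrable Leb (%x. partial j ka x * cmod2 (u x))"
  "integrable Leb (%x. ka x * Re (cnj (u x) * g j x))"
  using integrable_bounded_scaleR[OF energy_integrable(1) m(1), where C = N] integrable_bounded_scaleR[OF energy_integrable(1) m(2), where C = N]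
   integrable_bounded_scaleR[OF integrable_Re_product(1)[OF weakD(1,2)[OF u[of j]]] m(1), where C = N] N by auto
qed

text \<open>\<open>\<partial>\<^sub>j |u|\<^sup>2 = 2 Re (cnj u \<partial>\<^sub>j u)\<close> is, up to the factor \<open>h\<close>, an imaginary part of \<open>cnj u D\<^sub>j u\<close>.\<close>
lemma divergence_estimate:
 fixes X :: "2 => real^2 => real"
 assumes "!!j. C1_compact Om (X j)" "!!x j. x \<in> Om ==> \<bar>X j x\<bar> <= K" "K >= 0"
 shows "(\<Sum>j\<in>UNIV. \<integral>x. partial j (X j) x * cmod2 (u x) \<partial>Leb) <= 2 * K / h * cross h u g"
proof -
 have e: "h * (\<integral>x. partial j (X j) x * cmod2 (u x) \<partial>Leb) <= (\<integral>x. 2 * K * (cmod (u x) * cmod (dA h u g j x)) \<partial>Leb)" for j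
 proof -
  have "h * (\<integral>x. partial j (X j) x * cmod2 (u x) \<partial>Leb) = (\<integral>x. (- 2 * h) * (X j x * Re (cnj (u x) * g j x)) \<partial>Leb)"
   unfolding weak_partial_square[OF u assms(1)] by simp
  also have "... <= (\<integral>x. 2 * K * (cmod (u x) * cmod (dA h u g j x)) \<partial>Leb)"
  proof (rule lint_mono)
   show "integrable Leb (%x. (- 2 * h) * (X j x * Re (cnj (u x) * g j x)))"
    by (intro integrable_mult_right C1_compact_square_integrable(3) assms(1))
   show "integrable Leb (%x. 2 * K * (cmod (u x) * cmod (dA h u g j x)))"
    by (intro integrable_mult_right L2_product(1) weakD(1)[OF u] dA_L2)
   fix x assume "x \<in> space Leb"
   then have K: "\<bar>X j x\<bar> <= K" using assms(2) by simp
   have "(- 2 * h) * (X j x * Re (cnj (u x) * g j x)) = 2 * (X j x * Im (cnj (u x) * dA h u g j x))"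
    using Re_partial_eq[of x j] by algebra
   also have "... <= 2 * (\<bar>X j x\<bar> * \<bar>Im (cnj (u x) * dA h u g j x)\<bar>)" unfolding abs_mult[symmetric] by simp
   also have "... <= 2 * (K * (cmod (u x) * cmod (dA h u g j x)))"
    using abs_Im_le_cmod[of "cnj (u x) * dA h u g j x"] K assms(3)
    by (intro mult_left_mono mult_mono) (auto simp: norm_mult)
   finally show "(- 2 * h) * (X j x * Re (cnj (u x) * g j x)) <= 2 * K * (cmod (u x) * cmod (dA h u g j x))" by simp
  qed
  finally show ?thesis .
 qed
 have "h * (\<Sum>j\<in>UNIV. \<integral>x. partial j (X j) x * cmod2 (u x) \<partial>Leb)
   <= (\<Sum>j\<in>UNIV. \<integral>x. 2 * K * (cmod (u x) * cmod (dA h u g j x)) \<partial>Leb)"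
  unfolding sum_distrib_left by (intro sum_mono e)
 also have "... = (\<integral>x. (\<Sum>j\<in>UNIV. 2 * K * (cmod (u x) * cmod (dA h u g j x))) \<partial>Leb)"
  by (rule lint_sum[symmetric]) (intro integrable_mult_right L2_product(1) weakD(1)[OF u] dA_L2)
 also have "... = (\<integral>x. 2 * K * (cmod (u x) * (\<Sum>j\<in>UNIV. cmod (dA h u g j x))) \<partial>Leb)"
  by (simp add: sum_distrib_left)
 also have "... = 2 * K * cross h u g" by (simp add: cross_def)
 finally show ?thesis using h by (simp add: field_simps)
qed

lemma layer_energy_le: "bl_energy u g <= mass u + cross h u g / h"
proof -
 have e: "h * (\<integral>x. \<bar>Re (cnj (u x) * g j x)\<bar> \<partial>Leb) <= (\<integral>x. cmod (u x) * cmod (dA h u g j x) \<partial>Leb)" for j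
 proof -
  have "(\<integral>x. h * \<bar>Re (cnj (u x) * g j x)\<bar> \<partial>Leb) <= (\<integral>x. cmod (u x) * cmod (dA h u g j x) \<partial>Leb)"
  proof (rule lint_mono)
   show "integrable Leb (%x. h * \<bar>Re (cnj (u x) * g j x)\<bar>)"
    by (intro integrable_mult_right integrable_Re_product(2) weakD(1)[OF u] weakD(2)[OF u])
   show "integrable Leb (%x. cmod (u x) * cmod (dA h u g j x))"
    by (intro L2_product(1) weakD(1)[OF u] dA_L2)
   fix x
   have "h * \<bar>Re (cnj (u x) * g j x)\<bar> = \<bar>h * Re (cnj (u x) * g j x)\<bar>" using h by (simp only: abs_mult abs_of_pos)
   also have "... <= cmod (cnj (u x) * dA h u g j x)" unfolding Re_partial_eq abs_minus_cancel by (rule abs_Im_le_cmod)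
   finally show "h * \<bar>Re (cnj (u x) * g j x)\<bar> <= cmod (u x) * cmod (dA h u g j x)" by (simp only: norm_mult complex_mod_cnj)
  qed
  then show ?thesis by simp
 qed
 have "h * (\<Sum>j\<in>UNIV. \<integral>x. \<bar>Re (cnj (u x) * g j x)\<bar> \<partial>Leb) <= (\<Sum>j\<in>UNIV. \<integral>x. cmod (u x) * cmod (dA h u g j x) \<partial>Leb)"
  unfolding sum_distrib_left by (intro sum_mono e)
 also have "... = (\<integral>x. (\<Sum>j\<in>UNIV. cmod (u x) * cmod (dA h u g j x)) \<partial>Leb)"
  by (rule lint_sum[symmetric]) (intro L2_product(1) weakD(1)[OF u] dA_L2)
 also have "... = cross h u g" by (simp add: cross_def sum_distrib_left)
 finally show ?thesis unfolding bl_energy_def mass_def using h by (simp add: field_simps)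
qed

text \<open>Up to exact divergences, \<open>h \<kappa> B |u|\<^sup>2\<close> equals \<open>2 \<kappa> Im (D\<^sub>2u cnj (D\<^sub>1u))\<close> minus terms with a derivative of \<open>\<kappa>\<close>, where only one magnetic derivative of \<open>u\<close> occurs.\<close>
lemma commutator_estimate:
 fixes ka :: "real^2 => real"
 assumes ka: "C1_compact Om ka" and K: "!!x. x \<in> Om ==> \<bar>ka x\<bar> <= K0" "!!x j. x \<in> Om ==> \<bar>partial j ka x\<bar> <= K1" "K0 >= 0" "K1 >= 0"
 shows "h * (\<integral>x. ka x * B x * cmod2 (u x) \<partial>Leb) <= K0 * energy h u g + h * K1 * cross h u g"
proof -
 note L = weakD[OF u]
 obtain N where N: "N >= 0" "!!x. norm (ka x) <= N" "!!x j. norm (partial j ka x) <= N" using C1_compact_bounded[OF ka] by blast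
 have m: "ka \<in> borel_measurable Leb" "partial j ka \<in> borel_measurable Leb" for j
  by (auto intro!: borel_lebesgue_on C1_compact_measurable[OF ka])
 have b: "!!x. x \<in> space Leb ==> \<bar>ka x\<bar> <= N" "!!x j. x \<in> space Leb ==> \<bar>partial j ka x\<bar> <= N" using N by auto
 define W where "W x = (ka x *\<^sub>R (cnj (g 1 x) * g 2 x) - ka x *\<^sub>R (cnj (g 2 x) * g 1 x))
  - (partial 1 ka x *\<^sub>R (cnj (g 2 x) * u x) - partial 2 ka x *\<^sub>R (cnj (g 1 x) * u x))" for x
 note i = L2_product_bounded(1)[OF L2_cnj[OF L(2)] L(2) m(1) b(1)] L2_product_bounded(1)[OF L2_cnj[OF L(2)] L(1) m(2) b(2)]
 have Wi: "integrable Leb W" unfolding W_def[abs_def] by (intro litg_diff i)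
 have W0: "integral\<^sup>L Leb W = 0"
  unfolding W_def[abs_def] using mixed_derivatives_commute[OF u ka] i
  by (simp only: lint_diff litg_diff diff_self)
 have Im0: "integrable Leb (%x. Im (W x))" "(\<integral>x. Im (W x) \<partial>Leb) = 0"
  using integrable_Im[OF Wi] integral_Im[OF Wi] W0 by auto
 define Z where "Z i j x = partial i (%x. ka x * A x $ j) x * cmod2 (u x) + 2 * (ka x * A x $ j * Re (cnj (u x) * g i x))" for i j x
 note pA = C1_compact_bilinear[OF bounded_bilinear_mult open_domain ka A_C1]
 have Z: "integrable Leb (Z i j)" "integral\<^sup>L Leb (Z i j) = 0" for i j
 proof -
  note ii = C1_compact_square_integrable(2,3)[OF pA(1)[of j], of i]
  show "integrable Leb (Z i j)" unfolding Z_def[abs_def] by (intro litg_add integrable_mult_right ii)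
  have "integral\<^sup>L Leb (Z i j) = (\<integral>x. partial i (%x. ka x * A x $ j) x * cmod2 (u x) \<partial>Leb)
    + (\<integral>x. 2 * (ka x * A x $ j * Re (cnj (u x) * g i x)) \<partial>Leb)"
   unfolding Z_def[abs_def] by (rule lint_add) (intro integrable_mult_right ii)+
  then show "integral\<^sup>L Leb (Z i j) = 0" unfolding weak_partial_square[OF u pA(1)] by simp
 qed
 define v where "v = dA h u g"
 define T where "T x = 2 * (ka x * Im (v 2 x * cnj (v 1 x)))
  - h * (partial 2 ka x * Re (u x * cnj (v 1 x)) - partial 1 ka x * Re (u x * cnj (v 2 x)))" for x
 have id: "ka x * B x * cmod2 (u x) * h + h^2 * Im (W x) - h * Z 2 1 x + h * Z 1 2 x = T x" if "x \<in> Om" for x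
  unfolding T_def W_def Z_def v_def dA_def pA(2)[OF that] curl[OF that]
  by (simp only: cmod_power2) (simp add: power2_eq_square algebra_simps)
 note iB = C1_compact_square_integrable(1)[OF C1_compact_bilinear(1)[OF bounded_bilinear_mult open_domain ka B_C1(1)]]
 have I: "integrable Leb (%x. ka x * B x * cmod2 (u x) * h + h^2 * Im (W x) - h * Z 2 1 x + h * Z 1 2 x)"
  by (intro litg_add litg_diff integrable_mult_right integrable_mult_left Z Im0 iB)
 have Ti: "integrable Leb T"
  using I by (subst Bochner_Integration.integrable_cong[OF refl, where g = "%x. ka x * B x * cmod2 (u x) * h + h^2 * Im (W x) - h * Z 2 1 x + h * Z 1 2 x"]) (auto simp: id)
 have "h * (\<integral>x. ka x * B x * cmod2 (u x) \<partial>Leb)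
   = (\<integral>x. ka x * B x * cmod2 (u x) * h + h^2 * Im (W x) - h * Z 2 1 x + h * Z 1 2 x \<partial>Leb)"
  using Z Im0 iB by simp
 also have "... = integral\<^sup>L Leb T" by (intro lint_cong) (auto simp: id)
 also have "... <= (\<integral>x. K0 * (\<Sum>j\<in>UNIV. cmod2 (v j x)) + h * K1 * (cmod (u x) * (\<Sum>j\<in>UNIV. cmod (v j x))) \<partial>Leb)"
 proof (rule lint_mono[OF Ti])
  show "integrable Leb (%x. K0 * (\<Sum>j\<in>UNIV. cmod2 (v j x)) + h * K1 * (cmod (u x) * (\<Sum>j\<in>UNIV. cmod (v j x))))"
   unfolding v_def by (intro litg_add integrable_mult_right energy_integrable)
  fix x assume "x \<in> space Leb"
  then have x: "x \<in> Om" by simp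
  have 1: "ka x * Im (v 2 x * cnj (v 1 x)) <= K0 * (cmod (v 2 x) * cmod (v 1 x))"
  proof -
   have "ka x * Im (v 2 x * cnj (v 1 x)) <= \<bar>ka x\<bar> * \<bar>Im (v 2 x * cnj (v 1 x))\<bar>" unfolding abs_mult[symmetric] by simp
   also have "... <= K0 * (cmod (v 2 x) * cmod (v 1 x))"
    using abs_Im_le_cmod[of "v 2 x * cnj (v 1 x)"] K(1)[OF x] K(3) by (intro mult_mono) (auto simp: norm_mult)
   finally show ?thesis .
  qed
  have 2: "\<bar>partial i ka x * Re (u x * cnj (v j x))\<bar> <= K1 * (cmod (u x) * cmod (v j x))" for i j
   unfolding abs_mult using abs_Re_le_cmod[of "u x * cnj (v j x)"] K(2)[OF x] K(4) by (intro mult_mono) (auto simp: norm_mult)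
  have "K0 * (2 * (cmod (v 2 x) * cmod (v 1 x))) <= K0 * (cmod2 (v 1 x) + cmod2 (v 2 x))"
   using zero_le_power2[of "cmod (v 1 x) - cmod (v 2 x)"] K(3) by (intro mult_left_mono) (auto simp: power2_diff algebra_simps)
  moreover have "- (partial 2 ka x * Re (u x * cnj (v 1 x)) - partial 1 ka x * Re (u x * cnj (v 2 x))) <= K1 * (cmod (u x) * cmod (v 1 x)) + K1 * (cmod (u x) * cmod (v 2 x))"
   using 2[of 2 1] 2[of 1 2] by linarith
  then have "h * (- (partial 2 ka x * Re (u x * cnj (v 1 x)) - partial 1 ka x * Re (u x * cnj (v 2 x)))) <= h * (K1 * (cmod (u x) * cmod (v 1 x)) + K1 * (cmod (u x) * cmod (v 2 x)))"
   using h by (intro mult_left_mono) auto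
  ultimately show "T x <= K0 * (\<Sum>j\<in>UNIV. cmod2 (v j x)) + h * K1 * (cmod (u x) * (\<Sum>j\<in>UNIV. cmod (v j x)))"
   using 1 unfolding T_def sum_2 by (simp add: algebra_simps)
 qed
 also have "... = K0 * energy h u g + h * K1 * cross h u g"
  unfolding v_def energy_def cross_def
  by (subst lint_add) (auto intro!: integrable_mult_right energy_integrable)
 finally show ?thesis .
qed

end

text \<open>The divergence of \<open>X\<close> is \<open>b |\<nabla>B|\<^sup>2 / (\<rho>\<^sup>2 (1+y\<^sup>2))\<close> up to errors of size \<open>w/s\<close> and terms in the boundary layer, while \<open>\<kappa> B/(s w) = b y (arctan y) \<rho>/s\<close>. Where \<open>|\<nabla>B| \<ge> c r\<close> the sum is bounded below for every \<open>y\<close>; where \<open>|B| \<ge> c\<close> the smallness of \<open>w\<close> makes \<open>|y| \<ge> 1\<close>.\<close>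
lemma critical_zero_multiplier:
 assumes w: "0 < w" "w <= s" "s <= 1" "w <= c / (M + 2)"
 obtains X :: "2 => real^2 => real" and ka where
  "!!j. C1_compact Om (X j)" "!!x j. x \<in> Om ==> \<bar>X j x\<bar> <= 2 * M * w"
  "C1_compact Om ka" "!!x. x \<in> Om ==> \<bar>ka x\<bar> <= 2" "!!x j. x \<in> Om ==> \<bar>partial j ka x\<bar> <= (M + 4) / w"
  "!!x. x \<in> Om ==> min 1 ((2 * c / 5)^2) / 2 * indicator {x. s <= infdist x S} x
   <= (\<Sum>j\<in>UNIV. partial j (X j) x) + 20 * M * (w / s) + (4 * M + 1) * indicator {x. infdist x (- Om) < 5 * w} x + ka x * B x / (s * w)"
proof -
 obtain F T and G :: "2 => real^2 => real" where F: "!!n. C1_on UNIV (F n)" "!!x. x \<in> Om ==> infdist x S <= T" "T >= 0"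
   "!!n x. \<bar>F n x - min (infdist x S) T\<bar> <= 1 / real (Suc n)"
   "!!n x j. \<bar>partial j (F n) x\<bar> <= 1" "!!x j. \<bar>G j x\<bar> <= 1" "!!j. G j \<in> borel_measurable Leb"
   "!!j. AE x in Leb. (%n. partial j (F n) x) \<longlonglongrightarrow> G j x"
  by (rule smooth_distance[OF S]) (rule that)
 have s: "s > 0" using w by simp
 then obtain n where n: "1 / real (Suc n) <= s / 2" using nat_approx_posE[of "s / 2"] by (auto intro: less_imp_le)
 define \<rho> where "\<rho> x = s + F n x" for x
 have \<rho>C: "C1_on UNIV \<rho>" and \<rho>p: "partial j \<rho> x = partial j (F n) x" for j x
  unfolding \<rho>_def[abs_def] using C1_on_add[OF C1_on_const[of _ s] F(1)[of n]] by (auto simp: partial_def)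
 have \<rho>b: "infdist x S + s / 2 <= \<rho> x" "\<rho> x <= infdist x S + 3 * s / 2" if "x \<in> Om" for x
  using F(4)[of n x] F(2)[OF that] n unfolding \<rho>_def by linarith+
 have \<rho>s: "s / 2 <= \<rho> x" for x
  using F(4)[of n x] n infdist_nonneg[of x S] F(3) unfolding \<rho>_def by linarith
 have \<rho>1: "\<bar>partial j \<rho> x\<bar> <= 1" for j x unfolding \<rho>p by (rule F(5))
 have \<rho>pos: "\<rho> x > 0" for x using \<rho>s[of x] s by linarith
 define q where "q x = inverse (\<rho> x)" for x
 have qC: "C1_on UNIV q" and qp: "partial j q x = - ((q x)\<^sup>2 * partial j \<rho> x)" for j x
 proof -
  have d: "(inverse has_real_derivative - (inverse (\<rho> x))\<^sup>2) (at (\<rho> x))" for x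
   using DERIV_inverse[of "\<rho> x" UNIV] \<rho>pos[of x] by (simp add: numeral_2_eq_2)
  have ct: "continuous_on UNIV (%x. - (inverse (\<rho> x))\<^sup>2)"
   by (intro continuous_intros C1_on_continuous[OF \<rho>C]) (use \<rho>pos in \<open>metis less_irrefl\<close>)
  note cc = C1_on_compose_real[OF \<rho>C, of inverse "%y. - (inverse y)\<^sup>2", OF d ct]
  show "C1_on UNIV q" unfolding q_def[abs_def] by (rule cc(1))
  show "partial j q x = - ((q x)\<^sup>2 * partial j \<rho> x)" unfolding q_def[abs_def] using cc(2)[of x j] by simp
 qed
 have qpos: "q x > 0" "q x <= 2 / s" "q x * \<rho> x = 1" for x
 proof -
  show "q x > 0" "q x * \<rho> x = 1" using \<rho>pos[of x] by (auto simp: q_def)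
  show "q x <= 2 / s" using \<rho>s[of x] le_imp_inverse_le[of "s / 2" "\<rho> x"] s by (simp add: q_def)
 qed
 have qOm: "C1_on Om q" by (rule C1_on_subset[OF qC subset_UNIV])
 define y where "y x = (1 / w) * (B x * q x)" for x
 note Bq = C1_on_mult[OF B_C1(1) qOm]
 note yl = C1_on_linear[OF bounded_linear_mult_right[of "1 / w"] Bq(1)]
 have yC: "C1_on Om y" unfolding y_def[abs_def] by (rule yl(1))
 have yp: "w * partial j y x = partial j B x * q x - y x * w * (q x * partial j \<rho> x)" if "x \<in> Om" for j x
  using w(1) unfolding y_def[abs_def] yl(2)[OF that] Bq(2)[OF that] qp by (simp add: field_simps power2_eq_square)
 define \<tau> where "\<tau> x = 1 / (1 + (y x)^2)" for x
 define \<sigma> where "\<sigma> x = arctan (y x)" for x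
 have \<sigma>C: "C1_on Om \<sigma>" and \<sigma>p: "x \<in> Om ==> partial j \<sigma> x = \<tau> x * partial j y x" for x j
 proof -
  have ne: "1 + t^2 ~= 0" for t :: real using zero_le_power2[of t] by linarith
  have ct: "continuous_on Om (%x. inverse (1 + (y x)^2))" by (intro continuous_intros C1_on_continuous[OF yC]) (use ne in blast)
  note cc = C1_on_compose_real[OF yC, of arctan "%y. inverse (1 + y^2)", OF DERIV_arctan ct]
  show "C1_on Om \<sigma>" unfolding \<sigma>_def[abs_def] by (rule cc(1))
  show "x \<in> Om ==> partial j \<sigma> x = \<tau> x * partial j y x" unfolding \<sigma>_def[abs_def] \<tau>_def using cc(2)[of x j] by (simp add: inverse_eq_divide)
 qed
 obtain b where b: "C1_compact Om b" "!!x. 0 <= b x" "!!x. b x <= 1" "!!x j. \<bar>partial j b x\<bar> <= 1 / w"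
  "!!x. 4 * w <= infdist x (- Om) ==> b x = 1" "!!x j. 4 * w < infdist x (- Om) ==> partial j b x = 0"
  using boundary_cutoff[OF w(1)] by blast
 define ka where "ka x = b x * \<sigma> x" for x
 note kb = C1_compact_bilinear[OF bounded_bilinear_mult open_domain b(1) \<sigma>C]
 note D1 = C1_on_mult[OF B_C1(2) qOm]
 note D2 = C1_on_mult[OF \<sigma>C D1(1)]
 define a where "a j x = w * (\<sigma> x * (partial j B x * q x))" for j x
 have aC: "C1_on Om (a j)" for j unfolding a_def[abs_def] by (rule C1_on_linear(1)[OF bounded_linear_mult_right D2(1)])
 note ab = C1_compact_bilinear[OF bounded_bilinear_mult open_domain b(1) aC]
 define X where "X j x = b x * a j x" for j x
 have Dq: "\<bar>partial j B x * q x\<bar> <= M" if "x \<in> Om" for x j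
 proof -
  have "\<bar>partial j B x\<bar> <= M * \<rho> x"
   using B_bound(1)[OF that, of j] \<rho>b(1)[OF that] s const(1) mult_left_mono[of "infdist x S" "\<rho> x" M] by linarith
  then have "\<bar>partial j B x\<bar> * q x <= (M * \<rho> x) * q x" using qpos(1)[of x] by (intro mult_right_mono) auto
  then show ?thesis using qpos(1,3)[of x] by (simp add: abs_mult mult.assoc mult.commute[of "\<rho> x"])
 qed
 have \<sigma>2: "\<bar>\<sigma> x\<bar> <= 2" and \<tau>b: "0 < \<tau> x" "\<tau> x <= 1" "\<tau> x * \<bar>y x\<bar> <= 1" for x
  unfolding \<sigma>_def \<tau>_def using arctan_bounds[of "y x"] by auto
 have wq: "w * q x <= 2 * (w / s)" "w * q x <= 2" for x
 proof -
  show "w * q x <= 2 * (w / s)" using mult_left_mono[OF qpos(2)[of x], of w] w(1) by (simp add: mult.commute)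
  also have "... <= 2" using w s by (simp add: field_simps)
  finally show "w * q x <= 2" .
 qed
 have Xb: "\<bar>X j x\<bar> <= 2 * M * w" if "x \<in> Om" for x j
 proof -
  have "\<bar>\<sigma> x\<bar> * \<bar>partial j B x * q x\<bar> <= 2 * M" using \<sigma>2[of x] Dq[OF that, of j] by (intro mult_mono) auto
  then have "w * (\<bar>\<sigma> x\<bar> * \<bar>partial j B x * q x\<bar>) <= w * (2 * M)" using w(1) by (intro mult_left_mono) auto
  then have "\<bar>a j x\<bar> <= 2 * M * w" using w(1) by (simp add: a_def abs_mult algebra_simps)
  then show ?thesis unfolding X_def abs_mult using b(2,3)[of x] mult_mono[of "\<bar>b x\<bar>" 1 "\<bar>a j x\<bar>" "2 * M * w"] by simp
 qed
 have kab: "\<bar>ka x\<bar> <= 2" for x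
  unfolding ka_def abs_mult using b(2,3)[of x] \<sigma>2[of x] mult_mono[of "\<bar>b x\<bar>" 1 "\<bar>\<sigma> x\<bar>" 2] by simp
 have kap: "\<bar>partial j ka x\<bar> <= (M + 4) / w" if "x \<in> Om" for x j
 proof -
  have y1: "\<bar>\<tau> x * (y x * (w * q x * partial j \<rho> x))\<bar> <= 2"
  proof -
   have "\<bar>w * q x * partial j \<rho> x\<bar> <= 2 * 1" unfolding abs_mult[of "w * q x"] using wq(2)[of x] \<rho>1[of j x] w(1) qpos(1)[of x]
    by (intro mult_mono) auto
   then have "(\<tau> x * \<bar>y x\<bar>) * \<bar>w * q x * partial j \<rho> x\<bar> <= 1 * 2" using \<tau>b[of x] by (intro mult_mono) auto
   then show ?thesis using \<tau>b(1)[of x] by (simp add: abs_mult mult.assoc)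
  qed
  have "\<bar>\<tau> x * (partial j B x * q x)\<bar> <= 1 * M" unfolding abs_mult[of "\<tau> x"] using \<tau>b[of x] Dq[OF that, of j] by (intro mult_mono) auto
  moreover have ws: "w * partial j \<sigma> x = \<tau> x * (partial j B x * q x) - \<tau> x * (y x * (w * q x * partial j \<rho> x))"
   using yp[OF that, of j] unfolding \<sigma>p[OF that] by algebra
  ultimately have 1: "\<bar>w * partial j \<sigma> x\<bar> <= M + 2" using y1 by linarith
  have f1: "\<bar>b x * (w * partial j \<sigma> x)\<bar> <= 1 * (M + 2)" unfolding abs_mult[of "b x"] using b(2,3)[of x] 1 by (intro mult_mono) auto
  have f2: "\<bar>(w * partial j b x) * \<sigma> x\<bar> <= 1 * 2"
   unfolding abs_mult[of "w * partial j b x"] using b(4)[of j x] w(1) \<sigma>2[of x] by (intro mult_mono) (auto simp: abs_mult field_simps)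
  have f3: "w * partial j ka x = b x * (w * partial j \<sigma> x) + (w * partial j b x) * \<sigma> x"
   unfolding ka_def[abs_def] kb(2)[OF that] by algebra
  have "\<bar>w * partial j ka x\<bar> <= 1 * (M + 2) + 1 * 2"
   unfolding f3 by (rule order_trans[OF abs_triangle_ineq add_mono[OF f1 f2]])
  then show ?thesis using w(1) by (simp add: abs_mult field_simps)
 qed
 let ?lay = "%x. indicator {x. infdist x (- Om) < 5 * w} x :: real"
 have dX: "b x * (\<tau> x * (partial j B x * q x)^2) - 10 * M * (w / s) - 2 * M * ?lay x <= partial j (X j) x" if "x \<in> Om" for x j
 proof -
  define D where "D = partial j B x * q x"
  define R where "R = partial j \<rho> x"
  define D2 where "D2 = partial j (partial j B) x"
  have D: "\<bar>D\<bar> <= M" unfolding D_def by (rule Dq[OF that])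
  have pa: "partial j (a j) x = \<tau> x * D^2 - (\<tau> x * y x) * (w * q x) * R * D + \<sigma> x * ((w * q x) * D2 - (w * q x) * D * R)"
  proof -
   have "partial j (a j) x = w * (\<sigma> x * (partial j B x * partial j q x + D2 * q x) + partial j \<sigma> x * D)"
    unfolding a_def[abs_def] C1_on_linear(2)[OF bounded_linear_mult_right D2(1) that] D2(2)[OF that] D1(2)[OF that] D2_def D_def by simp
   also have "... = \<sigma> x * (w * (partial j B x * partial j q x) + w * D2 * q x) + \<tau> x * (w * partial j y x) * D"
    unfolding \<sigma>p[OF that] by algebra
   also have "... = \<sigma> x * (w * (partial j B x * (- ((q x)\<^sup>2 * R))) + w * D2 * q x) + \<tau> x * (D - y x * w * (q x * R)) * D"
    unfolding yp[OF that] qp D_def R_def ..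
   also have "... = \<tau> x * D^2 - (\<tau> x * y x) * (w * q x) * R * D + \<sigma> x * ((w * q x) * D2 - (w * q x) * D * R)"
    unfolding D_def by algebra
   finally show ?thesis .
  qed
  have wq0: "0 <= w * q x" using w(1) qpos(1)[of x] by simp
  have R: "\<bar>R\<bar> <= 1" unfolding R_def by (rule \<rho>1)
  have e1: "\<bar>(\<tau> x * y x) * (w * q x) * R * D\<bar> <= 1 * (2 * (w / s)) * 1 * M"
  proof -
   have ty: "\<bar>\<tau> x * y x\<bar> <= 1" using \<tau>b[of x] by (simp add: abs_mult)
   have wa: "\<bar>w * q x\<bar> <= 2 * (w / s)" using wq(1)[of x] wq0 by simp
   show ?thesis
    unfolding abs_mult[of "\<tau> x * y x * (w * q x) * R"] abs_mult[of "\<tau> x * y x * (w * q x)"] abs_mult[of "\<tau> x * y x" "w * q x"]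
    by (intro mult_mono ty wa R D) (use s w(1) in auto)
  qed
  have e2: "\<bar>\<sigma> x * ((w * q x) * D2 - (w * q x) * D * R)\<bar> <= 2 * (4 * M * (w / s))"
  proof -
   have D2: "\<bar>D2\<bar> <= M" unfolding D2_def by (rule B_bound(2)[OF that])
   have f1: "\<bar>(w * q x) * D2\<bar> <= (2 * (w / s)) * M" unfolding abs_mult[of "w * q x"] using wq(1)[of x] wq0 D2 w(1) s by (intro mult_mono) auto
   have f2: "\<bar>(w * q x) * D * R\<bar> <= (2 * (w / s)) * M * 1"
    unfolding abs_mult[of "w * q x * D"] abs_mult[of "w * q x"] using wq(1)[of x] wq0 D R w(1) s const(1) by (intro mult_mono) auto
   have "\<bar>(w * q x) * D2 - (w * q x) * D * R\<bar> <= (2 * (w / s)) * M + (2 * (w / s)) * M * 1"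
    by (rule order_trans[OF abs_triangle_ineq4 add_mono[OF f1 f2]])
   also have "... = 4 * M * (w / s)" by simp
   finally show ?thesis unfolding abs_mult[of "\<sigma> x"] using \<sigma>2[of x] by (intro mult_mono) auto
  qed
  have e3: "\<tau> x * D^2 - 10 * M * (w / s) <= partial j (a j) x"    proof -
   have gen: "T - 10 * M * t <= T - y + z" if "\<bar>y\<bar> <= 1 * (2 * t) * 1 * M" "\<bar>z\<bar> <= 2 * (4 * M * t)" for T y z t :: real
    using that by (simp add: abs_le_iff algebra_simps)
   show ?thesis unfolding pa by (rule gen[OF e1 e2])
  qed
  have nn: "0 <= 10 * M * (w / s)" using const(1) w(1) s by simp
  have "b x * (\<tau> x * D^2) - 10 * M * (w / s) <= b x * (\<tau> x * D^2 - 10 * M * (w / s))"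
   using mult_right_mono[OF b(3)[of x] nn] by (simp add: algebra_simps)
  also have "... <= b x * partial j (a j) x" using e3 b(2)[of x] by (rule mult_left_mono)
  finally have e4: "b x * (\<tau> x * D^2) - 10 * M * (w / s) <= b x * partial j (a j) x" .
  have e5: "- (2 * M * ?lay x) <= partial j b x * a j x"
  proof (cases "infdist x (- Om) < 5 * w")
   case True
   have f: "\<bar>(w * partial j b x) * (\<sigma> x * D)\<bar> <= 1 * (2 * M)"
    unfolding abs_mult[of "w * partial j b x"] abs_mult[of "\<sigma> x"] using b(4)[of j x] w(1) \<sigma>2[of x] D
    by (intro mult_mono) (auto simp: abs_mult field_simps)
   have e: "partial j b x * a j x = (w * partial j b x) * (\<sigma> x * D)" unfolding a_def D_def by algebra
   show ?thesis unfolding e using abs_le_D2[OF f] True by simp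
  next
   case False
   then have "partial j b x = 0" using b(6) w(1) by simp
   then show ?thesis using False by simp
  qed
  have "partial j (X j) x = b x * partial j (a j) x + partial j b x * a j x" unfolding X_def[abs_def] by (rule ab(2)[OF that])
  then show ?thesis using e4 e5 unfolding D_def by linarith
 qed
 \<comment> \<open>\<open>2/5\<close> is the least value of the distance divided by \<open>\<rho>\<close> where the distance is at least \<open>s\<close>\<close>
 define c1 where "c1 = min 1 ((2 * c / 5)^2)"
 have c1: "0 < c1" "c1 <= 1" "c1 <= (2 * c / 5)^2" using const(2) by (auto simp: c1_def)
 have key: "b x * (c1 / 2 * indicator {x. s <= infdist x S} x) <= b x * (\<tau> x * (norm (grad B x) * q x)^2) + ka x * B x / (s * w)" if "x \<in> Om" for x
 proof -
  have By: "B x = y x * w * \<rho> x" using w(1) qpos(3)[of x] unfolding y_def by (simp add: mult.assoc)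
  have kaB: "ka x * B x / (s * w) = b x * ((y x * \<sigma> x) * (\<rho> x / s))" unfolding ka_def By using w(1) s by (simp add: field_simps)
  have y\<sigma>: "0 <= y x * \<sigma> x" unfolding \<sigma>_def by (rule arctan_bounds(2))
  have "c1 / 2 * indicator {x. s <= infdist x S} x <= \<tau> x * (norm (grad B x) * q x)^2 + (y x * \<sigma> x) * (\<rho> x / s)"
  proof (cases "s <= infdist x S")
   case True
   have "1 <= \<rho> x / s" using \<rho>b(1)[OF that] True s by simp
   then have ge: "y x * \<sigma> x <= (y x * \<sigma> x) * (\<rho> x / s)" using mult_left_mono[of 1 "\<rho> x / s", OF _ y\<sigma>] by simp
   have "c1 / 2 <= \<tau> x * (norm (grad B x) * q x)^2 + y x * \<sigma> x"
    using B_nondegenerate[OF that]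
   proof
    assume g: "c * infdist x S <= norm (grad B x)"
    have "\<rho> x <= 5 / 2 * infdist x S" using \<rho>b(2)[OF that] True by linarith
    then have "c * \<rho> x * (2 / 5) <= c * infdist x S" using const(2) by simp
    then have "c * \<rho> x * (2 / 5) <= norm (grad B x)" using g by linarith
    then have "(c * \<rho> x * (2 / 5)) * q x <= norm (grad B x) * q x" using qpos(1)[of x] by (intro mult_right_mono) auto
    moreover have "(c * \<rho> x * (2 / 5)) * q x = 2 * c / 5"
    proof -
     have "(c * \<rho> x * (2 / 5)) * q x = 2 * c / 5 * (q x * \<rho> x)" by simp
     then show ?thesis unfolding qpos(3) by simp
    qed
    ultimately have "2 * c / 5 <= norm (grad B x) * q x" by (simp only:)
    then have "(2 * c / 5)^2 <= (norm (grad B x) * q x)^2" using const(2) by (intro power_mono) auto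
    then have "\<tau> x * c1 <= \<tau> x * (norm (grad B x) * q x)^2" using c1(3) \<tau>b(1)[of x] by (intro mult_left_mono) auto
    moreover have "c1 * (y x * \<sigma> x) <= y x * \<sigma> x" using mult_right_mono[OF c1(2) y\<sigma>] by simp
    moreover have "c1 * (1 / 2) <= c1 * (\<tau> x + y x * \<sigma> x)"
     unfolding \<tau>_def \<sigma>_def using arctan_bounds(4)[of "y x"] c1(1) by (intro mult_left_mono) auto
    ultimately show ?thesis by (simp add: algebra_simps)
   next
    assume B: "c <= \<bar>B x\<bar>"
    have "\<rho> x <= M + 2" using \<rho>b(2)[OF that] dist_bound[OF that] w(3) by linarith
    then have "w * \<rho> x <= w * (M + 2)" using w(1) by (intro mult_left_mono) auto
    also have "... <= c" using w(4) const(1) by (simp add: field_simps)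
    also have "... <= \<bar>y x\<bar> * (w * \<rho> x)" using B w(1) \<rho>pos[of x] unfolding By by (simp add: abs_mult)
    finally have "1 <= \<bar>y x\<bar>" using w(1) \<rho>pos[of x] by simp
    then have "1 / 2 <= y x * \<sigma> x" unfolding \<sigma>_def by (rule arctan_bounds(3))
    moreover have "0 <= \<tau> x * (norm (grad B x) * q x)^2" using \<tau>b(1)[of x] by simp
    ultimately show ?thesis using c1(2) by linarith
   qed
   then have "c1 / 2 <= \<tau> x * (norm (grad B x) * q x)^2 + (y x * \<sigma> x) * (\<rho> x / s)" using ge by linarith
   then show ?thesis using True by simp
  next
   case False
   have "0 <= (y x * \<sigma> x) * (\<rho> x / s)" using y\<sigma> by (rule mult_nonneg_nonneg) (use \<rho>pos[of x] s in simp)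
   then have "0 <= \<tau> x * (norm (grad B x) * q x)^2 + (y x * \<sigma> x) * (\<rho> x / s)" using \<tau>b(1)[of x] by (intro add_nonneg_nonneg) auto
   then show ?thesis using False by simp
  qed
  from mult_left_mono[OF this b(2)[of x]] show ?thesis unfolding kaB by (simp add: distrib_left)
 qed
 have final: "c1 / 2 * indicator {x. s <= infdist x S} x <= (\<Sum>j\<in>UNIV. partial j (X j) x) + 20 * M * (w / s) + (4 * M + 1) * ?lay x + ka x * B x / (s * w)"
  if "x \<in> Om" for x
 proof -
  let ?I = "c1 / 2 * indicator {x. s <= infdist x S} x"
  have I: "0 <= ?I" "?I <= 1" using c1 by (auto simp: indicator_def)
  have "?I <= b x * ?I + ?lay x"
  proof (cases "infdist x (- Om) < 5 * w")
   case True
   have "0 <= b x * ?I" using b(2)[of x] I(1) by (rule mult_nonneg_nonneg)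
   then show ?thesis using True I(2) by simp
  next
   case False
   then show ?thesis using b(5)[of x] w(1) by simp
  qed
  moreover have "b x * (\<tau> x * (norm (grad B x) * q x)^2) = b x * (\<tau> x * (partial 1 B x * q x)^2) + b x * (\<tau> x * (partial 2 B x * q x)^2)"
  proof -
   have "(norm (grad B x))^2 = (partial 1 B x)^2 + (partial 2 B x)^2"
    unfolding power2_norm_eq_inner inner_vec_def grad_component inner_real_def sum_2 by (simp add: power2_eq_square)
   then show ?thesis unfolding power_mult_distrib by algebra
  qed
  ultimately show ?thesis using key[OF that] dX[OF that, of 1] dX[OF that, of 2] unfolding sum_2 distrib_right by linarith
 qed
 show thesis
 proof (rule that[of X ka])
  show "C1_compact Om (X j)" for j unfolding X_def[abs_def] by (rule ab(1))
  show "C1_compact Om ka" unfolding ka_def[abs_def] by (rule kb(1))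
 qed (use Xb kab kap final[unfolded c1_def] in auto)
qed

lemma mass_away_from_critical_zeros:
 "\<exists>C>0. \<exists>w0>0. \<forall>h w s u g. 0 < h --> 0 < w --> w <= s --> s <= 1 --> w <= w0 --> (\<forall>j. weak j u (g j)) -->
  (\<integral>x. indicator {x. s <= infdist x S} x * cmod2 (u x) \<partial>Leb)
   <= C * ((w / s) * mass u + (w / h) * cross h u g + (energy h u g + (h / w) * cross h u g) / (h * w * s))"
proof -
 obtain L t0 where L: "L > 0" "t0 > 0" "\<forall>t. 0 < t --> t <= t0 --> (\<forall>u g. (\<forall>j. weak j u (g j)) -->
  (\<integral>x. indicator {x. infdist x (- Om) < t} x * cmod2 (u x) \<partial>Leb) <= L * t * bl_energy u g)"
  using boundary_layer by blast
 define c1 where "c1 = min 1 ((2 * c / 5)^2) / 2"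
 have c1: "c1 > 0" using const(2) by (simp add: c1_def)
 define C0 where "C0 = 24 * M + (4 * M + 1) * (5 * L) + M + 6"
 have C0: "C0 > 0" "20 * M + (4 * M + 1) * (5 * L) <= C0" "4 * M + (4 * M + 1) * (5 * L) <= C0" "2 <= C0" "M + 4 <= C0"
  using const(1) L(1) by (auto simp: C0_def intro: add_pos_pos add_nonneg_pos)
 define w0 where "w0 = min (t0 / 5) (c / (M + 2))"
 have main: "(\<integral>x. indicator {x. s <= infdist x S} x * cmod2 (u x) \<partial>Leb)
   <= C0 / c1 * ((w / s) * mass u + (w / h) * cross h u g + (energy h u g + (h / w) * cross h u g) / (h * w * s))"
  if h: "0 < h" and w: "0 < w" "w <= s" "s <= 1" "w <= w0" and u: "\<forall>j. weak j u (g j)" for h w s u g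
 proof -
  let ?T = "(w / s) * mass u + (w / h) * cross h u g + (energy h u g + (h / w) * cross h u g) / (h * w * s)"
  have u': "!!j. weak j u (g j)" using u by blast
  have w4: "w <= c / (M + 2)" "5 * w <= t0" using w(4) by (auto simp: w0_def)
  obtain X ka where X: "!!j. C1_compact Om (X j)" "!!x j. x \<in> Om ==> \<bar>X j x\<bar> <= 2 * M * w"
   and ka: "C1_compact Om ka" "!!x. x \<in> Om ==> \<bar>ka x\<bar> <= 2" "!!x j. x \<in> Om ==> \<bar>partial j ka x\<bar> <= (M + 4) / w"
   and low: "!!x. x \<in> Om ==> min 1 ((2 * c / 5)^2) / 2 * indicator {x. s <= infdist x S} x
   <= (\<Sum>j\<in>UNIV. partial j (X j) x) + 20 * M * (w / s) + (4 * M + 1) * indicator {x. infdist x (- Om) < 5 * w} x + ka x * B x / (s * w)"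
   using critical_zero_multiplier[OF w(1-3) w4(1)] by blast
  let ?u = "%x. cmod2 (u x)"
  note nn = energy_nonneg[OF h u']
  note iu = energy_integrable(1)[OF h u']
  note csi = C1_compact_square_integrable[OF h u']
  have sets: "{x. s <= infdist x S} \<in> sets lebesgue" "{x. infdist x (- Om) < 5 * w} \<in> sets lebesgue"
   by (intro sets_completionI_sets, simp, intro borel_closed closed_Collect_le continuous_intros)
    (intro sets_completionI_sets, simp, intro borel_open open_Collect_less continuous_intros)
  note il = indicator_integrable[OF iu sets(1)] indicator_integrable[OF iu sets(2)]
  have iX: "integrable Leb (%x. \<Sum>j\<in>UNIV. partial j (X j) x * ?u x)"
   by (intro litg_sum csi(2) X(1))
  have iB: "integrable Leb (%x. ka x * B x * ?u x)"
   by (rule csi(1)[OF C1_compact_bilinear(1)[OF bounded_bilinear_mult open_domain ka(1) B_C1(1)]])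
  let ?R = "%x. (\<Sum>j\<in>UNIV. partial j (X j) x * ?u x) + 20 * M * (w / s) * ?u x + (4 * M + 1) * (indicator {x. infdist x (- Om) < 5 * w} x * ?u x)
    + (1 / (s * w)) * (ka x * B x * ?u x)"
  have iR: "integrable Leb ?R" by (intro litg_add integrable_mult_right iX iu il iB)
  have "c1 * (\<integral>x. indicator {x. s <= infdist x S} x * ?u x \<partial>Leb) = (\<integral>x. c1 * (indicator {x. s <= infdist x S} x * ?u x) \<partial>Leb)" by simp
  also have "... <= integral\<^sup>L Leb ?R"
  proof (rule lint_mono[OF integrable_mult_right[OF il(1)] iR])
   fix x assume "x \<in> space Leb"
   then have "x \<in> Om" by simp
   from mult_right_mono[OF low[OF this], of "?u x"]
   show "c1 * (indicator {x. s <= infdist x S} x * ?u x) <= ?R x" unfolding c1_def by (simp add: algebra_simps sum_distrib_left)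
  qed
  also have "... = (\<Sum>j\<in>UNIV. \<integral>x. partial j (X j) x * ?u x \<partial>Leb) + 20 * M * (w / s) * mass u
    + (4 * M + 1) * (\<integral>x. indicator {x. infdist x (- Om) < 5 * w} x * ?u x \<partial>Leb) + (1 / (s * w)) * (\<integral>x. ka x * B x * ?u x \<partial>Leb)"
  proof -
   have e: "(\<integral>x. (\<Sum>j\<in>UNIV. partial j (X j) x * ?u x) \<partial>Leb) = (\<Sum>j\<in>UNIV. \<integral>x. partial j (X j) x * ?u x \<partial>Leb)"
    by (rule lint_sum) (rule csi(2)[OF X(1)])
   note i2 = integrable_mult_right[OF iu, of "20 * M * (w / s)"] and i3 = integrable_mult_right[OF il(2), of "4 * M + 1"]
    and i4 = integrable_mult_right[OF iB, of "1 / (s * w)"]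
   note a = litg_add[OF iX i2]
   note b = litg_add[OF a i3]
   have "integral\<^sup>L Leb ?R = (\<integral>x. (\<Sum>j\<in>UNIV. partial j (X j) x * ?u x) \<partial>Leb) + (\<integral>x. 20 * M * (w / s) * ?u x \<partial>Leb)
    + (\<integral>x. (4 * M + 1) * (indicator {x. infdist x (- Om) < 5 * w} x * ?u x) \<partial>Leb) + (\<integral>x. (1 / (s * w)) * (ka x * B x * ?u x) \<partial>Leb)"
    by (simp only: lint_add[OF b i4] lint_add[OF a i3] lint_add[OF iX i2])
   then show ?thesis unfolding e mass_def by simp
  qed
  also have "... <= 2 * (2 * M * w) / h * cross h u g + 20 * M * (w / s) * mass u
    + (4 * M + 1) * (L * (5 * w) * (mass u + cross h u g / h)) + (1 / (s * w)) * ((2 * energy h u g + h * ((M + 4) / w) * cross h u g) / h)"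
  proof (intro add_mono order_refl mult_left_mono)
   show "(\<Sum>j\<in>UNIV. \<integral>x. partial j (X j) x * ?u x \<partial>Leb) <= 2 * (2 * M * w) / h * cross h u g"
    by (rule divergence_estimate[OF h u' X]) (use const(1) w(1) in auto)
   have "(\<integral>x. indicator {x. infdist x (- Om) < 5 * w} x * ?u x \<partial>Leb) <= L * (5 * w) * bl_energy u g"
    by (rule L(3)[rule_format]) (use w(1) w4(2) u in auto)
   also have "... <= L * (5 * w) * (mass u + cross h u g / h)"
    using layer_energy_le[OF h u'] L(1) w(1) by (intro mult_left_mono) auto
   finally show "(\<integral>x. indicator {x. infdist x (- Om) < 5 * w} x * ?u x \<partial>Leb) <= L * (5 * w) * (mass u + cross h u g / h)" .
   have "h * (\<integral>x. ka x * B x * ?u x \<partial>Leb) <= 2 * energy h u g + h * ((M + 4) / w) * cross h u g"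
    by (rule commutator_estimate[OF h u' ka]) (use const(1) w(1) in auto)
   then show "(\<integral>x. ka x * B x * ?u x \<partial>Leb) <= (2 * energy h u g + h * ((M + 4) / w) * cross h u g) / h"
    using h by (simp add: field_simps)
  qed (use const(1) w in auto)
  also have "... <= C0 * ?T"
  proof -
   have s: "s > 0" using w by linarith
   define m where "m = (w / s) * mass u"
   define p where "p = (w / h) * cross h u g"
   define e1 where "e1 = energy h u g / (h * w * s)"
   define e2 where "e2 = (h / w) * cross h u g / (h * w * s)"
   have pos: "0 <= m" "0 <= p" "0 <= e1" "0 <= e2" unfolding m_def p_def e1_def e2_def using nn h w(1) s by auto
   have "w <= w / s" using w s by (simp add: field_simps)
   then have wm: "w * mass u <= m" unfolding m_def using nn(1) by (rule mult_right_mono)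
   have "2 * (2 * M * w) / h * cross h u g = 4 * M * p" unfolding p_def by (simp add: field_simps)
   moreover have "20 * M * (w / s) * mass u = 20 * M * m" unfolding m_def by simp
   moreover have "(4 * M + 1) * (L * (5 * w) * (mass u + cross h u g / h)) = ((4 * M + 1) * (5 * L)) * (w * mass u) + ((4 * M + 1) * (5 * L)) * p"
    unfolding p_def by (simp add: algebra_simps add_divide_distrib)
   moreover have "((4 * M + 1) * (5 * L)) * (w * mass u) <= ((4 * M + 1) * (5 * L)) * m" using wm const(1) L(1) by (intro mult_left_mono) auto
   moreover have "(1 / (s * w)) * ((2 * energy h u g + h * ((M + 4) / w) * cross h u g) / h) = 2 * e1 + (M + 4) * e2"
    unfolding e1_def e2_def using h w(1) s by (simp add: field_simps)
   moreover have "(20 * M + (4 * M + 1) * (5 * L)) * m <= C0 * m" "(4 * M + (4 * M + 1) * (5 * L)) * p <= C0 * p" "2 * e1 <= C0 * e1" "(M + 4) * e2 <= C0 * e2"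
    by (intro mult_right_mono C0 pos)+
   moreover have "C0 * ?T = C0 * m + C0 * p + C0 * e1 + C0 * e2"
    unfolding m_def p_def e1_def e2_def by (simp add: distrib_left add_divide_distrib)
   ultimately show ?thesis unfolding distrib_right by linarith
  qed
  finally show ?thesis using c1 by (simp add: pos_le_divide_eq mult.commute)
 qed
 have "C0 / c1 > 0" "w0 > 0" using C0(1) c1 L(2) const by (auto simp: w0_def)
 then show ?thesis using main by blast
qed

end

section \<open>The weighted estimate\<close>

context magnetic_domain
begin

lemma mag_deriv_eq_dA: "mag_deriv Om A h j u = dA h u (%j. weak_partial Om j u) j"
 by (simp add: fun_eq_iff mag_deriv_def dA_def)

lemma mag_form_eq_energy:
 assumes "!!j. weak j u (g j)"
 shows "mag_form Om A h u = energy h u g"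
proof -
 have u: "u \<in> H1 Om" by (rule H1I[OF assms])
 have ae: "AE x in Leb. weak_partial Om 1 u x = g 1 x \<and> weak_partial Om 2 u x = g 2 x"
  using weak_partial_AE[OF assms[of 1]] weak_partial_AE[OF assms[of 2]] by eventually_elim simp
 have m: "(%x. \<Sum>j\<in>UNIV. cmod2 (dA h u g' j x)) \<in> borel_measurable Leb"
  if "!!j. weak j u (g' j)" for g'
 proof -
  have "dA h u g' j \<in> borel_measurable Leb" for j
  proof -
   have [measurable]: "(%x. A x $ j) \<in> borel_measurable Leb"
    by (rule continuous_domain_measurable[OF C1_on_continuous[OF A_C1]])
   have [measurable]: "u \<in> borel_measurable Leb" "g' j \<in> borel_measurable Leb"
    using L2D(1)[OF weakD(1)[OF that]] L2D(1)[OF weakD(2)[OF that]] by auto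
   show ?thesis unfolding dA_def[abs_def] by measurable
  qed
  then show ?thesis by (intro borel_measurable_sum borel_measurable_power borel_measurable_norm[THEN measurable_compose_rev] measurable_compose[OF _ borel_measurable_norm]) auto
 qed
 show ?thesis
  unfolding mag_form_def energy_def mag_deriv_eq_dA
 proof (rule integral_cong_AE[OF m[OF H1D[OF u]] m[OF assms]])
  show "AE x in Leb. (\<Sum>j\<in>UNIV. cmod2 (dA h u (%j. weak_partial Om j u) j x)) = (\<Sum>j\<in>UNIV. cmod2 (dA h u g j x))"
   using ae by eventually_elim (simp add: sum_2 dA_def)
 qed
qed

text \<open>Green's formula with the test function \<open>cnj (exp (2kr) \<psi>)\<close>. The cross terms of the weighted derivatives cancel against those of the test function, so only the squared gradient of the weight remains.\<close>
lemma weighted_energy_le: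
 fixes G :: "2 => real^2 => real"
 assumes eig: "eigenpair Om A h \<mu> \<psi>" and h: "h > 0" and k: "k >= 0"
  and G: "!!x. (\<Sum>j\<in>UNIV. (G j x)^2) <= 2"
  and weak: "!!k u g j. 0 <= k ==> weak j u g ==>
   weak j (%x. exp (k * infdist x S) *\<^sub>R u x) (%x. exp (k * infdist x S) *\<^sub>R (g x + (k * G j x) *\<^sub>R u x))"
 defines "u \<equiv> %x. exp (k * infdist x S) *\<^sub>R \<psi> x"
 defines "g \<equiv> %j x. exp (k * infdist x S) *\<^sub>R (weak_partial Om j \<psi> x + (k * G j x) *\<^sub>R \<psi> x)"
 shows "!!j. weak j u (g j)" "energy h u g <= (\<mu> + 2 * h^2 * k^2) * mass u"
proof -
 define v where "v j = mag_deriv Om A h j \<psi>" for j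
 define dv where "dv j = weak_partial Om j (v j)" for j
 obtain gt where nd: "\<psi> \<in> H2 Om" "!!j. has_trace Om (v j) (gt j)"
   "AE x in surface_measure Om. (\<Sum>j\<in>UNIV. complex_of_real (outward_normal Om x $ j) * gt j x) = 0"
  and op: "AE x in Leb. mag_op Om A h \<psi> x = complex_of_real \<mu> * \<psi> x"
  using eig unfolding eigenpair_def neumann_domain_def v_def by auto
 have \<psi>: "weak j \<psi> (weak_partial Om j \<psi>)" for j using nd(1) H1D[of \<psi> j] by (simp add: H2_def)
 interpret neumann_field Om v dv gt by unfold_locales (use nd dv_def in auto)
 show ug: "weak j u (g j)" for j unfolding u_def g_def by (rule weak[OF k \<psi>])
 define \<phi> where "\<phi> x = cnj (exp ((2 * k) * infdist x S) *\<^sub>R \<psi> x)" for x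
 define d\<phi> where "d\<phi> j x = cnj (exp ((2 * k) * infdist x S) *\<^sub>R (weak_partial Om j \<psi> x + ((2 * k) * G j x) *\<^sub>R \<psi> x))" for j x
 have "0 <= 2 * k" using k by simp
 from weak_cnj[OF weak[OF this \<psi>]]
 have \<phi>w: "weak j \<phi> (d\<phi> j)" for j unfolding \<phi>_def[abs_def] d\<phi>_def[abs_def] .
 have vL: "v j \<in> L2 Leb" "dv j \<in> L2 Leb" for j using weakD[OF field_div] by auto
 note i1 = L2_product(3)[OF vL(2) weakD(1)[OF \<phi>w]] and i2 = L2_product(3)[OF vL(1) weakD(2)[OF \<phi>w]]
 define I where "I x = (\<Sum>j\<in>UNIV. dv j x * \<phi> x + v j x * d\<phi> j x)" for x
 have Ii: "integrable Leb I" unfolding I_def[abs_def] by (intro litg_sum litg_add i1 i2)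
 have "integral\<^sup>L Leb I = (\<Sum>j\<in>UNIV. \<integral>x. dv j x * \<phi> x + v j x * d\<phi> j x \<partial>Leb)"
  unfolding I_def[abs_def] by (rule lint_sum) (intro litg_add i1 i2)
 also have "... = div_pairing v dv \<phi> d\<phi>"
  unfolding div_pairing_def by (rule sum.cong[OF refl]) (rule lint_add[OF i1 i2])
 also have "... = 0" by (rule neumann_green[OF \<phi>w])
 finally have I0: "integral\<^sup>L Leb I = 0" .
 have J: "integrable Leb (%x. h * Im (I x))" by (rule integrable_mult_right[OF integrable_Im[OF Ii]])
 have Im0: "(\<integral>x. Im (I x) \<partial>Leb) = 0" using integral_Im[OF Ii] I0 by auto
 note iu = energy_integrable[OF h ug]
 have "energy h u g <= (\<integral>x. (\<mu> + 2 * h^2 * k^2) * cmod2 (u x) - h * Im (I x) \<partial>Leb)"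
  unfolding energy_def
 proof (rule integral_mono_AE[OF iu(2)])
  show "integrable Leb (%x. (\<mu> + 2 * h^2 * k^2) * cmod2 (u x) - h * Im (I x))"
   by (intro litg_diff integrable_mult_right iu(1) J)
  show "AE x in Leb. (\<Sum>j\<in>UNIV. cmod2 (dA h u g j x)) <= (\<mu> + 2 * h^2 * k^2) * cmod2 (u x) - h * Im (I x)"
   using op
  proof eventually_elim
   case (elim x)
   define f where "f = exp (k * infdist x S)"
   define p where "p = \<psi> x"
   define P where "P j = weak_partial Om j \<psi> x" for j
   have f2: "exp ((2 * k) * infdist x S) = f^2" unfolding f_def power2_eq_square exp_add[symmetric] by simp
   have vx: "v j x = - \<i> * complex_of_real h * P j + complex_of_real (A x $ j) * p" for j
    unfolding v_def mag_deriv_def P_def p_def ..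
   have "(\<Sum>j\<in>UNIV. - \<i> * complex_of_real h * dv j x + complex_of_real (A x $ j) * v j x) = complex_of_real \<mu> * p"
    using elim unfolding mag_op_def p_def dv_def v_def by (simp only: mag_deriv_def[of Om A h _ "mag_deriv Om A h _ \<psi>"])
   then have op': "- \<i> * complex_of_real h * (dv 1 x + dv 2 x) = complex_of_real \<mu> * p - (complex_of_real (A x $ 1) * v 1 x + complex_of_real (A x $ 2) * v 2 x)"
    unfolding sum_2 by algebra
   have "- \<i> * complex_of_real h * I x = f\<^sup>2 *\<^sub>R ((- \<i> * complex_of_real h * (dv 1 x + dv 2 x)) * cnj p
     + (\<Sum>j\<in>UNIV. - \<i> * complex_of_real h * v j x * (cnj (P j) + (2 * k * G j x) *\<^sub>R cnj p)))"
    unfolding I_def \<phi>_def d\<phi>_def f2 P_def[symmetric] p_def[symmetric] sum_2 scaleR_conv_of_real by (simp add: algebra_simps)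
   also have "... = f^2 *\<^sub>R ((complex_of_real \<mu> * p - (complex_of_real (A x $ 1) * v 1 x + complex_of_real (A x $ 2) * v 2 x)) * cnj p
     + (\<Sum>j\<in>UNIV. - \<i> * complex_of_real h * v j x * (cnj (P j) + (2 * k * G j x) *\<^sub>R cnj p)))"
    unfolding op' ..
   finally have eq: "- \<i> * complex_of_real h * I x = ..." .
   have "h * Im (I x) = Re (- \<i> * complex_of_real h * I x)" by simp
   also have "... = f^2 * (\<mu> * (cmod p)^2 - (\<Sum>j\<in>UNIV. cmod2 (v j x)) + (\<Sum>j\<in>UNIV. 2 * h * k * G j x * Im (v j x * cnj p)))"
    unfolding eq sum_2 vx cmod_power2 by (simp add: power2_eq_square algebra_simps)
   finally have hI: "h * Im (I x) = f^2 * (\<mu> * (cmod p)^2 - (\<Sum>j\<in>UNIV. cmod2 (v j x)) + (\<Sum>j\<in>UNIV. 2 * h * k * G j x * Im (v j x * cnj p)))" .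
   have dx: "dA h u g j x = f *\<^sub>R (v j x - (\<i> * complex_of_real (h * k * G j x)) * p)" for j
    unfolding dA_def u_def g_def vx f_def[symmetric] P_def[symmetric] p_def[symmetric] scaleR_conv_of_real by (simp add: algebra_simps)
   have sq: "cmod2 (dA h u g j x) = f^2 * (cmod2 (v j x) - 2 * h * k * G j x * Im (v j x * cnj p) + (h^2 * k^2) * (G j x)^2 * (cmod p)^2)" for j
    unfolding dx norm_scaleR power_mult_distrib power2_abs cmod_power2 by (simp add: power2_eq_square algebra_simps)
   have "(\<Sum>j\<in>UNIV. cmod2 (dA h u g j x)) = f^2 * (\<mu> * (cmod p)^2 + (h^2 * k^2) * (\<Sum>j\<in>UNIV. (G j x)^2) * (cmod p)^2) - h * Im (I x)"
    unfolding hI sq sum_2 by (simp only: distrib_left distrib_right right_diff_distrib mult_ac)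
   also have "... <= f^2 * (\<mu> * (cmod p)^2 + (h^2 * k^2) * 2 * (cmod p)^2) - h * Im (I x)"
    by (intro diff_right_mono mult_left_mono add_left_mono mult_right_mono G) auto
   also have "... = (\<mu> + 2 * h^2 * k^2) * cmod2 (u x) - h * Im (I x)"
    unfolding u_def norm_scaleR power_mult_distrib power2_abs f_def[symmetric] p_def[symmetric] by (simp add: algebra_simps)
   finally show ?case .
  qed
 qed
 also have "... = (\<mu> + 2 * h^2 * k^2) * mass u"
  by (subst lint_diff[OF integrable_mult_right[OF iu(1)] J]) (simp add: Im0 mass_def)
 finally show "energy h u g <= (\<mu> + 2 * h^2 * k^2) * mass u" .
qed

text \<open>The four exponents are positive for this \<open>\<alpha>\<close> exactly because \<open>0 < d < 1/4\<close>.\<close>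
lemma small_error_exponents:
 fixes d K C :: real
 assumes "0 < d" "d < 1 / 4"
 defines "\<alpha> \<equiv> 1 / 4 + (1 / 4 - d) / 4"
 shows "\<forall>\<^sub>F h in at_right 0. C * (h powr (\<alpha> - d) + K * h powr (\<alpha> - 1 / 4) + K * h powr (1 / 2 - \<alpha> - d) + K * h powr (3 / 4 - 2 * \<alpha> - d)) < 1 / 2"
proof -
 have z: "((%h::real. h powr a) \<longlongrightarrow> 0) (at_right 0)" if "a > 0" for a
  by (rule tendsto_zero_powrI[where b = a]) (use that in \<open>auto simp: eventually_at_right_less intro: tendsto_ident_at eventually_mono[OF eventually_at_right_less]\<close>)
 have "((%h. C * (h powr (\<alpha> - d) + K * h powr (\<alpha> - 1 / 4) + K * h powr (1 / 2 - \<alpha> - d) + K * h powr (3 / 4 - 2 * \<alpha> - d)))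
   \<longlongrightarrow> C * (0 + K * 0 + K * 0 + K * 0)) (at_right 0)"
  by (intro tendsto_mult tendsto_add tendsto_const z) (use assms in \<open>auto simp: \<alpha>_def field_simps\<close>)
 then show ?thesis by (intro order_tendstoD(2)) auto
qed

text \<open>At most half of the mass lies in \<open>r \<ge> h^d\<close>, and elsewhere the weight is at most \<open>e\<close>.\<close>
lemma weighted_mass_le:
 assumes "0 < L" "0 < d" "d < 1 / 4"
 obtains h0 where "0 < h0" "h0 <= 1" "!!h \<mu> \<psi> u. 0 < h ==> h < h0 ==> eigenpair Om A h \<mu> \<psi> ==> \<mu> <= L * h powr (3 / 2) ==>
  u = (%x. exp (infdist x S / h powr d) *\<^sub>R \<psi> x) ==> u \<in> H1 Om \<and> mass u <= 2 * exp 2 * mass \<psi> \<and> mag_form Om A h u <= (L + 2) * h powr (3 / 2) * mass u"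
proof -
 obtain G where G: "!!x. (\<Sum>j\<in>UNIV. (G j x)^2) <= (2::real)" "!!j. G j \<in> borel_measurable Leb"
  "!!k u g j. 0 <= k ==> weak j u g ==>
   weak j (%x. exp (k * infdist x S) *\<^sub>R u x) (%x. exp (k * infdist x S) *\<^sub>R (g x + (k * G j x) *\<^sub>R u x))"
  by (rule weak_exp_distance[OF S]) (rule that)
 obtain C w0 where C: "C > 0" "w0 > 0" and low: "!!h w s u g. 0 < h ==> 0 < w ==> w <= s ==> s <= 1 ==> w <= w0 ==> \<forall>j. weak j u (g j) ==>
  (\<integral>x. indicator {x. s <= infdist x S} x * cmod2 (u x) \<partial>Leb)
   <= C * ((w / s) * mass u + (w / h) * cross h u g + (energy h u g + (h / w) * cross h u g) / (h * w * s))"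
  using mass_away_from_critical_zeros by blast
 define \<alpha> where "\<alpha> = 1 / 4 + (1 / 4 - d) / 4"
 have \<alpha>: "\<alpha> > d" "\<alpha> > 0" using assms unfolding \<alpha>_def by (auto simp: field_simps)
 define K where "K = sqrt (2 * (L + 2)) + (L + 2)"
 have K: "sqrt (2 * (L + 2)) <= K" "L + 2 <= K" using assms(1) by (auto simp: K_def)
 have "((%h::real. h powr \<alpha>) \<longlongrightarrow> 0) (at_right 0)"
  by (rule tendsto_zero_powrI[where b = \<alpha>]) (use \<alpha>(2) in \<open>auto intro: tendsto_ident_at eventually_mono[OF eventually_at_right_less]\<close>)
 then have "\<forall>\<^sub>F h in at_right 0. h powr \<alpha> < w0" using C(2) by (rule order_tendstoD(2))
 with small_error_exponents[OF assms(2,3), of C K, folded \<alpha>_def]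
 have "\<forall>\<^sub>F h in at_right (0::real). h powr \<alpha> < w0 \<and> C * (h powr (\<alpha> - d) + K * h powr (\<alpha> - 1 / 4) + K * h powr (1 / 2 - \<alpha> - d) + K * h powr (3 / 4 - 2 * \<alpha> - d)) < 1 / 2"
  by eventually_elim simp
 then obtain h1 where h1: "h1 > 0" "!!h. 0 < h ==> h < h1 ==> h powr \<alpha> < w0 \<and> C * (h powr (\<alpha> - d) + K * h powr (\<alpha> - 1 / 4) + K * h powr (1 / 2 - \<alpha> - d) + K * h powr (3 / 4 - 2 * \<alpha> - d)) < 1 / 2"
  unfolding eventually_at_right_field by blast
 show thesis
 proof (rule that[of "min 1 h1"])
  show "0 < min 1 h1" "min 1 h1 <= 1" using h1(1) by auto
  fix h \<mu> \<psi> u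
  assume h: "0 < h" "h < min 1 h1" and eig: "eigenpair Om A h \<mu> \<psi>" and \<mu>: "\<mu> <= L * h powr (3 / 2)"
   and udef: "u = (%x. exp (infdist x S / h powr d) *\<^sub>R \<psi> x)"
  define k where "k = 1 / h powr d"
  have k: "k >= 0" by (simp add: k_def)
  have hl: "h < 1" "h < h1" using h(2) by auto
  have u: "u = (%x. exp (k * infdist x S) *\<^sub>R \<psi> x)" unfolding udef by (simp add: k_def)
  define g where "g j x = exp (k * infdist x S) *\<^sub>R (weak_partial Om j \<psi> x + (k * G j x) *\<^sub>R \<psi> x)" for j x
  note we = weighted_energy_le[OF eig h(1) k G(1,3)]
  have ug: "weak j u (g j)" for j unfolding u g_def[abs_def] by (rule we(1))
  have ue: "energy h u g <= (\<mu> + 2 * h^2 * k^2) * mass u" unfolding u g_def[abs_def] by (rule we(2))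
  note nn = energy_nonneg[OF h(1) ug]
  have hk: "h^2 * k^2 <= h powr (3 / 2)"
  proof -
   have "h powr (2 * d) = (h powr d)^2" by (simp add: power2_eq_square flip: powr_add)
   then have "h^2 * k^2 = h powr (2 - 2 * d)" unfolding powr_diff k_def using h(1) by (simp add: power_divide powr_numeral)
   also have "... <= h powr (3 / 2)" by (rule powr_mono') (use h(1) hl(1) assms(3) in auto)
   finally show ?thesis .
  qed
  define m where "m = mass u"
  have m: "m >= 0" unfolding m_def by (rule nn(1))
  have e: "energy h u g <= (L + 2) * h powr (3 / 2) * m"
  proof -
   have "\<mu> + 2 * h^2 * k^2 <= (L + 2) * h powr (3 / 2)" using \<mu> hk by (simp add: algebra_simps)
   from mult_right_mono[OF this nn(1)] show ?thesis using ue unfolding m_def by linarith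
  qed
  have cr: "cross h u g <= K * h powr (3 / 4) * m"
  proof -
   have "cross h u g <= sqrt (2 * m * energy h u g)" unfolding m_def by (rule cross_le[OF h(1) ug])
   also have "... <= sqrt (2 * m * ((L + 2) * h powr (3 / 2) * m))" using e m by (intro real_sqrt_le_mono mult_left_mono) auto
   also have "2 * m * ((L + 2) * h powr (3 / 2) * m) = (2 * (L + 2)) * (h powr (3 / 4) * m)^2"
   proof -
    have "h powr (3 / 2) = (h powr (3 / 4))^2" using h(1) by (simp add: power2_eq_square flip: powr_add)
    then show ?thesis by (simp add: power2_eq_square algebra_simps)
   qed
   also have "sqrt ... = sqrt (2 * (L + 2)) * (h powr (3 / 4) * m)" unfolding real_sqrt_mult real_sqrt_abs using m by simp
   also have "... <= K * (h powr (3 / 4) * m)" using K(1) m by (intro mult_right_mono) auto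
   finally show ?thesis by (simp add: mult.assoc)
  qed
  define s where "s = h powr d"
  define w where "w = h powr \<alpha>"
  have sw: "0 < w" "0 < s" "w <= s" "s <= 1" "w <= w0"
   unfolding s_def w_def using h(1) hl h1(2)[of h] assms(2) \<alpha>(1) by (auto intro: powr_mono' powr_le1 less_imp_le)
  have q: "w / s = h powr (\<alpha> - d)" "w / h * h powr (3 / 4) = h powr (\<alpha> - 1 / 4)" "h powr (3 / 2) / (h * w * s) = h powr (1 / 2 - \<alpha> - d)"
   "(h / w) * h powr (3 / 4) / (h * w * s) = h powr (3 / 4 - 2 * \<alpha> - d)"
  proof -
   have h1': "h = h powr 1" using h(1) by simp
   show "w / s = h powr (\<alpha> - d)" unfolding w_def s_def by (rule powr_diff[symmetric])
   have "w / h * h powr (3 / 4) = h powr \<alpha> / h powr 1 * h powr (3 / 4)" using h(1) by (simp add: w_def)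
   also have "... = h powr (\<alpha> - 1 / 4)" unfolding powr_diff[symmetric] powr_add[symmetric] by simp
   finally show "w / h * h powr (3 / 4) = h powr (\<alpha> - 1 / 4)" .
   have "h powr (3 / 2) / (h * w * s) = h powr (3 / 2) / (h powr 1 * h powr \<alpha> * h powr d)" using h(1) by (simp add: w_def s_def)
   also have "... = h powr (1 / 2 - \<alpha> - d)" unfolding powr_diff[symmetric] powr_add[symmetric] by (simp add: algebra_simps)
   finally show "h powr (3 / 2) / (h * w * s) = h powr (1 / 2 - \<alpha> - d)" .
   have "(h / w) * h powr (3 / 4) / (h * w * s) = h powr 1 / h powr \<alpha> * h powr (3 / 4) / (h powr 1 * h powr \<alpha> * h powr d)" using h(1) by (simp add: w_def s_def)
   also have "... = h powr (3 / 4 - 2 * \<alpha> - d)" unfolding powr_diff[symmetric] powr_add[symmetric] by (simp add: algebra_simps)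
   finally show "(h / w) * h powr (3 / 4) / (h * w * s) = h powr (3 / 4 - 2 * \<alpha> - d)" .
  qed
  let ?far = "\<integral>x. indicator {x. s <= infdist x S} x * cmod2 (u x) \<partial>Leb"
  have "?far <= C * ((w / s) * m + (w / h) * cross h u g + (energy h u g + (h / w) * cross h u g) / (h * w * s))"
   unfolding m_def by (rule low) (use h(1) sw ug in auto)
  also have "... <= C * ((w / s) * m + (w / h) * (K * h powr (3 / 4) * m) + (K * h powr (3 / 2) * m + (h / w) * (K * h powr (3 / 4) * m)) / (h * w * s))"
  proof -
   have "energy h u g <= K * h powr (3 / 2) * m"
    using e K(2) m mult_right_mono[OF K(2), of "h powr (3 / 2) * m"] by (simp add: mult.assoc)
   then show ?thesis using cr C(1) h(1) sw by (intro mult_left_mono add_mono divide_right_mono order_refl) auto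
  qed
  also have "... = (C * (w / s + K * (w / h * h powr (3 / 4)) + K * (h powr (3 / 2) / (h * w * s)) + K * ((h / w) * h powr (3 / 4) / (h * w * s)))) * m"
   by (simp add: algebra_simps add_divide_distrib)
  also have "... <= 1 / 2 * m" unfolding q using h1(2)[OF h(1) hl(2)] m by (intro mult_right_mono) auto
  finally have far: "?far <= m / 2" by simp
  note iu = energy_integrable(1)[OF h(1) ug]
  have \<psi>L: "\<psi> \<in> L2 Leb"
   using eig unfolding eigenpair_def neumann_domain_def H2_def H1_def by auto
  have fs: "{x. s <= infdist x S} \<in> sets lebesgue" by (auto intro!: sets_completionI_sets borel_closed closed_Collect_le continuous_intros)
  have "m <= (\<integral>x. indicator {x. s <= infdist x S} x * cmod2 (u x) + exp 2 * cmod2 (\<psi> x) \<partial>Leb)"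
   unfolding m_def mass_def
  proof (rule lint_mono[OF iu])
   show "integrable Leb (%x. indicator {x. s <= infdist x S} x * cmod2 (u x) + exp 2 * cmod2 (\<psi> x))"
    by (intro litg_add integrable_mult_right L2D(2)[OF \<psi>L] indicator_integrable[OF iu fs])
   fix x
   show "cmod2 (u x) <= indicator {x. s <= infdist x S} x * cmod2 (u x) + exp 2 * cmod2 (\<psi> x)"
   proof (cases "s <= infdist x S")
    case False
    have "k * infdist x S <= 1" using False sw(2) by (simp add: k_def s_def)
    then have "(exp (k * infdist x S))^2 <= exp 1 ^ 2" by (intro power_mono) auto
    also have "... = exp (2::real)" by (simp add: power2_eq_square flip: exp_add)
    finally have "(exp (k * infdist x S))^2 * cmod2 (\<psi> x) <= exp 2 * cmod2 (\<psi> x)" by (rule mult_right_mono) simp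
    then show ?thesis using False by (simp add: u power_mult_distrib)
   qed simp
  qed
  also have "... = ?far + exp 2 * mass \<psi>"
   unfolding mass_def
   by (subst lint_add[OF indicator_integrable[OF iu fs] integrable_mult_right[OF L2D(2)[OF \<psi>L]]]) simp
  finally have "m <= 2 * exp 2 * mass \<psi>" using far by simp
  moreover have "mag_form Om A h u = energy h u g" by (rule mag_form_eq_energy[OF ug])
  ultimately show "u \<in> H1 Om \<and> mass u <= 2 * exp 2 * mass \<psi> \<and> mag_form Om A h u <= (L + 2) * h powr (3 / 2) * mass u"
   using H1I[OF ug] e unfolding m_def by auto
 qed
qed

end

text \<open>Eigenvalues of opposite signs make the Hessian invertible; all other constants are maxima over the compact closure.\<close>
lemma standing_assumptions_magnetic_domain:
 assumes "open \<Omega>" "bounded \<Omega>" "smooth_boundary \<Omega>" "smooth_on_closure \<Omega> A"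
  and S: "singular_set \<Omega> A ~= {}" "finite (singular_set \<Omega> A)"
  and hess: "\<forall>x\<in>singular_set \<Omega> A. \<exists>a b. a < 0 \<and> 0 < b \<and>
     eigenvalue (hessian (magnetic_field A) x) a \<and> eigenvalue (hessian (magnetic_field A) x) b"
 obtains M c where "magnetic_domain \<Omega> A (magnetic_field A) (singular_set \<Omega> A) M c"
proof -
 let ?B = "magnetic_field A" and ?S = "singular_set \<Omega> A"
 obtain U where U: "open U" "closure \<Omega> \<subseteq> U" "smooth_on U A" using assms(4) by (auto simp: smooth_on_closure_def)
 note mf = magnetic_field_C1[OF U(1,3)]
 have K: "compact (closure \<Omega>)" using assms(2) by simp
 have sub: "\<Omega> \<subseteq> closure \<Omega>" "\<Omega> \<subseteq> U" using closure_subset U(2) by auto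
 have Seq: "?S = {x \<in> closure \<Omega>. ?B x = 0 \<and> grad ?B x = 0}" by (auto simp: singular_set_def zero_set_def)
 have inj: "inj ((*v) (transpose (hessian ?B x)))" if "x \<in> ?S" for x
 proof -
  from bspec[OF hess that] obtain a b where "a < 0" "0 < b" "eigenvalue (hessian ?B x) a" "eigenvalue (hessian ?B x) b" by blast
  then show ?thesis using distinct_eigenvalues_invertible[of "hessian ?B x" a b] by auto
 qed
 obtain c where c: "c > 0" "!!x. x \<in> closure \<Omega> ==> norm (grad ?B x) <= infdist x ?S / c"
  "!!x. x \<in> closure \<Omega> ==> c * infdist x ?S <= norm (grad ?B x) \<or> c <= \<bar>?B x\<bar>"
  by (rule critical_zero_estimate[OF U(1) K U(2) mf(3,4) Seq S(2,1) inj]) (assumption, rule that)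
 have bd: "\<exists>M. \<forall>x\<in>closure \<Omega>. \<bar>f x\<bar> <= M" if "continuous_on (closure \<Omega>) f" for f :: "real^2 => real"
  using compact_imp_bounded[OF compact_continuous_image[OF that K]] unfolding bounded_iff by auto
 note on = continuous_on_subset[OF _ U(2)]
 have "\<forall>i. \<exists>M. \<forall>x\<in>closure \<Omega>. \<bar>A x $ i\<bar> <= M" by (intro allI bd on C1_on_continuous[OF mf(1)])
 then obtain MA where MA: "!!i x. x \<in> closure \<Omega> ==> \<bar>A x $ i\<bar> <= MA i" unfolding choice_iff by blast
 have "\<forall>i. \<exists>M. \<forall>x\<in>closure \<Omega>. \<bar>partial i (partial i ?B) x\<bar> <= M" by (intro allI bd on C1_on_partial[OF mf(4)])
 then obtain MB where MB: "!!i x. x \<in> closure \<Omega> ==> \<bar>partial i (partial i ?B) x\<bar> <= MB i" unfolding choice_iff by blast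
 have "\<exists>M. \<forall>x\<in>closure \<Omega>. \<bar>infdist x ?S\<bar> <= M" by (rule bd) (intro continuous_intros)
 then obtain MS where MS: "!!x. x \<in> closure \<Omega> ==> \<bar>infdist x ?S\<bar> <= MS" by blast
 define M where "M = 1 + 1 / c + \<bar>MA 1\<bar> + \<bar>MA 2\<bar> + \<bar>MB 1\<bar> + \<bar>MB 2\<bar> + \<bar>MS\<bar>"
 have c': "1 / c > 0" using c(1) by simp
 have M: "1 <= M" "1 / c <= M" "MA i <= M" "MB i <= M" "MS <= M" for i
 proof -
  have "f i <= \<bar>f 1\<bar> + \<bar>f 2\<bar>" for f :: "2 => real"
  proof -
   have "f i = f 1 \<or> f i = f 2" using exhaust_2[of i] by auto
   then show ?thesis by (elim disjE) linarith+
  qed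
  from this[of MA] this[of MB] show "1 <= M" "1 / c <= M" "MA i <= M" "MB i <= M" "MS <= M"
   using c' unfolding M_def by linarith+
 qed
 have "magnetic_domain \<Omega> A ?B ?S M c"
 proof unfold_locales
  fix x :: "real^2" and j :: 2
  assume "x \<in> \<Omega>"
  then have x: "x \<in> closure \<Omega>" using sub(1) by blast
  show "?B x = partial 2 (%y. A y $ 1) x - partial 1 (%y. A y $ 2) x" by (rule magnetic_field_def)
  show "\<bar>A x $ j\<bar> <= M" using MA[OF x, of j] M(3)[of j] by linarith
  show "infdist x ?S <= M" using MS[OF x] M(5) by linarith
  show "\<bar>partial j (partial j ?B) x\<bar> <= M" using MB[OF x, of j] M(4)[of j] by linarith
  have "\<bar>partial j ?B x\<bar> <= norm (grad ?B x)" using component_le_norm_cart[of "grad ?B x" j] by (simp add: grad_component)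
  also have "... <= infdist x ?S / c" by (rule c(2)[OF x])
  also have "... <= M * infdist x ?S" using mult_right_mono[OF M(2) infdist_nonneg[of x ?S]] by simp
  finally show "\<bar>partial j ?B x\<bar> <= M * infdist x ?S" .
  show "c * infdist x ?S <= norm (grad ?B x) \<or> c <= \<bar>?B x\<bar>" by (rule c(3)[OF x])
 qed (use assms S M(1) c(1) C1_on_subset[OF mf(1) sub(2)] C1_on_subset[OF mf(3) sub(2)] C1_on_subset[OF mf(4) sub(2)] in auto)
 then show thesis by (rule that)
qed

theorem theorem1p7:
  fixes \<Omega> :: "(real^2) set" and A :: "real^2 \<Rightarrow> real^2" and L d :: real
  assumes "open \<Omega>" and "bounded \<Omega>" and "smooth_boundary \<Omega>" and "simply_connected \<Omega>"
    and "smooth_on_closure \<Omega> A"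
    and "zero_set \<Omega> A \<noteq> {}"
    and "singular_set \<Omega> A \<noteq> {}" and "finite (singular_set \<Omega> A)"
    and "frontier \<Omega> \<inter> singular_set \<Omega> A = {}"
    and "\<forall>x\<in>singular_set \<Omega> A. \<exists>a b. a < 0 \<and> 0 < b \<and>
           eigenvalue (hessian (magnetic_field A) x) a \<and> eigenvalue (hessian (magnetic_field A) x) b"
    and "finite (zero_set \<Omega> A \<inter> frontier \<Omega>)"
    and "\<forall>x\<in>zero_set \<Omega> A \<inter> frontier \<Omega>. non_tangent \<Omega> A x"
    and "L > 0" and "d \<in> {3/16<..<1/4}"
  shows "\<exists>C>0. \<exists>h\<^sub>d>0. \<forall>h\<in>{0<..<h\<^sub>d}. \<forall>(\<mu>::real) (\<psi> :: real^2 \<Rightarrow> complex).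
    eigenpair \<Omega> A h \<mu> \<psi> \<and> \<mu> \<le> L * h powr (3/2) \<longrightarrow>
    (\<lambda>x. exp (infdist x (singular_set \<Omega> A) / h powr d) *\<^sub>R \<psi> x) \<in> H1 \<Omega> \<and>
    (\<integral>x. exp (2 * infdist x (singular_set \<Omega> A) / h powr d) * (cmod (\<psi> x))\<^sup>2 \<partial>lebesgue_on \<Omega>)
      + h powr (-3/2) *
        mag_form \<Omega> A h (\<lambda>x. exp (infdist x (singular_set \<Omega> A) / h powr d) *\<^sub>R \<psi> x)
      \<le> C * (L2_norm (lebesgue_on \<Omega>) \<psi>)\<^sup>2"
proof -
 let ?S = "singular_set \<Omega> A"
 obtain M c where "magnetic_domain \<Omega> A (magnetic_field A) ?S M c"
  by (rule standing_assumptions_magnetic_domain[OF assms(1-3,5,7,8,10)])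
 then interpret magnetic_domain \<Omega> A "magnetic_field A" ?S M c .
 have d: "0 < d" "d < 1 / 4" using assms(14) by auto
 obtain h0 where h0: "0 < h0" "h0 <= 1" "!!h \<mu> \<psi> u. 0 < h ==> h < h0 ==> eigenpair \<Omega> A h \<mu> \<psi> ==> \<mu> <= L * h powr (3 / 2) ==>
  u = (%x. exp (infdist x ?S / h powr d) *\<^sub>R \<psi> x) ==> u \<in> H1 \<Omega> \<and> mass u <= 2 * exp 2 * mass \<psi> \<and> mag_form \<Omega> A h u <= (L + 2) * h powr (3 / 2) * mass u"
  by (rule weighted_mass_le[OF assms(13) d]) (rule that)
 have "(%x. exp (infdist x ?S / h powr d) *\<^sub>R \<psi> x) \<in> H1 \<Omega> \<and>
  (\<integral>x. exp (2 * infdist x ?S / h powr d) * (cmod (\<psi> x))^2 \<partial>lebesgue_on \<Omega>)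
   + h powr (-3/2) * mag_form \<Omega> A h (%x. exp (infdist x ?S / h powr d) *\<^sub>R \<psi> x)
   <= ((L + 3) * (2 * exp 2)) * (L2_norm (lebesgue_on \<Omega>) \<psi>)^2"
  if h: "h \<in> {0<..<h0}" and e: "eigenpair \<Omega> A h \<mu> \<psi>" "\<mu> <= L * h powr (3/2)" for h \<mu> and \<psi> :: "real^2 => complex"
 proof -
  define u where "u x = exp (infdist x ?S / h powr d) *\<^sub>R \<psi> x" for x
  have hp: "0 < h" "h < h0" using h by auto
  note r = h0(3)[OF hp e, of u, unfolded u_def[abs_def], OF refl, folded u_def[abs_def]]
  have mu: "(\<integral>x. exp (2 * infdist x ?S / h powr d) * (cmod (\<psi> x))^2 \<partial>lebesgue_on \<Omega>) = mass u"
  proof -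
   have "exp (2 * t / y) = (exp (t / y))^2" for t y :: real by (simp add: power2_eq_square flip: exp_add)
   then show ?thesis unfolding mass_def u_def by (simp add: power_mult_distrib)
  qed
  have "h powr (-3/2) * mag_form \<Omega> A h u <= h powr (-3/2) * ((L + 2) * h powr (3 / 2) * mass u)"
   using r by (intro mult_left_mono) auto
  also have "... = (L + 2) * (h powr (-3/2) * h powr (3 / 2)) * mass u" by simp
  also have "h powr (-3/2) * h powr (3 / 2) = 1" using hp(1) by (simp flip: powr_add)
  finally have "mass u + h powr (-3/2) * mag_form \<Omega> A h u <= (L + 3) * mass u" by (simp add: algebra_simps)
  also have "... <= (L + 3) * (2 * exp 2 * mass \<psi>)" using r assms(13) by (intro mult_left_mono) auto
  finally have "mass u + h powr (-3/2) * mag_form \<Omega> A h u <= ((L + 3) * (2 * exp 2)) * (L2_norm (lebesgue_on \<Omega>) \<psi>)^2"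
   by (simp add: L2_norm_square mass_def mult.assoc)
  then show ?thesis using r unfolding mu u_def[abs_def, symmetric] by blast
 qed
 moreover have "(L + 3) * (2 * exp 2) > 0" using assms(13) by simp
 ultimately show ?thesis using h0(1) by blast
qed

end
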